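(* Let $\alpha>0$, $T>0$, $\mathbf{u}_0\in V$ and $\theta_0\in L^2(\mathbb{T}^2)$. Then there exists a weak solution $(\mathbf{u},\theta)$ on $[0,T]$ of the two-dimensional inviscid, non-diffusive Boussinesq–Voigt system $$-\alpha^2\Delta\partial_t\mathbf{u}+\partial_t\mathbf{u}+\sum_{j=1}^2\partial_j(u^j\mathbf{u})=-\nabla p+\theta\mathbf{e}_2,\qquad\nabla\cdot\mathbf{u}=0,\qquad\partial_t\theta+\nabla\cdot(\mathbf{u}\theta)=0,$$ $\mathbf{u}(0)=\mathbf{u}_0$, $\theta(0)=\theta_0$. Furthermore, if $\theta_0\in L^\infty(\mathbb{T}^2)$, then $\theta\in L^\infty([0,T],L^\infty)$.
   Context: $\mathbb{T}^2=[0,1]^2$ with periodic boundary conditions; all functions are periodic with zero spatial average, and $L^p$, $H^s$ denote such mean-zero spaces; $H^{-2}$ is the dual of mean-zero $H^2$. $(\cdot,\cdot)$ is the $L^2$ inner product, $((\mathbf{u},\mathbf{v}))=\sum_{i,j}\int\partial_ju^i\partial_jv^i\,dx$. $H$, $V$ are the closures in $L^2$, $H^1$ of mean-zero divergence-free vector trigonometric polynomials; $\mathbf{e}_2=(0,1)$; $C_w$ denotes weak continuity. Test functions: $\Phi$ smooth, periodic, mean zero and divergence free in $x$, $\Phi(\cdot,T)=0$; $\varphi$ smooth, periodic, mean zero in $x$, $\varphi(\cdot,T)=0$. A weak solution on $[0,T]$ is $(\mathbf{u},\theta)$ with $\mathbf{u}\in C([0,T],V)$, $\partial_t\mathbf{u}\in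 L^\infty([0,T],V)$, $\theta\in L^\infty([0,T],L^2)\cap C_w([0,T],L^2)$, $\partial_t\theta\in L^\infty([0,T],H^{-2})$, such that for all test functions $$-\int_0^T(\mathbf{u},\partial_s\Phi)\,ds-\alpha^2\int_0^T((\mathbf{u},\partial_s\Phi))\,ds-\sum_{j=1}^2\int_0^T(u^j\mathbf{u},\partial_j\Phi)\,ds=(\mathbf{u}_0,\Phi(0))+\alpha^2((\mathbf{u}_0,\Phi(0)))+\int_0^T(\theta\mathbf{e}_2,\Phi)\,ds,$$ $$-\int_0^T(\theta,\partial_s\varphi)\,ds-\int_0^T(\theta\mathbf{u},\nabla\varphi)\,ds=(\theta_0,\varphi(0)).$$ *)

theory Defs
  imports "HOL-Analysis.Analysis"
begin

text \<open>Points of the torus are represented by points of real^2; functions on the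
torus are represented by functions on real^2 that are 1-periodic in each
coordinate. Integrals over the torus are Lebesgue integrals over the unit cell.\<close>

type_synonym pt = "real^2"

definition cell :: "pt set" where
  "cell = cbox 0 1"

definition periodic2 :: "(pt \<Rightarrow> 'b) \<Rightarrow> bool" where
  "periodic2 f \<longleftrightarrow> (\<forall>x j. f (x + axis j 1) = f x)"

definition meanzero :: "(pt \<Rightarrow> 'b::{banach,second_countable_topology}) \<Rightarrow> bool" where
  "meanzero f \<longleftrightarrow> (LINT x:cell|lebesgue. f x) = 0"

definition ip :: "(pt \<Rightarrow> 'b::real_inner) \<Rightarrow> (pt \<Rightarrow> 'b) \<Rightarrow> real" where
  "ip f g = (LINT x:cell|lebesgue. inner (f x) (g x))"

definition L2norm :: "(pt \<Rightarrow> 'b::real_normed_vector) \<Rightarrow> real" where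
  "L2norm f = sqrt (LINT x:cell|lebesgue. (norm (f x))^2)"

definition L2 :: "(pt \<Rightarrow> 'b::euclidean_space) set" where
  "L2 = {f. periodic2 f \<and> f \<in> borel_measurable lebesgue
           \<and> set_integrable lebesgue cell (\<lambda>x. (norm (f x))^2) \<and> meanzero f}"

definition Linf :: "(pt \<Rightarrow> 'b::euclidean_space) set" where
  "Linf = {f. periodic2 f \<and> f \<in> borel_measurable lebesgue
           \<and> (\<exists>C. AE x in lebesgue. norm (f x) \<le> C) \<and> meanzero f}"

fun Ck :: "nat \<Rightarrow> ('a::real_normed_vector \<Rightarrow> 'b::real_normed_vector) \<Rightarrow> bool" where
  "Ck 0 f = continuous_on UNIV f"
| "Ck (Suc k) f = ((\<forall>x. f differentiable (at x)) \<and>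
                   (\<forall>v. Ck k (\<lambda>x. frechet_derivative f (at x) v)))"

definition smooth :: "('a::real_normed_vector \<Rightarrow> 'b::real_normed_vector) \<Rightarrow> bool" where
  "smooth f \<longleftrightarrow> (\<forall>k. Ck k f)"

definition pd :: "2 \<Rightarrow> (pt \<Rightarrow> 'b::real_normed_vector) \<Rightarrow> pt \<Rightarrow> 'b" where
  "pd j f x = frechet_derivative f (at x) (axis j 1)"

definition grad :: "(pt \<Rightarrow> real) \<Rightarrow> pt \<Rightarrow> real^2" where
  "grad f x = (\<chi> j. pd j f x)"

definition div_cl :: "(pt \<Rightarrow> real^2) \<Rightarrow> pt \<Rightarrow> real" where
  "div_cl f x = (\<Sum>j\<in>UNIV. pd j f x $ j)"

definition weak_pd :: "2 \<Rightarrow> (pt \<Rightarrow> 'b::euclidean_space) \<Rightarrow> (pt \<Rightarrow> 'b) \<Rightarrow> bool" where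
  "weak_pd j f g \<longleftrightarrow> set_integrable lebesgue cell g \<and>
     (\<forall>\<phi>::pt \<Rightarrow> real. smooth \<phi> \<and> periodic2 \<phi> \<longrightarrow>
        (LINT x:cell|lebesgue. pd j \<phi> x *\<^sub>R f x) = - (LINT x:cell|lebesgue. \<phi> x *\<^sub>R g x))"

definition H1 :: "(pt \<Rightarrow> 'b::euclidean_space) set" where
  "H1 = {f. f \<in> L2 \<and> (\<forall>j. \<exists>g. weak_pd j f g \<and> g \<in> L2)}"

text \<open>The (a.e. determined) weak derivative of an H^1 function.\<close>
definition D :: "2 \<Rightarrow> (pt \<Rightarrow> 'b::euclidean_space) \<Rightarrow> pt \<Rightarrow> 'b" where
  "D j f = (SOME g. weak_pd j f g \<and> g \<in> L2)"

definition ip1 :: "(pt \<Rightarrow> real^2) \<Rightarrow> (pt \<Rightarrow> real^2) \<Rightarrow> real" where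
  "ip1 u v = (\<Sum>j\<in>UNIV. ip (D j u) (D j v))"

definition H1norm :: "(pt \<Rightarrow> 'b::euclidean_space) \<Rightarrow> real" where
  "H1norm f = sqrt ((L2norm f)^2 + (\<Sum>j\<in>UNIV. (L2norm (D j f))^2))"

definition trigpoly :: "(pt \<Rightarrow> 'b::real_vector) \<Rightarrow> bool" where
  "trigpoly p \<longleftrightarrow> (\<exists>N::int. \<exists>a b :: int \<Rightarrow> int \<Rightarrow> 'b.
     p = (\<lambda>x. \<Sum>m\<in>{-N..N}. \<Sum>n\<in>{-N..N}.
            cos (2*pi*(of_int m * x$1 + of_int n * x$2)) *\<^sub>R a m n
          + sin (2*pi*(of_int m * x$1 + of_int n * x$2)) *\<^sub>R b m n))"

definition V :: "(pt \<Rightarrow> real^2) set" where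
  "V = {u. u \<in> H1 \<and> (\<exists>p :: nat \<Rightarrow> pt \<Rightarrow> real^2.
          (\<forall>n. trigpoly (p n) \<and> meanzero (p n) \<and> (\<forall>x. div_cl (p n) x = 0))
          \<and> (\<lambda>n. H1norm (\<lambda>x. u x - p n x)) \<longlonglongrightarrow> 0)}"

definition H2norm_cl :: "(pt \<Rightarrow> real) \<Rightarrow> real" where
  "H2norm_cl \<phi> = sqrt ((L2norm \<phi>)^2 + (\<Sum>j\<in>UNIV. (L2norm (pd j \<phi>))^2)
                    + (\<Sum>j\<in>UNIV. \<Sum>k\<in>UNIV. (L2norm (pd k (pd j \<phi>)))^2))"

definition dt :: "(real \<Rightarrow> pt \<Rightarrow> 'b::real_normed_vector) \<Rightarrow> real \<Rightarrow> pt \<Rightarrow> 'b" where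
  "dt \<Phi> t x = vector_derivative (\<lambda>s. \<Phi> s x) (at t)"

definition testV :: "real \<Rightarrow> (real \<Rightarrow> pt \<Rightarrow> real^2) \<Rightarrow> bool" where
  "testV T \<Phi> \<longleftrightarrow> smooth (\<lambda>z::real \<times> pt. \<Phi> (fst z) (snd z)) \<and>
     (\<forall>t. periodic2 (\<Phi> t) \<and> meanzero (\<Phi> t) \<and> (\<forall>x. div_cl (\<Phi> t) x = 0)) \<and>
     (\<forall>x. \<Phi> T x = 0)"

definition testS :: "real \<Rightarrow> (real \<Rightarrow> pt \<Rightarrow> real) \<Rightarrow> bool" where
  "testS T \<phi> \<longleftrightarrow> smooth (\<lambda>z::real \<times> pt. \<phi> (fst z) (snd z)) \<and>
     (\<forall>t. periodic2 (\<phi> t) \<and> meanzero (\<phi> t)) \<and> (\<forall>x. \<phi> T x = 0)"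

definition C_V :: "real \<Rightarrow> (real \<Rightarrow> pt \<Rightarrow> real^2) \<Rightarrow> bool" where
  "C_V T u \<longleftrightarrow> (\<forall>t\<in>{0..T}. u t \<in> V) \<and>
     (\<forall>t\<in>{0..T}. ((\<lambda>s. H1norm (\<lambda>x. u s x - u t x)) \<longlongrightarrow> 0) (at t within {0..T}))"

text \<open>\<partial>_t u \<in> L^\<infinity>([0,T],V): there is an essentially bounded, (weakly, hence
  strongly, since V is separable) measurable V-valued w with u(t) = u(0) + int_0^t w
  (tested against smooth periodic vector fields).\<close>
definition dt_Linf_V :: "real \<Rightarrow> (real \<Rightarrow> pt \<Rightarrow> real^2) \<Rightarrow> bool" where
  "dt_Linf_V T u \<longleftrightarrow> (\<exists>w :: real \<Rightarrow> pt \<Rightarrow> real^2.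
     (AE t in lborel. t \<in> {0..T} \<longrightarrow> w t \<in> V) \<and>
     (\<exists>C. AE t in lborel. t \<in> {0..T} \<longrightarrow> H1norm (w t) \<le> C) \<and>
     (\<forall>\<psi>::pt \<Rightarrow> real^2. smooth \<psi> \<and> periodic2 \<psi> \<longrightarrow>
        (\<lambda>t. ip (w t) \<psi>) \<in> borel_measurable (restrict_space lborel {0..T}) \<and>
        (\<forall>j. (\<lambda>t. ip (D j (w t)) \<psi>) \<in> borel_measurable (restrict_space lborel {0..T})) \<and>
        (\<forall>t\<in>{0..T}. ip (u t) \<psi> - ip (u 0) \<psi> = (LINT s:{0..t}|lborel. ip (w s) \<psi>))))"

definition Linf_L2 :: "real \<Rightarrow> (real \<Rightarrow> pt \<Rightarrow> real) \<Rightarrow> bool" where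
  "Linf_L2 T \<theta> \<longleftrightarrow> (\<forall>t\<in>{0..T}. \<theta> t \<in> L2) \<and>
     (\<exists>C. AE t in lborel. t \<in> {0..T} \<longrightarrow> L2norm (\<theta> t) \<le> C)"

definition Cw_L2 :: "real \<Rightarrow> (real \<Rightarrow> pt \<Rightarrow> real) \<Rightarrow> bool" where
  "Cw_L2 T \<theta> \<longleftrightarrow> (\<forall>t\<in>{0..T}. \<theta> t \<in> L2) \<and>
     (\<forall>g\<in>L2. continuous_on {0..T} (\<lambda>t. ip (\<theta> t) g))"

text \<open>\<partial>_t \<theta> \<in> L^\<infinity>([0,T],H^{-2}): a measurable family F(t) of linear functionals,
  uniformly bounded in the dual H^2 norm (on the dense class of smooth periodic
  mean-zero functions, hence uniquely extending to elements of H^{-2}), with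
  (\<theta>(t),\<phi>) - (\<theta>(0),\<phi>) = int_0^t F(s) \<phi> ds.\<close>
definition dt_Linf_Hm2 :: "real \<Rightarrow> (real \<Rightarrow> pt \<Rightarrow> real) \<Rightarrow> bool" where
  "dt_Linf_Hm2 T \<theta> \<longleftrightarrow> (\<exists>F :: real \<Rightarrow> (pt \<Rightarrow> real) \<Rightarrow> real.
     (let S = {\<phi>. smooth \<phi> \<and> periodic2 \<phi> \<and> meanzero \<phi>} in
       (\<forall>t\<in>{0..T}. \<forall>\<phi>\<in>S. \<forall>\<psi>\<in>S. \<forall>a b. F t (\<lambda>x. a * \<phi> x + b * \<psi> x) = a * F t \<phi> + b * F t \<psi>) \<and>
       (\<exists>C. AE t in lborel. t \<in> {0..T} \<longrightarrow> (\<forall>\<phi>\<in>S. \<bar>F t \<phi>\<bar> \<le> C * H2norm_cl \<phi>)) \<and>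
       (\<forall>\<phi>\<in>S. (\<lambda>t. F t \<phi>) \<in> borel_measurable (restrict_space lborel {0..T}) \<and>
          (\<forall>t\<in>{0..T}. ip (\<theta> t) \<phi> - ip (\<theta> 0) \<phi> = (LINT s:{0..t}|lborel. F s \<phi>)))))"

definition e2 :: "real^2" where "e2 = axis 2 1"

definition weak_solution ::
  "real \<Rightarrow> real \<Rightarrow> (pt \<Rightarrow> real^2) \<Rightarrow> (pt \<Rightarrow> real)
    \<Rightarrow> (real \<Rightarrow> pt \<Rightarrow> real^2) \<Rightarrow> (real \<Rightarrow> pt \<Rightarrow> real) \<Rightarrow> bool" where
  "weak_solution \<alpha> T u0 \<theta>0 u \<theta> \<longleftrightarrow>
     C_V T u \<and> dt_Linf_V T u \<and> Linf_L2 T \<theta> \<and> Cw_L2 T \<theta> \<and> dt_Linf_Hm2 T \<theta> \<and>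
     (\<forall>\<Phi>. testV T \<Phi> \<longrightarrow>
        - (LINT s:{0..T}|lborel. ip (u s) (dt \<Phi> s))
        - \<alpha>^2 * (LINT s:{0..T}|lborel. ip1 (u s) (dt \<Phi> s))
        - (\<Sum>j\<in>UNIV. LINT s:{0..T}|lborel. ip (\<lambda>x. u s x $ j *\<^sub>R u s x) (pd j (\<Phi> s)))
        = ip u0 (\<Phi> 0) + \<alpha>^2 * ip1 u0 (\<Phi> 0)
          + (LINT s:{0..T}|lborel. ip (\<lambda>x. \<theta> s x *\<^sub>R e2) (\<Phi> s))) \<and>
     (\<forall>\<phi>. testS T \<phi> \<longrightarrow>
        - (LINT s:{0..T}|lborel. ip (\<theta> s) (dt \<phi> s))
        - (LINT s:{0..T}|lborel. ip (\<lambda>x. \<theta> s x *\<^sub>R u s x) (grad (\<phi> s)))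
        = ip \<theta>0 (\<phi> 0))"

definition Linf_Linf :: "real \<Rightarrow> (real \<Rightarrow> pt \<Rightarrow> real) \<Rightarrow> bool" where
  "Linf_Linf T \<theta> \<longleftrightarrow> (\<exists>C. AE t in lborel. t \<in> {0..T} \<longrightarrow>
       \<theta> t \<in> Linf \<and> (AE x in lebesgue. \<bar>\<theta> t x\<bar> \<le> C))"

end

theory Submission imports Defs "HOL-Complex_Analysis.Great_Picard" begin

text \<open>The Voigt term turns the momentum equation into an ordinary differential equation for the
coefficients of the velocity along the divergence-free modes, with a right-hand side that is bounded
in \<open>V\<close> in terms of the energy. Approximate solutions come from an explicit Euler scheme with finitely
many modes in which one step of the transport equation replaces the temperature by the average, over
the modes, of its compositions with shears along the single modes: every shear preserves the measure,
so that the square mean and the supremum do not increase, and to first order in the time step the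
average moves the temperature with the full velocity. The energy is bounded uniformly, the
coefficients are almost Lipschitz in time, and a diagonal subsequence of them converges. The velocities
then converge strongly and the temperatures weakly in \<open>L\<^sup>2\<close>, which suffices for the quadratic
terms. The limit equations hold mode by mode; truncating the Fourier series of a smooth test function
extends them to all static test functions, and differentiating the pairing with a time-dependent test
function gives the weak formulation.\<close>

text \<open>The temperature needs both the L^2 bound and the sup bound, while the velocity is only
  in H^1: truncating the temperature to finitely many modes would lose the sup bound, and an H^1
  field has no classical flow. A single mode \<open>cas k x *\<^sub>R Ev k\<close>, however, is
  constant along its own streamlines, so its flow is an explicit shear. The average over the modes
  instead of their composition keeps the step linear in the velocity to first order, at the price of
  shears that are \<open>card F\<close> times too long; hence the time step has to be small against
  the square of the number of modes.

  Two further obstacles shape the proof. In the plane H^1 does not embed in L^infinity, so products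
  of velocity components, and of the velocity with the gradient of an H^2 function, are estimated in
  L^2 by a convolution argument on the coefficients, where a lattice sum of
  \<open>1 / (nk k)\<^sup>2\<close> plays the role of the embedding of H^1 in L^4. And an explicit
  Euler step does not conserve energy: its error is quadratic in the step and is absorbed because
  the nonlinearity, after inversion of the Voigt operator, is bounded in the energy norm
  itself.\<close>

abbreviation tor :: "pt measure" where "tor \<equiv> lebesgue_on cell"

lemma cell_lebesgue [measurable, simp]: "cell \<in> sets lebesgue" "cell \<in> sets lborel" "cell \<in> sets borel"
  by (auto simp: cell_def)

lemma emeasure_cell: "emeasure lborel cell = 1"
proof -
  have "emeasure lborel (cbox (0::pt) 1) = ennreal (\<Prod>b\<in>Basis. (1 - 0 :: pt) \<bullet> b)"
    by (rule emeasure_lborel_cbox) (auto simp: Basis_vec_def inner_axis)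
  also have "(\<Prod>b\<in>Basis. (1 - 0 :: pt) \<bullet> b) = 1"
    by (rule prod.neutral) (auto simp: Basis_vec_def inner_axis)
  finally show ?thesis by (simp add: cell_def)
qed

lemma space_tor [simp]: "space tor = cell" by simp

lemma measure_tor: "measure tor cell = 1"
  by (simp add: measure_def emeasure_restrict_space emeasure_cell)

lemma finite_tor: "finite_measure tor"
  by (intro finite_measureI) (simp add: emeasure_restrict_space emeasure_cell)

interpretation tor: finite_measure tor by (rule finite_tor)

lemma tor_integral:
  fixes f :: "pt \<Rightarrow> 'b::{banach,second_countable_topology}"
  shows "(LINT x:cell|lebesgue. f x) = (LINT x|tor. f x)"
  unfolding set_lebesgue_integral_def by (rule integral_restrict_space[symmetric]) simp

lemma tor_integrable:
  fixes f :: "pt \<Rightarrow> 'b::{banach,second_countable_topology}"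
  shows "set_integrable lebesgue cell f \<longleftrightarrow> integrable tor f"
  unfolding set_integrable_def by (rule integrable_restrict_space[symmetric]) simp

lemma borel_tor: "f \<in> borel_measurable borel \<Longrightarrow> f \<in> borel_measurable tor"
  by (intro measurable_restrict_space1 measurable_completion) simp

lemma continuous_tor: "continuous_on UNIV f \<Longrightarrow> f \<in> borel_measurable tor"
  by (intro borel_tor borel_measurable_continuous_onI)

lemma lebesgue_tor: "f \<in> borel_measurable lebesgue \<Longrightarrow> f \<in> borel_measurable tor"
  by (intro measurable_restrict_space1)

lemma bounded_on_cell:
  fixes f :: "pt \<Rightarrow> 'b::real_normed_vector"
  assumes "continuous_on UNIV f"
  obtains B where "B \<ge> 0" "\<And>x. x \<in> cell \<Longrightarrow> norm (f x) \<le> B"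
proof -
  have "compact (f ` cell)"
    unfolding cell_def by (intro compact_continuous_image continuous_on_subset[OF assms]) auto
  then obtain B where "\<forall>y\<in>f`cell. norm y \<le> B"
    using compact_imp_bounded bounded_iff by metis
  then show ?thesis by (intro that[of "max B 0"]) (auto simp: le_max_iff_disj)
qed

lemma integrable_tor_bounded:
  fixes f :: "pt \<Rightarrow> 'b::euclidean_space"
  assumes "f \<in> borel_measurable tor" "\<And>x. x \<in> cell \<Longrightarrow> norm (f x) \<le> B"
  shows "integrable tor f"
  by (rule tor.integrable_const_bound[of _ B]) (use assms in auto)

lemma integrable_tor_continuous:
  fixes f :: "pt \<Rightarrow> 'b::euclidean_space"
  assumes "continuous_on UNIV f"
  shows "integrable tor f"
  using bounded_on_cell[OF assms] integrable_tor_bounded continuous_tor[OF assms] by metis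

lemma AE_tor_iff: "(AE x in tor. P x) \<longleftrightarrow> (AE x in lebesgue. x \<in> cell \<longrightarrow> P x)"
  by (subst AE_restrict_space_iff) auto

subsection \<open>Translations and shears\<close>

text \<open>Half-open, unlike \<open>cell\<close>, so that its lattice translates tile the space
  without overlap. The dimension is left general because the shear argument also averages over the
  unit interval of the line.\<close>

definition ucell :: "'a::euclidean_space set" where
  "ucell = {x. \<forall>b\<in>Basis. 0 \<le> x \<bullet> b \<and> x \<bullet> b < 1}"

definition lat :: "'a::euclidean_space set" where
  "lat = {n. \<forall>b\<in>Basis. n \<bullet> b \<in> \<int>}"

lemma ucell_borel [measurable]: "ucell \<in> sets borel"
proof -
  have "ucell = (\<Inter>b\<in>Basis. {x::'a. 0 \<le> x \<bullet> b} \<inter> {x. x \<bullet> b < 1})"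
    by (auto simp: ucell_def)
  also have "\<dots> \<in> sets borel"
    by (intro sets.finite_INT) auto
  finally show ?thesis .
qed

lemma countable_lat: "countable (lat :: 'a::euclidean_space set)"
proof (rule countable_subset)
  show "lat \<subseteq> (\<lambda>f. \<Sum>b\<in>Basis. of_int (f b) *\<^sub>R b) ` (PiE (Basis::'a set) (\<lambda>_. UNIV :: int set))"
  proof
    fix n :: 'a assume n: "n \<in> lat"
    have "n = (\<Sum>b\<in>Basis. of_int (restrict (\<lambda>b. \<lfloor>n \<bullet> b\<rfloor>) Basis b) *\<^sub>R b)"
      using n by (subst euclidean_representation[symmetric, of n], intro sum.cong) (auto simp: lat_def)
    then show "n \<in> (\<lambda>f. \<Sum>b\<in>Basis. of_int (f b) *\<^sub>R b) ` (PiE (Basis::'a set) (\<lambda>_. UNIV :: int set))"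
      by (intro image_eqI[where x="restrict (\<lambda>b. \<lfloor>n \<bullet> b\<rfloor>) Basis"]) auto
  qed
qed (intro countable_image countable_PiE; auto)

lemma ucell_lat_unique:
  fixes z :: "'a::euclidean_space"
  shows "\<exists>n0\<in>lat. \<forall>n\<in>lat. z - n \<in> ucell \<longleftrightarrow> n = n0"
proof
  let ?n0 = "\<Sum>b\<in>Basis. of_int \<lfloor>z \<bullet> b\<rfloor> *\<^sub>R b"
  have b: "?n0 \<bullet> b = of_int \<lfloor>z \<bullet> b\<rfloor>" if "b \<in> Basis" for b
    using that by simp
  show "?n0 \<in> lat" by (auto simp: lat_def b)
  show "\<forall>n\<in>lat. z - n \<in> ucell \<longleftrightarrow> n = ?n0"
  proof safe
    fix n :: 'a assume n: "n \<in> lat" and u: "z - n \<in> ucell"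
    show "n = ?n0"
    proof (rule euclidean_eqI)
      fix b :: 'a assume b': "b \<in> Basis"
      have "0 \<le> z \<bullet> b - n \<bullet> b" "z \<bullet> b - n \<bullet> b < 1"
        using u b' by (auto simp: ucell_def inner_diff_left)
      moreover obtain i where "n \<bullet> b = of_int i"
        using n b' by (auto simp: lat_def elim: Ints_cases)
      ultimately show "n \<bullet> b = ?n0 \<bullet> b"
        unfolding b[OF b'] by (simp add: floor_unique)
    qed
  next
    show "z - ?n0 \<in> ucell" by (auto simp: ucell_def inner_diff_left b) linarith+
  qed
qed

text \<open>The tiling as a partition of unity. Both signs are needed: one to insert the translates
  into an integral, the other to remove them after the variable has been shifted.\<close>

lemma ucell_lat_sum:
  fixes z :: "'a::euclidean_space"
  shows "(\<integral>\<^sup>+n. indicator ucell (z - n) \<partial>count_space lat) = (1::ennreal)"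
    and "(\<integral>\<^sup>+n. indicator ucell (z + n) \<partial>count_space lat) = (1::ennreal)"
proof -
  obtain n0 where n0: "n0 \<in> lat" "\<And>n. n \<in> lat \<Longrightarrow> z - n \<in> ucell \<longleftrightarrow> n = n0"
    using ucell_lat_unique by metis
  have "(\<integral>\<^sup>+n. indicator ucell (z - n) \<partial>count_space lat) = (\<integral>\<^sup>+n. indicator {n0} n \<partial>count_space lat)"
    by (intro nn_integral_cong) (auto simp: n0 indicator_def)
  also have "\<dots> = 1" using n0(1) by simp
  finally show "(\<integral>\<^sup>+n. indicator ucell (z - n) \<partial>count_space lat) = (1::ennreal)" .
  have m: "- n \<in> lat \<longleftrightarrow> n \<in> lat" for n :: 'a by (auto simp: lat_def minus_in_Ints_iff)
  have "z + n \<in> ucell \<longleftrightarrow> n = - n0" if "n \<in> lat" for n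
    using n0(2)[of "-n"] that m by (auto simp: equation_minus_iff)
  then have "(\<integral>\<^sup>+n. indicator ucell (z + n) \<partial>count_space lat) = (\<integral>\<^sup>+n. indicator {-n0} n \<partial>count_space lat)"
    by (intro nn_integral_cong) (auto simp: indicator_def)
  also have "\<dots> = 1" using n0(1) m by simp
  finally show "(\<integral>\<^sup>+n. indicator ucell (z + n) \<partial>count_space lat) = (1::ennreal)" .
qed

lemma nn_integral_lborel_translate:
  fixes f :: "'a::euclidean_space \<Rightarrow> ennreal"
  assumes [measurable]: "f \<in> borel_measurable borel"
  shows "(\<integral>\<^sup>+x. f (a + x) \<partial>lborel) = (\<integral>\<^sup>+x. f x \<partial>lborel)"
  by (subst (2) lborel_distr_plus[of a, symmetric]) (simp add: nn_integral_distr)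

text \<open>Unfolding argument: insert the partition of unity by lattice translates, exchange sum
  and integral, shift each piece back by its lattice vector using periodicity, and sum the partition
  of unity again. With nonnegative integrands the exchange needs no integrability.\<close>

lemma nn_integral_ucell_translate:
  fixes g :: "'a::euclidean_space \<Rightarrow> ennreal"
  assumes [measurable]: "g \<in> borel_measurable borel" and per: "\<And>n x. n \<in> lat \<Longrightarrow> g (x + n) = g x"
  shows "(\<integral>\<^sup>+x. g (x + a) * indicator ucell x \<partial>lborel) = (\<integral>\<^sup>+x. g x * indicator ucell x \<partial>lborel)"
proof -
  have m: "(\<lambda>x. g x * indicator ucell (x - a) * indicator ucell (x - n)) \<in> borel_measurable lborel"
    for n :: 'a by measurable
  have "(\<integral>\<^sup>+x. g (x + a) * indicator ucell x \<partial>lborel) = (\<integral>\<^sup>+x. g (a + x) * indicator ucell ((a + x) - a) \<partial>lborel)"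
    by (simp add: add.commute)
  also have "\<dots> = (\<integral>\<^sup>+x. g x * indicator ucell (x - a) \<partial>lborel)"
    by (rule nn_integral_lborel_translate) measurable
  also have "\<dots> = (\<integral>\<^sup>+x. (\<integral>\<^sup>+n. g x * indicator ucell (x - a) * indicator ucell (x - n) \<partial>count_space lat) \<partial>lborel)"
    by (simp add: nn_integral_cmult ucell_lat_sum)
  also have "\<dots> = (\<integral>\<^sup>+n. (\<integral>\<^sup>+x. g x * indicator ucell (x - a) * indicator ucell (x - n) \<partial>lborel) \<partial>count_space lat)"
    by (rule nn_integral_count_space_nn_integral) (use countable_lat m in auto)
  also have "\<dots> = (\<integral>\<^sup>+n. (\<integral>\<^sup>+x. g x * indicator ucell x * indicator ucell ((x - a) + n) \<partial>lborel) \<partial>count_space lat)"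
  proof (rule nn_integral_cong)
    fix n :: 'a assume "n \<in> space (count_space lat)"
    then have n: "n \<in> lat" by simp
    have "(\<integral>\<^sup>+x. g x * indicator ucell (x - a) * indicator ucell (x - n) \<partial>lborel)
      = (\<integral>\<^sup>+x. g (n + x) * indicator ucell ((n + x) - a) * indicator ucell ((n + x) - n) \<partial>lborel)"
      by (rule nn_integral_lborel_translate[symmetric]) measurable
    also have "\<dots> = (\<integral>\<^sup>+x. g x * indicator ucell x * indicator ucell ((x - a) + n) \<partial>lborel)"
      by (intro nn_integral_cong) (simp add: add.commute[of n] per[OF n] add_diff_eq diff_add_eq mult.assoc mult.commute mult.left_commute)
    finally show "(\<integral>\<^sup>+x. g x * indicator ucell (x - a) * indicator ucell (x - n) \<partial>lborel) = \<dots>" .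
  qed
  also have "\<dots> = (\<integral>\<^sup>+x. (\<integral>\<^sup>+n. g x * indicator ucell x * indicator ucell ((x - a) + n) \<partial>count_space lat) \<partial>lborel)"
    by (rule nn_integral_count_space_nn_integral[symmetric]) (use countable_lat in auto)
  also have "\<dots> = (\<integral>\<^sup>+x. g x * indicator ucell x \<partial>lborel)"
    by (simp add: nn_integral_cmult ucell_lat_sum)
  finally show ?thesis .
qed

section \<open>Periodic functions and measure-preserving maps of the torus\<close>

lemma periodic2_int:
  assumes "periodic2 f" shows "f (x + of_int m *\<^sub>R axis j 1) = f x"
proof -
  have p: "f (x + axis j 1) = f x" for x using assms by (auto simp: periodic2_def)
  have nat: "f (x + of_nat n *\<^sub>R axis j 1) = f x" for n x
    by (induction n arbitrary: x) (auto simp: scaleR_add_left add.assoc[symmetric] p add.commute[of "axis j 1"])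
  show ?thesis
  proof (cases m)
    case (nonneg n) then show ?thesis using nat by simp
  next
    case (neg n)
    have "f (x + of_int m *\<^sub>R axis j 1) = f (x + of_int m *\<^sub>R axis j 1 + of_nat (Suc n) *\<^sub>R axis j 1)"
      by (rule nat[symmetric])
    also have "\<dots> = f x" by (simp add: neg scaleR_add_left[symmetric] add.assoc del: of_nat_Suc)
    finally show ?thesis .
  qed
qed

lemma vec2_axis: "x = (x$1) *\<^sub>R axis 1 1 + (x$2) *\<^sub>R axis 2 (1::real)" for x :: pt
  by (simp add: vec_eq_iff axis_def forall_2)

lemma periodic2_int2:
  assumes "periodic2 f" shows "f (x + (of_int m *\<^sub>R axis 1 1 + of_int n *\<^sub>R axis 2 1)) = f x"
  using periodic2_int[OF assms] by (simp add: add.assoc[symmetric])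

lemma periodic2_lat:
  assumes "periodic2 f" "n \<in> lat" shows "f (x + n) = f x"
proof -
  have "n$1 \<in> \<int>" "n$2 \<in> \<int>" using assms(2) by (auto simp: lat_def Basis_vec_def inner_axis)
  then obtain i j where "n$1 = of_int i" "n$2 = of_int j" by (auto elim!: Ints_cases)
  then have "n = of_int i *\<^sub>R axis 1 1 + of_int j *\<^sub>R axis 2 1" using vec2_axis[of n] by simp
  then show ?thesis using periodic2_int2[OF assms(1)] by metis
qed

lemma AE_ucell: "AE x in lborel. x \<in> (cell::pt set) \<longleftrightarrow> x \<in> ucell"
proof -
  have "AE x in lborel. (x::pt) \<notin> cbox 0 1 - box 0 1"
    using negligible_frontier_interval[of "0::pt" 1]
    by (intro AE_not_in) (simp add: negligible_iff_null_sets null_sets_completion_iff)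
  moreover have "box 0 1 \<subseteq> (ucell::pt set)" "ucell \<subseteq> (cbox 0 1 :: pt set)"
    by (auto simp: ucell_def mem_box Basis_vec_def inner_axis) (meson less_imp_le)+
  ultimately show ?thesis unfolding cell_def by (auto elim!: AE_mp)
qed

lemma nn_integral_tor:
  assumes [measurable]: "g \<in> borel_measurable borel"
  shows "(\<integral>\<^sup>+x. g x \<partial>tor) = (\<integral>\<^sup>+x. g x * indicator ucell x \<partial>lborel)"
proof -
  have "(\<integral>\<^sup>+x. g x \<partial>tor) = (\<integral>\<^sup>+x. g x * indicator cell x \<partial>lebesgue)"
    by (rule nn_integral_restrict_space) auto
  also have "\<dots> = (\<integral>\<^sup>+x. g x * indicator cell x \<partial>lborel)"
    by (simp add: nn_integral_completion)
  also have "\<dots> = (\<integral>\<^sup>+x. g x * indicator ucell x \<partial>lborel)"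
    using AE_ucell by (intro nn_integral_cong_AE) (auto simp: indicator_def elim!: AE_mp)
  finally show ?thesis .
qed

lemma nn_integral_tor_translate:
  assumes "g \<in> borel_measurable borel" "periodic2 g"
  shows "(\<integral>\<^sup>+x. g (x + a) \<partial>tor) = (\<integral>\<^sup>+x. g x \<partial>tor)"
  using nn_integral_ucell_translate[of g a] assms periodic2_lat[OF assms(2)]
  by (subst (1 2) nn_integral_tor) auto

text \<open>A translation or shear moves points out of the cell, so preservation of measure is
  expressed through periodic test functions. These are Borel, since Lebesgue measurability would not
  survive the composition.\<close>

definition tor_preserving :: "(pt \<Rightarrow> pt) \<Rightarrow> bool" where
  "tor_preserving S \<longleftrightarrow> S \<in> borel_measurable borel \<and>
     (\<forall>g::pt\<Rightarrow>ennreal. g \<in> borel_measurable borel \<longrightarrow> periodic2 g \<longrightarrow> (\<integral>\<^sup>+x. g (S x) \<partial>tor) = (\<integral>\<^sup>+x. g x \<partial>tor))"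

lemma tor_preserving_integral:
  fixes f :: "pt \<Rightarrow> real"
  assumes S: "tor_preserving S" and [measurable]: "f \<in> borel_measurable borel" and per: "periodic2 f"
  shows "(LINT x|tor. f (S x)) = (LINT x|tor. f x)"
    and "integrable tor (\<lambda>x. f (S x)) \<longleftrightarrow> integrable tor f"
proof -
  have Sm[measurable]: "S \<in> borel_measurable borel"
    and nn: "\<And>g::pt\<Rightarrow>ennreal. g \<in> borel_measurable borel \<Longrightarrow> periodic2 g \<Longrightarrow> (\<integral>\<^sup>+x. g (S x) \<partial>tor) = (\<integral>\<^sup>+x. g x \<partial>tor)"
    using S by (auto simp: tor_preserving_def)
  have m: "f \<in> borel_measurable tor" "(\<lambda>x. f (S x)) \<in> borel_measurable tor"
    by (auto intro!: borel_tor)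
  have p: "periodic2 (\<lambda>x. h (f x))" for h :: "real \<Rightarrow> ennreal" using per by (auto simp: periodic2_def)
  have 1: "(\<integral>\<^sup>+x. ennreal (norm (f (S x))) \<partial>tor) = (\<integral>\<^sup>+x. ennreal (norm (f x)) \<partial>tor)"
    by (rule nn) (use p in auto)
  show i: "integrable tor (\<lambda>x. f (S x)) \<longleftrightarrow> integrable tor f"
    using m 1 by (simp add: integrable_iff_bounded)
  have 2: "(\<integral>\<^sup>+x. ennreal (f (S x)) \<partial>tor) = (\<integral>\<^sup>+x. ennreal (f x) \<partial>tor)"
     "(\<integral>\<^sup>+x. ennreal (- f (S x)) \<partial>tor) = (\<integral>\<^sup>+x. ennreal (- f x) \<partial>tor)"
    by (rule nn; use p[of ennreal] p[of "\<lambda>t. ennreal (- t)"] in auto)+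
  show "(LINT x|tor. f (S x)) = (LINT x|tor. f x)"
  proof (cases "integrable tor f")
    case True
    then show ?thesis using i 2 by (simp add: real_lebesgue_integral_def)
  next
    case False
    then show ?thesis using i by (simp add: not_integrable_integral_eq)
  qed
qed

lemma tor_preserving_translate: "tor_preserving (\<lambda>x. x + a)"
  unfolding tor_preserving_def using nn_integral_tor_translate by auto

text \<open>Averaging over the translations along the direction \<open>d\<close>, under which the profile is
  invariant, turns the shear into a translation of the averaging variable.\<close>
lemma tor_preserving_shear:
  fixes p :: "pt \<Rightarrow> real" and d :: pt
  assumes p[measurable]: "p \<in> borel_measurable borel" and per: "periodic2 p"
    and inv: "\<And>x s. p (x + s *\<^sub>R d) = p x" and d: "d \<in> lat"
  shows "tor_preserving (\<lambda>x. x + p x *\<^sub>R d)"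
  unfolding tor_preserving_def
proof (intro conjI allI impI)
  show "(\<lambda>x. x + p x *\<^sub>R d) \<in> borel_measurable borel" by measurable
  fix g :: "pt \<Rightarrow> ennreal"
  assume g[measurable]: "g \<in> borel_measurable borel" and gp: "periodic2 g"
  let ?C = "\<lambda>f. \<integral>\<^sup>+x. f x * indicator ucell x \<partial>lborel"
  have u1: "(\<integral>\<^sup>+s. c * indicator ucell (s::real) \<partial>lborel) = c" for c :: ennreal
  proof -
    have "(ucell::real set) = {0..<1}" by (auto simp: ucell_def)
    then have "emeasure lborel (ucell::real set) = emeasure lborel {0..<1::real}" by (rule arg_cong)
    then have "emeasure lborel (ucell::real set) = 1" by simp
    then show ?thesis by (simp add: nn_integral_cmult_indicator)
  qed
  have pers: "g (x + p x *\<^sub>R d + axis j 1) = g (x + p x *\<^sub>R d)" for x j using gp by (auto simp: periodic2_def)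
  have gs: "g (x + (s + n) *\<^sub>R d) = g (x + s *\<^sub>R d)" if "n \<in> lat" for x :: pt and s n :: real
  proof -
    have "n *\<^sub>R d \<in> lat" using that d by (auto simp: lat_def)
    from periodic2_lat[OF gp this, of "x + s *\<^sub>R d"] show ?thesis by (simp add: algebra_simps)
  qed
  have "(\<integral>\<^sup>+x. g (x + p x *\<^sub>R d) \<partial>tor) = ?C (\<lambda>x. g (x + p x *\<^sub>R d))"
    by (rule nn_integral_tor) measurable
  also have "\<dots> = (\<integral>\<^sup>+s. ?C (\<lambda>x. g (x + p x *\<^sub>R d)) * indicator ucell (s::real) \<partial>lborel)"
    by (simp only: u1)
  also have "\<dots> = (\<integral>\<^sup>+s. ?C (\<lambda>x. g (x + (s + p x) *\<^sub>R d)) * indicator ucell s \<partial>lborel)"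
  proof (rule nn_integral_cong)
    fix s :: real
    have "?C (\<lambda>x. g (x + p x *\<^sub>R d)) = ?C (\<lambda>x. g ((x + s *\<^sub>R d) + p (x + s *\<^sub>R d) *\<^sub>R d))"
    proof (rule nn_integral_ucell_translate[symmetric])
      fix n x :: pt assume n: "n \<in> lat"
      show "g (x + n + p (x + n) *\<^sub>R d) = g (x + p x *\<^sub>R d)"
        using periodic2_lat[OF per n, of x] periodic2_lat[OF gp n, of "x + p x *\<^sub>R d"]
        by (simp add: algebra_simps)
    qed measurable
    also have "\<dots> = ?C (\<lambda>x. g (x + (s + p x) *\<^sub>R d))"
      by (simp add: inv scaleR_add_left add.assoc)
    finally show "?C (\<lambda>x. g (x + p x *\<^sub>R d)) * indicator ucell s = ?C (\<lambda>x. g (x + (s + p x) *\<^sub>R d)) * indicator ucell s"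
      by (rule arg_cong)
  qed
  also have "\<dots> = (\<integral>\<^sup>+s. (\<integral>\<^sup>+x. g (x + (s + p x) *\<^sub>R d) * indicator ucell x * indicator ucell s \<partial>lborel) \<partial>lborel)"
    by (intro nn_integral_cong nn_integral_multc[symmetric]) measurable
  also have "\<dots> = (\<integral>\<^sup>+x. (\<integral>\<^sup>+s. g (x + (s + p x) *\<^sub>R d) * indicator ucell x * indicator ucell s \<partial>lborel) \<partial>lborel)"
    by (rule lborel_pair.Fubini'[symmetric]) measurable
  also have "\<dots> = (\<integral>\<^sup>+x. (\<integral>\<^sup>+s. g (x + s *\<^sub>R d) * indicator ucell x * indicator ucell s \<partial>lborel) \<partial>lborel)"
  proof (rule nn_integral_cong)
    fix x :: pt
    show "(\<integral>\<^sup>+s. g (x + (s + p x) *\<^sub>R d) * indicator ucell x * indicator ucell s \<partial>lborel)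
       = (\<integral>\<^sup>+s. g (x + s *\<^sub>R d) * indicator ucell x * indicator ucell s \<partial>lborel)"
      by (rule nn_integral_ucell_translate) (use gs in auto)
  qed
  also have "\<dots> = (\<integral>\<^sup>+s. (\<integral>\<^sup>+x. g (x + s *\<^sub>R d) * indicator ucell x * indicator ucell s \<partial>lborel) \<partial>lborel)"
    by (rule lborel_pair.Fubini') measurable
  also have "\<dots> = (\<integral>\<^sup>+s. ?C (\<lambda>x. g (x + s *\<^sub>R d)) * indicator ucell s \<partial>lborel)"
    by (intro nn_integral_cong nn_integral_multc) measurable
  also have "\<dots> = (\<integral>\<^sup>+s. ?C g * indicator ucell (s::real) \<partial>lborel)"
    by (rule nn_integral_cong, subst nn_integral_ucell_translate[OF g periodic2_lat[OF gp]]) auto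
  also have "\<dots> = ?C g" by (rule u1)
  also have "\<dots> = (\<integral>\<^sup>+x. g x \<partial>tor)" by (rule nn_integral_tor[symmetric]) measurable
  finally show "(\<integral>\<^sup>+x. g (x + p x *\<^sub>R d) \<partial>tor) = (\<integral>\<^sup>+x. g x \<partial>tor)" .
qed

text \<open>The difference quotients have integral zero by translation invariance, and the mean
  value bound dominates them on the cell. This replaces iterated integration and boundary terms, and
  works for any direction \<open>d\<close>.\<close>

lemma integral_partial_derivative_zero:
  fixes f g :: "pt \<Rightarrow> real"
  assumes per: "periodic2 f" and cg: "continuous_on UNIV g" and cf: "continuous_on UNIV f"
    and der: "\<And>x. ((\<lambda>s. f (x + s *\<^sub>R d)) has_vector_derivative g x) (at 0)"
  shows "(LINT x|tor. g x) = 0"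
proof -
  have der': "((\<lambda>s. f (x + s *\<^sub>R d)) has_vector_derivative g (x + t *\<^sub>R d)) (at t within A)" for x t A
  proof -
    have "((\<lambda>s. f (x + t *\<^sub>R d + s *\<^sub>R d)) has_vector_derivative g (x + t *\<^sub>R d)) (at (t + (-t)))"
      using der[of "x + t *\<^sub>R d"] by simp
    then have "((\<lambda>s. f (x + t *\<^sub>R d + s *\<^sub>R d)) \<circ> (\<lambda>s. s - t) has_vector_derivative 1 *\<^sub>R g (x + t *\<^sub>R d)) (at t)"
      by (intro vector_diff_chain_at) (auto intro!: derivative_eq_intros)
    then show ?thesis by (auto simp: o_def algebra_simps intro: has_vector_derivative_at_within)
  qed
  have cf': "continuous_on UNIV (\<lambda>x. f (x + a))" for a
    by (intro continuous_on_compose2[OF cf] continuous_intros) auto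
  have lim: "(\<lambda>n. f (x + (1 / real (Suc n)) *\<^sub>R d) - f x) = (\<lambda>n. integral {0..1 / real (Suc n)} (\<lambda>s. g (x + s *\<^sub>R d)))" for x
  proof
    fix n
    have "((\<lambda>s. g (x + s *\<^sub>R d)) has_integral (f (x + (1 / real (Suc n)) *\<^sub>R d) - f (x + 0 *\<^sub>R d))) {0..1 / real (Suc n)}"
      by (rule fundamental_theorem_of_calculus) (use der' in auto)
    then show "f (x + (1 / real (Suc n)) *\<^sub>R d) - f x = integral {0..1 / real (Suc n)} (\<lambda>s. g (x + s *\<^sub>R d))"
      by (simp add: integral_unique)
  qed
  have "continuous_on UNIV (\<lambda>z::real\<times>pt. g (snd z + fst z *\<^sub>R d))"
    by (intro continuous_on_compose2[OF cg] continuous_intros) auto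
  moreover have "compact ({0..1::real} \<times> cell)" unfolding cell_def by (intro compact_Times) auto
  ultimately have "compact ((\<lambda>z::real\<times>pt. g (snd z + fst z *\<^sub>R d)) ` ({0..1::real} \<times> cell))"
    by (meson compact_continuous_image continuous_on_subset subset_UNIV)
  then have "bounded ((\<lambda>z::real\<times>pt. g (snd z + fst z *\<^sub>R d)) ` ({0..1::real} \<times> cell))"
    by (rule compact_imp_bounded)
  then obtain B where B: "\<And>s x. s \<in> {0..1} \<Longrightarrow> x \<in> cell \<Longrightarrow> norm (g (x + s *\<^sub>R d)) \<le> B"
    unfolding bounded_iff by fastforce
  define h where "h n x = real (Suc n) * (f (x + (1 / real (Suc n)) *\<^sub>R d) - f x)" for n x
  have hb: "norm (h n x) \<le> B" if "x \<in> cell" for n x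
  proof -
    have "norm (f (x + (1 / real (Suc n)) *\<^sub>R d) - f (x + 0 *\<^sub>R d)) \<le> B * norm (1 / real (Suc n) - 0)"
    proof (rule differentiable_bound[of "{0..1/real (Suc n)}" "\<lambda>s. f (x + s *\<^sub>R d)" "\<lambda>t h. h *\<^sub>R g (x + t *\<^sub>R d)" B])
      fix s assume s: "s \<in> {0..1 / real (Suc n)}"
      show "((\<lambda>s. f (x + s *\<^sub>R d)) has_derivative (\<lambda>h. h *\<^sub>R g (x + s *\<^sub>R d))) (at s within {0..1 / real (Suc n)})"
        using der'[of x s] by (simp only: has_vector_derivative_def)
      have "1 / real (Suc n) \<le> 1" by simp
      then have "s \<in> {0..1}" using s order_trans[of s "1 / real (Suc n)" 1] by (auto simp del: of_nat_Suc)
      then have "norm (g (x + s *\<^sub>R d)) \<le> B" using B that by blast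
      then show "onorm (\<lambda>h. h *\<^sub>R g (x + s *\<^sub>R d)) \<le> B"
        by (intro onorm_le) (simp add: abs_mult mult.commute[of B] mult_left_mono)
    qed auto
    then have "real (Suc n) * norm (f (x + (1 / real (Suc n)) *\<^sub>R d) - f x) \<le> real (Suc n) * (B * (1 / real (Suc n)))"
      by (intro mult_left_mono) (simp_all del: of_nat_Suc)
    then show ?thesis by (simp add: h_def abs_mult del: of_nat_Suc)
  qed
  have hz: "(LINT x|tor. h n x) = 0" for n
  proof -
    have "(LINT x|tor. f (x + (1 / real (Suc n)) *\<^sub>R d)) = (LINT x|tor. f x)"
      by (rule tor_preserving_integral[OF tor_preserving_translate])
         (use per cf in \<open>auto intro: borel_measurable_continuous_onI\<close>)
    then show ?thesis unfolding h_def
      using integrable_tor_continuous[OF cf] integrable_tor_continuous[OF cf'] by simp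
  qed
  have hl: "(\<lambda>n. h n x) \<longlonglongrightarrow> g x" for x
  proof -
    have "((\<lambda>s. (f (x + s *\<^sub>R d) - f x) / s) \<longlongrightarrow> g x) (at 0)"
      using der[of x] by (simp add: has_real_derivative_iff_has_vector_derivative[symmetric] DERIV_def)
    moreover have "filterlim (\<lambda>n. 1 / real (Suc n)) (at 0) sequentially"
      using LIMSEQ_Suc[OF lim_1_over_n] by (simp add: filterlim_at del: of_nat_Suc)
    ultimately have "(\<lambda>n. (f (x + (1 / real (Suc n)) *\<^sub>R d) - f x) / (1 / real (Suc n))) \<longlonglongrightarrow> g x"
      by (rule filterlim_compose)
    then show ?thesis by (simp add: h_def mult.commute)
  qed
  have "(\<lambda>n. LINT x|tor. h n x) \<longlonglongrightarrow> (LINT x|tor. g x)"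
  proof (rule integral_dominated_convergence[where w="\<lambda>_. B"])
    show "h n \<in> borel_measurable tor" for n
      unfolding h_def using cf' cf by (intro continuous_tor continuous_intros)
  qed (use hb hl continuous_tor[OF cg] in \<open>auto intro!: AE_I2\<close>)
  then show ?thesis by (simp add: hz LIMSEQ_const_iff)
qed

subsection \<open>Square-integrable functions on the torus\<close>

definition sqi :: "(pt \<Rightarrow> 'b::euclidean_space) \<Rightarrow> bool" where
  "sqi f \<longleftrightarrow> f \<in> borel_measurable tor \<and> integrable tor (\<lambda>x. (norm (f x))\<^sup>2)"

lemma sqi_meas: "sqi f \<Longrightarrow> f \<in> borel_measurable tor"
  and sqi_int2: "sqi f \<Longrightarrow> integrable tor (\<lambda>x. (norm (f x))\<^sup>2)"
  by (auto simp: sqi_def)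

lemma sqi_L2: "f \<in> L2 \<Longrightarrow> sqi f"
  by (auto simp: L2_def sqi_def tor_integrable lebesgue_tor)

lemma ip_tor: "ip f g = (LINT x|tor. f x \<bullet> g x)"
  by (simp add: ip_def tor_integral)

lemma L2norm_tor: "L2norm f = sqrt (LINT x|tor. (norm (f x))\<^sup>2)"
  by (simp add: L2norm_def tor_integral)

lemma L2norm_nonneg [simp]: "0 \<le> L2norm f"
  by (simp add: L2norm_tor)

lemma L2norm_power2: "(L2norm f)\<^sup>2 = (LINT x|tor. (norm (f x))\<^sup>2)"
  by (simp add: L2norm_tor)

lemma L2norm_ip: "(L2norm f)\<^sup>2 = ip f f"
  by (simp add: L2norm_power2 ip_tor power2_norm_eq_inner)

lemma two_inner_le: "\<bar>x \<bullet> y\<bar> \<le> (norm x)\<^sup>2 + (norm y)\<^sup>2" for x y :: "'b::real_inner"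
proof -
  have "\<bar>x \<bullet> y\<bar> \<le> norm x * norm y" by (rule Cauchy_Schwarz_ineq2)
  moreover have "0 \<le> (norm x - norm y)\<^sup>2" "0 \<le> (norm x)\<^sup>2" "0 \<le> (norm y)\<^sup>2" by simp_all
  ultimately show ?thesis by (simp add: power2_diff)
qed

lemma integrable_inner: 
  assumes "sqi f" "sqi g" shows "integrable tor (\<lambda>x. f x \<bullet> g x)"
proof (rule Bochner_Integration.integrable_bound)
  show "integrable tor (\<lambda>x. (norm (f x))\<^sup>2 + (norm (g x))\<^sup>2)"
    using assms by (intro Bochner_Integration.integrable_add sqi_int2)
  show "(\<lambda>x. f x \<bullet> g x) \<in> borel_measurable tor"
    using assms by (intro borel_measurable_inner sqi_meas)
  show "AE x in tor. norm (f x \<bullet> g x) \<le> norm ((norm (f x))\<^sup>2 + (norm (g x))\<^sup>2)"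
    using two_inner_le by (intro AE_I2) (auto intro!: order_trans[OF two_inner_le])
qed

lemma sqi_add: 
  assumes "sqi f" "sqi g" shows "sqi (\<lambda>x. f x + g x)"
proof -
  have "(norm (f x + g x))\<^sup>2 = (norm (f x))\<^sup>2 + (norm (g x))\<^sup>2 + 2 * (f x \<bullet> g x)" for x
    by (simp add: power2_norm_eq_inner inner_add_left inner_add_right inner_commute)
  then show ?thesis
    using assms integrable_inner[OF assms] by (simp add: sqi_def borel_measurable_add)
qed

lemma sqi_scaleR: 
  assumes "sqi f" shows "sqi (\<lambda>x. c *\<^sub>R f x)"
  using assms by (auto simp: sqi_def power_mult_distrib)

lemma sqi_uminus: "sqi f \<Longrightarrow> sqi (\<lambda>x. - f x)"
  using sqi_scaleR[of f "-1"] by simp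

lemma sqi_diff: "sqi f \<Longrightarrow> sqi g \<Longrightarrow> sqi (\<lambda>x. f x - g x)"
  using sqi_add[OF _ sqi_uminus, of f g] by simp

lemma sqi_bounded:
  assumes "f \<in> borel_measurable tor" "\<And>x. x \<in> cell \<Longrightarrow> norm (f x) \<le> B"
  shows "sqi f"
  unfolding sqi_def
proof
  have "norm ((norm (f x))\<^sup>2) \<le> B\<^sup>2" if "x \<in> cell" for x
    using power_mono[OF assms(2)[OF that], of 2] by simp
  then show "integrable tor (\<lambda>x. (norm (f x))\<^sup>2)"
    using assms(1) by (intro integrable_tor_bounded[of _ "B\<^sup>2"]) auto
qed (use assms in auto)

lemma sqi_continuous:
  assumes "continuous_on UNIV f" shows "sqi f"
  using bounded_on_cell[OF assms] sqi_bounded continuous_tor[OF assms] by metis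

lemma sqi_const [simp]: "sqi (\<lambda>x. c)"
  by (rule sqi_continuous) simp

lemma sqi_sum:
  "(\<And>i. i \<in> F \<Longrightarrow> sqi (f i)) \<Longrightarrow> sqi (\<lambda>x. \<Sum>i\<in>F. f i x)"
  by (induction F rule: infinite_finite_induct) (auto intro!: sqi_add)

lemma sqi_bounded_scaleR:
  assumes f: "sqi f" and h: "h \<in> borel_measurable tor" "\<And>x. x \<in> cell \<Longrightarrow> \<bar>h x\<bar> \<le> B"
  shows "sqi (\<lambda>x. h x *\<^sub>R f x)"
  unfolding sqi_def
proof
  show m: "(\<lambda>x. h x *\<^sub>R f x) \<in> borel_measurable tor"
    using h sqi_meas[OF f] by (intro borel_measurable_scaleR)
  show "integrable tor (\<lambda>x. (norm (h x *\<^sub>R f x))\<^sup>2)"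
  proof (rule Bochner_Integration.integrable_bound)
    show "integrable tor (\<lambda>x. B\<^sup>2 * (norm (f x))\<^sup>2)" using sqi_int2[OF f] by simp
    have "\<bar>h x\<bar>\<^sup>2 \<le> B\<^sup>2" if "x \<in> cell" for x
      using power_mono[OF h(2)[OF that], of 2] by simp
    then show "AE x in tor. norm ((norm (h x *\<^sub>R f x))\<^sup>2) \<le> norm (B\<^sup>2 * (norm (f x))\<^sup>2)"
      by (intro AE_I2) (auto simp: power_mult_distrib intro!: mult_right_mono)
  qed (use m in measurable)
qed

lemma sqi_integrable:
  assumes "sqi f" shows "integrable tor f"
proof (rule Bochner_Integration.integrable_bound)
  show "integrable tor (\<lambda>x. (norm (f x))\<^sup>2 + 1)" using sqi_int2[OF assms] by simp
  have "a \<le> a\<^sup>2 + 1" for a :: real using zero_le_power2[of "a - 1"] zero_le_power2[of a] unfolding power2_diff power_one mult_1_right by linarith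
  then show "AE x in tor. norm (f x) \<le> norm ((norm (f x))\<^sup>2 + 1)" by (intro AE_I2) auto
qed (use assms sqi_meas in auto)

lemma sqi_component: 
  fixes f :: "pt \<Rightarrow> 'b::euclidean_space"
  assumes "sqi f" shows "sqi (\<lambda>x. f x \<bullet> v)"
proof -
  have "integrable tor (\<lambda>x. (norm (f x \<bullet> v))\<^sup>2)"
  proof (rule Bochner_Integration.integrable_bound)
    show "integrable tor (\<lambda>x. (norm v)\<^sup>2 * (norm (f x))\<^sup>2)" using sqi_int2[OF assms] by simp
    have "\<bar>f x \<bullet> v\<bar>\<^sup>2 \<le> (norm (f x) * norm v)\<^sup>2" for x
      by (intro power_mono Cauchy_Schwarz_ineq2) simp
    then show "AE x in tor. norm ((norm (f x \<bullet> v))\<^sup>2) \<le> norm ((norm v)\<^sup>2 * (norm (f x))\<^sup>2)"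
      by (intro AE_I2) (auto simp: power_mult_distrib mult.commute)
  qed (use sqi_meas[OF assms] in auto)
  then show ?thesis using sqi_meas[OF assms] by (simp add: sqi_def)
qed

lemma ip_diff_left: "sqi f \<Longrightarrow> sqi g \<Longrightarrow> sqi h \<Longrightarrow> ip (\<lambda>x. f x - g x) h = ip f h - ip g h"
  by (simp add: ip_tor inner_diff_left integrable_inner)
lemma ip_scaleR_left: "ip (\<lambda>x. c *\<^sub>R f x) h = c * ip f h"
  by (simp add: ip_tor)
lemma ip_commute: "ip f g = ip g f"
  by (simp add: ip_tor inner_commute)
lemma ip_sum_left:
  "(\<And>i. i \<in> F \<Longrightarrow> sqi (f i)) \<Longrightarrow> sqi h \<Longrightarrow> ip (\<lambda>x. \<Sum>i\<in>F. f i x) h = (\<Sum>i\<in>F. ip (f i) h)"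
  by (simp add: ip_tor inner_sum_left integrable_inner)

lemma ip_cauchy_schwarz:
  assumes "sqi f" "sqi g" shows "\<bar>ip f g\<bar> \<le> L2norm f * L2norm g"
proof -
  have q: "0 \<le> (L2norm f)\<^sup>2 * t\<^sup>2 + 2 * t * ip f g + (L2norm g)\<^sup>2" for t
  proof -
    have "0 \<le> ip (\<lambda>x. t *\<^sub>R f x + g x) (\<lambda>x. t *\<^sub>R f x + g x)" by (simp add: ip_tor)
    also have "\<dots> = (LINT x|tor. t\<^sup>2 * (f x \<bullet> f x) + 2 * t * (f x \<bullet> g x) + g x \<bullet> g x)"
      by (simp add: ip_tor inner_add_left inner_add_right inner_commute power2_eq_square algebra_simps)
    also have "\<dots> = (L2norm f)\<^sup>2 * t\<^sup>2 + 2 * t * ip f g + (L2norm g)\<^sup>2"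
      using assms by (simp add: L2norm_ip ip_tor integrable_inner)
    finally show ?thesis .
  qed
  have "(ip f g)\<^sup>2 \<le> (L2norm f)\<^sup>2 * (L2norm g)\<^sup>2"
  proof (cases "L2norm f = 0")
    case True
    have "ip f g = 0"
    proof (rule ccontr)
      assume n: "ip f g \<noteq> 0"
      \<comment> \<open>At this \<open>t\<close> the quadratic form, which is affine when
        \<open>L2norm f = 0\<close>, takes the value -1.\<close>
      from q[of "-((L2norm g)\<^sup>2 + 1) / (2 * ip f g)"] show False using True n by (simp add: field_simps)
    qed
    then show ?thesis by simp
  next
    case False
    then have p: "0 < (L2norm f)\<^sup>2" by simp
    have "a * (- c / a)\<^sup>2 + 2 * (- c / a) * c = - (c\<^sup>2 / a)" if "0 < a" for a c :: real
      using that by (simp add: field_simps power2_eq_square)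
    from this[OF p, of "ip f g"] have "0 \<le> (L2norm g)\<^sup>2 - (ip f g)\<^sup>2 / (L2norm f)\<^sup>2"
      using q[of "- ip f g / (L2norm f)\<^sup>2"] by linarith
    then show ?thesis using p by (simp add: field_simps)
  qed
  then have "(ip f g)\<^sup>2 \<le> (L2norm f * L2norm g)\<^sup>2" by (simp add: power_mult_distrib)
  then show ?thesis by (simp add: abs_le_square_iff[symmetric] abs_mult)
qed

lemma L2norm_scaleR: "L2norm (\<lambda>x. c *\<^sub>R f x) = \<bar>c\<bar> * L2norm f"
  by (simp add: L2norm_tor power_mult_distrib real_sqrt_mult)

lemma L2norm_triangle:
  assumes "sqi f" "sqi g" shows "L2norm (\<lambda>x. f x + g x) \<le> L2norm f + L2norm g"
proof (rule power2_le_imp_le)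
  have "(L2norm (\<lambda>x. f x + g x))\<^sup>2 = (L2norm f)\<^sup>2 + 2 * ip f g + (L2norm g)\<^sup>2"
    using assms by (simp add: L2norm_ip ip_tor inner_add_left inner_add_right integrable_inner inner_commute)
  then show "(L2norm (\<lambda>x. f x + g x))\<^sup>2 \<le> (L2norm f + L2norm g)\<^sup>2"
    using ip_cauchy_schwarz[OF assms] by (simp add: power2_sum)
qed simp

lemma L2norm_cong_AE: 
  assumes "f \<in> borel_measurable tor" "g \<in> borel_measurable tor" "AE x in tor. f x = g x"
  shows "L2norm f = L2norm g"
  unfolding L2norm_tor using assms by (intro arg_cong[where f=sqrt] integral_cong_AE) auto

lemma ip_cong_AE:
  fixes f :: "pt \<Rightarrow> 'b::euclidean_space"
  assumes "f \<in> borel_measurable tor" "g \<in> borel_measurable tor" "h \<in> borel_measurable tor" "AE x in tor. f x = g x"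
  shows "ip f h = ip g h"
  unfolding ip_tor using assms by (intro integral_cong_AE) auto

lemma norm_integral_le_L2norm:
  fixes f :: "pt \<Rightarrow> 'b::euclidean_space"
  assumes "sqi f" shows "(LINT x|tor. norm (f x)) \<le> L2norm f"
proof -
  have s: "sqi (\<lambda>x. norm (f x))" using assms by (auto simp: sqi_def)
  have "\<bar>ip (\<lambda>x. norm (f x)) (\<lambda>x. 1)\<bar> \<le> L2norm (\<lambda>x. norm (f x)) * L2norm (\<lambda>x. 1::real)"
    by (rule ip_cauchy_schwarz) (use s in auto)
  then show ?thesis by (simp add: ip_tor L2norm_tor measure_tor)
qed

subsection \<open>The Hartley basis\<close>

definition ph :: "int \<times> int \<Rightarrow> pt \<Rightarrow> real" where
  "ph k x = 2 * pi * (of_int (fst k) * x$1 + of_int (snd k) * x$2)"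

text \<open>These functions form a real orthonormal basis of \<open>L\<^sup>2\<close>, so that complex coefficients are avoided;
the derivative exchanges the indices \<open>k\<close> and \<open>- k\<close>.\<close>
definition cas :: "int \<times> int \<Rightarrow> pt \<Rightarrow> real" where
  "cas k x = cos (ph k x) + sin (ph k x)"

lemma ph_simps: "ph (k + l) x = ph k x + ph l x" "ph (k - l) x = ph k x - ph l x" "ph (- k) x = - ph k x"
  "ph k (x + y) = ph k x + ph k y" "ph k (s *\<^sub>R x) = s * ph k x" "ph 0 x = 0"
  by (simp_all add: ph_def algebra_simps)

lemma cas_0 [simp]: "cas 0 x = 1" by (simp add: cas_def ph_simps)

lemma cos_cas: "cos (ph k x) = (cas k x + cas (- k) x) / 2"
  and sin_cas: "sin (ph k x) = (cas k x - cas (- k) x) / 2"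
  by (simp_all add: cas_def ph_simps)

lemma cas_mult: "cas k x * cas l x = (cas (k - l) x + cas (l - k) x + cas (k + l) x - cas (- k - l) x) / 2"
  by (simp add: cas_def ph_simps cos_add cos_diff sin_add sin_diff algebra_simps)

lemma cas_bound: "\<bar>cas k x\<bar> \<le> 2"
  using abs_cos_le_one[of "ph k x"] abs_sin_le_one[of "ph k x"] unfolding cas_def by linarith

lemma ph_has_derivative: "(ph k has_derivative ph k) (at x within A)"
proof -
  have "bounded_linear (ph k)"
    by (intro linear_conv_bounded_linear[THEN iffD1] linearI) (auto simp: ph_simps)
  then show ?thesis by (rule bounded_linear_imp_has_derivative)
qed

lemma cas_has_derivative: "(cas k has_derivative (\<lambda>v. ph k v * cas (- k) x)) (at x within A)"
  unfolding cas_def[abs_def]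
  by (rule derivative_eq_intros ph_has_derivative refl)+ (auto simp: ph_simps algebra_simps)

lemma continuous_cas [continuous_intros]: "continuous_on A (cas k)"
  unfolding cas_def[abs_def] ph_def by (intro continuous_intros)

lemma cas_measurable [measurable]: "cas k \<in> borel_measurable tor" "cas k \<in> borel_measurable borel"
  using continuous_cas continuous_tor borel_measurable_continuous_onI by blast+

lemma sqi_cas [simp]: "sqi (cas k)" by (intro sqi_continuous continuous_cas)

lemma axis_nth2: "axis i (1::real) $ j = (if i = j then 1 else 0)" by (simp add: axis_def)

lemma cos_period_int: "cos (x + 2 * pi * of_int m) = cos x" and sin_period_int: "sin (x + 2 * pi * of_int m) = sin x"
  by (simp_all add: cos_add sin_add cos_int_2pin sin_int_2pin)

lemma ph_axis: "ph k (axis j 1) = 2 * pi * of_int (if j = 1 then fst k else snd k)"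
  using exhaust_2[of j] by (auto simp: ph_def axis_nth2)

lemma periodic_cas: "periodic2 (cas k)"
  unfolding periodic2_def cas_def ph_simps ph_axis by (simp only: cos_period_int sin_period_int) simp

definition kc :: "int \<times> int \<Rightarrow> 2 \<Rightarrow> real" where
  "kc k j = of_int (if j = 1 then fst k else snd k)"

lemma kc_simps: "kc (- k) j = - kc k j" "kc 0 j = 0" "kc k 1 = of_int (fst k)" "kc k 2 = of_int (snd k)"
  by (auto simp: kc_def)

lemma kc_eq_0: "(\<forall>j. kc k j = 0) \<longleftrightarrow> k = 0"
  by (auto simp: forall_2 kc_simps prod_eq_iff)

lemma ph_axis_kc: "ph k (axis j 1) = 2 * pi * kc k j"
  unfolding ph_axis kc_def ..

lemma cas_directional: "((\<lambda>s. cas k (x + s *\<^sub>R v)) has_vector_derivative (ph k v * cas (- k) (x + t *\<^sub>R v))) (at t within A)"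
proof -
  have "((\<lambda>s. cas k (x + s *\<^sub>R v)) has_derivative (\<lambda>h. ph k (h *\<^sub>R v) * cas (- k) (x + t *\<^sub>R v))) (at t within A)"
    by (rule has_derivative_compose[OF _ cas_has_derivative])
       (rule derivative_eq_intros refl | simp)+
  then show ?thesis by (simp add: has_vector_derivative_def ph_simps mult.assoc)
qed

lemma integral_cas: "(LINT x|tor. cas k x) = (if k = 0 then 1 else 0)"
proof (cases "k = 0")
  case False
  then obtain j where j: "kc k j \<noteq> 0" using kc_eq_0 by blast
  have "(LINT x|tor. ph (- k) (axis j 1) * cas k x) = 0"
  proof (rule integral_partial_derivative_zero[where f="cas (- k)" and d="axis j 1"])
    show "((\<lambda>s. cas (- k) (x + s *\<^sub>R axis j 1)) has_vector_derivative ph (- k) (axis j 1) * cas k x) (at 0)" for x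
      using cas_directional[of "- k" x "axis j 1" 0 UNIV] by simp
  qed (intro periodic_cas continuous_intros)+
  then show ?thesis using j False by (simp add: ph_axis_kc kc_simps)
qed (simp add: measure_tor)

lemma integral_cas_mult: "(LINT x|tor. cas k x * cas l x) = (if k = l then 1 else 0)"
proof -
  have i: "integrable tor (cas m)" for m by (intro integrable_tor_continuous continuous_cas)
  have "(LINT x|tor. cas k x * cas l x) =
    ((LINT x|tor. cas (k - l) x) + (LINT x|tor. cas (l - k) x) + (LINT x|tor. cas (k + l) x) - (LINT x|tor. cas (- k - l) x)) / 2"
    unfolding cas_mult by (simp add: i)
  \<comment> \<open>The last two integrals cancel whether or not \<open>k + l = 0\<close>; the first
    two both equal 1 exactly when \<open>k = l\<close>.\<close>
  moreover have "- k - l = 0 \<longleftrightarrow> k + l = 0" by (cases k; cases l) (auto simp: zero_prod_def)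
  ultimately show ?thesis by (auto simp: integral_cas)
qed

definition hat :: "(pt \<Rightarrow> 'b::euclidean_space) \<Rightarrow> int \<times> int \<Rightarrow> 'b" where
  "hat f k = (LINT x|tor. cas k x *\<^sub>R f x)"

definition Psum :: "(int \<times> int) set \<Rightarrow> (int \<times> int \<Rightarrow> 'b::euclidean_space) \<Rightarrow> pt \<Rightarrow> 'b" where
  "Psum F a x = (\<Sum>k\<in>F. cas k x *\<^sub>R a k)"

lemma integrable_cas_scaleR:
  fixes f :: "pt \<Rightarrow> 'b::euclidean_space"
  assumes "integrable tor f" shows "integrable tor (\<lambda>x. cas k x *\<^sub>R f x)"
proof (rule Bochner_Integration.integrable_bound)
  show "integrable tor (\<lambda>x. 2 *\<^sub>R f x)" using assms by simp
  show "(\<lambda>x. cas k x *\<^sub>R f x) \<in> borel_measurable tor"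
    using borel_measurable_integrable[OF assms] by (intro borel_measurable_scaleR) auto
  show "AE x in tor. norm (cas k x *\<^sub>R f x) \<le> norm (2 *\<^sub>R f x)"
    by (auto intro!: mult_right_mono cas_bound)
qed

lemma hat_inner: "integrable tor f \<Longrightarrow> hat f k \<bullet> v = hat (\<lambda>x. f x \<bullet> v) k"
  unfolding hat_def by (subst integral_inner_left[symmetric]) (auto intro: integrable_cas_scaleR)

lemma hat_add: "integrable tor f \<Longrightarrow> integrable tor g \<Longrightarrow> hat (\<lambda>x. f x + g x) k = hat f k + hat g k"
  by (simp add: hat_def scaleR_add_right integrable_cas_scaleR)
lemma hat_diff: "integrable tor f \<Longrightarrow> integrable tor g \<Longrightarrow> hat (\<lambda>x. f x - g x) k = hat f k - hat g k"
  by (simp add: hat_def scaleR_diff_right integrable_cas_scaleR)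
lemma hat_scaleR: "hat (\<lambda>x. c *\<^sub>R f x) k = c *\<^sub>R hat f k"
  unfolding hat_def by (subst integral_scaleR_right[symmetric]) (simp add: mult.commute)
lemma hat_sum: "(\<And>i. i \<in> F \<Longrightarrow> integrable tor (f i)) \<Longrightarrow> hat (\<lambda>x. \<Sum>i\<in>F. f i x) k = (\<Sum>i\<in>F. hat (f i) k)"
  by (simp add: hat_def scaleR_sum_right integrable_cas_scaleR)
lemma hat_cong_AE:
  fixes f :: "pt \<Rightarrow> 'b::euclidean_space"
  shows "f \<in> borel_measurable tor \<Longrightarrow> g \<in> borel_measurable tor \<Longrightarrow> AE x in tor. f x = g x \<Longrightarrow> hat f k = hat g k"
  unfolding hat_def by (intro integral_cong_AE) auto

lemma hat_cas: "hat (\<lambda>x. cas l x *\<^sub>R v) k = (if k = l then v else 0)"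
proof -
  have "hat (\<lambda>x. cas l x *\<^sub>R v) k = (LINT x|tor. (cas k x * cas l x) *\<^sub>R v)"
    by (simp add: hat_def)
  also have "\<dots> = (LINT x|tor. cas k x * cas l x) *\<^sub>R v"
    by (intro integral_scaleR_left integrable_tor_continuous continuous_intros)
  finally show ?thesis by (simp add: integral_cas_mult)
qed

lemma continuous_Psum [continuous_intros]: "continuous_on A (Psum F a)"
  unfolding Psum_def[abs_def] by (intro continuous_intros)

lemma periodic_Psum: "periodic2 (Psum F a)"
  using periodic_cas unfolding Psum_def[abs_def] periodic2_def by simp

lemma sqi_Psum [simp]: "sqi (Psum F a)" by (intro sqi_continuous continuous_intros)

lemma hat_Psum: "finite F \<Longrightarrow> hat (Psum F a) k = (if k \<in> F then a k else 0)"
  unfolding Psum_def[abs_def]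
  by (subst hat_sum) (auto simp: hat_cas sum.delta intro!: integrable_tor_continuous continuous_intros)

lemma hat_ip_vec: "integrable tor f \<Longrightarrow> ip (\<lambda>x. cas k x *\<^sub>R v) f = hat f k \<bullet> v"
  unfolding hat_def ip_tor
  by (subst integral_inner_left[symmetric]) (auto simp: inner_commute intro: integrable_cas_scaleR)

lemma ip_Psum: "sqi f \<Longrightarrow> ip (Psum F a) f = (\<Sum>k\<in>F. hat f k \<bullet> a k)"
  unfolding Psum_def[abs_def]
  by (subst ip_sum_left) (auto intro!: sqi_continuous continuous_intros sum.cong hat_ip_vec sqi_integrable)

lemma L2norm_Psum: "finite F \<Longrightarrow> (L2norm (Psum F a))\<^sup>2 = (\<Sum>k\<in>F. (norm (a k))\<^sup>2)"
  unfolding L2norm_ip by (subst ip_Psum[OF sqi_Psum]) (simp add: hat_Psum power2_norm_eq_inner)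

lemma L2norm_diff_Psum:
  assumes "sqi f" "finite F"
  shows "(L2norm (\<lambda>x. f x - Psum F (hat f) x))\<^sup>2 = (L2norm f)\<^sup>2 - (\<Sum>k\<in>F. (norm (hat f k))\<^sup>2)"
proof -
  define S where "S = Psum F (hat f)"
  have S: "sqi S" unfolding S_def by simp
  have 1: "ip S f = (\<Sum>k\<in>F. (norm (hat f k))\<^sup>2)"
    unfolding S_def ip_Psum[OF assms(1)] by (simp add: power2_norm_eq_inner)
  have 2: "(L2norm S)\<^sup>2 = (\<Sum>k\<in>F. (norm (hat f k))\<^sup>2)"
    unfolding S_def by (rule L2norm_Psum[OF assms(2)])
  have "(L2norm (\<lambda>x. f x - S x))\<^sup>2 = ip f (\<lambda>x. f x - S x) - ip S (\<lambda>x. f x - S x)"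
    unfolding L2norm_ip by (rule ip_diff_left[OF assms(1) S sqi_diff[OF assms(1) S]])
  also have "ip f (\<lambda>x. f x - S x) = (L2norm f)\<^sup>2 - ip S f"
    by (subst ip_commute, subst ip_diff_left[OF assms(1) S assms(1)]) (simp add: L2norm_ip)
  also have "ip S (\<lambda>x. f x - S x) = ip S f - (L2norm S)\<^sup>2"
    by (subst ip_commute, subst ip_diff_left[OF assms(1) S S]) (simp add: L2norm_ip ip_commute)
  finally have "(L2norm (\<lambda>x. f x - S x))\<^sup>2 = (L2norm f)\<^sup>2 - (\<Sum>k\<in>F. (norm (hat f k))\<^sup>2)"
    unfolding 1 2 by simp
  then show ?thesis unfolding S_def .
qed

lemma bessel: "sqi f \<Longrightarrow> finite F \<Longrightarrow> (\<Sum>k\<in>F. (norm (hat f k))\<^sup>2) \<le> (L2norm f)\<^sup>2"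
  using L2norm_diff_Psum[of f F] zero_le_power2[of "L2norm (\<lambda>x. f x - Psum F (hat f) x)"] by linarith

lemma norm_hat_le: "sqi f \<Longrightarrow> norm (hat f k) \<le> L2norm f"
  using bessel[of f "{k}"] by (auto intro: power2_le_imp_le[OF _ L2norm_nonneg])

subsection \<open>Completeness of the Hartley system\<close>

definition trigs :: "(pt \<Rightarrow> real) set" where
  "trigs = {p. \<exists>F a. finite F \<and> p = Psum F a}"

lemma trigs_cas: "cas k \<in> trigs"
  unfolding trigs_def by (rule CollectI, rule exI[of _ "{k}"], rule exI[of _ "\<lambda>_. 1"]) (auto simp: Psum_def)

lemma Psum_mono: 
  assumes "finite G" "F \<subseteq> G" shows "Psum F a = Psum G (\<lambda>k. if k \<in> F then a k else 0)"
proof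
  fix x
  have "(\<Sum>k\<in>G. cas k x *\<^sub>R (if k \<in> F then a k else 0)) = (\<Sum>k\<in>F. cas k x *\<^sub>R (if k \<in> F then a k else 0))"
    by (rule sum.mono_neutral_right) (use assms in auto)
  also have "\<dots> = Psum F a x" unfolding Psum_def by (rule sum.cong) auto
  finally show "Psum F a x = Psum G (\<lambda>k. if k \<in> F then a k else 0) x" by (simp add: Psum_def)
qed

lemma trigs_scale: assumes "p \<in> trigs" shows "(\<lambda>x. c * p x) \<in> trigs"
proof -
  obtain F a where F: "finite F" "p = Psum F a" using assms by (auto simp: trigs_def)
  have "(\<lambda>x. c * p x) = Psum F (\<lambda>k. c * a k)"
    by (auto simp: F Psum_def sum_distrib_left mult.left_commute)
  then show ?thesis using F(1) unfolding trigs_def by blast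
qed

lemma trigs_add: assumes "p \<in> trigs" "q \<in> trigs" shows "(\<lambda>x. p x + q x) \<in> trigs"
proof -
  obtain F a where F: "finite F" "p = Psum F a" using assms by (auto simp: trigs_def)
  obtain G b where G: "finite G" "q = Psum G b" using assms by (auto simp: trigs_def)
  have "(\<lambda>x. p x + q x) = Psum (F \<union> G) (\<lambda>k. (if k \<in> F then a k else 0) + (if k \<in> G then b k else 0))"
    unfolding F G using Psum_mono[of "F \<union> G" F a] Psum_mono[of "F \<union> G" G b] F(1) G(1)
    by (simp add: fun_eq_iff) (simp add: Psum_def scaleR_add_right sum.distrib distrib_left)
  moreover have "finite (F \<union> G)" using F G by simp
  ultimately show ?thesis unfolding trigs_def by blast
qed

lemma trigs_sum: "(\<And>i. i \<in> I \<Longrightarrow> f i \<in> trigs) \<Longrightarrow> (\<lambda>x. \<Sum>i\<in>I. f i x) \<in> trigs"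
proof (induction I rule: infinite_finite_induct)
  case (insert i I) then show ?case using trigs_add[of "f i" "\<lambda>x. \<Sum>i\<in>I. f i x"] by simp
qed (use trigs_scale[OF trigs_cas, of 0] in auto)

lemma trigs_mult: assumes "p \<in> trigs" "q \<in> trigs" shows "(\<lambda>x. p x * q x) \<in> trigs"
proof -
  obtain F a where F: "finite F" "p = Psum F a" using assms by (auto simp: trigs_def)
  obtain G b where G: "finite G" "q = Psum G b" using assms by (auto simp: trigs_def)
  have c: "(\<lambda>x. cas k x * cas l x) \<in> trigs" for k l
  proof -
    have "(\<lambda>x. (1/2) * (cas (k - l) x + cas (l - k) x + cas (k + l) x + (-1) * cas (- k - l) x)) \<in> trigs"
      by (intro trigs_scale trigs_add trigs_cas)
    then show ?thesis by (simp add: cas_mult)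
  qed
  have "(\<lambda>x. p x * q x) = (\<lambda>x. \<Sum>k\<in>F. \<Sum>l\<in>G. (a k * b l) * (cas k x * cas l x))"
    unfolding F G Psum_def by (simp add: sum_product mult_ac)
  also have "\<dots> \<in> trigs" by (intro trigs_sum trigs_scale c)
  finally show ?thesis .
qed

lemma trigs_const: "(\<lambda>x. c) \<in> trigs"
  using trigs_scale[OF trigs_cas[of 0], of c] by simp

lemma trigs_cos_coord: "(\<lambda>x. cos (2 * pi * (x $ j - c))) \<in> trigs"
proof -
  define k :: "int \<times> int" where "k = (if j = 1 then (1,0) else (0,1))"
  have p: "2 * pi * x $ j = ph k x" for x
    using exhaust_2[of j] by (auto simp: k_def ph_def)
  have "(\<lambda>x. cos (2 * pi * (x $ j - c))) = (\<lambda>x. cos (2*pi*c) * ((1/2) * (cas k x + cas (- k) x)) + sin (2*pi*c) * ((1/2) * (cas k x + (-1) * cas (- k) x)))"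
    unfolding right_diff_distrib cos_diff p cos_cas sin_cas by (simp add: fun_eq_iff field_simps)
  also have "\<dots> \<in> trigs" by (intro trigs_add trigs_scale trigs_cas)
  finally show ?thesis .
qed

lemma trigs_polynomial:
  assumes "real_polynomial_function P" "f \<in> trigs"
  shows "(\<lambda>x. P (f x)) \<in> trigs"
  using assms(1)
proof (induction P)
  case (linear g)
  then have "g = (\<lambda>t. g 1 * t)" using real_bounded_linear by (auto simp: mult.commute)
  then show ?case using trigs_scale[OF assms(2), of "g 1"] by metis
qed (auto intro: trigs_const trigs_add trigs_mult)

lemma integral_trigs_zero:
  fixes g :: "pt \<Rightarrow> real"
  assumes g: "integrable tor g" and z: "\<And>k. hat g k = 0" and p: "p \<in> trigs"
  shows "(LINT x|tor. p x * g x) = 0"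
proof -
  obtain F a where F: "finite F" "p = Psum F a" using p by (auto simp: trigs_def)
  have "(LINT x|tor. p x * g x) = (LINT x|tor. (\<Sum>k\<in>F. a k * (cas k x * g x)))"
    unfolding F Psum_def sum_distrib_right by (simp add: mult_ac)
  also have "\<dots> = (\<Sum>k\<in>F. a k * (LINT x|tor. cas k x * g x))"
    using integrable_cas_scaleR[OF g] by (subst Bochner_Integration.integral_sum) auto
  also have "\<dots> = 0" using z by (simp add: hat_def)
  finally show ?thesis .
qed

text \<open>Bounded pointwise convergence to a discontinuous step, all that dominated convergence
  needs. Polynomials are used so that composition with a cosine stays in
  \<open>trigs\<close>.\<close>

definition step_approx :: "real \<Rightarrow> (nat \<Rightarrow> real \<Rightarrow> real) \<Rightarrow> bool" where
  "step_approx c P \<longleftrightarrow> (\<forall>n. real_polynomial_function (P n)) \<and> (\<forall>n t. \<bar>t\<bar> \<le> 1 \<longrightarrow> \<bar>P n t\<bar> \<le> 2) \<and>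
    (\<forall>t. \<bar>t\<bar> \<le> 1 \<longrightarrow> (\<lambda>n. P n t) \<longlonglongrightarrow> (if t > c then 1 else 0))"

lemma step_approx_exists: "\<exists>P. step_approx c P"
proof -
  \<comment> \<open>A ramp of slope \<open>n\<close> starting at \<open>c\<close>; its values lie in
    [0,1] and the Weierstrass error is at most 1, whence the uniform bound 2.\<close>
  define h where "h n t = min 1 (max 0 (real n * (t - c)))" for n t
  have ch: "continuous_on {-1..1} (h n)" for n unfolding h_def by (intro continuous_intros)
  have "\<exists>P. real_polynomial_function P \<and> (\<forall>t\<in>{-1..1}. \<bar>h n t - P t\<bar> < 1 / real (Suc n))" for n
    by (rule Stone_Weierstrass_real_polynomial_function[OF _ ch[of n], of "1 / real (Suc n)"]) auto
  then obtain P where P0: "\<And>n. real_polynomial_function (P n) \<and> (\<forall>t\<in>{-1..1}. \<bar>h n t - P n t\<bar> < 1 / real (Suc n))"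
    by metis
  have P: "\<And>n. real_polynomial_function (P n)"
    "\<And>n t. \<bar>t\<bar> \<le> 1 \<Longrightarrow> \<bar>h n t - P n t\<bar> < 1 / real (Suc n)"
    using P0 by (simp_all add: abs_le_iff del: of_nat_Suc)
  have "step_approx c P"
    unfolding step_approx_def
  proof (intro conjI allI impI)
    show "real_polynomial_function (P n)" for n by (rule P)
  next
    fix n and t :: real assume t: "\<bar>t\<bar> \<le> 1"
    have "1 / real (Suc n) \<le> 1" by simp
    moreover have "0 \<le> h n t" "h n t \<le> 1" by (auto simp: h_def)
    ultimately show "\<bar>P n t\<bar> \<le> 2" using P(2)[OF t, of n] by linarith
  next
    fix t :: real assume t: "\<bar>t\<bar> \<le> 1"
    have "(\<lambda>n. h n t) \<longlonglongrightarrow> (if t > c then 1 else 0)"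
    proof (cases "t > c")
      case True
      then obtain N where N: "1 / (t - c) < real N" using reals_Archimedean2 by blast
      have "eventually (\<lambda>n. h n t = 1) sequentially"
        using eventually_ge_at_top[of N]
      proof eventually_elim
        case (elim n)
        have "1 \<le> real N * (t - c)" using N True by (simp add: field_simps)
        also have "\<dots> \<le> real n * (t - c)" using elim True by (intro mult_right_mono) auto
        finally show ?case by (simp add: h_def)
      qed
      then show ?thesis using True by (simp add: tendsto_eventually)
    next
      case False
      then have "h n t = 0" for n by (auto simp: h_def mult_nonneg_nonpos)
      then show ?thesis using False by simp
    qed
    moreover have "(\<lambda>n. h n t - P n t) \<longlonglongrightarrow> 0"
    proof (rule Lim_null_comparison)
      show "\<forall>\<^sub>F n in sequentially. norm (h n t - P n t) \<le> 1 / real (Suc n)"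
        using P(2)[OF t] by (intro always_eventually) (auto intro: less_imp_le simp del: of_nat_Suc)
      show "(\<lambda>n. 1 / real (Suc n)) \<longlonglongrightarrow> 0" using LIMSEQ_Suc[OF lim_1_over_n] by simp
    qed
    ultimately have "(\<lambda>n. h n t - (h n t - P n t)) \<longlonglongrightarrow> (if t > c then 1 else 0) - 0"
      by (rule tendsto_diff)
    then show "(\<lambda>n. P n t) \<longlonglongrightarrow> (if t > c then 1 else 0)" by simp
  qed
  then show ?thesis by (rule exI[of "step_approx c"])
qed

text \<open>Arcs are superlevel sets of a cosine, so their indicators are limits of polynomials in a cosine.\<close>
lemma cos_arc_iff:
  fixes a b t :: real
  assumes "0 \<le> a" "a < b" "b \<le> 1" "0 \<le> t" "t \<le> 1"
  shows "cos (2 * pi * (t - (a + b) / 2)) > cos (pi * (b - a)) \<longleftrightarrow> a < t \<and> t < b"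
proof -
  define y where "y = \<bar>t - (a + b) / 2\<bar>"
  define h where "h = (b - a) / 2"
  have h: "0 < h" "h \<le> 1/2" using assms by (auto simp: h_def)
  have "y = t - (a + b) / 2 \<or> y = (a + b) / 2 - t" by (auto simp: y_def abs_if)
  then have y: "0 \<le> y" "y \<le> 1 - h" using assms by (auto simp: y_def h_def field_simps)
  have "2 * pi * y = \<bar>2 * pi * (t - (a + b) / 2)\<bar>" by (simp add: y_def abs_mult)
  then have c: "cos (2 * pi * (t - (a + b) / 2)) = cos (2 * pi * y)" by (simp only: cos_abs_real)
  have iff: "a < t \<and> t < b \<longleftrightarrow> y < h" unfolding y_def h_def abs_less_iff diff_divide_distrib add_divide_distrib by linarith
  have ch: "pi * (b - a) = 2 * pi * h" by (simp add: h_def)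
  show ?thesis
  proof (cases "y \<le> 1/2")
    case True
    have "cos (2 * pi * h) < cos (2 * pi * y) \<longleftrightarrow> 2 * pi * y < 2 * pi * h"
      by (rule cos_mono_less_eq) (use True y h in auto)
    then show ?thesis unfolding c iff ch by simp
  next
    case False
    \<comment> \<open>Beyond half a turn the cosine increases again; it is reflected to
      \<open>1 - y\<close>, and \<open>y \<le> 1 - h\<close> makes both sides of the equivalence
      false.\<close>
    have "cos (2 * pi * y) = cos (2 * pi * (1 - y))"
      using cos_minus[of "2 * pi * y"] cos_period_int[of "- (2 * pi * y)" 1] by (simp add: algebra_simps)
    moreover have "cos (2 * pi * h) < cos (2 * pi * (1 - y)) \<longleftrightarrow> 2 * pi * (1 - y) < 2 * pi * h"
      by (rule cos_mono_less_eq) (use False y h in auto)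
    ultimately show ?thesis unfolding c iff ch using False y h by auto
  qed
qed

text \<open>The indicator of a box inside the cell is a bounded pointwise limit of products of
  polynomials in the two coordinate cosines. These products are trigonometric polynomials, hence
  orthogonal to \<open>g\<close>.\<close>

lemma integral_box_zero:
  fixes g :: "pt \<Rightarrow> real"
  assumes g: "integrable tor g" and z: "\<And>k. hat g k = 0"
    and ab: "\<And>j. 0 \<le> a$j" "\<And>j. a$j < b$j" "\<And>j. b$j \<le> 1"
  shows "(LINT x|tor. indicator (box a b) x * g x) = 0"
proof -
  obtain P where P0: "step_approx (cos (pi * (b$1 - a$1))) P" using step_approx_exists by blast
  have P: "\<And>n. real_polynomial_function (P n)" "\<And>n t. \<bar>t\<bar> \<le> 1 \<Longrightarrow> \<bar>P n t\<bar> \<le> 2"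
    "\<And>t. \<bar>t\<bar> \<le> 1 \<Longrightarrow> (\<lambda>n. P n t) \<longlonglongrightarrow> (if t > cos (pi * (b$1 - a$1)) then 1 else (0::real))"
    using P0 by (simp_all add: step_approx_def)
  obtain Q where Q0: "step_approx (cos (pi * (b$2 - a$2))) Q" using step_approx_exists by blast
  have Q: "\<And>n. real_polynomial_function (Q n)" "\<And>n t. \<bar>t\<bar> \<le> 1 \<Longrightarrow> \<bar>Q n t\<bar> \<le> 2"
    "\<And>t. \<bar>t\<bar> \<le> 1 \<Longrightarrow> (\<lambda>n. Q n t) \<longlonglongrightarrow> (if t > cos (pi * (b$2 - a$2)) then 1 else (0::real))"
    using Q0 by (simp_all add: step_approx_def)
  let ?c = "\<lambda>j x. cos (2 * pi * (x $ j - (a$j + b$j) / 2))"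
  define R where "R n x = P n (?c 1 x) * Q n (?c 2 x)" for n and x :: pt
  have Rt: "R n \<in> trigs" for n
    unfolding R_def by (rule trigs_mult[OF trigs_polynomial[OF P(1) trigs_cos_coord] trigs_polynomial[OF Q(1) trigs_cos_coord]])
  have Rm: "R n \<in> borel_measurable tor" for n
    using Rt[of n] sqi_meas[OF sqi_Psum] by (auto simp: trigs_def)
  have Rb: "\<bar>R n x\<bar> \<le> 4" for n x
    using mult_mono[OF P(2)[of "?c 1 x" n] Q(2)[of "?c 2 x" n]] by (simp add: R_def abs_mult)
  have Rl: "(\<lambda>n. R n x) \<longlonglongrightarrow> indicator (box a b) x" if x: "x \<in> cell" for x
  proof -
    have x01: "0 \<le> x$j" "x$j \<le> 1" for j using x by (auto simp: cell_def mem_box_cart)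
    have "(\<lambda>n. R n x) \<longlonglongrightarrow> (if ?c 1 x > cos (pi * (b$1 - a$1)) then 1 else 0) * (if ?c 2 x > cos (pi * (b$2 - a$2)) then 1 else 0)"
      unfolding R_def by (intro tendsto_mult P Q) auto
    also have "(if ?c 1 x > cos (pi * (b$1 - a$1)) then 1 else 0) * (if ?c 2 x > cos (pi * (b$2 - a$2)) then 1 else 0) = (indicator (box a b) x :: real)"
      using cos_arc_iff[OF ab(1,2,3) x01, of 1] cos_arc_iff[OF ab(1,2,3) x01, of 2]
      by (auto simp: indicator_def mem_box_cart forall_2)
    finally show ?thesis .
  qed
  have "(\<lambda>n. LINT x|tor. R n x * g x) \<longlonglongrightarrow> (LINT x|tor. indicator (box a b) x * g x)"
  proof (rule integral_dominated_convergence[where w="\<lambda>x. 4 * \<bar>g x\<bar>"])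
    show "AE x in tor. (\<lambda>n. R n x * g x) \<longlonglongrightarrow> indicator (box a b) x * g x"
      by (intro AE_I2 tendsto_mult Rl tendsto_const) simp
    show "AE x in tor. norm (R n x * g x) \<le> 4 * \<bar>g x\<bar>" for n
      using Rb by (intro AE_I2) (auto simp: abs_mult intro!: mult_right_mono)
    have "(indicator (box a b) :: pt \<Rightarrow> real) \<in> borel_measurable tor" by (intro borel_tor) auto
    then show "(\<lambda>x. indicator (box a b) x * g x) \<in> borel_measurable tor"
      using borel_measurable_integrable[OF g] by (intro borel_measurable_times)
    show "(\<lambda>x. R n x * g x) \<in> borel_measurable tor" for n
      using borel_measurable_integrable[OF g] Rm by (intro borel_measurable_times)
  qed (use g in auto)
  moreover have "(LINT x|tor. R n x * g x) = 0" for n by (rule integral_trigs_zero[OF g z Rt])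
  ultimately show ?thesis by (simp add: LIMSEQ_const_iff)
qed

lemma integral_box_zero':
  fixes g :: "pt \<Rightarrow> real"
  assumes g: "integrable tor g" and z: "\<And>k. hat g k = 0"
  shows "(LINT x|tor. indicator (box a b) x * g x) = 0"
proof -
  define a' b' :: pt where "a' = (\<chi> j. max 0 (a$j))" and "b' = (\<chi> j. min 1 (b$j))"
  have ae: "AE x in tor. x \<in> box 0 1"
  proof -
    have "AE x in lebesgue. (x::pt) \<notin> cbox 0 1 - box 0 1"
      using negligible_frontier_interval[of "0::pt" 1] by (intro AE_not_in) (simp add: negligible_iff_null_sets)
    then have "AE x in lebesgue. x \<in> cell \<longrightarrow> x \<in> box 0 1" unfolding cell_def by eventually_elim auto
    then show ?thesis unfolding AE_tor_iff .
  qed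
  have "(LINT x|tor. indicator (box a b) x * g x) = (LINT x|tor. indicator (box a' b') x * g x)"
  proof (rule integral_cong_AE)
    show "AE x in tor. indicator (box a b) x * g x = indicator (box a' b') x * g x"
      using ae by eventually_elim (auto simp: indicator_def mem_box_cart a'_def b'_def)
    show "(\<lambda>x. indicator (box a b) x * g x) \<in> borel_measurable tor" for a b
      using borel_measurable_integrable[OF g] borel_tor[of "indicator (box a b)"] by (intro borel_measurable_times) auto
    then show "(\<lambda>x. indicator (box a' b') x * g x) \<in> borel_measurable tor" .
  qed
  also have "\<dots> = 0"
  proof (cases "\<forall>j. a'$j < b'$j")
    case True
    then show ?thesis by (intro integral_box_zero g z) (auto simp: a'_def b'_def)
  next
    case False
    then have "box a' b' = {}" unfolding set_eq_iff mem_box_cart empty_iff by (meson less_trans)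
    then show ?thesis by simp
  qed
  finally show ?thesis .
qed

text \<open>Completeness of the system in L^1. Boxes are stable under intersection and generate the
  Borel sets, so orthogonality passes from boxes to all Borel sets; the sets on which
  \<open>g\<close> is positive or negative must then be null.\<close>

lemma hat_eq_0_real:
  fixes g :: "pt \<Rightarrow> real"
  assumes g: "integrable tor g" and z: "\<And>k. hat g k = 0"
  shows "AE x in tor. g x = 0"
proof -
  have gm: "g \<in> borel_measurable tor" using g by simp
  have im: "(indicator A :: pt \<Rightarrow> real) \<in> borel_measurable tor" if "A \<in> sets borel" for A
    using that by (intro borel_tor) auto
  have ii: "integrable tor (\<lambda>x. indicator A x * g x)" if "A \<in> sets borel" for A
  proof (rule Bochner_Integration.integrable_bound[OF g])
    show "(\<lambda>x. indicator A x * g x) \<in> borel_measurable tor" using im[OF that] gm by simp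
    show "AE x in tor. norm (indicator A x * g x) \<le> norm (g x)" by (auto simp: indicator_def)
  qed
  have all: "(LINT x|tor. indicator A x * g x) = 0" if "A \<in> sets borel" for A :: "pt set"
  proof -
    have stable: "Int_stable (range (\<lambda>(a, b). box a b :: pt set))"
    proof (rule Int_stableI)
      fix A B :: "pt set" assume "A \<in> range (\<lambda>(a, b). box a b)" "B \<in> range (\<lambda>(a, b). box a b)"
      then obtain a b c d where "A = box a b" "B = box c d" by auto
      then have "A \<inter> B = (\<lambda>(a, b). box a b) (\<Sum>i\<in>Basis. max (a \<bullet> i) (c \<bullet> i) *\<^sub>R i, \<Sum>i\<in>Basis. min (b \<bullet> i) (d \<bullet> i) *\<^sub>R i)"
        by (simp add: box_Int_box)
      then show "A \<inter> B \<in> range (\<lambda>(a, b). box a b)" by (rule range_eqI)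
    qed
    have "A \<in> sigma_sets UNIV (range (\<lambda>(a, b). box a b))"
      using that unfolding borel_eq_box by (simp add: sets_measure_of)
    from stable subset_UNIV[of "range (\<lambda>(a, b). box a b :: pt set)", folded Pow_UNIV] this show ?thesis
    proof (induction rule: sigma_sets_induct_disjoint)
      case (basic A) then show ?case using integral_box_zero'[OF g z] by auto
    next
      case (compl A)
      then have A: "A \<in> sets borel" unfolding borel_eq_box by (simp add: sets_measure_of)
      have "(LINT x|tor. indicator (UNIV - A) x * g x) = (LINT x|tor. g x - indicator A x * g x)"
        by (intro Bochner_Integration.integral_cong refl) (auto simp: indicator_def)
      also have "\<dots> = (LINT x|tor. g x) - (LINT x|tor. indicator A x * g x)"
        by (intro Bochner_Integration.integral_diff g ii A)
      also have "(LINT x|tor. g x) = 0" using z[of 0] by (simp add: hat_def)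
      finally show ?case using compl by simp
    next
      case (union A)
      then have A: "A i \<in> sets borel" for i
        unfolding borel_eq_box by (auto simp: sets_measure_of)
      have "(\<lambda>n. LINT x|tor. (\<Sum>i<n. indicator (A i) x * g x)) \<longlonglongrightarrow> (LINT x|tor. indicator (\<Union>i. A i) x * g x)"
      proof (rule integral_dominated_convergence[where w="\<lambda>x. \<bar>g x\<bar>"])
        have s: "(\<Sum>i<n. indicator (A i) x) = (indicator (\<Union>i<n. A i) x :: real)" for n x
          using union(1) by (subst indicator_UN_disjoint) (auto simp: disjoint_family_on_def)
        show "AE x in tor. norm (\<Sum>i<n. indicator (A i) x * g x) \<le> \<bar>g x\<bar>" for n
          unfolding sum_distrib_right[symmetric] s by (auto simp: indicator_def)
        show "AE x in tor. (\<lambda>n. \<Sum>i<n. indicator (A i) x * g x) \<longlonglongrightarrow> indicator (\<Union>i. A i) x * g x"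
          unfolding sum_distrib_right[symmetric] s
          by (intro AE_I2 tendsto_mult LIMSEQ_indicator_UN tendsto_const)
        show "(\<lambda>x. indicator (\<Union>i. A i) x * g x) \<in> borel_measurable tor"
          using im[of "\<Union>i. A i"] A gm by (intro borel_measurable_times) auto
        show "(\<lambda>x. \<Sum>i<n. indicator (A i) x * g x) \<in> borel_measurable tor" for n
          using im[OF A] gm by (intro borel_measurable_sum borel_measurable_times) auto
      qed (use g gm in auto)
      moreover have "(LINT x|tor. (\<Sum>i<n. indicator (A i) x * g x)) = 0" for n
        using union(3) ii[OF A] by (subst Bochner_Integration.integral_sum) auto
      ultimately show ?case by (simp add: LIMSEQ_const_iff)
    qed auto
  qed
  \<comment> \<open>\<open>g\<close> is only Lebesgue measurable; a Borel version makes its sign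
    sets Borel, so that they can be used as test sets.\<close>
  have "\<exists>g'\<in>borel_measurable lborel. AE x in lborel. indicator cell x * g x = g' x"
    by (rule completion_ex_borel_measurable_real) (use gm in \<open>simp add: borel_measurable_restrict_space_iff\<close>)
  then obtain g' where g': "g' \<in> borel_measurable borel" "AE x in lborel. indicator cell x * g x = g' x" by auto
  have e: "AE x in tor. g x = g' x"
  proof -
    have "AE x in lebesgue. x \<in> cell \<longrightarrow> g x = g' x"
      using AE_completion[OF g'(2)] by eventually_elim auto
    then show ?thesis unfolding AE_tor_iff .
  qed
  have pos: "AE x in tor. \<not> s * g' x > 0" if s: "s = 1 \<or> s = -1" for s :: real
  proof -
    define A where "A = {x. s * g' x > 0}"
    have A: "A \<in> sets borel" unfolding A_def using g'(1) by measurable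
    have "(LINT x|tor. s * (indicator A x * g x)) = 0" using all[OF A] by simp
    moreover have n: "AE x in tor. 0 \<le> s * (indicator A x * g x)"
      using e by eventually_elim (auto simp: A_def indicator_def)
    ultimately have "AE x in tor. s * (indicator A x * g x) = 0"
      by (subst (asm) integral_nonneg_eq_0_iff_AE) (use ii[OF A] in auto)
    then show ?thesis using e by eventually_elim (auto simp: A_def indicator_def split: if_splits)
  qed
  have "AE x in tor. \<not> 0 < 1 * g' x" by (rule pos) simp
  moreover have "AE x in tor. \<not> 0 < (-1) * g' x" by (rule pos) simp
  ultimately show ?thesis using e by eventually_elim auto
qed

lemma hat_eq_0:
  fixes g :: "pt \<Rightarrow> 'b::euclidean_space"
  assumes g: "integrable tor g" and z: "\<And>k. hat g k = 0"
  shows "AE x in tor. g x = 0"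
proof -
  have "AE x in tor. \<forall>b\<in>Basis. g x \<bullet> b = 0"
  proof (subst AE_ball_countable, safe)
    fix b :: 'b
    show "AE x in tor. g x \<bullet> b = 0"
      by (rule hat_eq_0_real) (use g z in \<open>auto simp: hat_inner[symmetric]\<close>)
  qed (rule countable_finite, simp)
  then show ?thesis by eventually_elim (simp add: euclidean_all_zero_iff)
qed

lemma hat_eqI:
  fixes f g :: "pt \<Rightarrow> 'b::euclidean_space"
  assumes "integrable tor f" "integrable tor g" "\<And>k. hat f k = hat g k"
  shows "AE x in tor. f x = g x"
proof -
  have "AE x in tor. f x - g x = 0"
    by (rule hat_eq_0) (use assms in \<open>auto simp: hat_diff\<close>)
  then show ?thesis by simp
qed

subsection \<open>Riesz--Fischer and Parseval\<close>

definition bx :: "nat \<Rightarrow> (int \<times> int) set" where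
  "bx n = {- int n..int n} \<times> {- int n..int n}"

definition nk :: "int \<times> int \<Rightarrow> real" where
  "nk k = (of_int (fst k))\<^sup>2 + (of_int (snd k))\<^sup>2"

lemma finite_bx [simp]: "finite (bx n)" by (simp add: bx_def)
lemma bx_mono: "m \<le> n \<Longrightarrow> bx m \<subseteq> bx n" by (auto simp: bx_def)

lemma bx_cover: 
  assumes "finite F" shows "\<exists>n. F \<subseteq> bx n"
  using assms
proof (induction F)
  case (insert k F)
  then obtain n where n: "F \<subseteq> bx n" by auto
  define m where "m = n + nat \<bar>fst k\<bar> + nat \<bar>snd k\<bar>"
  have "k \<in> bx m" by (cases k) (auto simp: bx_def m_def)
  moreover have "F \<subseteq> bx m" using n bx_mono[of n m] by (auto simp: m_def)
  ultimately show ?case by blast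
qed simp

lemma filterlim_bx: "filterlim bx (finite_subsets_at_top UNIV) sequentially"
  unfolding filterlim_finite_subsets_at_top
proof (intro allI impI)
  fix X :: "(int \<times> int) set" assume "finite X \<and> X \<subseteq> UNIV"
  then obtain n where n: "X \<subseteq> bx n" using bx_cover by blast
  show "\<forall>\<^sub>F m in sequentially. finite (bx m) \<and> X \<subseteq> bx m \<and> bx m \<subseteq> UNIV"
    using eventually_ge_at_top[of n] by eventually_elim (use n bx_mono in \<open>auto simp: subset_iff\<close>, blast?)
qed

lemma has_sum_bx: "(f has_sum s) UNIV \<Longrightarrow> (\<lambda>n. \<Sum>k\<in>bx n. f k) \<longlonglongrightarrow> s"
  unfolding has_sum_def using filterlim_compose filterlim_bx by blast

lemma eventually_mem_bx: "\<forall>\<^sub>F n in sequentially. k \<in> bx n"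
proof -
  obtain n where "{k} \<subseteq> bx n" using bx_cover[of "{k}"] by auto
  then show ?thesis using bx_mono by (intro eventually_sequentiallyI[of n]) blast
qed

lemma nk_nonneg [simp]: "0 \<le> nk k" by (simp add: nk_def)

lemma nk_outside: assumes "k \<notin> bx n" shows "(real n + 1)\<^sup>2 \<le> nk k"
proof -
  have *: "(real n + 1)\<^sup>2 \<le> (of_int i)\<^sup>2" if "\<not> (- int n \<le> i \<and> i \<le> int n)" for i
  proof -
    have "int n + 1 \<le> \<bar>i\<bar>" using that by auto
    then have "real_of_int (int n + 1) \<le> real_of_int \<bar>i\<bar>" by (rule of_int_le_iff[THEN iffD2])
    then have "(real n + 1)\<^sup>2 \<le> \<bar>real_of_int i\<bar>\<^sup>2" by (intro power_mono) auto
    then show ?thesis by simp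
  qed
  have "\<not> (- int n \<le> fst k \<and> fst k \<le> int n) \<or> \<not> (- int n \<le> snd k \<and> snd k \<le> int n)"
    using assms by (cases k) (auto simp: bx_def)
  then show ?thesis unfolding nk_def using *[of "fst k"] *[of "snd k"]
    by (smt (verit) zero_le_power2)
qed

lemma summable_tail:
  fixes f :: "int \<times> int \<Rightarrow> real"
  assumes "f summable_on UNIV" "\<And>k. 0 \<le> f k"
  shows "(\<lambda>n. infsum f UNIV - (\<Sum>k\<in>bx n. f k)) \<longlonglongrightarrow> 0"
    and "finite G \<Longrightarrow> bx n \<subseteq> G \<Longrightarrow> (\<Sum>k\<in>G - bx n. f k) \<le> infsum f UNIV - (\<Sum>k\<in>bx n. f k)"
proof -
  have h: "(f has_sum infsum f UNIV) UNIV" using assms(1) by simp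
  show "(\<lambda>n. infsum f UNIV - (\<Sum>k\<in>bx n. f k)) \<longlonglongrightarrow> 0"
    using tendsto_diff[OF tendsto_const has_sum_bx[OF h], of "infsum f UNIV"] by simp
  assume G: "finite G" "bx n \<subseteq> G"
  have "(\<Sum>k\<in>G. f k) \<le> infsum f UNIV"
    by (rule finite_sum_le_infsum) (use assms G in auto)
  then show "(\<Sum>k\<in>G - bx n. f k) \<le> infsum f UNIV - (\<Sum>k\<in>bx n. f k)"
    using G by (simp add: sum_diff)
qed

lemma L2norm_Psum_diff:
  assumes "finite G" "F \<subseteq> G"
  shows "(L2norm (\<lambda>x. Psum G a x - Psum F a x))\<^sup>2 = (\<Sum>k\<in>G - F. (norm (a k))\<^sup>2)"
proof -
  have "(\<lambda>x. Psum G a x - Psum F a x) = Psum (G - F) a"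
    using assms finite_subset[OF assms(2,1)] by (auto simp: Psum_def sum_diff)
  then show ?thesis using L2norm_Psum[of "G - F" a] assms by simp
qed

lemma nn_integral_L2norm:
  assumes "sqi f" shows "(\<integral>\<^sup>+x. ennreal ((norm (f x))\<^sup>2) \<partial>tor) = ennreal ((L2norm f)\<^sup>2)"
  unfolding L2norm_power2 by (rule nn_integral_eq_integral[OF sqi_int2[OF assms]]) auto

text \<open>The square partial sums along a sparse sequence have increments of norm at most
  \<open>(1/2)^i\<close> and therefore converge almost everywhere; Fatou's lemma turns the bound
  between partial sums into a bound on the distance to the limit.\<close>

lemma riesz_fischer:
  fixes a :: "int \<times> int \<Rightarrow> 'b::euclidean_space"
  assumes sm: "(\<lambda>k. (norm (a k))\<^sup>2) summable_on UNIV"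
  obtains f where "f \<in> borel_measurable borel" "periodic2 f" "sqi f" "\<And>k. hat f k = a k"
    "\<exists>r::nat\<Rightarrow>nat. (\<forall>i. i \<le> r i) \<and> (\<lambda>i. L2norm (\<lambda>x. f x - Psum (bx (r i)) a x)) \<longlonglongrightarrow> 0"
proof -
  define A where "A n = infsum (\<lambda>k. (norm (a k))\<^sup>2) UNIV - (\<Sum>k\<in>bx n. (norm (a k))\<^sup>2)" for n
  have A0: "A \<longlonglongrightarrow> 0" unfolding A_def by (rule summable_tail(1)[OF sm]) simp
  have tail: "(\<Sum>k\<in>bx m - bx n. (norm (a k))\<^sup>2) \<le> A n" if "n \<le> m" for n m
    unfolding A_def by (rule summable_tail(2)[OF sm]) (use bx_mono[OF that] in auto)
  have Ann: "0 \<le> A n" for n using tail[of n n] by simp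
  have "\<exists>N. \<forall>n\<ge>N. A n \<le> ((1/2)^i)\<^sup>2" for i :: nat
  proof -
    have "\<forall>\<^sub>F n in sequentially. A n < ((1/2)^i)\<^sup>2"
      by (rule order_tendstoD(2)[OF A0]) simp
    then show ?thesis unfolding eventually_sequentially by (meson less_imp_le)
  qed
  then obtain N where N: "\<And>i n. N i \<le> n \<Longrightarrow> A n \<le> ((1/2)^i)\<^sup>2" by metis
  \<comment> \<open>The cumulative sum makes \<open>r\<close> monotone and at least as large as both
    \<open>N i\<close> and \<open>i\<close>.\<close>
  define r where "r i = (\<Sum>j\<le>i. Suc (N j))" for i
  have rN: "N i \<le> r i" for i unfolding r_def using member_le_sum[of i "{..i}" "\<lambda>j. Suc (N j)"] by simp
  have ri: "i \<le> r i" for i unfolding r_def using sum_mono[of "{..i}" "\<lambda>_. 1" "\<lambda>j. Suc (N j)"] by simp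
  have rmono: "r i \<le> r j" if "i \<le> j" for i j unfolding r_def by (rule sum_mono2) (use that in auto)
  define S where "S i = Psum (bx (r i)) a" for i
  have Ss [simp]: "sqi (S i)" for i unfolding S_def by simp
  have Sc: "continuous_on UNIV (S i)" for i unfolding S_def by (intro continuous_intros)
  have Sd: "(L2norm (\<lambda>x. S j x - S i x))\<^sup>2 \<le> A (r i)" if "i \<le> j" for i j
    unfolding S_def using L2norm_Psum_diff[of "bx (r j)" "bx (r i)" a] bx_mono[OF rmono[OF that]] tail[OF rmono[OF that]] by simp
  have Sd1: "L2norm (\<lambda>x. S (Suc i) x - S i x) \<le> (1/2)^i" for i
  proof (rule power2_le_imp_le)
    show "(L2norm (\<lambda>x. S (Suc i) x - S i x))\<^sup>2 \<le> ((1/2)^i)\<^sup>2"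
      using order_trans[OF Sd[of i "Suc i"] N[OF rN[of i]]] by simp
  qed simp
  have conv: "AE x in tor. convergent (\<lambda>i. S i x)"
  proof -
    have "(\<integral>\<^sup>+x. (\<Sum>i. ennreal (norm (S (Suc i) x - S i x))) \<partial>tor) = (\<Sum>i. \<integral>\<^sup>+x. ennreal (norm (S (Suc i) x - S i x)) \<partial>tor)"
      using sqi_meas[OF Ss] by (intro nn_integral_suminf) auto
    also have "\<dots> \<le> (\<Sum>i. ennreal ((1/2)^i))"
    proof (intro suminf_le summableI)
      fix i
      have s: "sqi (\<lambda>x. S (Suc i) x - S i x)" by (intro sqi_diff Ss)
      have "(\<integral>\<^sup>+x. ennreal (norm (S (Suc i) x - S i x)) \<partial>tor) = ennreal (LINT x|tor. norm (S (Suc i) x - S i x))"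
        by (rule nn_integral_eq_integral) (use sqi_integrable[OF s] in auto)
      also have "\<dots> \<le> ennreal ((1/2)^i)"
        using norm_integral_le_L2norm[OF s] Sd1[of i] by (intro ennreal_leI) linarith
      finally show "(\<integral>\<^sup>+x. ennreal (norm (S (Suc i) x - S i x)) \<partial>tor) \<le> ennreal ((1/2)^i)" .
    qed
    also have "\<dots> < \<infinity>"
    proof -
      have "(\<Sum>i. ennreal ((1/2)^i)) \<noteq> top" by (rule ennreal_suminf_neq_top) (simp_all add: summable_geometric)
      then show ?thesis unfolding infinity_ennreal_def by (rule less_top[THEN iffD1])
    qed
    finally have "AE x in tor. (\<Sum>i. ennreal (norm (S (Suc i) x - S i x))) \<noteq> \<infinity>"
      using sqi_meas[OF Ss] by (intro nn_integral_noteq_infinite) auto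
    then show ?thesis
    proof eventually_elim
      case (elim x)
      then have "summable (\<lambda>i. norm (S (Suc i) x - S i x))"
        by (intro summable_suminf_not_top) auto
      then have "summable (\<lambda>i. S (Suc i) x - S i x)" by (rule summable_norm_cancel)
      then have "(\<lambda>n. \<Sum>i<n. S (Suc i) x - S i x) \<longlonglongrightarrow> (\<Sum>i. S (Suc i) x - S i x)" by (rule summable_LIMSEQ)
      then have "(\<lambda>n. (\<Sum>i<n. S (Suc i) x - S i x) + S 0 x) \<longlonglongrightarrow> (\<Sum>i. S (Suc i) x - S i x) + S 0 x"
        by (intro tendsto_add tendsto_const)
      then show ?case by (auto simp: sum_lessThan_telescope[of "\<lambda>i. S i x"] convergent_def)
    qed
  qed
  \<comment> \<open>Defined by \<open>lim\<close> at every point, also where the sequence diverges: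
    the partial sums are periodic and continuous, so the limit is periodic everywhere and Borel, not
    merely up to a null set.\<close>
  define f where "f x = lim (\<lambda>i. S i x)" for x
  have fb: "f \<in> borel_measurable borel"
    unfolding f_def using Sc by (intro borel_measurable_lim_metric borel_measurable_continuous_onI)
  have fp: "periodic2 f"
    by (simp add: f_def S_def periodic2_def periodic_Psum[unfolded periodic2_def, rule_format])
  have fl: "AE x in tor. (\<lambda>i. S i x) \<longlonglongrightarrow> f x"
    using conv by eventually_elim (simp add: f_def convergent_LIMSEQ_iff)
  have fatou: "(\<integral>\<^sup>+x. ennreal ((norm (f x - S i x))\<^sup>2) \<partial>tor) \<le> ennreal (A (r i))" for i
  proof -
    have "(\<integral>\<^sup>+x. ennreal ((norm (f x - S i x))\<^sup>2) \<partial>tor) = (\<integral>\<^sup>+x. liminf (\<lambda>j. ennreal ((norm (S j x - S i x))\<^sup>2)) \<partial>tor)"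
    proof (rule nn_integral_cong_AE)
      show "AE x in tor. ennreal ((norm (f x - S i x))\<^sup>2) = liminf (\<lambda>j. ennreal ((norm (S j x - S i x))\<^sup>2))"
        using fl
      proof eventually_elim
        case (elim x)
        have "(\<lambda>j. ennreal ((norm (S j x - S i x))\<^sup>2)) \<longlonglongrightarrow> ennreal ((norm (f x - S i x))\<^sup>2)"
          by (intro tendsto_ennrealI tendsto_intros elim)
        from lim_imp_Liminf[OF _ this] show ?case by simp
      qed
    qed
    also have "\<dots> \<le> liminf (\<lambda>j. \<integral>\<^sup>+x. ennreal ((norm (S j x - S i x))\<^sup>2) \<partial>tor)"
      using sqi_meas[OF Ss] by (intro nn_integral_liminf) auto
    also have "\<dots> \<le> ennreal (A (r i))"
    proof (rule Liminf_le)
      show "\<forall>\<^sub>F j in sequentially. (\<integral>\<^sup>+x. ennreal ((norm (S j x - S i x))\<^sup>2) \<partial>tor) \<le> ennreal (A (r i))"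
        using eventually_ge_at_top[of i]
        by eventually_elim (auto simp: nn_integral_L2norm sqi_diff intro!: ennreal_leI Sd)
    qed simp
    finally show ?thesis .
  qed
  have fm: "f \<in> borel_measurable tor" by (rule borel_tor[OF fb])
  have sd: "sqi (\<lambda>x. f x - S i x)" for i
    unfolding sqi_def integrable_iff_bounded using fm sqi_meas[OF Ss[of i]] fatou[of i]
    by (auto simp: less_top[symmetric] top_unique)
  have dn: "(L2norm (\<lambda>x. f x - S i x))\<^sup>2 \<le> A (r i)" for i
    using fatou[of i] Ann by (simp add: nn_integral_L2norm[OF sd] ennreal_le_iff)
  have sf: "sqi f" using sqi_add[OF sd[of 0] Ss[of 0]] by simp
  have "filterlim r at_top sequentially"
    using ri by (intro filterlim_at_top_mono[OF filterlim_ident]) auto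
  then have "(\<lambda>i. A (r i)) \<longlonglongrightarrow> 0" by (rule filterlim_compose[OF A0])
  then have "(\<lambda>i. (L2norm (\<lambda>x. f x - S i x))\<^sup>2) \<longlonglongrightarrow> 0"
    by (rule Lim_null_comparison[rotated]) (use dn in auto)
  then have lim: "(\<lambda>i. L2norm (\<lambda>x. f x - S i x)) \<longlonglongrightarrow> 0"
    by (simp add: power_tendsto_0_iff)
  have hatf: "hat f k = a k" for k
  proof -
    have "\<forall>\<^sub>F i in sequentially. k \<in> bx (r i)"
    proof -
      have "\<forall>\<^sub>F n in sequentially. k \<in> bx n" by (rule eventually_mem_bx)
      then show ?thesis using \<open>filterlim r at_top sequentially\<close> by (auto simp: filterlim_iff)
    qed
    then have ev: "\<forall>\<^sub>F i in sequentially. norm (hat f k - a k) \<le> L2norm (\<lambda>x. f x - S i x)"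
    proof eventually_elim
      case (elim i)
      have "hat (\<lambda>x. f x - S i x) k = hat f k - a k"
        using elim sf by (subst hat_diff) (auto simp: sqi_integrable S_def hat_Psum)
      then show ?case using norm_hat_le[OF sd[of i], of k] by simp
    qed
    have "norm (hat f k - a k) \<le> 0"
      by (rule tendsto_lowerbound[OF lim ev]) simp
    then show ?thesis by simp
  qed
  show thesis
    by (rule that[OF fb fp sf hatf]) (use lim ri in \<open>auto simp: S_def\<close>)
qed

lemma riesz_fischer_ex:
  fixes a :: "int \<times> int \<Rightarrow> 'b::euclidean_space"
  assumes "(\<lambda>k. (norm (a k))\<^sup>2) summable_on UNIV"
  shows "\<exists>f. f \<in> borel_measurable borel \<and> periodic2 f \<and> sqi f \<and> hat f = a"
proof (rule riesz_fischer[OF assms])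
  fix f :: "pt \<Rightarrow> 'b"
  assume f: "f \<in> borel_measurable borel" "periodic2 f" "sqi f" and h: "\<And>k. hat f k = a k"
  have "hat f = a" by (rule ext) (rule h)
  then show ?thesis using f by blast
qed

lemma summable_hat:
  assumes "sqi f" shows "(\<lambda>k. (norm (hat f k))\<^sup>2) summable_on UNIV"
  by (rule nonneg_bdd_above_summable_on) (use bessel[OF assms] in \<open>auto intro!: bdd_aboveI[of _ "(L2norm f)\<^sup>2"]\<close>)

text \<open>The function that Riesz-Fischer builds from the coefficients of \<open>f\<close> agrees
  with \<open>f\<close> almost everywhere by completeness. Its partial sums converge in norm along a
  subsequence, so the defect in Bessel's inequality tends to zero.\<close>

lemma parseval_norm:
  fixes f :: "pt \<Rightarrow> 'b::euclidean_space"
  assumes "sqi f" shows "((\<lambda>k. (norm (hat f k))\<^sup>2) has_sum (L2norm f)\<^sup>2) UNIV"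
proof -
  obtain g where g: "g \<in> borel_measurable borel" "sqi g" "\<And>k. hat g k = hat f k"
    and "periodic2 g" "\<exists>r::nat\<Rightarrow>nat. (\<forall>i. i \<le> r i) \<and> (\<lambda>i. L2norm (\<lambda>x. g x - Psum (bx (r i)) (hat f) x)) \<longlonglongrightarrow> 0"
    by (rule riesz_fischer[OF summable_hat[OF assms]]) blast
  then obtain r :: "nat \<Rightarrow> nat" where r: "\<And>i. i \<le> r i" "(\<lambda>i. L2norm (\<lambda>x. g x - Psum (bx (r i)) (hat f) x)) \<longlonglongrightarrow> 0" by blast
  have ae: "AE x in tor. f x = g x"
    by (rule hat_eqI) (use assms g in \<open>auto simp: sqi_integrable\<close>)
  have nn: "L2norm f = L2norm g"
    using ae assms g by (intro L2norm_cong_AE sqi_meas)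
  have h: "hat g = hat f" using g(3) by auto
  have s: "((\<lambda>k. (norm (hat f k))\<^sup>2) has_sum infsum (\<lambda>k. (norm (hat f k))\<^sup>2) UNIV) UNIV"
    using summable_hat[OF assms] by simp
  have rt: "filterlim r at_top sequentially"
    using r(1) by (intro filterlim_at_top_mono[OF filterlim_ident]) auto
  have "(\<lambda>i. \<Sum>k\<in>bx (r i). (norm (hat f k))\<^sup>2) \<longlonglongrightarrow> infsum (\<lambda>k. (norm (hat f k))\<^sup>2) UNIV"
    using filterlim_compose[OF has_sum_bx[OF s] rt] .
  moreover have "(\<lambda>i. (L2norm g)\<^sup>2 - (L2norm (\<lambda>x. g x - Psum (bx (r i)) (hat f) x))\<^sup>2) \<longlonglongrightarrow> (L2norm g)\<^sup>2 - 0\<^sup>2"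
    by (intro tendsto_intros r(2))
  then have "(\<lambda>i. \<Sum>k\<in>bx (r i). (norm (hat f k))\<^sup>2) \<longlonglongrightarrow> (L2norm f)\<^sup>2"
    unfolding L2norm_diff_Psum[OF g(2) finite_bx, unfolded h] nn by simp
  ultimately show ?thesis using s LIMSEQ_unique by metis
qed

lemma parseval:
  fixes f g :: "pt \<Rightarrow> 'b::euclidean_space"
  assumes "sqi f" "sqi g" shows "((\<lambda>k. hat f k \<bullet> hat g k) has_sum ip f g) UNIV"
proof -
  have e: "x \<bullet> y = ((norm (x + y))\<^sup>2 - (norm (x - y))\<^sup>2) / 4" for x y :: 'b
    by (simp add: power2_norm_eq_inner inner_add_left inner_add_right inner_diff_left inner_diff_right inner_commute)
  have "((\<lambda>k. (1/4) * ((norm (hat (\<lambda>x. f x + g x) k))\<^sup>2 - (norm (hat (\<lambda>x. f x - g x) k))\<^sup>2)) has_sum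
    (1/4) * ((L2norm (\<lambda>x. f x + g x))\<^sup>2 - (L2norm (\<lambda>x. f x - g x))\<^sup>2)) UNIV"
    unfolding diff_conv_add_uminus
    by (intro has_sum_cmult_right has_sum_add has_sum_uminusI parseval_norm sqi_add assms sqi_uminus)
  moreover have "(1/4) * ((L2norm (\<lambda>x. f x + g x))\<^sup>2 - (L2norm (\<lambda>x. f x - g x))\<^sup>2) = ip f g"
  proof -
    have "(1/4) * ((L2norm (\<lambda>x. f x + g x))\<^sup>2 - (L2norm (\<lambda>x. f x - g x))\<^sup>2)
       = (LINT x|tor. (1/4) * ((norm (f x + g x))\<^sup>2 - (norm (f x - g x))\<^sup>2))"
      using assms by (simp add: L2norm_power2 sqi_int2 sqi_add sqi_diff)
    also have "\<dots> = ip f g" unfolding ip_tor by (simp add: e)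
    finally show ?thesis .
  qed
  ultimately show ?thesis
    using assms by (simp add: e hat_add hat_diff sqi_integrable)
qed

lemma Psum_converges:
  fixes f :: "pt \<Rightarrow> 'b::euclidean_space"
  assumes "sqi f" shows "(\<lambda>n. L2norm (\<lambda>x. f x - Psum (bx n) (hat f) x)) \<longlonglongrightarrow> 0"
proof -
  have "(\<lambda>n. (L2norm f)\<^sup>2 - (\<Sum>k\<in>bx n. (norm (hat f k))\<^sup>2)) \<longlonglongrightarrow> (L2norm f)\<^sup>2 - (L2norm f)\<^sup>2"
    by (intro tendsto_intros has_sum_bx parseval_norm assms)
  then have "(\<lambda>n. (L2norm (\<lambda>x. f x - Psum (bx n) (hat f) x))\<^sup>2) \<longlonglongrightarrow> 0"
    using assms by (simp add: L2norm_diff_Psum)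
  then show ?thesis by (simp add: power_tendsto_0_iff)
qed

lemma L2norm_le_of_hat:
  fixes f :: "pt \<Rightarrow> 'b::euclidean_space"
  assumes "sqi f" "\<And>n. (\<Sum>k\<in>bx n. (norm (hat f k))\<^sup>2) \<le> B" shows "(L2norm f)\<^sup>2 \<le> B"
  by (rule LIMSEQ_le_const2[OF has_sum_bx[OF parseval_norm[OF assms(1)]]]) (use assms(2) in auto)

text \<open>Truncating the test function leaves finitely many coefficients plus an error that is
  small uniformly in \<open>i\<close> by the norm bound. The filter is arbitrary because the same
  statement serves for subsequences and for continuity in time.\<close>

lemma weak_convergence:
  fixes f :: "'i \<Rightarrow> pt \<Rightarrow> 'b::euclidean_space"
  assumes f: "\<And>i. sqi (f i)" "sqi f0" "sqi g"
    and b: "\<And>i. L2norm (f i) \<le> R" and c: "\<And>k. ((\<lambda>i. hat (f i) k) \<longlongrightarrow> hat f0 k) F"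
  shows "((\<lambda>i. ip (f i) g) \<longlongrightarrow> ip f0 g) F"
proof (rule tendstoI)
  fix e :: real assume e: "0 < e"
  \<comment> \<open>A bound for \<open>L2norm (\<lambda>x. f i x - f0 x)\<close>; the summand 1 only
    keeps it positive for the division.\<close>
  define K where "K = \<bar>R\<bar> + L2norm f0 + 1"
  have K: "0 < K" by (auto simp: K_def intro: add_nonneg_pos)
  have "\<forall>\<^sub>F n in sequentially. L2norm (\<lambda>x. g x - Psum (bx n) (hat g) x) < e / (2 * K)"
    by (rule order_tendstoD(2)[OF Psum_converges[OF f(3)]]) (use e K in auto)
  then obtain n where n: "L2norm (\<lambda>x. g x - Psum (bx n) (hat g) x) < e / (2 * K)"
    using eventually_happens by fastforce
  define P where "P = Psum (bx n) (hat g)"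
  have P: "sqi P" by (simp add: P_def)
  have "((\<lambda>i. \<Sum>k\<in>bx n. hat (f i) k \<bullet> hat g k) \<longlongrightarrow> (\<Sum>k\<in>bx n. hat f0 k \<bullet> hat g k)) F"
    by (intro tendsto_intros c)
  then have "((\<lambda>i. ip P (f i)) \<longlongrightarrow> ip P f0) F"
    unfolding P_def using f by (simp add: ip_Psum)
  then have "\<forall>\<^sub>F i in F. dist (ip P (f i)) (ip P f0) < e / 2"
    using e by (intro tendstoD) auto
  then show "\<forall>\<^sub>F i in F. dist (ip (f i) g) (ip f0 g) < e"
  proof eventually_elim
    case (elim i)
    have s: "sqi (\<lambda>x. f i x - f0 x)" "sqi (\<lambda>x. g x - P x)" using f P by (auto intro: sqi_diff)
    have d: "ip (f i) g - ip f0 g = (ip P (f i) - ip P f0) + ip (\<lambda>x. f i x - f0 x) (\<lambda>x. g x - P x)"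
      using f P s by (simp add: ip_diff_left ip_commute[of _ "\<lambda>x. g x - P x"] ip_commute[of P] ip_commute[of g])
    have "L2norm (\<lambda>x. f i x - f0 x) \<le> K"
    proof -
      have "L2norm (\<lambda>x. f i x + (-1) *\<^sub>R f0 x) \<le> L2norm (f i) + L2norm (\<lambda>x. (-1) *\<^sub>R f0 x)"
        by (intro L2norm_triangle sqi_scaleR f)
      then have "L2norm (\<lambda>x. f i x - f0 x) \<le> L2norm (f i) + L2norm f0"
        unfolding L2norm_scaleR by simp
      then show ?thesis using b[of i] by (simp add: K_def)
    qed
    then have "\<bar>ip (\<lambda>x. f i x - f0 x) (\<lambda>x. g x - P x)\<bar> \<le> K * (e / (2 * K))"
      using ip_cauchy_schwarz[OF s] n[folded P_def] K
      by (elim order_trans) (intro mult_mono, auto)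
    then have "\<bar>ip (\<lambda>x. f i x - f0 x) (\<lambda>x. g x - P x)\<bar> \<le> e / 2" using K by simp
    then show ?case using elim unfolding dist_real_def d by linarith
  qed
qed

text \<open>Rellich's compactness on the Fourier side: outside \<open>bx n\<close> the weight
  \<open>nk\<close> is at least \<open>(real n + 1)\<^sup>2\<close>, so the gradient bound makes the
  tails small uniformly in \<open>i\<close>, and only finitely many coefficients remain.\<close>

lemma strong_convergence:
  fixes f :: "'i \<Rightarrow> pt \<Rightarrow> 'b::euclidean_space"
  assumes f: "\<And>i. sqi (f i)" "sqi f0"
    and b: "\<And>i n. (\<Sum>k\<in>bx n. nk k * (norm (hat (f i) k))\<^sup>2) \<le> R" 
    and b0: "\<And>n. (\<Sum>k\<in>bx n. nk k * (norm (hat f0 k))\<^sup>2) \<le> R" 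
    and c: "\<And>k. ((\<lambda>i. hat (f i) k) \<longlongrightarrow> hat f0 k) F"
  shows "((\<lambda>i. L2norm (\<lambda>x. f i x - f0 x)) \<longlongrightarrow> 0) F"
proof -
  define d where "d i k = hat (f i) k - hat f0 k" for i k
  have hd: "hat (\<lambda>x. f i x - f0 x) k = d i k" for i k
    unfolding d_def using f by (simp add: hat_diff sqi_integrable)
  have dle: "(norm (d i k))\<^sup>2 \<le> 2 * (norm (hat (f i) k))\<^sup>2 + 2 * (norm (hat f0 k))\<^sup>2" for i k
  proof -
    have "(norm (d i k))\<^sup>2 \<le> (norm (hat (f i) k) + norm (hat f0 k))\<^sup>2"
      unfolding d_def by (intro power_mono norm_triangle_ineq4) simp
    also have "\<dots> \<le> 2 * (norm (hat (f i) k))\<^sup>2 + 2 * (norm (hat f0 k))\<^sup>2"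
      using zero_le_power2[of "norm (hat (f i) k) - norm (hat f0 k)"] by (simp add: power2_sum power2_diff)
    finally show ?thesis .
  qed
  have R: "0 \<le> R" using b0[of 0] sum_nonneg[of "bx 0" "\<lambda>k. nk k * (norm (hat f0 k))\<^sup>2"] by (simp add: order_trans)
  have main: "(L2norm (\<lambda>x. f i x - f0 x))\<^sup>2 \<le> (\<Sum>k\<in>bx n. (norm (d i k))\<^sup>2) + 4 * R / (real n + 1)\<^sup>2" for i n
  proof (rule L2norm_le_of_hat)
    show "sqi (\<lambda>x. f i x - f0 x)" using f by (intro sqi_diff)
    fix m
    define l where "l = max m n"
    have l: "bx m \<subseteq> bx l" "bx n \<subseteq> bx l" unfolding l_def by (auto intro!: bx_mono)
    have "(\<Sum>k\<in>bx m. (norm (d i k))\<^sup>2) \<le> (\<Sum>k\<in>bx l. (norm (d i k))\<^sup>2)"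
      using l by (intro sum_mono2) auto
    also have "\<dots> = (\<Sum>k\<in>bx n. (norm (d i k))\<^sup>2) + (\<Sum>k\<in>bx l - bx n. (norm (d i k))\<^sup>2)"
      using l by (subst sum.subset_diff[of "bx n"]) auto
    also have "(\<Sum>k\<in>bx l - bx n. (norm (d i k))\<^sup>2) \<le> (\<Sum>k\<in>bx l - bx n. (2 * (nk k * (norm (hat (f i) k))\<^sup>2) + 2 * (nk k * (norm (hat f0 k))\<^sup>2)) / (real n + 1)\<^sup>2)"
    proof (rule sum_mono)
      fix k assume "k \<in> bx l - bx n"
      then have "(real n + 1)\<^sup>2 \<le> nk k" using nk_outside by auto
      then have "(real n + 1)\<^sup>2 * (norm (d i k))\<^sup>2 \<le> nk k * (2 * (norm (hat (f i) k))\<^sup>2 + 2 * (norm (hat f0 k))\<^sup>2)"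
        using dle by (intro mult_mono) auto
      moreover have "0 < (real n + 1)\<^sup>2" by (simp add: add_nonneg_pos)
      ultimately show "(norm (d i k))\<^sup>2 \<le> (2 * (nk k * (norm (hat (f i) k))\<^sup>2) + 2 * (nk k * (norm (hat f0 k))\<^sup>2)) / (real n + 1)\<^sup>2"
        by (simp add: pos_le_divide_eq algebra_simps)
    qed
    also have "\<dots> \<le> (\<Sum>k\<in>bx l. (2 * (nk k * (norm (hat (f i) k))\<^sup>2) + 2 * (nk k * (norm (hat f0 k))\<^sup>2)) / (real n + 1)\<^sup>2)"
      by (intro sum_mono2) auto
    also have "\<dots> = (2 * (\<Sum>k\<in>bx l. nk k * (norm (hat (f i) k))\<^sup>2) + 2 * (\<Sum>k\<in>bx l. nk k * (norm (hat f0 k))\<^sup>2)) / (real n + 1)\<^sup>2"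
      by (simp add: sum_divide_distrib[symmetric] sum.distrib sum_distrib_left)
    also have "\<dots> \<le> 4 * R / (real n + 1)\<^sup>2"
      using b[of i l] b0[of l] by (intro divide_right_mono) auto
    finally show "(\<Sum>k\<in>bx m. (norm (hat (\<lambda>x. f i x - f0 x) k))\<^sup>2) \<le> (\<Sum>k\<in>bx n. (norm (d i k))\<^sup>2) + 4 * R / (real n + 1)\<^sup>2"
      unfolding hd by simp
  qed
  have "((\<lambda>i. (L2norm (\<lambda>x. f i x - f0 x))\<^sup>2) \<longlongrightarrow> 0) F"
  proof (rule tendstoI)
    fix e :: real assume e: "0 < e"
    have "(\<lambda>n. 4 * R / (real n + 1)\<^sup>2) \<longlonglongrightarrow> 0"
      by real_asymp
    then have "\<forall>\<^sub>F n in sequentially. 4 * R / (real n + 1)\<^sup>2 < e / 2" using e by (intro order_tendstoD(2)) auto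
    then obtain n where n: "4 * R / (real n + 1)\<^sup>2 < e / 2" using eventually_happens by fastforce
    have "((\<lambda>i. \<Sum>k\<in>bx n. (norm (d i k))\<^sup>2) \<longlongrightarrow> (\<Sum>k\<in>bx n. (norm (hat f0 k - hat f0 k))\<^sup>2)) F"
      unfolding d_def by (intro tendsto_intros c)
    then have "\<forall>\<^sub>F i in F. (\<Sum>k\<in>bx n. (norm (d i k))\<^sup>2) < e / 2"
      using e by (intro order_tendstoD(2)[where y=0]) auto
    then show "\<forall>\<^sub>F i in F. dist ((L2norm (\<lambda>x. f i x - f0 x))\<^sup>2) 0 < e"
    proof eventually_elim
      case (elim i)
      then show ?case using main[of i n] n by (simp add: dist_real_def)
    qed
  qed
  then show ?thesis by (simp add: power_tendsto_0_iff)
qed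

subsection \<open>Smooth periodic functions\<close>

lemma smooth_differentiable: "smooth f \<Longrightarrow> f differentiable (at x)"
  unfolding smooth_def using Ck.simps(2)[of 0 f] by blast

lemma smooth_frechet: 
  assumes "smooth f" shows "smooth (\<lambda>x. frechet_derivative f (at x) v)"
  unfolding smooth_def
proof
  fix k show "Ck k (\<lambda>x. frechet_derivative f (at x) v)"
    using assms Ck.simps(2)[of k f] unfolding smooth_def by blast
qed

lemma smooth_continuous: "smooth f \<Longrightarrow> continuous_on A f"
  by (intro continuous_at_imp_continuous_on ballI differentiable_imp_continuous_within smooth_differentiable)

lemma smooth_pd: "smooth f \<Longrightarrow> smooth (pd j f)"
  using smooth_frechet[of f "axis j 1"] by (simp add: pd_def[abs_def])

lemma frechet_directional:
  assumes "f differentiable (at x)"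
  shows "((\<lambda>s. f (x + s *\<^sub>R v)) has_vector_derivative frechet_derivative f (at x) v) (at 0)"
proof -
  have d: "(f has_derivative frechet_derivative f (at x)) (at x)"
    using assms frechet_derivative_works by blast
  have "((\<lambda>s. f (x + s *\<^sub>R v)) has_derivative (\<lambda>h. frechet_derivative f (at x) (h *\<^sub>R v))) (at 0)"
  proof (rule has_derivative_compose[where g=f])
    show "((\<lambda>s. x + s *\<^sub>R v) has_derivative (\<lambda>h. h *\<^sub>R v)) (at 0)"
      by (rule derivative_eq_intros refl | simp)+
    show "(f has_derivative frechet_derivative f (at x)) (at (x + 0 *\<^sub>R v))" using d by simp
  qed
  then show ?thesis
    using linear_frechet_derivative[OF assms] by (simp add: has_vector_derivative_def linear_cmul)
qed

lemma pd_directional: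
  "smooth f \<Longrightarrow> ((\<lambda>s. f (x + s *\<^sub>R axis j 1)) has_vector_derivative pd j f x) (at 0)"
  unfolding pd_def by (intro frechet_directional smooth_differentiable)

lemma pd_unique: "((\<lambda>s. f (x + s *\<^sub>R axis j 1)) has_vector_derivative d) (at 0) \<Longrightarrow> f differentiable (at x) \<Longrightarrow> pd j f x = d"
  unfolding pd_def using frechet_directional vector_derivative_unique_at by blast

lemma periodic_pd: assumes "smooth f" "periodic2 f" shows "periodic2 (pd j f)"
  unfolding periodic2_def
proof (intro allI)
  fix x i
  have "f (x + axis i 1 + s *\<^sub>R axis j 1) = f (x + s *\<^sub>R axis j 1)" for s
  proof -
    have "x + axis i 1 + s *\<^sub>R axis j 1 = (x + s *\<^sub>R axis j 1) + axis i 1" by (simp add: algebra_simps)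
    then have "f (x + axis i 1 + s *\<^sub>R axis j 1) = f ((x + s *\<^sub>R axis j 1) + axis i 1)" by (rule arg_cong)
    also have "\<dots> = f (x + s *\<^sub>R axis j 1)" using assms(2) by (simp add: periodic2_def)
    finally show ?thesis .
  qed
  then have "((\<lambda>s. f (x + s *\<^sub>R axis j 1)) has_vector_derivative pd j f (x + axis i 1)) (at 0)"
    using pd_directional[OF assms(1), of "x + axis i 1" j] by simp
  from pd_unique[OF this smooth_differentiable[OF assms(1)]] show "pd j f (x + axis i 1) = pd j f x" by simp
qed

text \<open>The constant factor is carried along because a derivative of \<open>cas k\<close> is a
  multiple of \<open>cas (- k)\<close>; with it the induction over the order closes.\<close>

lemma smooth_cas_scale: "smooth (\<lambda>x. c * cas k x)"
proof -
  have "Ck n (\<lambda>x. c * cas k x)" for n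
  proof (induction n arbitrary: c k)
    case 0 show ?case by (auto intro!: continuous_intros)
  next
    case (Suc n)
    have d: "((\<lambda>x. c * cas k x) has_derivative (\<lambda>v. c * (ph k v * cas (- k) x))) (at x)" for x
      by (intro has_derivative_mult_right cas_has_derivative)
    have "frechet_derivative (\<lambda>x. c * cas k x) (at x) v = (c * ph k v) * cas (- k) x" for x v
      using frechet_derivative_at[OF d[of x]] by (simp add: fun_eq_iff mult.assoc)
    moreover have "(\<lambda>x. c * cas k x) differentiable (at x)" for x using d differentiableI by blast
    ultimately show ?case using Suc[of "c * ph k _" "- k"] by simp
  qed
  then show ?thesis by (simp add: smooth_def)
qed

lemma smooth_cas: "smooth (cas k)"
  using smooth_cas_scale[of 1 k] by simp

lemma pd_cas: "pd j (cas k) x = 2 * pi * kc k j * cas (- k) x"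
proof -
  have "frechet_derivative (cas k) (at x) = (\<lambda>v. ph k v * cas (- k) x)"
    by (rule frechet_derivative_at[symmetric, OF cas_has_derivative])
  then show ?thesis by (simp add: pd_def ph_axis_kc)
qed

section \<open>Weak derivatives on the Fourier side\<close>

lemma integration_by_parts:
  fixes \<psi> :: "pt \<Rightarrow> 'b::euclidean_space"
  assumes \<phi>: "smooth \<phi>" "periodic2 \<phi>" and \<psi>: "smooth \<psi>" "periodic2 \<psi>"
  shows "(LINT x|tor. pd j \<phi> x *\<^sub>R \<psi> x) = - (LINT x|tor. \<phi> x *\<^sub>R pd j \<psi> x)"
proof -
  have c: "continuous_on UNIV \<phi>" "continuous_on UNIV \<psi>" "continuous_on UNIV (pd j \<phi>)" "continuous_on UNIV (pd j \<psi>)"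
    using smooth_continuous smooth_pd \<phi> \<psi> by blast+
  have i: "integrable tor (\<lambda>x. pd j \<phi> x *\<^sub>R \<psi> x)" "integrable tor (\<lambda>x. \<phi> x *\<^sub>R pd j \<psi> x)"
    by (intro integrable_tor_continuous continuous_intros c)+
  have "(LINT x|tor. pd j \<phi> x *\<^sub>R \<psi> x + \<phi> x *\<^sub>R pd j \<psi> x) = 0"
  proof (rule euclidean_eqI)
    fix b :: 'b
    have "(LINT x|tor. pd j \<phi> x *\<^sub>R \<psi> x + \<phi> x *\<^sub>R pd j \<psi> x) \<bullet> b = (LINT x|tor. pd j \<phi> x * (\<psi> x \<bullet> b) + \<phi> x * (pd j \<psi> x \<bullet> b))"
      using i by (subst integral_inner_left[symmetric]) (auto simp: inner_add_left)
    also have "\<dots> = 0"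
    proof (rule integral_partial_derivative_zero[where f="\<lambda>x. \<phi> x * (\<psi> x \<bullet> b)" and d="axis j 1"])
      fix x
      have 1: "((\<lambda>s. \<phi> (x + s *\<^sub>R axis j 1)) has_field_derivative pd j \<phi> x) (at 0)"
        using pd_directional[OF \<phi>(1)] by (simp add: has_real_derivative_iff_has_vector_derivative)
      have 2: "((\<lambda>s. \<psi> (x + s *\<^sub>R axis j 1) \<bullet> b) has_field_derivative pd j \<psi> x \<bullet> b) (at 0)"
        using pd_directional[OF \<psi>(1), of x j] bounded_linear.has_vector_derivative[OF bounded_linear_inner_left]
        by (auto simp: has_real_derivative_iff_has_vector_derivative)
      from DERIV_mult[OF 1 2] show "((\<lambda>s. \<phi> (x + s *\<^sub>R axis j 1) * (\<psi> (x + s *\<^sub>R axis j 1) \<bullet> b)) has_vector_derivative pd j \<phi> x * (\<psi> x \<bullet> b) + \<phi> x * (pd j \<psi> x \<bullet> b)) (at 0)"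
        by (simp add: has_real_derivative_iff_has_vector_derivative mult.commute)
    qed (use assms in \<open>auto simp: periodic2_def intro!: continuous_intros c\<close>)
    finally show "(LINT x|tor. pd j \<phi> x *\<^sub>R \<psi> x + \<phi> x *\<^sub>R pd j \<psi> x) \<bullet> b = 0 \<bullet> b" by simp
  qed
  then show ?thesis using i by (simp add: eq_neg_iff_add_eq_0)
qed

lemma sqi_smooth: "smooth f \<Longrightarrow> sqi f"
  by (intro sqi_continuous smooth_continuous)

lemma weak_pd_smooth: "smooth \<psi> \<Longrightarrow> periodic2 \<psi> \<Longrightarrow> weak_pd j \<psi> (pd j \<psi>)"
  unfolding weak_pd_def tor_integral tor_integrable
  by (auto intro: integration_by_parts sqi_integrable sqi_smooth smooth_pd)

lemma hat_weak_pd: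
  assumes "weak_pd j f g" shows "hat g k = - (2 * pi * kc k j) *\<^sub>R hat f (- k)"
proof -
  have "(LINT x|tor. pd j (cas k) x *\<^sub>R f x) = - hat g k"
    using assms smooth_cas periodic_cas unfolding weak_pd_def tor_integral hat_def by blast
  moreover have "(LINT x|tor. pd j (cas k) x *\<^sub>R f x) = (2 * pi * kc k j) *\<^sub>R hat f (- k)"
    unfolding hat_def by (subst integral_scaleR_right[symmetric]) (simp add: pd_cas mult.assoc)
  ultimately show ?thesis by simp
qed

lemma hat_pd: "smooth \<psi> \<Longrightarrow> periodic2 \<psi> \<Longrightarrow> hat (pd j \<psi>) k = - (2 * pi * kc k j) *\<^sub>R hat \<psi> (- k)"
  by (intro hat_weak_pd weak_pd_smooth)

lemma hat_pd_pd: 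
  assumes "smooth \<psi>" "periodic2 \<psi>" shows "hat (pd j (pd j \<psi>)) k = - (2 * pi * kc k j)\<^sup>2 *\<^sub>R hat \<psi> k"
  using assms by (simp add: hat_pd smooth_pd periodic_pd kc_simps power2_eq_square)

text \<open>Testing against the modes determines all coefficients of a weak derivative. This is what
  makes the choice in the definition of \<open>D\<close> harmless: every admissible derivative has
  the same coefficients.\<close>

lemma weak_pd_unique:
  assumes "weak_pd j f g" "weak_pd j f h" shows "AE x in tor. g x = h x"
proof (rule hat_eqI)
  show "integrable tor g" "integrable tor h" using assms by (auto simp: weak_pd_def tor_integrable)
qed (simp only: hat_weak_pd[OF assms(1)] hat_weak_pd[OF assms(2)])

lemma D_weak_pd: assumes "f \<in> H1" shows "weak_pd j f (D j f)" "D j f \<in> L2"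
proof -
  have "\<exists>g. weak_pd j f g \<and> g \<in> L2" using assms by (auto simp: H1_def)
  from someI_ex[OF this] show "weak_pd j f (D j f)" "D j f \<in> L2" by (auto simp: D_def)
qed

lemma meanzero_hat: "meanzero f \<longleftrightarrow> hat f 0 = 0"
  for f :: "pt \<Rightarrow> 'b::euclidean_space"
  by (simp add: meanzero_def tor_integral hat_def)

lemma L2_I: 
  assumes "f \<in> borel_measurable borel" "periodic2 f" "sqi f" "hat f 0 = 0" shows "f \<in> L2"
  using assms by (auto simp: L2_def tor_integrable sqi_int2 meanzero_hat intro!: measurable_completion)

lemma L2_smooth: "smooth f \<Longrightarrow> periodic2 f \<Longrightarrow> meanzero f \<Longrightarrow> f \<in> L2"
  by (intro L2_I borel_measurable_continuous_onI smooth_continuous) (auto simp: meanzero_hat sqi_smooth)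

lemma H1_smooth: 
  fixes f :: "pt \<Rightarrow> 'b::euclidean_space"
  assumes "smooth f" "periodic2 f" "meanzero f" shows "f \<in> H1"
proof -
  have "pd j f \<in> L2" for j
    using assms by (intro L2_smooth smooth_pd periodic_pd) (auto simp: meanzero_hat hat_pd kc_simps)
  then show ?thesis using assms weak_pd_smooth L2_smooth unfolding H1_def by blast
qed

lemma D_smooth:
  assumes "smooth f" "periodic2 f" "meanzero f" shows "AE x in tor. D j f x = pd j f x"
  using weak_pd_unique D_weak_pd(1)[OF H1_smooth[OF assms]] weak_pd_smooth[OF assms(1,2)] by blast

lemma H1_L2: "f \<in> H1 \<Longrightarrow> f \<in> L2" by (simp add: H1_def)

section \<open>The H^1 norm and membership in H^1 in terms of coefficients\<close>

lemma bij_uminus_k: "bij_betw uminus (UNIV :: (int \<times> int) set) UNIV"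
  by (rule bij_betwI[of _ _ _ uminus]) auto

lemma nk_uminus [simp]: "nk (- k) = nk k" by (simp add: nk_def)
lemma nk_kc: "(\<Sum>j\<in>UNIV. (kc k j)\<^sup>2) = nk k" by (simp add: UNIV_2 kc_simps nk_def)

lemma D_norm_sum:
  fixes f :: "pt \<Rightarrow> 'b::euclidean_space"
  assumes "weak_pd j f g" "sqi g"
  shows "((\<lambda>k. (2 * pi * kc k j)\<^sup>2 * (norm (hat f k))\<^sup>2) has_sum (L2norm g)\<^sup>2) UNIV"
proof -
  have "((\<lambda>k. (norm (hat g k))\<^sup>2) has_sum (L2norm g)\<^sup>2) UNIV" by (rule parseval_norm[OF assms(2)])
  then have "((\<lambda>k. (norm (hat g (- k)))\<^sup>2) has_sum (L2norm g)\<^sup>2) UNIV"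
    by (subst has_sum_reindex_bij_betw[OF bij_uminus_k])
  then show ?thesis by (simp add: hat_weak_pd[OF assms(1)] kc_simps power_mult_distrib)
qed

lemma H1norm_power2: "(H1norm f)\<^sup>2 = (L2norm f)\<^sup>2 + (\<Sum>j\<in>UNIV. (L2norm (D j f))\<^sup>2)"
  unfolding H1norm_def by (rule real_sqrt_pow2) (intro add_nonneg_nonneg sum_nonneg, auto)

lemma H1norm_nonneg: "0 \<le> H1norm f" unfolding H1norm_def by (intro real_sqrt_ge_zero add_nonneg_nonneg sum_nonneg) auto

text \<open>The Fourier symbol of the identity minus the Laplacian; it turns the H^1 norm into a
  weighted square sum.\<close>

definition wt :: "int \<times> int \<Rightarrow> real" where "wt k = 1 + 4 * pi\<^sup>2 * nk k"

lemma wt_ge_1: "1 \<le> wt k" by (simp add: wt_def)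

lemma H1norm_sum:
  fixes f :: "pt \<Rightarrow> 'b::euclidean_space"
  assumes "f \<in> H1" shows "((\<lambda>k. wt k * (norm (hat f k))\<^sup>2) has_sum (H1norm f)\<^sup>2) UNIV"
proof -
  have "((\<lambda>k. (norm (hat f k))\<^sup>2 + (\<Sum>j\<in>UNIV. (2 * pi * kc k j)\<^sup>2 * (norm (hat f k))\<^sup>2)) has_sum (H1norm f)\<^sup>2) UNIV"
    unfolding H1norm_power2 sum_2
    by (intro has_sum_add parseval_norm D_norm_sum D_weak_pd assms sqi_L2 H1_L2)
  moreover have "(norm (hat f k))\<^sup>2 + (\<Sum>j\<in>UNIV. (2 * pi * kc k j)\<^sup>2 * (norm (hat f k))\<^sup>2) = wt k * (norm (hat f k))\<^sup>2" for k
    unfolding wt_def nk_kc[symmetric] by (simp add: UNIV_2 power_mult_distrib algebra_simps)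
  ultimately show ?thesis by simp
qed

text \<open>The derivative is constructed by Riesz-Fischer from the multiplied and reflected
  coefficients. That it is a weak derivative is then Parseval's identity for the test function, with
  the index reflected on one side.\<close>

lemma H1_I:
  fixes f :: "pt \<Rightarrow> 'b::euclidean_space"
  assumes f: "f \<in> L2" and s: "(\<lambda>k. wt k * (norm (hat f k))\<^sup>2) summable_on UNIV"
  shows "f \<in> H1"
proof -
  have sf: "sqi f" using f by (rule sqi_L2)
  have "\<exists>g. weak_pd j f g \<and> g \<in> L2" for j
  proof -
    define a where "a k = - (2 * pi * kc k j) *\<^sub>R hat f (- k)" for k
    have "(\<lambda>k. wt (- k) * (norm (hat f (- k)))\<^sup>2) summable_on UNIV"
      using s by (subst summable_on_reindex_bij_betw[OF bij_uminus_k])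
    then have "(\<lambda>k. (norm (a k))\<^sup>2) summable_on UNIV"
    proof (rule summable_on_comparison_test)
      fix k
      have "(kc k j)\<^sup>2 \<le> nk k" unfolding nk_kc[symmetric] by (rule member_le_sum) auto
      then have "4 * pi\<^sup>2 * (kc k j)\<^sup>2 \<le> 4 * pi\<^sup>2 * nk k" by (intro mult_left_mono) auto
      moreover have "(2 * pi * kc k j)\<^sup>2 = 4 * pi\<^sup>2 * (kc k j)\<^sup>2" by (simp add: power_mult_distrib)
      ultimately have w: "(2 * pi * kc k j)\<^sup>2 \<le> wt (- k)" unfolding wt_def nk_uminus by linarith
      have "(norm (a k))\<^sup>2 = (2 * pi * kc k j)\<^sup>2 * (norm (hat f (- k)))\<^sup>2"
        unfolding a_def by (simp add: power_mult_distrib)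
      also have "\<dots> \<le> wt (- k) * (norm (hat f (- k)))\<^sup>2"
        by (rule mult_right_mono[OF w]) simp
      finally show "(norm (a k))\<^sup>2 \<le> wt (- k) * (norm (hat f (- k)))\<^sup>2" .
    qed auto
    then obtain g where g: "g \<in> borel_measurable borel" "periodic2 g" "sqi g" and "hat g = a"
      using riesz_fischer_ex by blast
    then have ga: "hat g k = a k" for k by simp
    have "g \<in> L2" using g by (intro L2_I) (auto simp: ga a_def kc_simps)
    moreover have "weak_pd j f g"
      unfolding weak_pd_def tor_integrable tor_integral
    proof (intro conjI allI impI sqi_integrable g)
      fix \<phi> :: "pt \<Rightarrow> real" assume p: "smooth \<phi> \<and> periodic2 \<phi>"
      have sp: "sqi \<phi>" "sqi (pd j \<phi>)" using p by (auto intro: sqi_smooth smooth_pd)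
      have bd: "integrable tor (\<lambda>x. h x *\<^sub>R F x)" if h: "smooth h" and F: "sqi F" for h :: "pt \<Rightarrow> real" and F :: "pt \<Rightarrow> 'b"
      proof -
        obtain B where "\<And>x. x \<in> cell \<Longrightarrow> norm (h x) \<le> B"
          using bounded_on_cell[OF smooth_continuous[OF h]] by blast
        then show ?thesis
          by (intro sqi_integrable sqi_bounded_scaleR[of _ _ B] sqi_meas[OF sqi_smooth] h F) auto
      qed
      show "(LINT x|tor. pd j \<phi> x *\<^sub>R f x) = - (LINT x|tor. \<phi> x *\<^sub>R g x)"
      proof (rule euclidean_eqI)
        fix b :: 'b
        have hb: "hat (\<lambda>x. F x \<bullet> b) k = hat F k \<bullet> b" if "sqi F" for F :: "pt \<Rightarrow> 'b" and k
          using hat_inner[OF sqi_integrable[OF that]] by simp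
        have "((\<lambda>k. hat (pd j \<phi>) k * (hat f k \<bullet> b)) has_sum ip (pd j \<phi>) (\<lambda>x. f x \<bullet> b)) UNIV"
          using parseval[OF sp(2) sqi_component[OF sf, of b]] by (simp add: hb[OF sf])
        moreover have "((\<lambda>k. hat \<phi> k * (hat g k \<bullet> b)) has_sum ip \<phi> (\<lambda>x. g x \<bullet> b)) UNIV"
          using parseval[OF sp(1) sqi_component[OF g(3), of b]] by (simp add: hb[OF g(3)])
        then have "((\<lambda>k. - (hat \<phi> (- k) * (hat g (- k) \<bullet> b))) has_sum - ip \<phi> (\<lambda>x. g x \<bullet> b)) UNIV"
          by (intro has_sum_uminusI) (subst has_sum_reindex_bij_betw[OF bij_uminus_k, of "\<lambda>k. hat \<phi> k * (hat g k \<bullet> b)"])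
        moreover have "- (hat \<phi> (- k) * (hat g (- k) \<bullet> b)) = hat (pd j \<phi>) k * (hat f k \<bullet> b)" for k
          using p by (simp add: ga a_def hat_pd kc_simps)
        ultimately have "ip (pd j \<phi>) (\<lambda>x. f x \<bullet> b) = - ip \<phi> (\<lambda>x. g x \<bullet> b)"
          by (simp add: has_sum_unique)
        moreover have "(LINT x|tor. pd j \<phi> x *\<^sub>R f x) \<bullet> b = ip (pd j \<phi>) (\<lambda>x. f x \<bullet> b)"
          using p sf unfolding ip_tor by (subst integral_inner_left[symmetric]) (auto intro!: bd smooth_pd)
        moreover have "(LINT x|tor. \<phi> x *\<^sub>R g x) \<bullet> b = ip \<phi> (\<lambda>x. g x \<bullet> b)"
          using p g unfolding ip_tor by (subst integral_inner_left[symmetric]) (auto intro!: bd)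
        ultimately show "(LINT x|tor. pd j \<phi> x *\<^sub>R f x) \<bullet> b = - (LINT x|tor. \<phi> x *\<^sub>R g x) \<bullet> b"
          by simp
      qed
    qed
    ultimately show ?thesis by blast
  qed
  then show ?thesis using f by (simp add: H1_def)
qed

section \<open>Lattice sums and absolutely convergent series of smooth functions\<close>

lemma nk_ge_1: assumes "k \<noteq> 0" shows "1 \<le> nk k"
proof -
  obtain m n where k: "k = (m, n)" by (cases k)
  have "1 \<le> m\<^sup>2 + n\<^sup>2"
  proof (cases "m = 0")
    case True then have "n \<noteq> 0" using assms k by (auto simp: zero_prod_def)
    then show ?thesis using True by (simp add: int_one_le_iff_zero_less)
  next
    case False then have "1 \<le> m\<^sup>2" by (simp add: int_one_le_iff_zero_less)
    then show ?thesis by (simp add: add_increasing2)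
  qed
  then have "(1::real) \<le> of_int (m\<^sup>2 + n\<^sup>2)" using of_int_le_iff[of 1] by (metis of_int_1)
  then show ?thesis by (simp add: nk_def k)
qed

lemma nk_pos: "k \<noteq> 0 \<Longrightarrow> 0 < nk k" using nk_ge_1[of k] by linarith

text \<open>A bound in telescoping form: passing from \<open>N\<close> to \<open>N + 1\<close> adds
  \<open>2 / (1 + a\<^sup>2)\<close> with \<open>a = N + 1\<close>, which is at most
  \<open>4 / a - 4 / (a + 1)\<close>. The constant 5 gives equality at \<open>N = 0\<close>.\<close>

lemma sum_inverse_one_plus_square: "(\<Sum>m\<in>{- int N..int N}. 1 / (1 + (real_of_int m)\<^sup>2)) \<le> 5 - 4 / (real N + 1)"
proof (induction N)
  case (Suc N)
  have key: "2 / (1 + a\<^sup>2) + (5 - 4 / a) \<le> 5 - 4 / (a + 1)" if "0 < a" for a :: real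
  proof -
    have "a * (a + 1) \<le> 2 * (1 + a\<^sup>2)"
    proof -
      have "0 \<le> a\<^sup>2 - 2 * a + 1" using zero_le_power2[of "a - 1"] by (simp add: power2_diff)
      then have "a\<^sup>2 + a \<le> 2 + 2 * a\<^sup>2" using zero_le_power2[of a] by linarith
      then have "a\<^sup>2 + a \<le> 2 * (1 + a\<^sup>2)" by simp
      moreover have "a * (a + 1) = a\<^sup>2 + a" by (simp add: power2_eq_square distrib_left)
      ultimately show ?thesis by (simp only:)
    qed
    moreover have p: "0 < a * (a + 1)" using that by (intro mult_pos_pos) linarith+
    moreover have "0 < 2 * (1 + a\<^sup>2)" using zero_le_power2[of a] by (simp add: add_pos_nonneg)
    ultimately have "4 / (2 * (1 + a\<^sup>2)) \<le> 4 / (a * (a + 1))"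
      by (intro divide_left_mono mult_pos_pos[of "2 * (1 + a\<^sup>2)"]) simp_all
    moreover have "4 / (2 * c) = 2 / c" for c :: real by simp
    ultimately have "2 / (1 + a\<^sup>2) \<le> 4 / (a * (a + 1))" by (simp only:)
    also have "\<dots> = 4 / a - 4 / (a + 1)" using that by (subst diff_frac_eq) auto
    finally show ?thesis by linarith
  qed
  have r: "real_of_int (int (Suc N)) = real N + 1" "real_of_int (- int (Suc N)) = - (real N + 1)" by simp_all
  have "{- int (Suc N)..int (Suc N)} = insert (- int (Suc N)) (insert (int (Suc N)) {- int N..int N})" by auto
  then have "(\<Sum>m\<in>{- int (Suc N)..int (Suc N)}. 1 / (1 + (real_of_int m)\<^sup>2))
    = 1 / (1 + (real_of_int (- int (Suc N)))\<^sup>2) + (1 / (1 + (real_of_int (int (Suc N)))\<^sup>2) + (\<Sum>m\<in>{- int N..int N}. 1 / (1 + (real_of_int m)\<^sup>2)))"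
    by (simp only:) (subst sum.insert, simp_all del: of_nat_Suc)
  also have "\<dots> = 2 / (1 + (real N + 1)\<^sup>2) + (\<Sum>m\<in>{- int N..int N}. 1 / (1 + (real_of_int m)\<^sup>2))"
    unfolding r power2_minus by simp
  also have "\<dots> \<le> 2 / (1 + (real N + 1)\<^sup>2) + (5 - 4 / (real N + 1))" using Suc by simp
  also have "\<dots> \<le> 5 - 4 / (real N + 1 + 1)" by (rule key) simp
  also have "real N + 1 = real (Suc N)" by simp
  finally show ?case .
qed simp

text \<open>Since \<open>nk k \<ge> 1\<close>, the summand is at most four times a product of two
  one-dimensional summands, each with total at most 5; hence 100.\<close>

lemma sum_inverse_nk_square:
  assumes "finite F" "0 \<notin> F" shows "(\<Sum>k\<in>F. 1 / (nk k)\<^sup>2) \<le> 100"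
proof -
  obtain N where N: "F \<subseteq> bx N" using bx_cover[OF assms(1)] by blast
  have "(\<Sum>k\<in>F. 1 / (nk k)\<^sup>2) \<le> (\<Sum>k\<in>F. 4 * (1 / (1 + (real_of_int (fst k))\<^sup>2) * (1 / (1 + (real_of_int (snd k))\<^sup>2))))"
  proof (rule sum_mono)
    fix k assume "k \<in> F"
    then have n: "1 \<le> nk k" using nk_ge_1 assms(2) by metis
    have "1 / (nk k)\<^sup>2 \<le> 4 / ((1 + a) * (1 + b))" if "0 \<le> a" "0 \<le> b" "nk k = a + b" for a b
    proof -
      have "1 \<le> (a + b)\<^sup>2" using n that one_le_power[of "a + b" 2] by simp
      moreover have "a + b \<le> (a + b)\<^sup>2" using n that mult_left_mono[of 1 "a + b" "a + b"] by (simp add: power2_eq_square)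
      moreover have "a * b \<le> (a + b)\<^sup>2" using that by (simp add: power2_eq_square algebra_simps)
      ultimately have "(1 + a) * (1 + b) \<le> 4 * (a + b)\<^sup>2" by (simp add: algebra_simps)
      moreover have "0 < (1 + a) * (1 + b)" using that by (intro mult_pos_pos) linarith+
      moreover have "0 < 4 * (a + b)\<^sup>2" using n that by simp
      ultimately have "4 / (4 * (a + b)\<^sup>2) \<le> 4 / ((1 + a) * (1 + b))"
        by (intro divide_left_mono mult_pos_pos[of "4 * (a + b)\<^sup>2"]) simp_all
      then show ?thesis using that(3) by simp
    qed
    from this[of "(real_of_int (fst k))\<^sup>2" "(real_of_int (snd k))\<^sup>2"]
    show "1 / (nk k)\<^sup>2 \<le> 4 * (1 / (1 + (real_of_int (fst k))\<^sup>2) * (1 / (1 + (real_of_int (snd k))\<^sup>2)))"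
      by (simp add: nk_def)
  qed
  also have "\<dots> \<le> (\<Sum>k\<in>bx N. 4 * (1 / (1 + (real_of_int (fst k))\<^sup>2) * (1 / (1 + (real_of_int (snd k))\<^sup>2))))"
    using N by (intro sum_mono2) auto
  also have "\<dots> = 4 * ((\<Sum>m\<in>{- int N..int N}. 1 / (1 + (real_of_int m)\<^sup>2)) * (\<Sum>m\<in>{- int N..int N}. 1 / (1 + (real_of_int m)\<^sup>2)))"
    unfolding bx_def sum_product sum.cartesian_product by (simp only: sum_distrib_left case_prod_beta)
  also have "\<dots> \<le> 4 * (5 * 5)"
  proof -
    have s: "(\<Sum>m\<in>{- int N..int N}. 1 / (1 + (real_of_int m)\<^sup>2)) \<le> 5"
      using sum_inverse_one_plus_square[of N] divide_nonneg_nonneg[of 4 "real N + 1"] by linarith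
    show ?thesis by (intro mult_left_mono mult_mono s sum_nonneg) auto
  qed
  finally show ?thesis by simp
qed

text \<open>Two applications of the Laplacian bring out the factor
  \<open>(4 * pi\<^sup>2 * nk k)\<^sup>2\<close>, and every coefficient is bounded by the L^2 norm.
  Four derivatives are taken because this decay is covered by the lattice sum above.\<close>

lemma smooth_hat_decay:
  fixes \<psi> :: "pt \<Rightarrow> 'b::euclidean_space"
  assumes "smooth \<psi>" "periodic2 \<psi>"
  obtains C where "0 \<le> C" "\<And>k. k \<noteq> 0 \<Longrightarrow> norm (hat \<psi> k) \<le> C * (1 / (nk k)\<^sup>2)"
proof
  let ?C = "\<Sum>i\<in>UNIV. \<Sum>j\<in>UNIV. L2norm (pd i (pd i (pd j (pd j \<psi>))))"
  show "0 \<le> ?C" by (intro sum_nonneg) auto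
  fix k :: "int \<times> int" assume k: "k \<noteq> 0"
  have h: "hat (pd i (pd i (pd j (pd j \<psi>)))) k = ((2 * pi * kc k i)\<^sup>2 * (2 * pi * kc k j)\<^sup>2) *\<^sub>R hat \<psi> k" for i j
    using assms by (simp add: hat_pd_pd smooth_pd periodic_pd)
  have "(4 * pi\<^sup>2 * nk k)\<^sup>2 *\<^sub>R hat \<psi> k = (\<Sum>i\<in>UNIV. \<Sum>j\<in>UNIV. hat (pd i (pd i (pd j (pd j \<psi>)))) k)"
    unfolding h scaleR_sum_left[symmetric] nk_kc[symmetric]
    by (simp add: UNIV_2 power2_eq_square algebra_simps)
  then have "norm ((4 * pi\<^sup>2 * nk k)\<^sup>2 *\<^sub>R hat \<psi> k) \<le> ?C"
    using assms by (auto intro!: order_trans[OF norm_sum] sum_mono norm_hat_le sqi_smooth smooth_pd)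
  moreover have "(nk k)\<^sup>2 \<le> (4 * pi\<^sup>2 * nk k)\<^sup>2"
  proof (intro power_mono)
    have "1 \<le> 4 * pi\<^sup>2" using pi_ge_two power_mono[of 2 pi 2] by simp
    then show "nk k \<le> 4 * pi\<^sup>2 * nk k" using mult_right_mono[of 1 "4 * pi\<^sup>2" "nk k"] by simp
  qed simp
  then have "(nk k)\<^sup>2 * norm (hat \<psi> k) \<le> (4 * pi\<^sup>2 * nk k)\<^sup>2 * norm (hat \<psi> k)"
    by (rule mult_right_mono) simp
  ultimately have "(nk k)\<^sup>2 * norm (hat \<psi> k) \<le> ?C" by simp
  then show "norm (hat \<psi> k) \<le> ?C * (1 / (nk k)\<^sup>2)" using nk_pos[OF k] by (simp add: field_simps)
qed

lemma summable_hat_smooth: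
  fixes \<psi> :: "pt \<Rightarrow> 'b::euclidean_space"
  assumes "smooth \<psi>" "periodic2 \<psi>" shows "(\<lambda>k. norm (hat \<psi> k)) summable_on UNIV"
proof -
  obtain C where C: "0 \<le> C" "\<And>k. k \<noteq> 0 \<Longrightarrow> norm (hat \<psi> k) \<le> C * (1 / (nk k)\<^sup>2)"
    using smooth_hat_decay[OF assms] by blast
  have "(\<Sum>k\<in>F. norm (hat \<psi> k)) \<le> norm (hat \<psi> 0) + C * 100" if "finite F" for F
  proof -
    have "(\<Sum>k\<in>F. norm (hat \<psi> k)) \<le> (\<Sum>k\<in>insert 0 (F - {0}). norm (hat \<psi> k))"
      using that by (intro sum_mono2) auto
    also have "\<dots> = norm (hat \<psi> 0) + (\<Sum>k\<in>F - {0}. norm (hat \<psi> k))"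
      using that by (intro sum.insert) auto
    also have "(\<Sum>k\<in>F - {0}. norm (hat \<psi> k)) \<le> (\<Sum>k\<in>F - {0}. C * (1 / (nk k)\<^sup>2))"
      by (intro sum_mono C) auto
    also have "\<dots> \<le> C * 100"
      unfolding sum_distrib_left[symmetric] using that C by (intro mult_left_mono sum_inverse_nk_square) auto
    finally show ?thesis by simp
  qed
  then show ?thesis
    by (intro nonneg_bdd_above_summable_on) (auto intro!: bdd_aboveI[of _ "norm (hat \<psi> 0) + C * 100"])
qed

text \<open>The series converges uniformly to some \<open>S\<close> with the coefficients of
  \<open>\<psi>\<close>. Completeness identifies \<open>S\<close> with \<open>\<psi>\<close> almost
  everywhere only, which is enough under integrals.\<close>

lemma smooth_Psum_AE:
  fixes \<psi> :: "pt \<Rightarrow> 'b::euclidean_space"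
  assumes "smooth \<psi>" "periodic2 \<psi>"
  obtains T where "T \<longlonglongrightarrow> 0" "\<And>n. AE x in tor. norm (\<psi> x - Psum (bx n) (hat \<psi>) x) \<le> T n"
proof -
  \<comment> \<open>Twice the tail of the coefficient sum, since the modes are bounded by 2.\<close>
  define T where "T n = 2 * (infsum (\<lambda>k. norm (hat \<psi> k)) UNIV - (\<Sum>k\<in>bx n. norm (hat \<psi> k)))" for n
  note sm = summable_hat_smooth[OF assms]
  have T0: "T \<longlonglongrightarrow> 0"
    unfolding T_def using tendsto_mult[OF tendsto_const summable_tail(1)[OF sm], of 2] by simp
  let ?P = "\<lambda>n. Psum (bx n) (hat \<psi>)"
  have pd: "norm (?P m x - ?P n x) \<le> T n" if "n \<le> m" for n m x
  proof -
    have "?P m x - ?P n x = (\<Sum>k\<in>bx m - bx n. cas k x *\<^sub>R hat \<psi> k)"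
      unfolding Psum_def using bx_mono[OF that] by (simp add: sum_diff)
    also have "norm \<dots> \<le> (\<Sum>k\<in>bx m - bx n. 2 * norm (hat \<psi> k))"
      by (rule sum_norm_le) (auto intro!: mult_right_mono cas_bound)
    also have "\<dots> \<le> T n" unfolding T_def sum_distrib_left[symmetric]
      using summable_tail(2)[OF sm, of "bx m" n] bx_mono[OF that] by simp
    finally show ?thesis .
  qed
  have "Cauchy (\<lambda>n. ?P n x)" for x
  proof (rule metric_CauchyI)
    fix e :: real assume e: "0 < e"
    have "\<forall>\<^sub>F n in sequentially. T n < e / 2" using e by (intro order_tendstoD(2)[OF T0]) auto
    then obtain N where N: "T N < e / 2" using eventually_happens by fastforce
    show "\<exists>M. \<forall>m\<ge>M. \<forall>n\<ge>M. dist (?P m x) (?P n x) < e"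
    proof (intro exI allI impI)
      fix m n assume "N \<le> m" "N \<le> n"
      then have "norm (?P m x - ?P N x) \<le> T N" "norm (?P n x - ?P N x) \<le> T N" using pd by auto
      then show "dist (?P m x) (?P n x) < e"
        using N dist_triangle2[of "?P m x" "?P n x" "?P N x"] by (simp add: dist_norm)
    qed
  qed
  then have "\<exists>l. (\<lambda>n. ?P n x) \<longlonglongrightarrow> l" for x by (simp add: Cauchy_convergent_iff convergent_def)
  then obtain S where S: "\<And>x. (\<lambda>n. ?P n x) \<longlonglongrightarrow> S x" by metis
  have Sd: "norm (S x - ?P n x) \<le> T n" for x n
  proof (rule LIMSEQ_le_const2)
    show "(\<lambda>m. norm (?P m x - ?P n x)) \<longlonglongrightarrow> norm (S x - ?P n x)" by (intro tendsto_intros S)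
  qed (use pd in blast)
  have Sm: "S \<in> borel_measurable tor"
    by (rule borel_measurable_LIMSEQ_metric[OF _ S]) (auto intro: sqi_meas)
  have sd: "sqi (\<lambda>x. S x - ?P n x)" for n
    by (intro sqi_bounded[of _ "T n"] Sd borel_measurable_diff Sm sqi_meas[OF sqi_Psum])
  have S2: "sqi S" using sqi_add[OF sd[of 0] sqi_Psum[of "bx 0" "hat \<psi>"]] by simp
  have "hat S k = hat \<psi> k" for k
  proof -
    have ev: "\<forall>\<^sub>F n in sequentially. norm (hat S k - hat \<psi> k) \<le> T n"
      using eventually_mem_bx[of k]
    proof eventually_elim
      case (elim n)
      have "hat (\<lambda>x. S x - ?P n x) k = hat S k - hat \<psi> k"
        using elim S2 by (subst hat_diff) (auto simp: sqi_integrable hat_Psum)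
      moreover have "norm (hat (\<lambda>x. S x - ?P n x) k) \<le> L2norm (\<lambda>x. S x - ?P n x)"
        by (rule norm_hat_le[OF sd])
      moreover have "L2norm (\<lambda>x. S x - ?P n x) \<le> T n"
      proof -
        have "0 \<le> T n" using Sd[of 0 n] norm_ge_zero order_trans by blast
        have "(LINT x|tor. (norm (S x - ?P n x))\<^sup>2) \<le> (LINT x|tor. (T n)\<^sup>2)"
          using Sd by (intro integral_mono sqi_int2 sd power_mono) auto
        also have "\<dots> = (T n)\<^sup>2" by (simp add: measure_tor)
        finally show ?thesis unfolding L2norm_tor using \<open>0 \<le> T n\<close> by (simp add: real_le_lsqrt)
      qed
      ultimately show ?case by simp
    qed
    have "norm (hat S k - hat \<psi> k) \<le> 0" by (rule tendsto_lowerbound[OF T0 ev]) simp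
    then show ?thesis by simp
  qed
  then have "AE x in tor. \<psi> x = S x"
    using assms S2 by (intro hat_eqI) (auto intro: sqi_integrable sqi_smooth)
  then have "AE x in tor. norm (\<psi> x - ?P n x) \<le> T n" for n
    by eventually_elim (simp add: Sd)
  then show thesis using that T0 by blast
qed

subsection \<open>Divergence-free modes\<close>

text \<open>The unit vector orthogonal to the frequency \<open>k\<close>, so that
  \<open>cas k x *\<^sub>R Ev k\<close> is divergence free. Division by zero makes
  \<open>Ev 0 = 0\<close>, which removes the mean automatically.\<close>

definition Ev :: "int \<times> int \<Rightarrow> real^2" where
  "Ev k = (1 / sqrt (nk k)) *\<^sub>R vector [- of_int (snd k), of_int (fst k)]"

lemma Ev_nth: "Ev k $ 1 = - of_int (snd k) / sqrt (nk k)" "Ev k $ 2 = of_int (fst k) / sqrt (nk k)"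
  by (simp_all add: Ev_def vector_2)

lemma inner_2: "x \<bullet> y = x$1 * y$1 + x$2 * y$2" for x y :: "real^2"
  by (simp add: inner_vec_def sum_2)

lemma nk_0 [simp]: "nk 0 = 0" by (simp add: nk_def)

lemma Ev_0 [simp]: "Ev 0 = 0" by (simp add: Ev_def)

lemma Ev_inner: "Ev k \<bullet> Ev k = (if k = 0 then 0 else 1)"
proof (cases "k = 0")
  case False
  have "Ev k \<bullet> Ev k = ((of_int (snd k))\<^sup>2 + (of_int (fst k))\<^sup>2) / nk k"
    unfolding inner_2 Ev_nth by (simp add: add_divide_distrib power2_eq_square)
  also have "\<dots> = nk k / nk k" by (simp add: nk_def add.commute)
  also have "\<dots> = 1" using nk_pos[OF False] by simp
  finally show ?thesis using False by (simp only: if_False)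
qed simp

lemma norm_Ev: "norm (Ev k) = (if k = 0 then 0 else 1)"
  by (simp add: norm_eq_sqrt_inner Ev_inner)

lemma norm_Ev_le: "norm (Ev k) \<le> 1" by (simp add: norm_Ev)

lemma Ev_kc: "kc k 1 * Ev k $ 1 + kc k 2 * Ev k $ 2 = 0"
  unfolding Ev_nth kc_simps by (simp add: algebra_simps)

text \<open>In the plane the vectors orthogonal to a nonzero frequency form the line spanned by
  \<open>Ev k\<close>; a divergence-free field therefore has one scalar coefficient per
  mode.\<close>

lemma div_free_vector:
  fixes v :: "real^2"
  assumes "k \<noteq> 0" "kc k 1 * v$1 + kc k 2 * v$2 = 0" shows "(v \<bullet> Ev k) *\<^sub>R Ev k = v"
proof -
  define m n :: real where "m = of_int (fst k)" and "n = of_int (snd k)"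
  have p: "0 < nk k" by (rule nk_pos[OF assms(1)])
  have nk: "nk k = m\<^sup>2 + n\<^sup>2" by (simp add: nk_def m_def n_def)
  have o: "m * v$1 + n * v$2 = 0" using assms(2) by (simp add: kc_simps m_def n_def)
  have s: "sqrt (nk k) * sqrt (nk k) = nk k" using p by simp
  have vE: "v \<bullet> Ev k = (m * v$2 - n * v$1) / sqrt (nk k)"
    unfolding inner_2 Ev_nth m_def[symmetric] n_def[symmetric] by (simp add: diff_divide_distrib mult.commute)
  have 1: "((v \<bullet> Ev k) *\<^sub>R Ev k) $ 1 = (n * (n * v$1 - m * v$2)) / nk k"
    unfolding vE vector_scaleR_component Ev_nth n_def[symmetric] real_scaleR_def times_divide_times_eq s
    by (simp add: algebra_simps)
  have 2: "((v \<bullet> Ev k) *\<^sub>R Ev k) $ 2 = (m * (m * v$2 - n * v$1)) / nk k"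
    unfolding vE vector_scaleR_component Ev_nth m_def[symmetric] real_scaleR_def times_divide_times_eq s
    by (simp add: algebra_simps)
  have "n * (n * v$1 - m * v$2) = v$1 * nk k"
  proof -
    have "v$1 * nk k - n * (n * v$1 - m * v$2) = m * (m * v$1 + n * v$2)"
      by (simp add: nk power2_eq_square algebra_simps)
    then show ?thesis by (simp add: o)
  qed
  moreover have "m * (m * v$2 - n * v$1) = v$2 * nk k"
  proof -
    have "v$2 * nk k - m * (m * v$2 - n * v$1) = n * (m * v$1 + n * v$2)"
      by (simp add: nk power2_eq_square algebra_simps)
    then show ?thesis by (simp add: o)
  qed
  ultimately show ?thesis using p by (simp only: vec_eq_iff forall_2 1 2) simp
qed

lemma Psum_has_derivative:
  "(Psum F a has_derivative (\<lambda>v. \<Sum>k\<in>F. (ph k v * cas (- k) x) *\<^sub>R a k)) (at x within A)"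
  unfolding Psum_def[abs_def]
  by (intro has_derivative_sum has_derivative_scaleR_left cas_has_derivative)

lemma pd_Psum: "pd j (Psum F a) x = (\<Sum>k\<in>F. (2 * pi * kc k j * cas (- k) x) *\<^sub>R a k)"
proof -
  have "frechet_derivative (Psum F a) (at x) = (\<lambda>v. \<Sum>k\<in>F. (ph k v * cas (- k) x) *\<^sub>R a k)"
    by (rule frechet_derivative_at[symmetric, OF Psum_has_derivative])
  then show ?thesis by (simp add: pd_def ph_axis_kc)
qed

lemma div_Psum_Ev: "div_cl (Psum F (\<lambda>k. q k *\<^sub>R Ev k)) x = 0"
proof -
  have "div_cl (Psum F (\<lambda>k. q k *\<^sub>R Ev k)) x = (\<Sum>k\<in>F. 2 * pi * cas (- k) x * q k * (kc k 1 * Ev k $ 1 + kc k 2 * Ev k $ 2))"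
    unfolding div_cl_def sum_2 pd_Psum by (simp add: sum.distrib[symmetric] algebra_simps)
  then show ?thesis by (simp add: Ev_kc)
qed

lemma trigpoly_Psum: "trigpoly (Psum (bx n) a)"
  unfolding trigpoly_def
proof (intro exI)
  show "Psum (bx n) a = (\<lambda>x. \<Sum>m\<in>{- int n..int n}. \<Sum>l\<in>{- int n..int n}.
            cos (2*pi*(of_int m * x$1 + of_int l * x$2)) *\<^sub>R a (m, l)
          + sin (2*pi*(of_int m * x$1 + of_int l * x$2)) *\<^sub>R a (m, l))"
    unfolding Psum_def[abs_def] bx_def sum.cartesian_product cas_def ph_def
    by (simp add: case_prod_beta scaleR_add_left)
qed

text \<open>The truncations of the series are the approximating polynomials that \<open>V\<close>
  asks for: each mode is divergence free, and the H^1 distance is the tail of the weighted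
  sum.\<close>

lemma V_I:
  fixes u :: "pt \<Rightarrow> real^2"
  assumes u: "u \<in> borel_measurable borel" "periodic2 u" "sqi u" "\<And>k. hat u k = q k *\<^sub>R Ev k"
    and s: "(\<lambda>k. wt k * (q k)\<^sup>2) summable_on UNIV"
  shows "u \<in> H1" "u \<in> V"
proof -
  have nq: "(norm (hat u k))\<^sup>2 \<le> (q k)\<^sup>2" for k by (simp add: u(4) norm_Ev)
  have w: "wt k * (norm (hat u k))\<^sup>2 \<le> wt k * (q k)\<^sup>2" for k
    using nq wt_ge_1[of k] by (intro mult_left_mono) auto
  have w0: "0 \<le> wt k" for k using wt_ge_1[of k] by linarith
  have sw: "(\<lambda>k. wt k * (norm (hat u k))\<^sup>2) summable_on UNIV"
    by (rule summable_on_comparison_test[OF s]) (use w w0 in auto)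
  show H1: "u \<in> H1" using u sw by (intro H1_I L2_I) auto
  define p where "p n = Psum (bx n) (hat u)" for n
  have pe: "p n = Psum (bx n) (\<lambda>k. q k *\<^sub>R Ev k)" for n
    unfolding p_def u(4)[symmetric] by (simp add: Psum_def fun_eq_iff)
  have hd: "hat (\<lambda>x. u x - p n x) k = (if k \<in> bx n then 0 else hat u k)" for n k
    unfolding p_def using u by (subst hat_diff) (auto simp: sqi_integrable hat_Psum)
  have dH: "(\<lambda>x. u x - p n x) \<in> H1" for n
  proof (intro H1_I L2_I)
    show "(\<lambda>x. u x - p n x) \<in> borel_measurable borel"
      unfolding p_def by (intro borel_measurable_diff u borel_measurable_continuous_onI continuous_intros)
    show "periodic2 (\<lambda>x. u x - p n x)"
      using u(2) unfolding p_def by (simp add: periodic2_def periodic_Psum[unfolded periodic2_def, rule_format])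
    show "sqi (\<lambda>x. u x - p n x)" unfolding p_def by (intro sqi_diff u sqi_Psum)
    show "hat (\<lambda>x. u x - p n x) 0 = 0" unfolding hd using u by simp
    show "(\<lambda>k. wt k * (norm (hat (\<lambda>x. u x - p n x) k))\<^sup>2) summable_on UNIV"
      by (rule summable_on_comparison_test[OF sw]) (use w0 in \<open>auto simp: hd\<close>)
  qed
  have "(\<lambda>n. (H1norm (\<lambda>x. u x - p n x))\<^sup>2) \<longlonglongrightarrow> 0"
  proof -
    define W where "W = infsum (\<lambda>k. wt k * (norm (hat u k))\<^sup>2) UNIV"
    have W: "((\<lambda>k. wt k * (norm (hat u k))\<^sup>2) has_sum W) UNIV" unfolding W_def using sw by simp
    have "(H1norm (\<lambda>x. u x - p n x))\<^sup>2 = W - (\<Sum>k\<in>bx n. wt k * (norm (hat u k))\<^sup>2)" for n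
    proof -
      have "((\<lambda>k. if k \<in> bx n then wt k * (norm (hat u k))\<^sup>2 else 0) has_sum (\<Sum>k\<in>bx n. wt k * (norm (hat u k))\<^sup>2)) UNIV"
        by (rule has_sum_cong_neutral[THEN iffD1, OF _ _ _ has_sum_finite[OF finite_bx]]) auto
      then have "((\<lambda>k. wt k * (norm (hat u k))\<^sup>2 + - (if k \<in> bx n then wt k * (norm (hat u k))\<^sup>2 else 0)) has_sum
        W + - (\<Sum>k\<in>bx n. wt k * (norm (hat u k))\<^sup>2)) UNIV"
        by (intro has_sum_add has_sum_uminusI W)
      moreover have "wt k * (norm (hat u k))\<^sup>2 + - (if k \<in> bx n then wt k * (norm (hat u k))\<^sup>2 else 0) = wt k * (norm (hat (\<lambda>x. u x - p n x) k))\<^sup>2" for k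
        by (simp add: hd)
      ultimately show ?thesis using has_sum_unique[OF H1norm_sum[OF dH]] by simp
    qed
    moreover have "(\<lambda>n. W - (\<Sum>k\<in>bx n. wt k * (norm (hat u k))\<^sup>2)) \<longlonglongrightarrow> 0"
      unfolding W_def by (rule summable_tail(1)[OF sw]) (use w0 in auto)
    ultimately show ?thesis by simp
  qed
  then have lim: "(\<lambda>n. H1norm (\<lambda>x. u x - p n x)) \<longlonglongrightarrow> 0" by (simp add: power_tendsto_0_iff)
  have "trigpoly (p n) \<and> meanzero (p n) \<and> (\<forall>x. div_cl (p n) x = 0)" for n
  proof (intro conjI allI)
    show "trigpoly (p n)" unfolding p_def by (rule trigpoly_Psum)
    show "meanzero (p n)" unfolding p_def meanzero_hat by (simp add: hat_Psum u)
    show "div_cl (p n) x = 0" for x unfolding pe by (rule div_Psum_Ev)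
  qed
  then show "u \<in> V" unfolding V_def using H1 lim by blast
qed

text \<open>The coefficient of the divergence at \<open>- k\<close> is a multiple of the scalar
  product of \<open>k\<close> with \<open>hat \<Psi> k\<close>, which therefore vanishes.\<close>

lemma hat_div_free:
  fixes \<Psi> :: "pt \<Rightarrow> real^2"
  assumes "smooth \<Psi>" "periodic2 \<Psi>" "meanzero \<Psi>" "\<And>x. div_cl \<Psi> x = 0"
  shows "hat \<Psi> k = (hat \<Psi> k \<bullet> Ev k) *\<^sub>R Ev k"
proof (cases "k = 0")
  case True then show ?thesis using assms(3) by (simp add: meanzero_hat)
next
  case False
  have i: "integrable tor (pd j \<Psi>)" for j by (intro sqi_integrable sqi_smooth smooth_pd assms)
  have c: "hat (pd j \<Psi>) l $ j = hat (\<lambda>x. pd j \<Psi> x $ j) l" for j l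
    using hat_inner[OF i, of j l "axis j 1"] by (simp add: inner_axis)
  have ic: "integrable tor (\<lambda>x. pd j \<Psi> x $ j)" for j
    using sqi_integrable[OF sqi_component[OF sqi_smooth[OF smooth_pd[OF assms(1)]], of j "axis j 1"]] by (simp add: inner_axis)
  have "hat (pd 1 \<Psi>) (- k) $ 1 + hat (pd 2 \<Psi>) (- k) $ 2 = hat (\<lambda>x. pd 1 \<Psi> x $ 1 + pd 2 \<Psi> x $ 2) (- k)"
    unfolding c by (rule hat_add[symmetric]) (rule ic)+
  also have "\<dots> = hat (\<lambda>x. 0 :: real) (- k)" using assms(4) by (simp add: div_cl_def sum_2)
  also have "\<dots> = 0" by (simp add: hat_def)
  finally have "2 * pi * (kc k 1 * hat \<Psi> k $ 1 + kc k 2 * hat \<Psi> k $ 2) = 0"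
    using assms(1,2) by (simp add: hat_pd kc_simps algebra_simps)
  then have "kc k 1 * hat \<Psi> k $ 1 + kc k 2 * hat \<Psi> k $ 2 = 0" by simp
  from div_free_vector[OF False this] show ?thesis by simp
qed

subsection \<open>Products of trigonometric polynomials\<close>

text \<open>Substitute for the planar embedding of H^1 in L^4. Pairs are grouped by their output
  frequency and Cauchy-Schwarz is applied on each fibre with the weight
  \<open>nk (fst p) * nk (snd p)\<close>. On a fibre either frequency determines the other, so the
  sum of inverse weights is bounded by lattice sums.\<close>

lemma convolution_estimate:
  fixes c :: "(int \<times> int) \<times> (int \<times> int) \<Rightarrow> real" and h :: "(int \<times> int) \<times> (int \<times> int) \<Rightarrow> int \<times> int"
  assumes A: "finite A" and nz: "\<And>p. p \<in> A \<Longrightarrow> fst p \<noteq> 0 \<and> snd p \<noteq> 0"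
    and i1: "\<And>p p'. h p = h p' \<Longrightarrow> fst p = fst p' \<Longrightarrow> p = p'"
    and i2: "\<And>p p'. h p = h p' \<Longrightarrow> snd p = snd p' \<Longrightarrow> p = p'"
  shows "(L2norm (\<lambda>x. \<Sum>p\<in>A. c p * cas (h p) x))\<^sup>2 \<le> 100 * (\<Sum>p\<in>A. nk (fst p) * nk (snd p) * (c p)\<^sup>2)"
proof -
  define w where "w p = nk (fst p) * nk (snd p)" for p
  define B where "B m = {p \<in> A. h p = m}" for m
  define C where "C m = (\<Sum>p\<in>B m. c p)" for m
  have fB: "finite (B m)" for m using A by (simp add: B_def)
  have w: "0 < w p" if "p \<in> A" for p unfolding w_def using nz[OF that] by (intro mult_pos_pos nk_pos) auto
  have "(\<lambda>x. \<Sum>p\<in>A. c p * cas (h p) x) = Psum (h ` A) C"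
  proof
    fix x
    have "(\<Sum>p\<in>A. c p * cas (h p) x) = (\<Sum>m\<in>h ` A. \<Sum>p\<in>B m. c p * cas (h p) x)"
      unfolding B_def by (rule sum.image_gen[OF A])
    also have "\<dots> = (\<Sum>m\<in>h ` A. cas m x * C m)"
      unfolding C_def sum_distrib_left by (intro sum.cong refl) (auto simp: B_def mult.commute)
    finally show "(\<Sum>p\<in>A. c p * cas (h p) x) = Psum (h ` A) C x" by (simp add: Psum_def)
  qed
  then have "(L2norm (\<lambda>x. \<Sum>p\<in>A. c p * cas (h p) x))\<^sup>2 = (\<Sum>m\<in>h ` A. (C m)\<^sup>2)"
    using L2norm_Psum[of "h ` A" C] A by simp
  also have "\<dots> \<le> (\<Sum>m\<in>h ` A. 100 * (\<Sum>p\<in>B m. w p * (c p)\<^sup>2))"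
  proof (rule sum_mono)
    fix m
    have BA: "p \<in> A" if "p \<in> B m" for p using that by (simp add: B_def)
    have "C m = (\<Sum>p\<in>B m. (1 / sqrt (w p)) * (sqrt (w p) * c p))"
      unfolding C_def by (intro sum.cong refl) (use w[OF BA] in \<open>simp add: less_imp_neq[symmetric]\<close>)
    then have CS: "(C m)\<^sup>2 \<le> (\<Sum>p\<in>B m. (1 / sqrt (w p))\<^sup>2) * (\<Sum>p\<in>B m. (sqrt (w p) * c p)\<^sup>2)"
      using Cauchy_Schwarz_ineq_sum[of "\<lambda>p. 1 / sqrt (w p)" "\<lambda>p. sqrt (w p) * c p" "B m"] by simp
    have e1: "(\<Sum>p\<in>B m. (sqrt (w p) * c p)\<^sup>2) = (\<Sum>p\<in>B m. w p * (c p)\<^sup>2)"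
      by (intro sum.cong refl) (use w[OF BA] in \<open>simp add: power_mult_distrib less_imp_le\<close>)
    have e2: "(\<Sum>p\<in>B m. (1 / sqrt (w p))\<^sup>2) = (\<Sum>p\<in>B m. 1 / w p)"
      by (intro sum.cong refl) (use w[OF BA] in \<open>simp add: power_divide less_imp_le\<close>)
    \<comment> \<open>The arithmetic-geometric mean inequality separates the two frequencies, so
      that each half is a sum over a single lattice.\<close>
    have "(\<Sum>p\<in>B m. 1 / w p) \<le> (\<Sum>p\<in>B m. (1/2) * (1 / (nk (fst p))\<^sup>2) + (1/2) * (1 / (nk (snd p))\<^sup>2))"
    proof (rule sum_mono)
      fix p
      have "2 * (1 / nk (fst p)) * (1 / nk (snd p)) \<le> (1 / nk (fst p))\<^sup>2 + (1 / nk (snd p))\<^sup>2"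
        by (rule sum_squares_bound)
      then show "1 / w p \<le> (1/2) * (1 / (nk (fst p))\<^sup>2) + (1/2) * (1 / (nk (snd p))\<^sup>2)"
        by (simp add: w_def power_divide)
    qed
    also have "\<dots> = (1/2) * (\<Sum>p\<in>B m. 1 / (nk (fst p))\<^sup>2) + (1/2) * (\<Sum>p\<in>B m. 1 / (nk (snd p))\<^sup>2)"
      by (simp only: sum.distrib sum_distrib_left)
    also have "\<dots> \<le> (1/2) * 100 + (1/2) * 100"
    proof -
      have z1: "0 \<notin> fst ` B m" and z2: "0 \<notin> snd ` B m" using nz BA by (metis imageE)+
      have "inj_on fst (B m)" by (rule inj_onI, rule i1) (simp_all add: B_def)
      then have "(\<Sum>p\<in>B m. 1 / (nk (fst p))\<^sup>2) = (\<Sum>k\<in>fst ` B m. 1 / (nk k)\<^sup>2)"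
        by (simp add: sum.reindex o_def)
      also have "\<dots> \<le> 100" using z1 fB by (intro sum_inverse_nk_square) auto
      finally have 1: "(\<Sum>p\<in>B m. 1 / (nk (fst p))\<^sup>2) \<le> 100" .
      have "inj_on snd (B m)" by (rule inj_onI, rule i2) (simp_all add: B_def)
      then have "(\<Sum>p\<in>B m. 1 / (nk (snd p))\<^sup>2) = (\<Sum>k\<in>snd ` B m. 1 / (nk k)\<^sup>2)"
        by (simp add: sum.reindex o_def)
      also have "\<dots> \<le> 100" using z2 fB by (intro sum_inverse_nk_square) auto
      finally have 2: "(\<Sum>p\<in>B m. 1 / (nk (snd p))\<^sup>2) \<le> 100" .
      from 1 2 show ?thesis by linarith
    qed
    finally have "(\<Sum>p\<in>B m. 1 / w p) \<le> 100" by simp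
    then have "(\<Sum>p\<in>B m. 1 / w p) * (\<Sum>p\<in>B m. w p * (c p)\<^sup>2) \<le> 100 * (\<Sum>p\<in>B m. w p * (c p)\<^sup>2)"
      using w[OF BA] by (intro mult_right_mono sum_nonneg) (auto simp: less_imp_le)
    with CS show "(C m)\<^sup>2 \<le> 100 * (\<Sum>p\<in>B m. w p * (c p)\<^sup>2)"
      unfolding e1 e2 by (rule order_trans)
  qed
  also have "\<dots> = 100 * (\<Sum>p\<in>A. w p * (c p)\<^sup>2)"
    unfolding sum_distrib_left[symmetric] B_def by (subst sum.image_gen[OF A, of "\<lambda>p. w p * (c p)\<^sup>2" h]) simp
  finally show ?thesis by (simp add: w_def)
qed

lemma Psum_mult: "Psum F a x * Psum G b x =
   (1/2) *\<^sub>R ((\<Sum>p\<in>F \<times> G. (a (fst p) * b (snd p)) * cas (fst p - snd p) x)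
      + ((\<Sum>p\<in>F \<times> G. (a (fst p) * b (snd p)) * cas (snd p - fst p) x)
      + ((\<Sum>p\<in>F \<times> G. (a (fst p) * b (snd p)) * cas (fst p + snd p) x)
      + (-1) *\<^sub>R (\<Sum>p\<in>F \<times> G. (a (fst p) * b (snd p)) * cas (- fst p - snd p) x))))"
proof -
  have "Psum F a x * Psum G b x = (\<Sum>p\<in>F \<times> G. (a (fst p) * b (snd p)) * (cas (fst p) x * cas (snd p) x))"
    unfolding Psum_def sum_product sum.cartesian_product by (simp add: case_prod_beta mult_ac)
  then show ?thesis
    unfolding cas_mult by (simp add: sum.distrib sum_subtractf sum_negf sum_divide_distrib distrib_left right_diff_distrib add_divide_distrib diff_divide_distrib)
qed

text \<open>The product of two modes consists of four modes with prefactor 1/2. Each of the four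
  sums has norm at most \<open>10 * (A * B)\<close>, the 10 being the root of the lattice constant
  100, whence 20.\<close>

lemma product_estimate:
  fixes a b :: "int \<times> int \<Rightarrow> real"
  assumes F: "finite F" "0 \<notin> F" and G: "finite G" "0 \<notin> G"
    and a: "(\<Sum>k\<in>F. nk k * (a k)\<^sup>2) \<le> A\<^sup>2" and b: "(\<Sum>k\<in>G. nk k * (b k)\<^sup>2) \<le> B\<^sup>2" and AB: "0 \<le> A" "0 \<le> B"
  shows "L2norm (\<lambda>x. Psum F a x * Psum G b x) \<le> 20 * A * B"
proof -
  have S: "(\<Sum>p\<in>F \<times> G. nk (fst p) * nk (snd p) * (a (fst p) * b (snd p))\<^sup>2) \<le> (A * B)\<^sup>2"
  proof -
    have "(\<Sum>p\<in>F \<times> G. nk (fst p) * nk (snd p) * (a (fst p) * b (snd p))\<^sup>2) = (\<Sum>k\<in>F. nk k * (a k)\<^sup>2) * (\<Sum>k\<in>G. nk k * (b k)\<^sup>2)"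
      unfolding sum_product sum.cartesian_product by (simp add: case_prod_beta power_mult_distrib mult_ac)
    also have "\<dots> \<le> A\<^sup>2 * B\<^sup>2" by (intro mult_mono a b sum_nonneg) auto
    finally show ?thesis by (simp add: power_mult_distrib)
  qed
  have est: "L2norm (\<lambda>x. \<Sum>p\<in>F \<times> G. (a (fst p) * b (snd p)) * cas (h p) x) \<le> 10 * (A * B)"
    if "\<And>p p'. h p = h p' \<Longrightarrow> fst p = fst p' \<Longrightarrow> p = p'" "\<And>p p'. h p = h p' \<Longrightarrow> snd p = snd p' \<Longrightarrow> p = p'" for h
  proof (rule power2_le_imp_le)
    have "(L2norm (\<lambda>x. \<Sum>p\<in>F \<times> G. (a (fst p) * b (snd p)) * cas (h p) x))\<^sup>2
        \<le> 100 * (\<Sum>p\<in>F \<times> G. nk (fst p) * nk (snd p) * (a (fst p) * b (snd p))\<^sup>2)"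
    proof (rule convolution_estimate)
      show "finite (F \<times> G)" using F G by simp
      show "fst p \<noteq> 0 \<and> snd p \<noteq> 0" if "p \<in> F \<times> G" for p using that F G by auto
    qed (fact that)+
    also have "\<dots> \<le> (10 * (A * B))\<^sup>2" using S by (simp add: power_mult_distrib)
    finally show "(L2norm (\<lambda>x. \<Sum>p\<in>F \<times> G. (a (fst p) * b (snd p)) * cas (h p) x))\<^sup>2 \<le> (10 * (A * B))\<^sup>2" .
  qed (use AB in simp)
  have s: "sqi (\<lambda>x. \<Sum>p\<in>F \<times> G. (a (fst p) * b (snd p)) * cas (h p) x)" for h
    by (intro sqi_continuous continuous_intros)
  let ?g = "\<lambda>h x. \<Sum>p\<in>F \<times> G. (a (fst p) * b (snd p)) * cas (h p) x"
  have e1: "L2norm (?g (\<lambda>p. fst p - snd p)) \<le> 10 * (A * B)" by (rule est) (auto simp: prod_eq_iff)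
  have e2: "L2norm (?g (\<lambda>p. snd p - fst p)) \<le> 10 * (A * B)" by (rule est) (auto simp: prod_eq_iff)
  have e3: "L2norm (?g (\<lambda>p. fst p + snd p)) \<le> 10 * (A * B)" by (rule est) (auto simp: prod_eq_iff)
  have e4: "L2norm (?g (\<lambda>p. - fst p - snd p)) \<le> 10 * (A * B)" by (rule est) (auto simp: prod_eq_iff)
  define g1 g2 g3 g4 where "g1 = ?g (\<lambda>p. fst p - snd p)" and "g2 = ?g (\<lambda>p. snd p - fst p)" and "g3 = ?g (\<lambda>p. fst p + snd p)" and "g4 = ?g (\<lambda>p. - fst p - snd p)"
  have sg: "sqi g1" "sqi g2" "sqi g3" "sqi g4" unfolding g1_def g2_def g3_def g4_def by (rule s)+
  have t0: "L2norm (\<lambda>x. Psum F a x * Psum G b x) = \<bar>1/2\<bar> * L2norm (\<lambda>x. g1 x + (g2 x + (g3 x + (-1) *\<^sub>R g4 x)))"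
    unfolding Psum_mult g1_def g2_def g3_def g4_def by (rule L2norm_scaleR)
  have t1: "L2norm (\<lambda>x. g1 x + (g2 x + (g3 x + (-1) *\<^sub>R g4 x))) \<le> L2norm g1 + L2norm (\<lambda>x. g2 x + (g3 x + (-1) *\<^sub>R g4 x))"
    by (intro L2norm_triangle sqi_add sqi_scaleR sg)
  have t2: "L2norm (\<lambda>x. g2 x + (g3 x + (-1) *\<^sub>R g4 x)) \<le> L2norm g2 + L2norm (\<lambda>x. g3 x + (-1) *\<^sub>R g4 x)"
    by (intro L2norm_triangle sqi_add sqi_scaleR sg)
  have t3: "L2norm (\<lambda>x. g3 x + (-1) *\<^sub>R g4 x) \<le> L2norm g3 + L2norm (\<lambda>x. (-1) *\<^sub>R g4 x)"
    by (intro L2norm_triangle sqi_scaleR sg)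
  have t4: "L2norm (\<lambda>x. (-1) *\<^sub>R g4 x) = L2norm g4"
    unfolding L2norm_scaleR by simp
  show ?thesis using t0 t1 t2 t3 t4 e1[folded g1_def] e2[folded g2_def] e3[folded g3_def] e4[folded g4_def] by simp
qed

subsection \<open>Trilinear forms\<close>

text \<open>Common form of the convective term and of the transport flux: two square-integrable
  factors and one bounded factor from the test function.\<close>

definition tri :: "(pt \<Rightarrow> real) \<Rightarrow> (pt \<Rightarrow> real) \<Rightarrow> (pt \<Rightarrow> real) \<Rightarrow> real" where
  "tri f g h = (LINT x|tor. f x * g x * h x)"

lemma tri_integrable:
  fixes f g h :: "pt \<Rightarrow> real"
  assumes f: "sqi f" "sqi g" and h: "h \<in> borel_measurable tor" "AE x in tor. \<bar>h x\<bar> \<le> B"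
  shows "integrable tor (\<lambda>x. f x * g x * h x)"
proof (rule Bochner_Integration.integrable_bound)
  show "integrable tor (\<lambda>x. B * (f x * g x))" using integrable_inner[OF f] by simp
  show "(\<lambda>x. f x * g x * h x) \<in> borel_measurable tor" by (rule borel_measurable_times[OF borel_measurable_times[OF sqi_meas[OF f(1)] sqi_meas[OF f(2)]] h(1)])
  show "AE x in tor. norm (f x * g x * h x) \<le> norm (B * (f x * g x))"
    using h(2)
  proof eventually_elim
    case (elim x)
    have "\<bar>f x * g x\<bar> * \<bar>h x\<bar> \<le> \<bar>f x * g x\<bar> * \<bar>B\<bar>" using elim by (intro mult_left_mono) auto
    then show ?case by (simp add: abs_mult mult_ac)
  qed
qed

lemma tri_bound:
  assumes f: "sqi f" "sqi g" and h: "h \<in> borel_measurable tor" "AE x in tor. \<bar>h x\<bar> \<le> B" and B: "0 \<le> B"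
  shows "\<bar>tri f g h\<bar> \<le> B * (L2norm f * L2norm g)"
proof -
  have s: "sqi (\<lambda>x. \<bar>f x\<bar>)" "sqi (\<lambda>x. \<bar>g x\<bar>)" using f by (auto simp: sqi_def)
  have "\<bar>tri f g h\<bar> \<le> (LINT x|tor. norm (f x * g x * h x))"
    unfolding tri_def using integral_norm_bound[of tor "\<lambda>x. f x * g x * h x"] by simp
  also have "\<dots> \<le> (LINT x|tor. B * (\<bar>f x\<bar> \<bullet> \<bar>g x\<bar>))"
  proof (rule integral_mono_AE)
    show "AE x in tor. norm (f x * g x * h x) \<le> B * (\<bar>f x\<bar> \<bullet> \<bar>g x\<bar>)"
      using h(2)
    proof eventually_elim
      case (elim x)
      have "\<bar>f x * g x\<bar> * \<bar>h x\<bar> \<le> \<bar>f x * g x\<bar> * B" using elim by (intro mult_left_mono) auto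
      then show ?case by (simp add: abs_mult mult_ac)
    qed
  qed (use tri_integrable[OF f h] integrable_inner[OF s] in auto)
  also have "\<dots> = B * ip (\<lambda>x. \<bar>f x\<bar>) (\<lambda>x. \<bar>g x\<bar>)" by (simp add: ip_tor)
  also have "\<dots> \<le> B * (L2norm (\<lambda>x. \<bar>f x\<bar>) * L2norm (\<lambda>x. \<bar>g x\<bar>))"
    using ip_cauchy_schwarz[OF s] B by (intro mult_left_mono) auto
  also have "\<dots> = B * (L2norm f * L2norm g)" by (simp add: L2norm_tor)
  finally show ?thesis .
qed

text \<open>Strong times weak convergence: replacing \<open>f i\<close> by \<open>f0\<close> costs
  the strong distance times the bound on \<open>g i\<close>, and afterwards
  \<open>h x *\<^sub>R f0 x\<close> is one fixed test function for the weak limit.\<close>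

lemma tri_converges:
  assumes f: "\<And>i. sqi (f i)" "sqi f0" and g: "\<And>i. sqi (g i)" "sqi g0"
    and h: "h \<in> borel_measurable tor" "\<And>x. x \<in> cell \<Longrightarrow> \<bar>h x\<bar> \<le> B"
    and fs: "((\<lambda>i. L2norm (\<lambda>x. f i x - f0 x)) \<longlongrightarrow> 0) F"
    and gb: "\<And>i. L2norm (g i) \<le> R"
    and gw: "\<And>\<phi>. sqi \<phi> \<Longrightarrow> ((\<lambda>i. ip (g i) \<phi>) \<longlongrightarrow> ip g0 \<phi>) F"
  shows "((\<lambda>i. tri (f i) (g i) h) \<longlongrightarrow> tri f0 g0 h) F"
proof -
  have h': "AE x in tor. \<bar>h x\<bar> \<le> \<bar>B\<bar>" using h(2) by (intro AE_I2) force
  have sf: "sqi (\<lambda>x. h x *\<^sub>R f0 x)" by (rule sqi_bounded_scaleR[OF f(2) h(1)]) (use h(2) in auto)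
  have e: "tri f0 k h = ip k (\<lambda>x. h x *\<^sub>R f0 x)" for k
    by (simp add: tri_def ip_tor mult_ac)
  have d: "tri (f i) (g i) h = tri (\<lambda>x. f i x - f0 x) (g i) h + ip (g i) (\<lambda>x. h x *\<^sub>R f0 x)" for i
    unfolding e[symmetric] tri_def
    using tri_integrable[OF sqi_diff[OF f(1) f(2)] g(1) h(1) h', of i i] tri_integrable[OF f(2) g(1) h(1) h', of i]
    by (subst Bochner_Integration.integral_add[symmetric])
       (auto intro!: Bochner_Integration.integral_cong simp: algebra_simps)
  have "((\<lambda>i. tri (\<lambda>x. f i x - f0 x) (g i) h) \<longlongrightarrow> 0) F"
  proof (rule Lim_null_comparison)
    show "\<forall>\<^sub>F i in F. norm (tri (\<lambda>x. f i x - f0 x) (g i) h) \<le> \<bar>B\<bar> * \<bar>R\<bar> * L2norm (\<lambda>x. f i x - f0 x)"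
    proof (rule always_eventually, rule allI)
      fix i
      have "\<bar>tri (\<lambda>x. f i x - f0 x) (g i) h\<bar> \<le> \<bar>B\<bar> * (L2norm (\<lambda>x. f i x - f0 x) * L2norm (g i))"
        by (rule tri_bound[OF _ _ h(1) h']) (auto intro: sqi_diff f g)
      also have "\<dots> \<le> \<bar>B\<bar> * (L2norm (\<lambda>x. f i x - f0 x) * \<bar>R\<bar>)"
        using order_trans[OF gb abs_ge_self] by (intro mult_left_mono) auto
      finally show "norm (tri (\<lambda>x. f i x - f0 x) (g i) h) \<le> \<bar>B\<bar> * \<bar>R\<bar> * L2norm (\<lambda>x. f i x - f0 x)"
        by (simp add: mult_ac)
    qed
    show "((\<lambda>i. \<bar>B\<bar> * \<bar>R\<bar> * L2norm (\<lambda>x. f i x - f0 x)) \<longlongrightarrow> 0) F"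
      using tendsto_mult[OF tendsto_const fs, of "\<bar>B\<bar> * \<bar>R\<bar>"] by simp
  qed
  from tendsto_add[OF this gw[OF sf]] show ?thesis unfolding d e by simp
qed

subsection \<open>Shears along single modes\<close>

text \<open>The exact flow, after time \<open>s\<close>, of the stationary field
  \<open>cas k x *\<^sub>R Ev k\<close>: the phase of mode \<open>k\<close> does not change along
  \<open>Ev k\<close>, so the trajectories are straight and the inverse is the shear by
  \<open>- s\<close>.\<close>

definition shear :: "real \<Rightarrow> int \<times> int \<Rightarrow> pt \<Rightarrow> pt" where
  "shear s k x = x + (s * cas k x) *\<^sub>R Ev k"

lemma ph_kc: "ph k v = 2 * pi * (kc k 1 * v$1 + kc k 2 * v$2)"
  by (simp add: ph_def kc_simps)

lemma ph_Ev: "ph k (Ev k) = 0"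
  unfolding ph_kc Ev_kc by simp

lemma cas_along_Ev: "cas k (x + t *\<^sub>R Ev k) = cas k x"
  by (simp add: cas_def ph_simps ph_Ev)

lemma shear_inverse: "shear (- s) k (shear s k x) = x"
  by (simp add: shear_def cas_along_Ev)

lemma shear_periodic: "shear s k (x + axis j 1) = shear s k x + axis j 1"
  using periodic_cas[of k] by (simp add: shear_def periodic2_def)

lemma shear_borel [measurable]: "shear s k \<in> borel_measurable borel"
  unfolding shear_def[abs_def] by measurable

text \<open>The general shear lemma needs a lattice direction. \<open>Ev k\<close> is not one, but
  it is a multiple of the integer vector \<open>d\<close>, and the factor
  \<open>1 / sqrt (nk k)\<close> is moved into the profile.\<close>

lemma tor_preserving_mode_shear: "tor_preserving (shear s k)"
proof -
  define d :: pt where "d = vector [- of_int (snd k), of_int (fst k)]"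
  have Ed: "Ev k = (1 / sqrt (nk k)) *\<^sub>R d" by (simp add: Ev_def d_def)
  have "d $ i \<in> \<int>" for i using exhaust_2[of i] by (auto simp: d_def vector_2)
  then have dl: "d \<in> lat" by (auto simp: lat_def Basis_vec_def inner_axis)
  have "tor_preserving (\<lambda>x. x + (s * cas k x / sqrt (nk k)) *\<^sub>R d)"
  proof (rule tor_preserving_shear[OF _ _ _ dl])
    show "(\<lambda>x. s * cas k x / sqrt (nk k)) \<in> borel_measurable borel" by measurable
    show "periodic2 (\<lambda>x. s * cas k x / sqrt (nk k))" using periodic_cas[of k] by (simp add: periodic2_def)
    fix x t
    have "cas k (x + t *\<^sub>R d) = cas k x"
      by (simp add: cas_def ph_simps) (simp add: ph_def d_def vector_2)
    then show "s * cas k (x + t *\<^sub>R d) / sqrt (nk k) = s * cas k x / sqrt (nk k)" by simp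
  qed
  moreover have "shear s k = (\<lambda>x. x + (s * cas k x / sqrt (nk k)) *\<^sub>R d)"
    by (simp add: shear_def Ed fun_eq_iff)
  ultimately show ?thesis by simp
qed

text \<open>Change of variables by the measure-preserving shear. It moves the displacement from the
  rough temperature to the smooth test function, where it can be expanded.\<close>

lemma shear_adjoint:
  fixes \<theta> \<phi> :: "pt \<Rightarrow> real"
  assumes "\<theta> \<in> borel_measurable borel" "periodic2 \<theta>" "\<phi> \<in> borel_measurable borel" "periodic2 \<phi>"
  shows "(LINT x|tor. \<phi> x * \<theta> (shear (- s) k x)) = (LINT x|tor. \<phi> (shear s k x) * \<theta> x)"
proof -
  have "(LINT x|tor. \<phi> (shear s k x) * \<theta> (shear (- s) k (shear s k x))) = (LINT x|tor. \<phi> x * \<theta> (shear (- s) k x))"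
    by (rule tor_preserving_integral(1)[OF tor_preserving_mode_shear])
       (use assms in \<open>auto simp: periodic2_def shear_periodic\<close>)
  then show ?thesis by (simp add: shear_inverse)
qed

lemma L2norm_shear:
  fixes \<theta> :: "pt \<Rightarrow> real"
  assumes "\<theta> \<in> borel_measurable borel" "periodic2 \<theta>"
  shows "L2norm (\<lambda>x. \<theta> (shear s k x)) = L2norm \<theta>" "sqi \<theta> \<Longrightarrow> sqi (\<lambda>x. \<theta> (shear s k x))"
proof -
  have p: "periodic2 (\<lambda>x. (norm (\<theta> x))\<^sup>2)" using assms by (simp add: periodic2_def)
  have m: "(\<lambda>x. (norm (\<theta> x))\<^sup>2) \<in> borel_measurable borel" using assms by simp
  note t = tor_preserving_integral[OF tor_preserving_mode_shear m p]
  show "L2norm (\<lambda>x. \<theta> (shear s k x)) = L2norm \<theta>" unfolding L2norm_tor t(1) ..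
  show "sqi (\<lambda>x. \<theta> (shear s k x))" if "sqi \<theta>"
    using that t(2) assms(1) by (auto simp: sqi_def intro!: borel_tor)
qed

text \<open>A Lipschitz constant for the phase of mode \<open>l\<close>.\<close>

definition pl :: "int \<times> int \<Rightarrow> real" where
  "pl l = 2 * pi * (\<bar>of_int (fst l)\<bar> + \<bar>of_int (snd l)\<bar>)"

lemma pl_nonneg [simp]: "0 \<le> pl l" by (simp add: pl_def)

lemma ph_le: "\<bar>ph l v\<bar> \<le> pl l * norm v"
proof -
  have "\<bar>of_int (fst l) * v$1 + of_int (snd l) * v$2\<bar> \<le> \<bar>of_int (fst l)\<bar> * \<bar>v$1\<bar> + \<bar>of_int (snd l)\<bar> * \<bar>v$2\<bar>"
    using abs_triangle_ineq[of "of_int (fst l) * v$1" "of_int (snd l) * v$2"] by (simp only: abs_mult)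
  also have "\<dots> \<le> \<bar>of_int (fst l)\<bar> * norm v + \<bar>of_int (snd l)\<bar> * norm v"
    by (intro add_mono mult_left_mono component_le_norm_cart) auto
  finally have "\<bar>2 * pi\<bar> * \<bar>of_int (fst l) * v$1 + of_int (snd l) * v$2\<bar> \<le> \<bar>2 * pi\<bar> * ((\<bar>of_int (fst l)\<bar> + \<bar>of_int (snd l)\<bar>) * norm v)"
    by (intro mult_left_mono) (auto simp: distrib_right)
  then show ?thesis unfolding ph_def pl_def by (simp add: abs_mult mult.assoc)
qed

lemma cas_taylor: "\<bar>cas l (x + v) - cas l x - ph l v * cas (- l) x\<bar> \<le> 2 * (ph l v)\<^sup>2"
proof -
  define a b where "a = ph l x" and "b = ph l v"
  have c: "\<bar>cos b - 1\<bar> \<le> b\<^sup>2 / 2"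
  proof -
    have "1 - cos b = 2 * (sin (b / 2))\<^sup>2" using cos_double_sin[of "b / 2"] by simp
    moreover have "(sin (b / 2))\<^sup>2 \<le> (b / 2)\<^sup>2"
      using power_mono[OF abs_sin_x_le_abs_x[of "b / 2"], of 2] by (simp only: power2_abs abs_ge_zero)
    moreover have "(b / 2)\<^sup>2 = b\<^sup>2 / 4" by (simp add: power_divide)
    moreover have "0 \<le> (sin (b / 2))\<^sup>2" by simp
    ultimately show ?thesis unfolding abs_le_iff by linarith
  qed
  have s: "\<bar>sin b - b\<bar> \<le> b\<^sup>2 / 2"
    using Maclaurin_sin_bound[of b 2] by (simp add: numeral_2_eq_2 sin_coeff_def)
  have "cas l (x + v) - cas l x - ph l v * cas (- l) x = (cos a + sin a) * (cos b - 1) + (cos a - sin a) * (sin b - b)"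
    unfolding cas_def ph_simps a_def[symmetric] b_def[symmetric] cos_add sin_add cos_minus sin_minus by (simp add: algebra_simps)
  also have "\<bar>\<dots>\<bar> \<le> \<bar>cos a + sin a\<bar> * \<bar>cos b - 1\<bar> + \<bar>cos a - sin a\<bar> * \<bar>sin b - b\<bar>"
    using abs_triangle_ineq by (metis abs_mult)
  also have "\<dots> \<le> 2 * (b\<^sup>2 / 2) + 2 * (b\<^sup>2 / 2)"
    using abs_cos_le_one[of a] abs_sin_le_one[of a] by (intro add_mono mult_mono c s) linarith+
  finally show ?thesis by (simp add: b_def)
qed

lemma L2norm_sum_le:
  "finite F \<Longrightarrow> (\<And>i. i \<in> F \<Longrightarrow> sqi (f i)) \<Longrightarrow> L2norm (\<lambda>x. \<Sum>i\<in>F. f i x) \<le> (\<Sum>i\<in>F. L2norm (f i))"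
proof (induction F rule: finite_induct)
  case empty then show ?case by (simp add: L2norm_tor)
next
  case (insert i F)
  have "L2norm (\<lambda>x. f i x + (\<Sum>i\<in>F. f i x)) \<le> L2norm (f i) + L2norm (\<lambda>x. \<Sum>i\<in>F. f i x)"
    using insert by (intro L2norm_triangle sqi_sum) auto
  then show ?case using insert by simp
qed

subsection \<open>One time step\<close>

definition Uf :: "(int \<times> int) set \<Rightarrow> (int \<times> int \<Rightarrow> real) \<Rightarrow> pt \<Rightarrow> real^2" where
  "Uf F q = Psum F (\<lambda>k. q k *\<^sub>R Ev k)"

definition conv :: "(pt \<Rightarrow> real^2) \<Rightarrow> (pt \<Rightarrow> real^2) \<Rightarrow> real" where
  "conv u \<Phi> = (\<Sum>j\<in>UNIV. ip (\<lambda>x. u x $ j *\<^sub>R u x) (pd j \<Phi>))"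

definition force :: "(pt \<Rightarrow> real) \<Rightarrow> (pt \<Rightarrow> real^2) \<Rightarrow> real" where
  "force \<theta> \<Phi> = ip (\<lambda>x. \<theta> x *\<^sub>R e2) \<Phi>"

definition flux :: "(pt \<Rightarrow> real^2) \<Rightarrow> (pt \<Rightarrow> real) \<Rightarrow> (pt \<Rightarrow> real) \<Rightarrow> real" where
  "flux u \<theta> \<phi> = ip (\<lambda>x. \<theta> x *\<^sub>R u x) (grad \<phi>)"

lemma flux_cas: "flux u \<theta> (cas l) = (LINT x|tor. (ph l (u x) * cas (- l) x) * \<theta> x)"
  unfolding flux_def ip_tor
  by (intro Bochner_Integration.integral_cong refl) (simp add: inner_2 grad_def pd_cas ph_kc algebra_simps)

text \<open>The factor \<open>card F\<close> in the shears compensates the average over \<open>F\<close>.\<close>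
definition th_step :: "(int \<times> int) set \<Rightarrow> real \<Rightarrow> (int \<times> int \<Rightarrow> real) \<Rightarrow> (pt \<Rightarrow> real) \<Rightarrow> pt \<Rightarrow> real" where
  "th_step F \<tau> q \<theta> x = (1 / real (card F)) * (\<Sum>k\<in>F. \<theta> (shear (- (\<tau> * real (card F) * q k)) k x))"

lemma th_step_borel:
  assumes [measurable]: "\<theta> \<in> borel_measurable borel" shows "th_step F \<tau> q \<theta> \<in> borel_measurable borel"
  unfolding th_step_def[abs_def] by measurable

lemma th_step_periodic: "periodic2 \<theta> \<Longrightarrow> periodic2 (th_step F \<tau> q \<theta>)"
  unfolding periodic2_def th_step_def by (simp add: shear_periodic)

lemma th_step_bound:
  assumes F: "finite F" "F \<noteq> {}" and C: "\<And>x. \<bar>\<theta> x\<bar> \<le> C" shows "\<bar>th_step F \<tau> q \<theta> x\<bar> \<le> C"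
proof -
  have "\<bar>\<Sum>k\<in>F. \<theta> (shear (- (\<tau> * real (card F) * q k)) k x)\<bar> \<le> (\<Sum>k\<in>F. C)"
    by (intro order_trans[OF sum_abs] sum_mono C)
  moreover have "0 < card F" using F by (simp add: card_gt_0_iff)
  ultimately show ?thesis by (simp add: th_step_def abs_mult field_simps)
qed

lemma th_step_sqi:
  assumes "\<theta> \<in> borel_measurable borel" "periodic2 \<theta>" "sqi \<theta>"
  shows "sqi (th_step F \<tau> q \<theta>)"
proof -
  have "sqi (\<lambda>x. (1 / real (card F)) *\<^sub>R (\<Sum>k\<in>F. \<theta> (shear (- (\<tau> * real (card F) * q k)) k x)))"
    by (intro sqi_scaleR sqi_sum L2norm_shear assms)
  then show ?thesis by (simp add: th_step_def[abs_def])
qed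

lemma th_step_L2norm:
  assumes F: "finite F" "F \<noteq> {}" and \<theta>: "\<theta> \<in> borel_measurable borel" "periodic2 \<theta>" "sqi \<theta>"
  shows "L2norm (th_step F \<tau> q \<theta>) \<le> L2norm \<theta>"
proof -
  have c: "0 < card F" using F by (simp add: card_gt_0_iff)
  have "L2norm (th_step F \<tau> q \<theta>) = (1 / real (card F)) * L2norm (\<lambda>x. \<Sum>k\<in>F. \<theta> (shear (- (\<tau> * real (card F) * q k)) k x))"
    unfolding th_step_def[abs_def]
    using L2norm_scaleR[of "1 / real (card F)" "\<lambda>x. \<Sum>k\<in>F. \<theta> (shear (- (\<tau> * real (card F) * q k)) k x)"] by simp
  also have "\<dots> \<le> (1 / real (card F)) * (\<Sum>k\<in>F. L2norm (\<lambda>x. \<theta> (shear (- (\<tau> * real (card F) * q k)) k x)))"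
    by (intro mult_left_mono L2norm_sum_le F L2norm_shear \<theta>) auto
  also have "\<dots> = L2norm \<theta>" using c by (simp add: L2norm_shear(1)[OF \<theta>(1,2)])
  finally show ?thesis .
qed

text \<open>By the adjoint relation the Taylor expansion acts on \<open>cas l\<close>, so no
  regularity of the temperature is used. The first-order terms of the shears add up to the flux of
  the full velocity because the factor \<open>card F\<close> cancels the average. Each displacement
  has length at most \<open>2 * (\<tau> * card F * R)\<close>, and the remainder is quadratic in
  it.\<close>

lemma th_step_consistent:
  assumes F: "finite F" "F \<noteq> {}" and \<theta>: "\<theta> \<in> borel_measurable borel" "periodic2 \<theta>" "sqi \<theta>"
    and R: "\<And>k. k \<in> F \<Longrightarrow> \<bar>q k\<bar> \<le> R" and \<tau>: "0 \<le> \<tau>"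
  shows "\<bar>hat (th_step F \<tau> q \<theta>) l - hat \<theta> l - \<tau> * flux (Uf F q) \<theta> (cas l)\<bar> \<le> 2 * (pl l * (2 * (\<tau> * real (card F) * R)))\<^sup>2 * L2norm \<theta>"
proof -
  define M where "M = real (card F)"
  have M: "0 < M" using F by (simp add: M_def card_gt_0_iff)
  define s where "s k = \<tau> * M * q k" for k
  define r where "r k x = cas l (shear (s k) k x) - cas l x - ph l ((s k * cas k x) *\<^sub>R Ev k) * cas (- l) x" for k x
  define E where "E = 2 * (pl l * (2 * (\<tau> * M * R)))\<^sup>2"
  have rb: "\<bar>r k x\<bar> \<le> E" if "k \<in> F" for k x
  proof -
    have "\<bar>s k * cas k x\<bar> \<le> (\<tau> * M * R) * 2"
      unfolding s_def abs_mult using R[OF that] \<tau> M cas_bound[of k x] by (intro mult_mono) auto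
    then have "norm ((s k * cas k x) *\<^sub>R Ev k) \<le> (\<tau> * M * R) * 2 * 1"
      unfolding norm_scaleR by (intro mult_mono norm_Ev_le) auto
    then have "\<bar>ph l ((s k * cas k x) *\<^sub>R Ev k)\<bar> \<le> pl l * (2 * (\<tau> * M * R))"
      by (intro order_trans[OF ph_le] mult_left_mono) auto
    then have "(ph l ((s k * cas k x) *\<^sub>R Ev k))\<^sup>2 \<le> (pl l * (2 * (\<tau> * M * R)))\<^sup>2"
      using power_mono[of "\<bar>ph l ((s k * cas k x) *\<^sub>R Ev k)\<bar>" _ 2] by simp
    then show ?thesis
      unfolding r_def E_def shear_def using cas_taylor[of l x "(s k * cas k x) *\<^sub>R Ev k"] by linarith
  qed
  have mc: "(\<lambda>x. cas l (shear (s k) k x)) \<in> borel_measurable tor" for k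
    by (rule borel_tor) measurable
  have i\<theta>: "integrable tor (\<lambda>x. h x * \<theta> x)" if "h \<in> borel_measurable tor" "\<And>x. \<bar>h x\<bar> \<le> B" for h and B :: real
    using sqi_integrable[OF sqi_bounded_scaleR[OF \<theta>(3) that(1), of B]] that(2) by simp
  have phm: "(\<lambda>x. ph l ((s k * cas k x) *\<^sub>R Ev k)) \<in> borel_measurable tor" for k
    unfolding ph_simps by measurable
  have rm: "r k \<in> borel_measurable tor" for k
    unfolding r_def[abs_def] by (intro borel_measurable_diff borel_measurable_times mc phm cas_measurable)
  have ir: "integrable tor (\<lambda>x. r k x * \<theta> x)" if "k \<in> F" for k
    by (rule i\<theta>[OF rm rb[OF that]])
  have ic: "integrable tor (\<lambda>x. cas l x * \<theta> x)" by (rule i\<theta>[OF _ cas_bound]) simp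
  have ip: "integrable tor (\<lambda>x. (ph l ((s k * cas k x) *\<^sub>R Ev k) * cas (- l) x) * \<theta> x)" for k
  proof -
    obtain B where B: "\<And>x. \<bar>ph l ((s k * cas k x) *\<^sub>R Ev k) * cas (- l) x\<bar> \<le> B"
    proof
      fix x
      show "\<bar>ph l ((s k * cas k x) *\<^sub>R Ev k) * cas (- l) x\<bar> \<le> (\<bar>s k\<bar> * 2 * \<bar>ph l (Ev k)\<bar>) * 2"
        unfolding ph_simps abs_mult by (intro mult_mono cas_bound) auto
    qed
    show ?thesis by (rule i\<theta>[OF _ B]) (intro borel_measurable_times phm cas_measurable)
  qed
  have A: "hat (th_step F \<tau> q \<theta>) l = (1 / M) * (\<Sum>k\<in>F. LINT x|tor. cas l (shear (s k) k x) * \<theta> x)"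
  proof -
    have i1: "integrable tor (\<lambda>x. cas l x * \<theta> (shear (- s k) k x))" for k
      using integrable_cas_scaleR[OF sqi_integrable[OF L2norm_shear(2)[OF \<theta>]], of l] by simp
    have "hat (th_step F \<tau> q \<theta>) l = (LINT x|tor. (1 / M) * (\<Sum>k\<in>F. cas l x * \<theta> (shear (- s k) k x)))"
      unfolding hat_def th_step_def s_def M_def
      by (intro Bochner_Integration.integral_cong refl) (simp add: sum_distrib_left)
    also have "\<dots> = (1 / M) * (\<Sum>k\<in>F. LINT x|tor. cas l x * \<theta> (shear (- s k) k x))"
      by (simp add: Bochner_Integration.integral_sum[OF i1])
    also have "\<dots> = (1 / M) * (\<Sum>k\<in>F. LINT x|tor. cas l (shear (s k) k x) * \<theta> x)"
      using \<theta> periodic_cas by (subst shear_adjoint) auto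
    finally show ?thesis .
  qed
  have Bq: "\<tau> * flux (Uf F q) \<theta> (cas l) = (1 / M) * (\<Sum>k\<in>F. LINT x|tor. (ph l ((s k * cas k x) *\<^sub>R Ev k) * cas (- l) x) * \<theta> x)"
  proof -
    have phU: "ph l (Uf F q x) = (\<Sum>k\<in>F. ph l ((q k * cas k x) *\<^sub>R Ev k))" for x
    proof -
      have lin: "linear (ph l)" by (rule linearI) (auto simp: ph_simps)
      show ?thesis unfolding Uf_def Psum_def linear_sum[OF lin] by (simp add: mult.commute)
    qed
    have "\<tau> * flux (Uf F q) \<theta> (cas l) = (LINT x|tor. \<tau> * ((ph l (Uf F q x) * cas (- l) x) * \<theta> x))"
      unfolding flux_cas by simp
    also have "\<dots> = (LINT x|tor. (1 / M) * (\<Sum>k\<in>F. (ph l ((s k * cas k x) *\<^sub>R Ev k) * cas (- l) x) * \<theta> x))"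
      using M by (intro Bochner_Integration.integral_cong refl)
         (simp add: phU s_def ph_simps sum_distrib_left sum_distrib_right mult_ac)
    also have "\<dots> = (1 / M) * (\<Sum>k\<in>F. LINT x|tor. (ph l ((s k * cas k x) *\<^sub>R Ev k) * cas (- l) x) * \<theta> x)"
      by (simp add: Bochner_Integration.integral_sum[OF ip])
    finally show ?thesis .
  qed
  have C: "hat \<theta> l = (1 / M) * (\<Sum>k\<in>F. LINT x|tor. cas l x * \<theta> x)"
    using M by (simp add: hat_def M_def)
  have ish: "integrable tor (\<lambda>x. cas l (shear (s k) k x) * \<theta> x)" for k
    by (rule i\<theta>[OF mc cas_bound])
  have "hat (th_step F \<tau> q \<theta>) l - hat \<theta> l - \<tau> * flux (Uf F q) \<theta> (cas l) = (1 / M) * (\<Sum>k\<in>F. LINT x|tor. r k x * \<theta> x)"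
  proof -
    have "(LINT x|tor. r k x * \<theta> x) = (LINT x|tor. cas l (shear (s k) k x) * \<theta> x) - (LINT x|tor. cas l x * \<theta> x)
       - (LINT x|tor. (ph l ((s k * cas k x) *\<^sub>R Ev k) * cas (- l) x) * \<theta> x)" for k
      unfolding r_def left_diff_distrib using ish ic ip by simp
    then show ?thesis unfolding A Bq C by (simp add: sum_subtractf right_diff_distrib)
  qed
  also have "\<bar>\<dots>\<bar> \<le> (1 / M) * (\<Sum>k\<in>F. E * L2norm \<theta>)"
  proof -
    have "\<bar>LINT x|tor. r k x * \<theta> x\<bar> \<le> E * L2norm \<theta>" if k: "k \<in> F" for k
    proof -
      have E0: "0 \<le> E" unfolding E_def by simp
      have "\<bar>LINT x|tor. r k x * \<theta> x\<bar> \<le> (LINT x|tor. norm (r k x * \<theta> x))"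
        using integral_norm_bound[of tor "\<lambda>x. r k x * \<theta> x"] by simp
      also have "\<dots> \<le> (LINT x|tor. E * norm (\<theta> x))"
        using integrable_norm[OF ir[OF k]] integrable_norm[OF sqi_integrable[OF \<theta>(3)]] rb[OF k]
        by (intro integral_mono) (auto simp: abs_mult intro!: mult_right_mono)
      also have "\<dots> \<le> E * L2norm \<theta>"
        using norm_integral_le_L2norm[OF \<theta>(3)] E0 by (simp add: mult_left_mono)
      finally show ?thesis .
    qed
    then have "\<bar>\<Sum>k\<in>F. LINT x|tor. r k x * \<theta> x\<bar> \<le> (\<Sum>k\<in>F. E * L2norm \<theta>)"
      by (intro order_trans[OF sum_abs] sum_mono)
    then show ?thesis using M unfolding abs_mult by (intro mult_mono) auto
  qed
  also have "\<dots> = E * L2norm \<theta>" using M by (simp add: M_def)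
  finally show ?thesis unfolding E_def M_def .
qed

subsection \<open>The Galerkin nonlinearity\<close>

text \<open>The weak right-hand side of the momentum equation tested against the field
  \<open>cas k x *\<^sub>R Ev k\<close>. This field is divergence free, so no pressure appears; the
  index \<open>- k\<close> comes from differentiating \<open>cas k\<close>.\<close>

definition Bk :: "(pt \<Rightarrow> real^2) \<Rightarrow> (pt \<Rightarrow> real) \<Rightarrow> int \<times> int \<Rightarrow> real" where
  "Bk u \<theta> k = (\<Sum>j\<in>UNIV. 2 * pi * kc k j * (hat (\<lambda>x. u x $ j *\<^sub>R u x) (- k) \<bullet> Ev k)) + hat \<theta> k * Ev k $ 2"

lemma sqi_nth: "sqi u \<Longrightarrow> sqi (\<lambda>x. u x $ i)" for u :: "pt \<Rightarrow> real^2"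
  using sqi_component[of u "axis i 1"] by (simp add: inner_axis)

lemma integrable_nth_scaleR:
  fixes u :: "pt \<Rightarrow> real^2"
  assumes "sqi u" shows "integrable tor (\<lambda>x. u x $ j *\<^sub>R u x)"
proof (rule Bochner_Integration.integrable_bound[OF sqi_int2[OF assms]])
  show "(\<lambda>x. u x $ j *\<^sub>R u x) \<in> borel_measurable tor"
    by (intro borel_measurable_scaleR sqi_meas sqi_nth assms)
  have "\<bar>u x $ j\<bar> * norm (u x) \<le> norm (u x) * norm (u x)" for x
    by (intro mult_right_mono component_le_norm_cart) auto
  then show "AE x in tor. norm (u x $ j *\<^sub>R u x) \<le> norm ((norm (u x))\<^sup>2)"
    by (simp add: power2_eq_square)
qed

lemma conv_Psum:
  assumes u: "sqi u" 
  shows "conv u (Psum F a) = (\<Sum>k\<in>F. \<Sum>j\<in>UNIV. 2 * pi * kc k j * (hat (\<lambda>x. u x $ j *\<^sub>R u x) (- k) \<bullet> a k))"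
proof -
  have "ip (\<lambda>x. u x $ j *\<^sub>R u x) (pd j (Psum F a)) = (\<Sum>k\<in>F. 2 * pi * kc k j * (hat (\<lambda>x. u x $ j *\<^sub>R u x) (- k) \<bullet> a k))" for j
  proof -
    define w where "w x = u x $ j *\<^sub>R u x" for x
    have w: "integrable tor w" unfolding w_def by (rule integrable_nth_scaleR[OF u])
    have i: "integrable tor (\<lambda>x. 2 * pi * kc k j * ((cas (- k) x *\<^sub>R w x) \<bullet> a k))" for k
      by (intro integrable_mult_right integrable_inner_left integrable_cas_scaleR w)
    have "ip w (pd j (Psum F a)) = (LINT x|tor. (\<Sum>k\<in>F. 2 * pi * kc k j * ((cas (- k) x *\<^sub>R w x) \<bullet> a k)))"
      unfolding ip_tor pd_Psum by (simp add: inner_sum_right mult_ac)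
    also have "\<dots> = (\<Sum>k\<in>F. 2 * pi * kc k j * (LINT x|tor. (cas (- k) x *\<^sub>R w x) \<bullet> a k))"
      by (subst Bochner_Integration.integral_sum[OF i]) simp
    also have "\<dots> = (\<Sum>k\<in>F. 2 * pi * kc k j * (hat w (- k) \<bullet> a k))"
      unfolding hat_def by (subst integral_inner_left) (auto intro: integrable_cas_scaleR w)
    finally show ?thesis unfolding w_def .
  qed
  then show ?thesis unfolding conv_def by (simp add: sum.swap[of _ F])
qed

lemma force_eq: "force \<theta> \<Phi> = (LINT x|tor. \<theta> x * \<Phi> x $ 2)"
  unfolding force_def ip_tor e2_def by (simp add: inner_axis')

lemma force_Psum:
  assumes "integrable tor \<theta>" shows "force \<theta> (Psum F a) = (\<Sum>k\<in>F. hat \<theta> k * a k $ 2)"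
proof -
  have i: "integrable tor (\<lambda>x. (cas k x * \<theta> x) * a k $ 2)" for k
    using integrable_cas_scaleR[OF assms, of k] by simp
  have "force \<theta> (Psum F a) = (LINT x|tor. (\<Sum>k\<in>F. (cas k x * \<theta> x) * a k $ 2))"
    unfolding force_eq Psum_def by (simp add: sum_distrib_left mult_ac)
  also have "\<dots> = (\<Sum>k\<in>F. hat \<theta> k * a k $ 2)"
    by (subst Bochner_Integration.integral_sum[OF i]) (simp add: hat_def)
  finally show ?thesis .
qed

lemma conv_force_Psum:
  assumes "sqi u" "sqi \<theta>"
  shows "conv u (Psum F (\<lambda>k. r k *\<^sub>R Ev k)) + force \<theta> (Psum F (\<lambda>k. r k *\<^sub>R Ev k)) = (\<Sum>k\<in>F. r k * Bk u \<theta> k)"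
  unfolding conv_Psum[OF assms(1)] force_Psum[OF sqi_integrable[OF assms(2)]] Bk_def sum.distrib[symmetric]
  by (intro sum.cong refl) (simp add: sum_2 algebra_simps)

lemma Psum_nth: "Psum F a x $ i = Psum F (\<lambda>k. a k $ i) x"
  unfolding Psum_def by simp

lemma Uf_nth: "Uf F q x $ i = Psum F (\<lambda>k. q k * Ev k $ i) x"
  unfolding Uf_def Psum_nth by simp

lemma continuous_pd_Psum: "continuous_on A (pd j (Psum F a))"
  unfolding pd_Psum[abs_def] by (intro continuous_intros)

text \<open>The energy identity of the convective term: for a divergence-free field the integrand is
  half the divergence of the velocity times its squared length.\<close>

lemma conv_Uf_self: "conv (Uf F q) (Uf F q) = 0"
proof -
  define U where "U i = Psum F (\<lambda>k. q k * Ev k $ i)" for i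
  define dU where "dU i j = pd j (U i)" for i j
  have cU: "continuous_on UNIV (U i)" for i unfolding U_def by (intro continuous_intros)
  have cdU: "continuous_on UNIV (dU i j)" for i j unfolding U_def dU_def by (rule continuous_pd_Psum)
  have nth: "pd j (Uf F q) x $ i = dU i j x" for i j x
    unfolding Uf_def dU_def U_def pd_Psum by (simp add: mult.assoc)
  have der: "((\<lambda>s. U i (x + s *\<^sub>R axis j 1)) has_field_derivative dU i j x) (at 0)" for i j x
  proof -
    have "U i differentiable (at x)" unfolding U_def using Psum_has_derivative differentiableI by blast
    from frechet_directional[OF this, of "axis j 1"] show ?thesis
      by (simp add: dU_def pd_def has_real_derivative_iff_has_vector_derivative)
  qed
  have div: "dU 1 1 x + dU 2 2 x = 0" for x
    using div_Psum_Ev[of F q x] unfolding div_cl_def sum_2 nth[symmetric] Uf_def .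
  \<comment> \<open>The derivative in direction \<open>j\<close> of \<open>U j x\<close> times the
    squared length of the velocity.\<close>
  define g where "g j x = dU j j x * ((U 1 x)\<^sup>2 + (U 2 x)\<^sup>2) + U j x * (2 * U 1 x * dU 1 j x + 2 * U 2 x * dU 2 j x)" for j x
  have z: "(LINT x|tor. g j x) = 0" for j
  proof (rule integral_partial_derivative_zero[where f="\<lambda>x. U j x * ((U 1 x)\<^sup>2 + (U 2 x)\<^sup>2)" and d="axis j 1"])
    show "periodic2 (\<lambda>x. U j x * ((U 1 x)\<^sup>2 + (U 2 x)\<^sup>2))"
      unfolding U_def by (simp add: periodic2_def periodic_Psum[unfolded periodic2_def, rule_format])
    show "continuous_on UNIV (g j)" unfolding g_def by (intro continuous_intros cU cdU)
    show "continuous_on UNIV (\<lambda>x. U j x * ((U 1 x)\<^sup>2 + (U 2 x)\<^sup>2))" by (intro continuous_intros cU)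
    fix x
    have "((\<lambda>s. U j (x + s *\<^sub>R axis j 1) * ((U 1 (x + s *\<^sub>R axis j 1))\<^sup>2 + (U 2 (x + s *\<^sub>R axis j 1))\<^sup>2)) has_field_derivative g j x) (at 0)"
      by (rule derivative_eq_intros der refl)+ (simp add: g_def algebra_simps)
    then show "((\<lambda>s. U j (x + s *\<^sub>R axis j 1) * ((U 1 (x + s *\<^sub>R axis j 1))\<^sup>2 + (U 2 (x + s *\<^sub>R axis j 1))\<^sup>2)) has_vector_derivative g j x) (at 0)"
      by (simp add: has_real_derivative_iff_has_vector_derivative)
  qed
  have ig: "integrable tor (g j)" for j unfolding g_def by (intro integrable_tor_continuous continuous_intros cU cdU)
  define c where "c j x = U j x * (U 1 x * dU 1 j x + U 2 x * dU 2 j x)" for j x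
  have ic: "integrable tor (c j)" for j unfolding c_def by (intro integrable_tor_continuous continuous_intros cU cdU)
  have "conv (Uf F q) (Uf F q) = (LINT x|tor. c 1 x) + (LINT x|tor. c 2 x)"
    unfolding conv_def sum_2 ip_tor c_def
    by (simp add: inner_2 nth Uf_nth U_def algebra_simps)
  also have "\<dots> = (LINT x|tor. (1/2) * (g 1 x + g 2 x))"
  proof -
    have "c 1 x + c 2 x = (1/2) * (g 1 x + g 2 x)" for x
    proof -
      have "g 1 x + g 2 x = (dU 1 1 x + dU 2 2 x) * ((U 1 x)\<^sup>2 + (U 2 x)\<^sup>2) + 2 * (c 1 x + c 2 x)"
        unfolding g_def c_def by (simp add: algebra_simps)
      then show ?thesis by (simp add: div)
    qed
    then have e: "(\<lambda>x. c 1 x + c 2 x) = (\<lambda>x. (1/2) * (g 1 x + g 2 x))" by (rule ext)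
    show ?thesis unfolding e[symmetric] by (rule Bochner_Integration.integral_add[symmetric, OF ic ic])
  qed
  also have "\<dots> = 0" using z ig by simp
  finally show ?thesis .
qed

section \<open>The Voigt energy and bounds for the nonlinearity\<close>

definition lam :: "real \<Rightarrow> int \<times> int \<Rightarrow> real" where
  "lam al k = 1 + 4 * pi\<^sup>2 * al\<^sup>2 * nk k"

lemma lam_ge_1: "1 \<le> lam al k" and lam_pos: "0 < lam al k"
  by (simp_all add: lam_def add_pos_nonneg)

text \<open>\<open>lam\<close> is the symbol of the identity minus \<open>al\<^sup>2\<close> times
  the Laplacian; on nonzero modes \<open>en\<close> is thus the squared L^2 norm plus
  \<open>al\<^sup>2\<close> times the squared gradient norm of \<open>Uf F q\<close>.\<close>

definition en :: "real \<Rightarrow> (int \<times> int) set \<Rightarrow> (int \<times> int \<Rightarrow> real) \<Rightarrow> real" where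
  "en al F q = (\<Sum>k\<in>F. lam al k * (q k)\<^sup>2)"

lemma en_nonneg: "0 \<le> en al F q"
  unfolding en_def by (intro sum_nonneg mult_nonneg_nonneg less_imp_le[OF lam_pos]) auto

lemma L2norm_Uf_le: assumes "finite F" shows "(L2norm (Uf F q))\<^sup>2 \<le> en al F q"
  unfolding Uf_def L2norm_Psum[OF assms] en_def
proof (rule sum_mono)
  fix k
  have "(norm (q k *\<^sub>R Ev k))\<^sup>2 \<le> (q k)\<^sup>2" by (simp add: norm_Ev)
  also have "\<dots> \<le> lam al k * (q k)\<^sup>2" using mult_right_mono[OF lam_ge_1, of "(q k)\<^sup>2" al k] by simp
  finally show "(norm (q k *\<^sub>R Ev k))\<^sup>2 \<le> lam al k * (q k)\<^sup>2" .
qed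

lemma Ev_nth_le: "(Ev k $ i)\<^sup>2 \<le> 1"
proof -
  have "\<bar>Ev k $ i\<bar> \<le> 1" using component_le_norm_cart[of "Ev k" i] norm_Ev_le[of k] by linarith
  then show ?thesis by (simp add: abs_square_le_1)
qed

lemma sum_nk_le_en:
  assumes al: "al > 0"
  shows "(\<Sum>k\<in>F. nk k * (q k * Ev k $ i)\<^sup>2) \<le> en al F q / (4 * pi\<^sup>2 * al\<^sup>2)"
proof -
  have "(\<Sum>k\<in>F. nk k * (q k * Ev k $ i)\<^sup>2) \<le> (\<Sum>k\<in>F. lam al k * (q k)\<^sup>2 / (4 * pi\<^sup>2 * al\<^sup>2))"
  proof (rule sum_mono)
    fix k
    have "nk k * (q k * Ev k $ i)\<^sup>2 \<le> nk k * (q k)\<^sup>2"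
      unfolding power_mult_distrib using mult_left_mono[OF Ev_nth_le, of "(q k)\<^sup>2" k i] by (intro mult_left_mono) auto
    moreover have "nk k \<le> lam al k / (4 * pi\<^sup>2 * al\<^sup>2)" using al by (simp add: lam_def field_simps)
    then have "nk k * (q k)\<^sup>2 \<le> lam al k / (4 * pi\<^sup>2 * al\<^sup>2) * (q k)\<^sup>2" by (rule mult_right_mono) simp
    ultimately show "nk k * (q k * Ev k $ i)\<^sup>2 \<le> lam al k * (q k)\<^sup>2 / (4 * pi\<^sup>2 * al\<^sup>2)" by simp
  qed
  then show ?thesis by (simp add: en_def sum_divide_distrib)
qed

lemma L2norm_pd_Uf:
  assumes al: "al > 0" and F: "finite F"
  shows "L2norm (\<lambda>x. pd j (Uf F g) x $ i) \<le> sqrt (en al F g) / al"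
proof -
  have inj: "inj_on uminus F" by (auto intro: inj_onI)
  have "(\<lambda>x. pd j (Uf F g) x $ i) = Psum (uminus ` F) (\<lambda>m. 2 * pi * kc (- m) j * (g (- m) * Ev (- m) $ i))"
    unfolding Uf_def pd_Psum Psum_def by (simp add: sum.reindex[OF inj] fun_eq_iff mult_ac)
  then have "(L2norm (\<lambda>x. pd j (Uf F g) x $ i))\<^sup>2 = (\<Sum>m\<in>uminus ` F. (norm (2 * pi * kc (- m) j * (g (- m) * Ev (- m) $ i)))\<^sup>2)"
    by (simp only:) (rule L2norm_Psum, use F in simp)
  also have "\<dots> = (\<Sum>k\<in>F. (2 * pi * kc k j * (g k * Ev k $ i))\<^sup>2)"
    unfolding sum.reindex[OF inj] by simp
  also have "\<dots> \<le> (\<Sum>k\<in>F. 4 * pi\<^sup>2 * (nk k * (g k * Ev k $ i)\<^sup>2))"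
  proof (rule sum_mono)
    fix k
    have "(kc k j)\<^sup>2 \<le> nk k" unfolding nk_kc[symmetric] by (rule member_le_sum) auto
    then have "(kc k j)\<^sup>2 * (g k * Ev k $ i)\<^sup>2 \<le> nk k * (g k * Ev k $ i)\<^sup>2" by (rule mult_right_mono) simp
    then have "4 * pi\<^sup>2 * ((kc k j)\<^sup>2 * (g k * Ev k $ i)\<^sup>2) \<le> 4 * pi\<^sup>2 * (nk k * (g k * Ev k $ i)\<^sup>2)" by (rule mult_left_mono) simp
    moreover have "(2 * pi * kc k j * (g k * Ev k $ i))\<^sup>2 = 4 * pi\<^sup>2 * ((kc k j)\<^sup>2 * (g k * Ev k $ i)\<^sup>2)"
      by (simp add: power_mult_distrib)
    ultimately show "(2 * pi * kc k j * (g k * Ev k $ i))\<^sup>2 \<le> 4 * pi\<^sup>2 * (nk k * (g k * Ev k $ i)\<^sup>2)" by (simp only:)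
  qed
  also have "\<dots> \<le> 4 * pi\<^sup>2 * (en al F g / (4 * pi\<^sup>2 * al\<^sup>2))"
    unfolding sum_distrib_left[symmetric] by (intro mult_left_mono sum_nk_le_en al) auto
  also have "\<dots> = (sqrt (en al F g) / al)\<^sup>2" using en_nonneg[of al F g] by (simp add: power_divide)
  finally show ?thesis by (rule power2_le_imp_le) (use al en_nonneg[of al F g] in auto)
qed

text \<open>Four component pairs with the product constant 20 give 80; the factor
  \<open>1 / (4 * pi\<^sup>2 * al\<^sup>2)\<close> converts the energy into the weighted coefficient
  sum, and the last \<open>1 / al\<close> bounds the gradient of the test field.\<close>

definition K1 :: "real \<Rightarrow> real" where "K1 al = 80 / (4 * pi\<^sup>2 * al\<^sup>2) / al"

text \<open>Both the products of velocity components and the gradient of the test field are bounded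
  in L^2 by the energy, uniformly in the set of modes. This is where the Voigt regularisation
  enters.\<close>

lemma conv_bound:
  assumes al: "al > 0" and F: "finite F" "0 \<notin> F"
  shows "\<bar>conv (Uf F q) (Uf F g)\<bar> \<le> K1 al * en al F q * sqrt (en al F g)"
proof -
  define A where "A = sqrt (en al F q / (4 * pi\<^sup>2 * al\<^sup>2))"
  have A0: "0 \<le> en al F q / (4 * pi\<^sup>2 * al\<^sup>2)" using en_nonneg[of al F q] by simp
  then have A2: "A * A = en al F q / (4 * pi\<^sup>2 * al\<^sup>2)" and A: "0 \<le> A"
    by (simp_all only: A_def real_sqrt_mult_self abs_of_nonneg real_sqrt_ge_zero)
  define p where "p i j x = Uf F q x $ i * Uf F q x $ j" for i j x
  define d where "d i j x = pd j (Uf F g) x $ i" for i j x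
  have cp: "continuous_on UNIV (p i j)" for i j
    unfolding p_def Uf_nth by (intro continuous_intros)
  have cd: "continuous_on UNIV (d i j)" for i j
    unfolding d_def Uf_def by (intro continuous_on_component continuous_pd_Psum)
  have pn: "L2norm (p i j) \<le> 20 * (A * A)" for i j
    unfolding p_def Uf_nth
    using product_estimate[OF F F, of "\<lambda>k. q k * Ev k $ i" A "\<lambda>k. q k * Ev k $ j" A] sum_nk_le_en[OF al, where F=F and q=q] A A2
    by (simp add: power2_eq_square)
  have t: "\<bar>ip (p i j) (d i j)\<bar> \<le> 20 * (A * A) * (sqrt (en al F g) / al)" for i j
  proof -
    have "\<bar>ip (p i j) (d i j)\<bar> \<le> L2norm (p i j) * L2norm (d i j)"
      by (intro ip_cauchy_schwarz sqi_continuous cp cd)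
    also have "\<dots> \<le> 20 * (A * A) * (sqrt (en al F g) / al)"
      unfolding d_def by (intro mult_mono pn L2norm_pd_Uf al F) (use A in auto)
    finally show ?thesis .
  qed
  have "conv (Uf F q) (Uf F g) = (\<Sum>j\<in>UNIV. ip (p 1 j) (d 1 j) + ip (p 2 j) (d 2 j))"
    unfolding conv_def
  proof (rule sum.cong)
    fix j :: 2
    have i: "integrable tor (\<lambda>x. p i j x * d i j x)" for i by (intro integrable_tor_continuous continuous_intros cp cd)
    have "ip (\<lambda>x. Uf F q x $ j *\<^sub>R Uf F q x) (pd j (Uf F g)) = (LINT x|tor. p 1 j x * d 1 j x + p 2 j x * d 2 j x)"
      unfolding ip_tor p_def d_def by (simp add: inner_2 algebra_simps)
    also have "\<dots> = ip (p 1 j) (d 1 j) + ip (p 2 j) (d 2 j)" using i by (simp add: ip_tor)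
    finally show "ip (\<lambda>x. Uf F q x $ j *\<^sub>R Uf F q x) (pd j (Uf F g)) = ip (p 1 j) (d 1 j) + ip (p 2 j) (d 2 j)" .
  qed simp
  then have "\<bar>conv (Uf F q) (Uf F g)\<bar> \<le> 4 * (20 * (A * A) * (sqrt (en al F g) / al))"
    using t[of 1 1] t[of 2 1] t[of 1 2] t[of 2 2] by (simp add: sum_2)
  also have "\<dots> = K1 al * en al F q * sqrt (en al F g)"
    unfolding A2 K1_def by simp
  finally show ?thesis .
qed

lemma force_bound:
  assumes F: "finite F" and \<theta>: "sqi \<theta>"
  shows "\<bar>force \<theta> (Uf F g)\<bar> \<le> L2norm \<theta> * sqrt (en al F g)"
proof -
  have s: "sqi (\<lambda>x. Uf F g x $ 2)" unfolding Uf_nth by simp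
  have sU: "sqi (Uf F g)" unfolding Uf_def by simp
  have "force \<theta> (Uf F g) = ip \<theta> (\<lambda>x. Uf F g x $ 2)" unfolding force_eq ip_tor by simp
  then have "\<bar>force \<theta> (Uf F g)\<bar> \<le> L2norm \<theta> * L2norm (\<lambda>x. Uf F g x $ 2)"
    using ip_cauchy_schwarz[OF \<theta> s] by simp
  also have "L2norm (\<lambda>x. Uf F g x $ 2) \<le> L2norm (Uf F g)"
    unfolding L2norm_tor by (intro real_sqrt_le_mono integral_mono sqi_int2 s sU)
      (simp, metis abs_ge_zero component_le_norm_cart power2_abs power_mono)
  also have "L2norm (Uf F g) \<le> sqrt (en al F g)" using L2norm_Uf_le[OF F] by (simp add: real_le_rsqrt)
  finally show ?thesis by (simp add: mult_left_mono)
qed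

text \<open>The first bound holds because convection does no work, so only buoyancy contributes. For
  the second the field with coefficients \<open>Bk / lam\<close> is tested against itself: its
  energy is at most a constant times the root of its energy, and the root is cancelled.\<close>

lemma Bk_energy:
  assumes al: "al > 0" and F: "finite F" "0 \<notin> F" and \<theta>: "sqi \<theta>"
  shows "(\<Sum>k\<in>F. q k * Bk (Uf F q) \<theta> k) \<le> L2norm \<theta> * sqrt (en al F q)"
    and "en al F (\<lambda>k. Bk (Uf F q) \<theta> k / lam al k) \<le> (K1 al * en al F q + L2norm \<theta>)\<^sup>2"
proof -
  have sU: "sqi (Uf F q)" unfolding Uf_def by simp
  note c = conv_force_Psum[OF sU \<theta>, folded Uf_def]
  show "(\<Sum>k\<in>F. q k * Bk (Uf F q) \<theta> k) \<le> L2norm \<theta> * sqrt (en al F q)"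
    using force_bound[OF F(1) \<theta>, of q al] unfolding c[symmetric] conv_Uf_self by simp
  define g where "g k = Bk (Uf F q) \<theta> k / lam al k" for k
  have "en al F g = (\<Sum>k\<in>F. g k * Bk (Uf F q) \<theta> k)"
    unfolding en_def g_def
  proof (rule sum.cong)
    fix k show "lam al k * (Bk (Uf F q) \<theta> k / lam al k)\<^sup>2 = Bk (Uf F q) \<theta> k / lam al k * Bk (Uf F q) \<theta> k"
      using lam_pos[of al k] by (simp add: power2_eq_square)
  qed simp
  also have "\<dots> = conv (Uf F q) (Uf F g) + force \<theta> (Uf F g)" by (rule c[symmetric])
  also have "\<dots> \<le> (K1 al * en al F q + L2norm \<theta>) * sqrt (en al F g)"
    using conv_bound[OF al F, of q g] force_bound[OF F(1) \<theta>, of g al] by (simp add: distrib_right)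
  finally have e: "en al F g \<le> (K1 al * en al F q + L2norm \<theta>) * sqrt (en al F g)" .
  have "sqrt (en al F g) \<le> K1 al * en al F q + L2norm \<theta>"
  proof (cases "en al F g = 0")
    case True
    have "0 \<le> K1 al * en al F q" using al en_nonneg[of al F q] by (simp add: K1_def)
    then show ?thesis using True by simp
  next
    case False
    then have p: "0 < sqrt (en al F g)" using en_nonneg[of al F g] by simp
    have "sqrt (en al F g) * sqrt (en al F g) \<le> (K1 al * en al F q + L2norm \<theta>) * sqrt (en al F g)"
      using e en_nonneg[of al F g] by simp
    then show ?thesis using p by (rule mult_right_le_imp_le)
  qed
  then have "(sqrt (en al F g))\<^sup>2 \<le> (K1 al * en al F q + L2norm \<theta>)\<^sup>2"
    by (rule power_mono) (use en_nonneg[of al F g] in simp)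
  then show "en al F (\<lambda>k. Bk (Uf F q) \<theta> k / lam al k) \<le> (K1 al * en al F q + L2norm \<theta>)\<^sup>2"
    using en_nonneg[of al F g] unfolding g_def by simp
qed

definition q_step :: "real \<Rightarrow> (int \<times> int) set \<Rightarrow> real \<Rightarrow> (int \<times> int \<Rightarrow> real) \<Rightarrow> (pt \<Rightarrow> real) \<Rightarrow> int \<times> int \<Rightarrow> real" where
  "q_step al F \<tau> q \<theta> k = (if k \<in> F then q k + \<tau> * (Bk (Uf F q) \<theta> k / lam al k) else 0)"

lemma en_step:
  "en al F (q_step al F \<tau> q \<theta>) = en al F q + 2 * \<tau> * (\<Sum>k\<in>F. q k * Bk (Uf F q) \<theta> k) + \<tau>\<^sup>2 * en al F (\<lambda>k. Bk (Uf F q) \<theta> k / lam al k)"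
proof -
  have "lam al k * (q_step al F \<tau> q \<theta> k)\<^sup>2 = lam al k * (q k)\<^sup>2 + 2 * \<tau> * (q k * Bk (Uf F q) \<theta> k) + \<tau>\<^sup>2 * (lam al k * (Bk (Uf F q) \<theta> k / lam al k)\<^sup>2)"
    if "k \<in> F" for k
  proof -
    have "lam al k * (q k + \<tau> * b)\<^sup>2 = lam al k * (q k)\<^sup>2 + 2 * \<tau> * (q k * (lam al k * b)) + \<tau>\<^sup>2 * (lam al k * b\<^sup>2)" for b
      by (simp add: power2_eq_square algebra_simps)
    from this[of "Bk (Uf F q) \<theta> k / lam al k"] show ?thesis
      using that lam_pos[of al k] by (simp add: q_step_def)
  qed
  then have "en al F (q_step al F \<tau> q \<theta>) = (\<Sum>k\<in>F. lam al k * (q k)\<^sup>2 + 2 * \<tau> * (q k * Bk (Uf F q) \<theta> k) + \<tau>\<^sup>2 * (lam al k * (Bk (Uf F q) \<theta> k / lam al k)\<^sup>2))"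
    unfolding en_def by (intro sum.cong) auto
  then show ?thesis by (simp add: en_def sum.distrib sum_distrib_left)
qed

subsection \<open>The scheme\<close>

primrec st :: "real \<Rightarrow> (int \<times> int) set \<Rightarrow> real \<Rightarrow> (int \<times> int \<Rightarrow> real) \<Rightarrow> (pt \<Rightarrow> real) \<Rightarrow> nat \<Rightarrow> (int \<times> int \<Rightarrow> real) \<times> (pt \<Rightarrow> real)" where
  "st al F \<tau> q0 th0 0 = (\<lambda>k. if k \<in> F then q0 k else 0, th0)"
| "st al F \<tau> q0 th0 (Suc n) = (let s = st al F \<tau> q0 th0 n in (q_step al F \<tau> (fst s) (snd s), th_step F \<tau> (fst s) (snd s)))"

lemma st_theta:
  assumes F: "finite F" "F \<noteq> {}" and th: "th0 \<in> borel_measurable borel" "periodic2 th0" "sqi th0"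
  shows "snd (st al F \<tau> q0 th0 n) \<in> borel_measurable borel \<and> periodic2 (snd (st al F \<tau> q0 th0 n)) \<and>
    sqi (snd (st al F \<tau> q0 th0 n)) \<and> L2norm (snd (st al F \<tau> q0 th0 n)) \<le> L2norm th0 \<and>
    (\<forall>C. (\<forall>x. \<bar>th0 x\<bar> \<le> C) \<longrightarrow> (\<forall>x. \<bar>snd (st al F \<tau> q0 th0 n) x\<bar> \<le> C))"
proof (induction n)
  case (Suc n)
  define s where "s = st al F \<tau> q0 th0 n"
  have e: "snd (st al F \<tau> q0 th0 (Suc n)) = th_step F \<tau> (fst s) (snd s)" by (simp add: s_def Let_def)
  have IH: "snd s \<in> borel_measurable borel" "periodic2 (snd s)" "sqi (snd s)" "L2norm (snd s) \<le> L2norm th0"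
    "\<And>C. (\<forall>x. \<bar>th0 x\<bar> \<le> C) \<Longrightarrow> (\<forall>x. \<bar>snd s x\<bar> \<le> C)"
    using Suc unfolding s_def by auto
  show ?case unfolding e
    using th_step_borel[OF IH(1)] th_step_periodic[OF IH(2)] th_step_sqi[OF IH(1-3)]
      order_trans[OF th_step_L2norm[OF F IH(1-3)] IH(4)] th_step_bound[OF F] IH(5) by blast
qed (use th in auto)

text \<open>One step raises the energy by at most \<open>\<tau> * (2 * \<Theta> * R + 1)\<close>:
  the first part is the work of buoyancy, and the 1 absorbs the Euler error, quadratic in
  \<open>\<tau>\<close>, by the restriction on the step. The condition on \<open>R\<close> closes
  the bootstrap, since the accumulated bound stays below \<open>R\<^sup>2\<close> up to time
  \<open>T\<close>.\<close>

lemma st_energy: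
  assumes al: "al > 0" and F: "finite F" "0 \<notin> F" "F \<noteq> {}"
    and th: "th0 \<in> borel_measurable borel" "periodic2 th0" "sqi th0"
    and E0: "en al F q0 \<le> E0" and \<Theta>: "L2norm th0 \<le> \<Theta>"
    and R: "E0 + T * (2 * \<Theta> * R + 1) \<le> R\<^sup>2" "0 \<le> R" and \<tau>: "0 \<le> \<tau>" "\<tau> * (K1 al * R\<^sup>2 + \<Theta>)\<^sup>2 \<le> 1"
    and n: "real n * \<tau> \<le> T"
  shows "en al F (fst (st al F \<tau> q0 th0 n)) \<le> E0 + real n * \<tau> * (2 * \<Theta> * R + 1)"
  using n
proof (induction n)
  case 0
  have "en al F (\<lambda>k. if k \<in> F then q0 k else 0) = en al F q0" unfolding en_def by (intro sum.cong) auto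
  then show ?case using E0 by simp
next
  case (Suc n)
  define s where "s = st al F \<tau> q0 th0 n"
  define q where "q = fst s"
  define \<theta> where "\<theta> = snd s"
  have e: "fst (st al F \<tau> q0 th0 (Suc n)) = q_step al F \<tau> q \<theta>" by (simp add: q_def \<theta>_def s_def Let_def)
  have \<theta>: "sqi \<theta>" "L2norm \<theta> \<le> \<Theta>"
    using st_theta[OF F(1,3) th, of al \<tau> q0 n] \<Theta> unfolding \<theta>_def s_def by auto
  have \<Theta>0: "0 \<le> \<Theta>" using \<Theta> L2norm_nonneg order_trans by blast
  have nT: "real n * \<tau> \<le> T" using Suc(2) \<tau>(1) by (simp add: algebra_simps)
  have IH: "en al F q \<le> E0 + real n * \<tau> * (2 * \<Theta> * R + 1)" using Suc(1)[OF nT] by (simp add: q_def s_def)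
  also have "\<dots> \<le> E0 + T * (2 * \<Theta> * R + 1)"
    using nT \<Theta>0 R(2) by (intro add_left_mono mult_right_mono) auto
  finally have qR: "en al F q \<le> R\<^sup>2" using R by linarith
  then have sq: "sqrt (en al F q) \<le> R" using R(2) by (simp add: real_le_lsqrt)
  note B = Bk_energy[OF al F(1,2) \<theta>(1), of q]
  have K0: "0 \<le> K1 al" using al by (simp add: K1_def)
  have b1: "(\<Sum>k\<in>F. q k * Bk (Uf F q) \<theta> k) \<le> \<Theta> * R"
    using en_nonneg[of al F q] by (intro order_trans[OF B(1)] mult_mono \<theta> sq \<Theta>0) auto
  have b2: "en al F (\<lambda>k. Bk (Uf F q) \<theta> k / lam al k) \<le> (K1 al * R\<^sup>2 + \<Theta>)\<^sup>2"
    using en_nonneg[of al F q] K0 by (intro order_trans[OF B(2)] power_mono add_mono mult_left_mono qR \<theta>) auto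
  have "\<tau>\<^sup>2 * en al F (\<lambda>k. Bk (Uf F q) \<theta> k / lam al k) \<le> \<tau>\<^sup>2 * (K1 al * R\<^sup>2 + \<Theta>)\<^sup>2"
    by (intro mult_left_mono b2) simp
  also have "\<dots> = \<tau> * (\<tau> * (K1 al * R\<^sup>2 + \<Theta>)\<^sup>2)" by (simp add: power2_eq_square mult.assoc)
  also have "\<dots> \<le> \<tau> * 1" by (intro mult_left_mono \<tau>)
  finally have b3: "\<tau>\<^sup>2 * en al F (\<lambda>k. Bk (Uf F q) \<theta> k / lam al k) \<le> \<tau>" by simp
  have b4: "2 * \<tau> * (\<Sum>k\<in>F. q k * Bk (Uf F q) \<theta> k) \<le> 2 * \<tau> * (\<Theta> * R)"
    by (intro mult_left_mono b1) (use \<tau> in simp)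
  have "en al F (q_step al F \<tau> q \<theta>) \<le> (E0 + real n * \<tau> * (2 * \<Theta> * R + 1)) + 2 * \<tau> * (\<Theta> * R) + \<tau>"
    unfolding en_step using IH b3 b4 by linarith
  also have "\<dots> = E0 + real (Suc n) * \<tau> * (2 * \<Theta> * R + 1)" by (simp add: algebra_simps)
  finally show ?case unfolding e .
qed

subsection \<open>Compactness in time\<close>

text \<open>Number of completed steps at time \<open>t\<close>; composition with it turns the
  discrete sequences into right-continuous step functions of time.\<close>

definition ix :: "real \<Rightarrow> real \<Rightarrow> nat" where "ix \<tau> t = nat \<lfloor>t / \<tau>\<rfloor>"

lemma ix_bounds:
  assumes "0 < \<tau>" "0 \<le> t" shows "real (ix \<tau> t) * \<tau> \<le> t" "t < (real (ix \<tau> t) + 1) * \<tau>"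
proof -
  have "0 \<le> \<lfloor>t / \<tau>\<rfloor>" using assms by simp
  then have r: "real (ix \<tau> t) = of_int \<lfloor>t / \<tau>\<rfloor>" by (simp add: ix_def)
  have "of_int \<lfloor>t / \<tau>\<rfloor> \<le> t / \<tau>" "t / \<tau> < of_int \<lfloor>t / \<tau>\<rfloor> + 1" by linarith+
  then show "real (ix \<tau> t) * \<tau> \<le> t" "t < (real (ix \<tau> t) + 1) * \<tau>"
    unfolding r pos_le_divide_eq[OF assms(1)] pos_divide_less_eq[OF assms(1)] by blast+
qed

lemma ix_eqI:
  assumes "0 < \<tau>" "real n * \<tau> \<le> t" "t < (real n + 1) * \<tau>" shows "ix \<tau> t = n"
proof -
  have "real n \<le> t / \<tau>" "t / \<tau> < real n + 1" using assms by (simp_all add: pos_le_divide_eq pos_divide_less_eq)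
  then have "\<lfloor>t / \<tau>\<rfloor> = int n" by (intro floor_unique) auto
  then show ?thesis by (simp add: ix_def)
qed

lemma ix_mono: "0 < \<tau> \<Longrightarrow> s \<le> t \<Longrightarrow> ix \<tau> s \<le> ix \<tau> t"
  unfolding ix_def by (intro nat_mono floor_mono divide_right_mono) auto

lemma step_integral:
  fixes f :: "nat \<Rightarrow> real"
  assumes \<tau>: "0 < \<tau>"
  shows "((\<lambda>s. f (ix \<tau> s)) has_integral (\<Sum>j<n. \<tau> * f j)) {0..real n * \<tau>}"
proof (induction n)
  case (Suc n)
  have "((\<lambda>s. f (ix \<tau> s)) has_integral (real (Suc n) * \<tau> - real n * \<tau>) *\<^sub>R f n) {real n * \<tau>..real (Suc n) * \<tau>}"
  \<comment> \<open>The right end point already belongs to the next step, so this single point is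
    exempted.\<close>
  proof (rule has_integral_spike_finite[where S="{real (Suc n) * \<tau>}" and f="\<lambda>_. f n"])
    fix s assume "s \<in> {real n * \<tau>..real (Suc n) * \<tau>} - {real (Suc n) * \<tau>}"
    then show "f (ix \<tau> s) = f n" using ix_eqI[OF \<tau>, of n s] by (auto simp: add.commute)
  qed (use has_integral_const_real[of "f n" "real n * \<tau>" "real (Suc n) * \<tau>"] \<tau> in \<open>auto simp: mult_right_mono\<close>)
  then have "((\<lambda>s. f (ix \<tau> s)) has_integral \<tau> * f n) {real n * \<tau>..real (Suc n) * \<tau>}"
    by (simp add: algebra_simps)
  from has_integral_combine[OF _ _ Suc this] \<tau> show ?case by (simp add: mult_right_mono)
next
  case 0
  show ?case using has_integral_null_real[of 0 0 "\<lambda>s. f (ix \<tau> s)"] by simp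
qed

lemma step_integral_upto:
  fixes f :: "nat \<Rightarrow> real"
  assumes \<tau>: "0 < \<tau>" and t: "0 \<le> t"
  shows "((\<lambda>s. f (ix \<tau> s)) has_integral ((\<Sum>j<ix \<tau> t. \<tau> * f j) + (t - real (ix \<tau> t) * \<tau>) * f (ix \<tau> t))) {0..t}"
proof -
  define n where "n = ix \<tau> t"
  note b = ix_bounds[OF \<tau> t, folded n_def]
  have "((\<lambda>s. f (ix \<tau> s)) has_integral (t - real n * \<tau>) *\<^sub>R f n) {real n * \<tau>..t}"
  proof (rule has_integral_eq[rotated])
    show "((\<lambda>_. f n) has_integral (t - real n * \<tau>) *\<^sub>R f n) {real n * \<tau>..t}"
      using has_integral_const_real[of "f n" "real n * \<tau>" t] b by simp
    fix s assume s: "s \<in> {real n * \<tau>..t}"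
    then have "ix \<tau> s = n" using b by (intro ix_eqI[OF \<tau>]) auto
    then show "f n = f (ix \<tau> s)" by simp
  qed
  from has_integral_combine[OF _ _ step_integral[OF \<tau>] this] b \<tau> show ?thesis by (simp add: n_def)
qed

text \<open>The sum over the completed steps is the integral of a step function, apart from the
  unfinished last step, which costs at most \<open>\<tau> N * K\<close>. The consistency errors add
  up to at most \<open>T * e N\<close>, and dominated convergence passes to the limit in the
  integral.\<close>

lemma euler_limit:
  fixes x f :: "nat \<Rightarrow> nat \<Rightarrow> real"
  assumes \<tau>: "\<And>N. 0 < \<tau> N" "\<tau> \<longlonglongrightarrow> 0" and e: "\<And>N. 0 \<le> e N" "e \<longlonglongrightarrow> 0"
    and s: "\<And>N n. real n * \<tau> N \<le> T \<Longrightarrow> \<bar>x N (Suc n) - x N n - \<tau> N * f N n\<bar> \<le> \<tau> N * e N"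
    and K: "\<And>N n. real n * \<tau> N \<le> T \<Longrightarrow> \<bar>f N n\<bar> \<le> K"
    and X: "\<And>t. t \<in> {0..T} \<Longrightarrow> (\<lambda>N. x N (ix (\<tau> N) t)) \<longlonglongrightarrow> X t"
    and g: "\<And>t. t \<in> {0..T} \<Longrightarrow> (\<lambda>N. f N (ix (\<tau> N) t)) \<longlonglongrightarrow> g t"
    and t: "t \<in> {0..T}"
  shows "X t - X 0 = integral {0..t} g"
proof -
  have t0: "0 \<le> t" "t \<le> T" using t by auto
  define I where "I N = integral {0..t} (\<lambda>s. f N (ix (\<tau> N) s))" for N
  have Ilim: "I \<longlonglongrightarrow> integral {0..t} g"
    unfolding I_def
  proof (rule dominated_convergence(2)[where h="\<lambda>_. K"])
    show "(\<lambda>s. f N (ix (\<tau> N) s)) integrable_on {0..t}" for N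
      using step_integral_upto[OF \<tau>(1) t0(1)] has_integral_integrable by blast
    show "norm (f N (ix (\<tau> N) s)) \<le> K" if "s \<in> {0..t}" for N s
      using ix_bounds[OF \<tau>(1), of s N] that t0 K[of "ix (\<tau> N) s" N] by auto
    show "(\<lambda>N. f N (ix (\<tau> N) s)) \<longlonglongrightarrow> g s" if "s \<in> {0..t}" for s
      using g[of s] that t0 by auto
  qed auto
  have "(\<lambda>N. x N (ix (\<tau> N) t) - x N (ix (\<tau> N) 0) - I N) \<longlonglongrightarrow> X t - X 0 - integral {0..t} g"
    by (intro tendsto_diff X Ilim) (use t0 in auto)
  moreover have "(\<lambda>N. x N (ix (\<tau> N) t) - x N (ix (\<tau> N) 0) - I N) \<longlonglongrightarrow> 0"
  proof (rule Lim_null_comparison)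
    show "(\<lambda>N. T * e N + \<tau> N * K) \<longlonglongrightarrow> 0"
      using tendsto_add[OF tendsto_mult[OF tendsto_const e(2), of T] tendsto_mult[OF \<tau>(2) tendsto_const, of K]] by simp
    show "\<forall>\<^sub>F N in sequentially. norm (x N (ix (\<tau> N) t) - x N (ix (\<tau> N) 0) - I N) \<le> T * e N + \<tau> N * K"
    proof (rule always_eventually, rule allI)
      fix N
      define n where "n = ix (\<tau> N) t"
      note b = ix_bounds[OF \<tau>(1) t0(1), of N, folded n_def]
      have i0: "ix (\<tau> N) 0 = 0" by (simp add: ix_def)
      have IN: "I N = (\<Sum>j<n. \<tau> N * f N j) + (t - real n * \<tau> N) * f N n"
        unfolding I_def n_def by (rule integral_unique[OF step_integral_upto[OF \<tau>(1) t0(1)]])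
      have d: "x N n - x N 0 = (\<Sum>j<n. x N (Suc j) - x N j)" by (rule sum_lessThan_telescope[symmetric])
      have jT: "real j * \<tau> N \<le> T" if "j \<le> n" for j
      proof -
        have "real j * \<tau> N \<le> real n * \<tau> N" using that \<tau>(1)[of N] by (intro mult_right_mono) auto
        then show ?thesis using b t0 by linarith
      qed
      have "\<bar>\<Sum>j<n. x N (Suc j) - x N j - \<tau> N * f N j\<bar> \<le> (\<Sum>j<n. \<tau> N * e N)"
        by (intro order_trans[OF sum_abs] sum_mono s jT) auto
      also have "\<dots> = (real n * \<tau> N) * e N" by simp
      also have "\<dots> \<le> T * e N" using b t0 e(1) by (intro mult_right_mono) auto
      finally have 1: "\<bar>\<Sum>j<n. x N (Suc j) - x N j - \<tau> N * f N j\<bar> \<le> T * e N" .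
      have "\<bar>(t - real n * \<tau> N) * f N n\<bar> \<le> \<tau> N * K"
        unfolding abs_mult using b \<tau>(1)[of N] K[OF jT[of n]] by (intro mult_mono) (auto simp: algebra_simps)
      with 1 show "norm (x N (ix (\<tau> N) t) - x N (ix (\<tau> N) 0) - I N) \<le> T * e N + \<tau> N * K"
        unfolding i0 n_def[symmetric] d IN by (simp add: sum_subtractf)
    qed
  qed
  ultimately have "X t - X 0 - integral {0..t} g = 0" by (rule LIMSEQ_unique)
  then show ?thesis by simp
qed

text \<open>The extra \<open>\<tau>\<close> on the right pays for the jumps of the step function:
  two nearby times may lie in different steps.\<close>

lemma step_lipschitz:
  fixes x :: "nat \<Rightarrow> real"
  assumes \<tau>: "0 < \<tau>" and s: "\<And>n. real n * \<tau> \<le> T \<Longrightarrow> \<bar>x (Suc n) - x n\<bar> \<le> \<tau> * C" and C: "0 \<le> C"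
    and ab: "0 \<le> a" "a \<le> b" "b \<le> T"
  shows "\<bar>x (ix \<tau> b) - x (ix \<tau> a)\<bar> \<le> C * (\<bar>b - a\<bar> + \<tau>)"
proof -
  define m n where "m = ix \<tau> a" and "n = ix \<tau> b"
  have mn: "m \<le> n" unfolding m_def n_def by (rule ix_mono[OF \<tau> ab(2)])
  have bn: "real n * \<tau> \<le> b" "a < (real m + 1) * \<tau>"
    using ix_bounds[OF \<tau>, of a] ix_bounds[OF \<tau>, of b] ab by (auto simp: m_def n_def)
  have jT: "real j * \<tau> \<le> T" if "j \<le> n" for j
  proof -
    have "real j * \<tau> \<le> real n * \<tau>" using that \<tau> by (intro mult_right_mono) auto
    then show ?thesis using bn ab by linarith
  qed
  have "x n - x m = (\<Sum>j\<in>{m..<n}. x (Suc j) - x j)" using mn by (simp add: sum_Suc_diff')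
  then have "\<bar>x n - x m\<bar> \<le> (\<Sum>j\<in>{m..<n}. \<tau> * C)"
    by (simp only:) (intro order_trans[OF sum_abs] sum_mono s jT, auto)
  also have "\<dots> = (real n * \<tau> - real m * \<tau>) * C" using mn by (simp add: of_nat_diff algebra_simps)
  also have "\<dots> \<le> (\<bar>b - a\<bar> + \<tau>) * C"
    using bn ab C by (intro mult_right_mono) (auto simp: distrib_right)
  finally show ?thesis by (simp add: m_def n_def mult.commute)
qed

text \<open>A version of Arzela-Ascoli for functions that are discontinuous but almost Lipschitz: a
  diagonal subsequence converges at rational times for every index \<open>j\<close>, and since the
  jumps vanish in the limit the estimate carries the Cauchy property to all times.\<close>

lemma compactness:
  fixes y :: "nat \<Rightarrow> 'j::countable \<Rightarrow> real \<Rightarrow> real"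
  assumes T: "0 < T" and B: "\<And>N j t. t \<in> {0..T} \<Longrightarrow> \<bar>y N j t\<bar> \<le> B"
    and L: "\<And>N j s t. 0 \<le> s \<Longrightarrow> s \<le> t \<Longrightarrow> t \<le> T \<Longrightarrow> \<bar>y N j t - y N j s\<bar> \<le> C j * (\<bar>t - s\<bar> + \<tau> N)"
    and C: "\<And>j. 0 \<le> C j" and \<tau>: "\<tau> \<longlonglongrightarrow> 0"
  obtains r Y where "strict_mono r" "\<And>j t. t \<in> {0..T} \<Longrightarrow> (\<lambda>N. y (r N) j t) \<longlonglongrightarrow> Y j t"
proof -
  have L': "\<bar>y N j t - y N j s\<bar> \<le> C j * (\<bar>t - s\<bar> + \<tau> N)" if "s \<in> {0..T}" "t \<in> {0..T}" for N j s t
  proof (cases "s \<le> t")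
    case True then show ?thesis using L that by auto
  next
    case False then show ?thesis using L[of t s N j] that by (simp add: abs_minus_commute)
  qed
  define S where "S = (UNIV :: 'j set) \<times> (\<rat> \<inter> {0..T})"
  have "countable S" unfolding S_def by (intro countable_SIGMA countable_Int1 countable_rat) auto
  moreover have "norm (y N (fst p) (snd p)) \<le> B" if "p \<in> S" for N p
    using that B by (auto simp: S_def)
  ultimately have "\<exists>r. strict_mono r \<and> (\<forall>p\<in>S. \<exists>l. (\<lambda>N. y (r N) (fst p) (snd p)) \<longlonglongrightarrow> l)"
  proof (rule function_convergent_subsequence[of S "\<lambda>N p. y N (fst p) (snd p)" B])
    fix k :: "nat \<Rightarrow> nat"
    assume 1: "strict_mono k" and 2: "\<And>x. x \<in> S \<Longrightarrow> \<exists>l. (\<lambda>n. y (k n) (fst x) (snd x)) \<longlonglongrightarrow> l"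
    show ?thesis by (rule exI[of _ k]) (use 1 2 in simp)
  qed
  then obtain r where r: "strict_mono r" "\<And>p. p \<in> S \<Longrightarrow> \<exists>l. (\<lambda>N. y (r N) (fst p) (snd p)) \<longlonglongrightarrow> l"
    by blast
  have \<tau>r: "(\<lambda>N. \<tau> (r N)) \<longlonglongrightarrow> 0" using LIMSEQ_subseq_LIMSEQ[OF \<tau> r(1)] by (simp add: o_def)
  have "\<exists>l. (\<lambda>N. y (r N) j t) \<longlonglongrightarrow> l" if t: "t \<in> {0..T}" for j t
  proof -
    have "Cauchy (\<lambda>N. y (r N) j t)"
    proof (rule metric_CauchyI)
      fix e :: real assume e: "0 < e"
      \<comment> \<open>Chosen so that \<open>C j * (2 * \<eta>)\<close> is at most
        \<open>e / 4\<close>; two such errors and \<open>e / 2\<close> at the rational time make up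
        \<open>e\<close>.\<close>
      define \<eta> where "\<eta> = e / (8 * (C j + 1))"
      have \<eta>: "0 < \<eta>" using e C[of j] by (simp add: \<eta>_def)
      have "\<exists>s\<in>\<rat>. s \<in> {0..T} \<and> \<bar>t - s\<bar> < \<eta>"
      proof (cases "t < T")
        case True
        then have "t < min T (t + \<eta>)" using \<eta> by simp
        from Rats_dense_in_real[OF this] obtain s where "s \<in> \<rat>" "t < s" "s < min T (t + \<eta>)" by blast
        then show ?thesis using t by (intro bexI[of _ s]) auto
      next
        case False
        then have "max 0 (t - \<eta>) < t" using \<eta> t T by simp
        from Rats_dense_in_real[OF this] obtain s where "s \<in> \<rat>" "max 0 (t - \<eta>) < s" "s < t" by blast
        then show ?thesis using t by (intro bexI[of _ s]) auto
      qed
      then obtain s where s: "s \<in> \<rat>" "s \<in> {0..T}" "\<bar>t - s\<bar> < \<eta>" by blast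
      have "convergent (\<lambda>N. y (r N) j s)" using r(2)[of "(j, s)"] s by (auto simp: S_def convergent_def)
      then have "Cauchy (\<lambda>N. y (r N) j s)" by (rule convergent_Cauchy)
      then obtain M1 where M1: "\<And>m n. m \<ge> M1 \<Longrightarrow> n \<ge> M1 \<Longrightarrow> dist (y (r m) j s) (y (r n) j s) < e / 2"
        using metric_CauchyD[of "\<lambda>N. y (r N) j s" "e / 2"] e by auto
      have "\<forall>\<^sub>F N in sequentially. \<tau> (r N) < \<eta>" by (rule order_tendstoD(2)[OF \<tau>r \<eta>])
      then obtain M2 where M2: "\<And>N. N \<ge> M2 \<Longrightarrow> \<tau> (r N) < \<eta>" by (auto simp: eventually_sequentially)
      have close: "\<bar>y (r N) j t - y (r N) j s\<bar> \<le> e / 4" if "N \<ge> M2" for N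
      proof -
        have "\<bar>y (r N) j t - y (r N) j s\<bar> \<le> C j * (\<bar>t - s\<bar> + \<tau> (r N))" by (rule L'[OF s(2) t])
        also have "\<dots> \<le> (C j + 1) * (2 * \<eta>)"
        proof -
          have "C j * (\<bar>t - s\<bar> + \<tau> (r N)) \<le> C j * (2 * \<eta>)" using s M2[OF that] C by (intro mult_left_mono) auto
          also have "\<dots> \<le> (C j + 1) * (2 * \<eta>)" using \<eta> by (intro mult_right_mono) auto
          finally show ?thesis .
        qed
        also have "\<dots> = e / 4" using C[of j] by (simp add: \<eta>_def field_simps)
        finally show ?thesis .
      qed
      show "\<exists>M. \<forall>m\<ge>M. \<forall>n\<ge>M. dist (y (r m) j t) (y (r n) j t) < e"
      proof (intro exI allI impI)
        fix m n assume "max M1 M2 \<le> m" "max M1 M2 \<le> n"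
        then show "dist (y (r m) j t) (y (r n) j t) < e"
          using M1[of m n] close[of m] close[of n] unfolding dist_real_def by linarith
      qed
    qed
    then show ?thesis by (simp add: Cauchy_convergent_iff convergent_def)
  qed
  then have "(\<lambda>N. y (r N) j t) \<longlonglongrightarrow> lim (\<lambda>N. y (r N) j t)" if "t \<in> {0..T}" for j t
    using that by (simp add: convergent_LIMSEQ_iff[symmetric] convergent_def)
  from that[OF r(1) this] show thesis .
qed

subsection \<open>Forms in terms of trilinear integrals\<close>

lemma flux_tri:
  assumes u: "sqi u" and \<theta>: "sqi \<theta>" and m: "\<And>j. pd j \<phi> \<in> borel_measurable tor"
    and B: "\<And>j. AE x in tor. \<bar>pd j \<phi> x\<bar> \<le> B"
  shows "flux u \<theta> \<phi> = (\<Sum>j\<in>UNIV. tri (\<lambda>x. u x $ j) \<theta> (pd j \<phi>))"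
proof -
  have i: "integrable tor (\<lambda>x. u x $ j * \<theta> x * pd j \<phi> x)" for j
    by (rule tri_integrable[OF sqi_nth[OF u] \<theta> m B])
  have "flux u \<theta> \<phi> = (LINT x|tor. u x $ 1 * \<theta> x * pd 1 \<phi> x + u x $ 2 * \<theta> x * pd 2 \<phi> x)"
    unfolding flux_def ip_tor by (simp add: inner_2 grad_def algebra_simps)
  then show ?thesis using i by (simp add: sum_2 tri_def)
qed

lemma L2norm_nth_le: "sqi u \<Longrightarrow> L2norm (\<lambda>x. u x $ i) \<le> L2norm u" for u :: "pt \<Rightarrow> real^2"
  unfolding L2norm_tor
  by (intro real_sqrt_le_mono integral_mono sqi_int2 sqi_nth)
     (auto simp: abs_le_square_iff[symmetric] component_le_norm_cart)

lemma flux_bound: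
  assumes u: "sqi u" and \<theta>: "sqi \<theta>" and m: "\<And>j. pd j \<phi> \<in> borel_measurable tor"
    and B: "\<And>j. AE x in tor. \<bar>pd j \<phi> x\<bar> \<le> B" "0 \<le> B"
  shows "\<bar>flux u \<theta> \<phi>\<bar> \<le> 2 * B * (L2norm u * L2norm \<theta>)"
proof -
  have t: "\<bar>tri (\<lambda>x. u x $ j) \<theta> (pd j \<phi>)\<bar> \<le> B * (L2norm u * L2norm \<theta>)" for j
  proof -
    have "\<bar>tri (\<lambda>x. u x $ j) \<theta> (pd j \<phi>)\<bar> \<le> B * (L2norm (\<lambda>x. u x $ j) * L2norm \<theta>)"
      by (rule tri_bound[OF sqi_nth[OF u] \<theta> m B])
    also have "\<dots> \<le> B * (L2norm u * L2norm \<theta>)"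
      by (intro mult_left_mono mult_right_mono L2norm_nth_le u B) auto
    finally show ?thesis .
  qed
  show ?thesis unfolding flux_tri[OF u \<theta> m B(1)] sum_2 using t[of 1] t[of 2] by simp
qed

lemma pd_cas_bound: "\<bar>pd j (cas l) x\<bar> \<le> 2 * pl l"
proof -
  have "\<bar>2 * pi * kc l j\<bar> \<le> pl l" using exhaust_2[of j] by (auto simp: pl_def kc_simps abs_mult)
  then have "\<bar>2 * pi * kc l j\<bar> * \<bar>cas (- l) x\<bar> \<le> pl l * 2" by (intro mult_mono cas_bound) auto
  then show ?thesis by (simp add: pd_cas abs_mult)
qed

lemma pd_cas_measurable: "pd j (cas l) \<in> borel_measurable tor"
  unfolding pd_cas[abs_def] by (intro borel_measurable_times cas_measurable) auto

lemma flux_cas_bound: "sqi u \<Longrightarrow> sqi \<theta> \<Longrightarrow> \<bar>flux u \<theta> (cas l)\<bar> \<le> 4 * pl l * (L2norm u * L2norm \<theta>)"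
  using flux_bound[of u \<theta> "cas l" "2 * pl l"] pd_cas_bound pd_cas_measurable by simp

lemma hat_nth_inner:
  fixes u :: "pt \<Rightarrow> real^2"
  assumes "sqi u"
  shows "hat (\<lambda>x. u x $ j *\<^sub>R u x) m \<bullet> v = (\<Sum>i\<in>UNIV. tri (\<lambda>x. u x $ j) (\<lambda>x. u x $ i) (cas m) * v $ i)"
proof -
  have i: "integrable tor (\<lambda>x. u x $ j * u x $ i * cas m x)" for i
    by (rule tri_integrable[OF sqi_nth sqi_nth _ AE_I2[OF cas_bound]]) (use assms in auto)
  have "hat (\<lambda>x. u x $ j *\<^sub>R u x) m \<bullet> v = (LINT x|tor. (u x $ j * u x $ 1 * cas m x) * v $ 1 + (u x $ j * u x $ 2 * cas m x) * v $ 2)"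
    by (subst hat_inner[OF integrable_nth_scaleR[OF assms]]) (simp add: hat_def inner_2 algebra_simps)
  also have "\<dots> = (LINT x|tor. u x $ j * u x $ 1 * cas m x) * v $ 1 + (LINT x|tor. u x $ j * u x $ 2 * cas m x) * v $ 2"
    by (subst Bochner_Integration.integral_add) (use i in auto)
  finally show ?thesis by (simp add: sum_2 tri_def)
qed

subsection \<open>Passage to the limit\<close>

text \<open>\<open>N\<close> numbers the approximations: \<open>F N\<close> are the active modes, \<open>\<tau> N\<close> is the time step, and \<open>q N n\<close> and
\<open>th N n\<close> are the velocity coefficients and the temperature after \<open>n\<close> steps.\<close>
locale approx =
  fixes al T R \<Theta> K :: real and F :: "nat \<Rightarrow> (int \<times> int) set" and \<tau> :: "nat \<Rightarrow> real"
    and q :: "nat \<Rightarrow> nat \<Rightarrow> int \<times> int \<Rightarrow> real" and th :: "nat \<Rightarrow> nat \<Rightarrow> pt \<Rightarrow> real"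
    and \<epsilon> :: "nat \<Rightarrow> int \<times> int \<Rightarrow> real"
    and q0 :: "int \<times> int \<Rightarrow> real" and th0 :: "pt \<Rightarrow> real"
  assumes al: "al > 0" and T: "T > 0" and R0: "0 \<le> R" and K0: "0 \<le> K"
    and F: "\<And>N. finite (F N)" "\<And>N. 0 \<notin> F N" "\<And>k. k \<noteq> 0 \<Longrightarrow> \<forall>\<^sub>F N in sequentially. k \<in> F N"
    and \<tau>: "\<And>N. 0 < \<tau> N" "\<tau> \<longlonglongrightarrow> 0"
    and qz: "\<And>N n k. k \<notin> F N \<Longrightarrow> q N n k = 0"
    and qi: "\<And>N k. k \<in> F N \<Longrightarrow> q N 0 k = q0 k" and thi: "\<And>N. th N 0 = th0"
    and qe: "\<And>N n. real n * \<tau> N \<le> T \<Longrightarrow> en al (F N) (q N n) \<le> R\<^sup>2"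
    and qs: "\<And>N n k. k \<in> F N \<Longrightarrow> q N (Suc n) k = q N n k + \<tau> N * (Bk (Uf (F N) (q N n)) (th N n) k / lam al k)"
    and Be: "\<And>N n. real n * \<tau> N \<le> T \<Longrightarrow> en al (F N) (\<lambda>k. Bk (Uf (F N) (q N n)) (th N n) k / lam al k) \<le> K\<^sup>2"
    and th: "\<And>N n. sqi (th N n)" "\<And>N n. L2norm (th N n) \<le> \<Theta>"
    and ths: "\<And>N n l. real n * \<tau> N \<le> T \<Longrightarrow>
        \<bar>hat (th N (Suc n)) l - hat (th N n) l - \<tau> N * flux (Uf (F N) (q N n)) (th N n) (cas l)\<bar> \<le> \<tau> N * \<epsilon> N l"
    and \<epsilon>: "\<And>N l. 0 \<le> \<epsilon> N l" "\<And>l. (\<lambda>N. \<epsilon> N l) \<longlonglongrightarrow> 0" "\<And>N l. \<epsilon> N l \<le> \<epsilon> 0 l"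
    and thb: "\<And>C N n x. (\<And>x. \<bar>th0 x\<bar> \<le> C) \<Longrightarrow> \<bar>th N n x\<bar> \<le> C"
begin

definition ut where "ut N t = Uf (F N) (q N (ix (\<tau> N) t))"
definition tt where "tt N t = th N (ix (\<tau> N) t)"
text \<open>Extension by zero to the inactive modes, so that the recursion for the coefficients
  holds for every \<open>k\<close>.\<close>

definition fB where "fB N n k = (if k \<in> F N then Bk (Uf (F N) (q N n)) (th N n) k / lam al k else 0)"

lemma Theta0: "0 \<le> \<Theta>" using th(2)[of 0 0] L2norm_nonneg order_trans by blast

lemma ixT: "t \<in> {0..T} \<Longrightarrow> real (ix (\<tau> N) t) * \<tau> N \<le> T"
  using ix_bounds(1)[OF \<tau>(1), of t N] by auto

lemma en_mode: "finite G \<Longrightarrow> k \<in> G \<Longrightarrow> en al G g \<le> C\<^sup>2 \<Longrightarrow> 0 \<le> C \<Longrightarrow> \<bar>g k\<bar> \<le> C"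
proof -
  assume G: "finite G" "k \<in> G" "en al G g \<le> C\<^sup>2" "0 \<le> C"
  have "lam al k * (g k)\<^sup>2 \<le> en al G g"
    unfolding en_def by (rule member_le_sum) (use G in \<open>auto intro!: mult_nonneg_nonneg less_imp_le[OF lam_pos]\<close>)
  moreover have "(g k)\<^sup>2 \<le> lam al k * (g k)\<^sup>2" using mult_right_mono[OF lam_ge_1, of "(g k)\<^sup>2" al k] by simp
  ultimately have "(g k)\<^sup>2 \<le> C\<^sup>2" using G(3) by linarith
  then show "\<bar>g k\<bar> \<le> C" using G(4) by (simp add: abs_le_square_iff[symmetric])
qed

lemma q_bound: "real n * \<tau> N \<le> T \<Longrightarrow> \<bar>q N n k\<bar> \<le> R"
  using en_mode[OF F(1) _ qe R0, of k N n] qz[of k N n] R0 by (cases "k \<in> F N") auto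

lemma fB_bound: "real n * \<tau> N \<le> T \<Longrightarrow> \<bar>fB N n k\<bar> \<le> K"
  using en_mode[OF F(1) _ Be K0, of k N n] K0 by (auto simp: fB_def)

lemma q_step_fB: "q N (Suc n) k - q N n k - \<tau> N * fB N n k = 0"
  by (cases "k \<in> F N") (auto simp: fB_def qs qz)

lemma sqi_Uf [simp]: "sqi (Uf G g)" by (simp add: Uf_def)

lemma L2norm_Uf: "real n * \<tau> N \<le> T \<Longrightarrow> L2norm (Uf (F N) (q N n)) \<le> R"
proof -
  assume n: "real n * \<tau> N \<le> T"
  have "(L2norm (Uf (F N) (q N n)))\<^sup>2 \<le> R\<^sup>2" using L2norm_Uf_le[OF F(1), of N "q N n" al] qe[OF n] by linarith
  then show ?thesis by (rule power2_le_imp_le[OF _ R0])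
qed

lemma flux_le: "real n * \<tau> N \<le> T \<Longrightarrow> \<bar>flux (Uf (F N) (q N n)) (th N n) (cas l)\<bar> \<le> 4 * pl l * (R * \<Theta>)"
  by (intro order_trans[OF flux_cas_bound] mult_left_mono mult_mono L2norm_Uf th sqi_Uf R0) auto

lemma th_hat_step: "real n * \<tau> N \<le> T \<Longrightarrow> \<bar>hat (th N (Suc n)) l - hat (th N n) l\<bar> \<le> \<tau> N * (4 * pl l * (R * \<Theta>) + \<epsilon> 0 l)"
proof -
  assume n: "real n * \<tau> N \<le> T"
  have "\<bar>\<tau> N * flux (Uf (F N) (q N n)) (th N n) (cas l)\<bar> \<le> \<tau> N * (4 * pl l * (R * \<Theta>))"
    unfolding abs_mult using flux_le[OF n] \<tau>(1)[of N] by (intro mult_mono) auto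
  moreover have "\<tau> N * \<epsilon> N l \<le> \<tau> N * \<epsilon> 0 l" using \<epsilon>(3) \<tau>(1)[of N] by (intro mult_left_mono) auto
  ultimately show ?thesis using ths[OF n, of l] unfolding distrib_left by linarith
qed

text \<open>Velocity and temperature coefficients in one countable family, so that a single
  subsequence serves both.\<close>

definition yy :: "nat \<Rightarrow> bool \<times> int \<times> int \<Rightarrow> real \<Rightarrow> real" where
  "yy N j t = (if fst j then q N (ix (\<tau> N) t) (snd j) else hat (tt N t) (snd j))"

lemma subsequence:
  "\<exists>r Y. strict_mono r \<and> (\<forall>j. \<forall>t\<in>{0..T}. (\<lambda>N. yy (r N) j t) \<longlonglongrightarrow> Y j t)"
proof -
  define C where "C j = (if fst j then K else 4 * pl (snd j) * (R * \<Theta>) + \<epsilon> 0 (snd j))" for j :: "bool \<times> int \<times> int"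
  have C0: "0 \<le> C j" for j using K0 R0 Theta0 \<epsilon>(1) by (auto simp: C_def)
  have "\<bar>yy N j t\<bar> \<le> max R \<Theta>" if t: "t \<in> {0..T}" for N j t
  proof (cases "fst j")
    case True
    have "\<bar>q N (ix (\<tau> N) t) (snd j)\<bar> \<le> R" by (rule q_bound[OF ixT[OF t]])
    then show ?thesis using True by (simp add: yy_def)
  next
    case False
    have "norm (hat (tt N t) (snd j)) \<le> \<Theta>" unfolding tt_def by (rule order_trans[OF norm_hat_le[OF th(1)] th(2)])
    then show ?thesis using False by (simp add: yy_def)
  qed
  moreover have "\<bar>yy N j t - yy N j s\<bar> \<le> C j * (\<bar>t - s\<bar> + \<tau> N)" if "0 \<le> s" "s \<le> t" "t \<le> T" for N j s t
  proof (cases "fst j")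
    case True
    have "\<bar>q N (ix (\<tau> N) t) (snd j) - q N (ix (\<tau> N) s) (snd j)\<bar> \<le> K * (\<bar>t - s\<bar> + \<tau> N)"
    proof (rule step_lipschitz[where x="\<lambda>n. q N n (snd j)" and T=T, OF \<tau>(1) _ K0 that])
      fix n assume n: "real n * \<tau> N \<le> T"
      have "q N (Suc n) (snd j) - q N n (snd j) = \<tau> N * fB N n (snd j)" using q_step_fB[of N n "snd j"] by simp
      then show "\<bar>q N (Suc n) (snd j) - q N n (snd j)\<bar> \<le> \<tau> N * K"
        using fB_bound[OF n, of "snd j"] \<tau>(1)[of N] by (simp add: abs_mult)
    qed
    then show ?thesis using True by (simp add: yy_def C_def)
  next
    case False
    have "\<bar>hat (th N (ix (\<tau> N) t)) (snd j) - hat (th N (ix (\<tau> N) s)) (snd j)\<bar> \<le> (4 * pl (snd j) * (R * \<Theta>) + \<epsilon> 0 (snd j)) * (\<bar>t - s\<bar> + \<tau> N)"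
      by (rule step_lipschitz[where x="\<lambda>n. hat (th N n) (snd j)" and T=T, OF \<tau>(1) th_hat_step _ that])
         (use R0 Theta0 \<epsilon>(1) in auto)
    then show ?thesis using False by (simp add: yy_def tt_def C_def)
  qed
  ultimately show ?thesis
  proof (rule compactness[where y=yy and B="max R \<Theta>" and C=C and \<tau>=\<tau>, OF T _ _ C0 \<tau>(2)])
    fix r Y
    assume 1: "strict_mono (r :: nat \<Rightarrow> nat)" and 2: "\<And>j t. t \<in> {0..T} \<Longrightarrow> (\<lambda>N. yy (r N) j t) \<longlonglongrightarrow> Y j t"
    show ?thesis by (rule exI[of _ r], rule exI[of _ Y]) (use 1 2 in simp)
  qed
qed

text \<open>The subsequence is fixed once by choice, so that all limit objects of the locale refer
  to the same one.\<close>

definition rr :: "nat \<Rightarrow> nat" where "rr = (SOME r. \<exists>Y. strict_mono r \<and> (\<forall>j. \<forall>t\<in>{0..T}. (\<lambda>N. yy (r N) j t) \<longlonglongrightarrow> Y j t))"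
definition QQ where "QQ t k = lim (\<lambda>N. yy (rr N) (True, k) t)"
definition HH where "HH t k = lim (\<lambda>N. yy (rr N) (False, k) t)"

lemma rr_props: "strict_mono rr" "\<And>j t. t \<in> {0..T} \<Longrightarrow> convergent (\<lambda>N. yy (rr N) j t)"
proof -
  have "\<exists>Y. strict_mono rr \<and> (\<forall>j. \<forall>t\<in>{0..T}. (\<lambda>N. yy (rr N) j t) \<longlonglongrightarrow> Y j t)"
    unfolding rr_def by (rule someI_ex[OF subsequence])
  then show "strict_mono rr" "\<And>j t. t \<in> {0..T} \<Longrightarrow> convergent (\<lambda>N. yy (rr N) j t)"
    unfolding convergent_def by blast+
qed

lemma QQ_lim: "t \<in> {0..T} \<Longrightarrow> (\<lambda>N. q (rr N) (ix (\<tau> (rr N)) t) k) \<longlonglongrightarrow> QQ t k"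
  using rr_props(2)[of t "(True, k)"] unfolding QQ_def by (simp add: convergent_LIMSEQ_iff yy_def)

lemma HH_lim: "t \<in> {0..T} \<Longrightarrow> (\<lambda>N. hat (tt (rr N) t) k) \<longlonglongrightarrow> HH t k"
  using rr_props(2)[of t "(False, k)"] unfolding HH_def by (simp add: convergent_LIMSEQ_iff yy_def)

lemma tau_rr: "(\<lambda>N. \<tau> (rr N)) \<longlonglongrightarrow> 0"
  using LIMSEQ_subseq_LIMSEQ[OF \<tau>(2) rr_props(1)] by (simp add: o_def)

lemma rr_at_top: "filterlim rr at_top sequentially" by (rule filterlim_subseq[OF rr_props(1)])

lemma en_outside:
  assumes "finite G" "\<And>k. k \<notin> F N \<Longrightarrow> g k = 0" shows "en al G g \<le> en al (F N) g"
proof -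
  have "en al G g = (\<Sum>k\<in>G \<inter> F N. lam al k * (g k)\<^sup>2)"
    unfolding en_def by (rule sum.mono_neutral_right) (use assms in auto)
  also have "\<dots> \<le> en al (F N) g"
    unfolding en_def by (intro sum_mono2 F) (auto intro!: mult_nonneg_nonneg less_imp_le[OF lam_pos])
  finally show ?thesis .
qed

lemma en_limit:
  assumes "finite G" "\<And>k. (\<lambda>N. g N k) \<longlonglongrightarrow> g0 k" "c \<longlonglongrightarrow> c0" "\<And>N. en al G (g N) \<le> c N"
  shows "en al G g0 \<le> c0"
proof (rule LIMSEQ_le[OF _ assms(3)])
  show "(\<lambda>N. en al G (g N)) \<longlonglongrightarrow> en al G g0" unfolding en_def by (intro tendsto_intros assms)
qed (use assms in auto)

lemma QQ_en: assumes "t \<in> {0..T}" "finite G" shows "en al G (QQ t) \<le> R\<^sup>2"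
  by (rule en_limit[OF assms(2) QQ_lim[OF assms(1)] tendsto_const])
     (rule order_trans[OF en_outside[OF assms(2) qz] qe[OF ixT[OF assms(1)]]])

lemma en_sqrt_triangle: "sqrt (en al G (\<lambda>k. f k + g k)) \<le> sqrt (en al G f) + sqrt (en al G g)"
proof -
  have e: "sqrt (en al G h) = L2_set (\<lambda>k. sqrt (lam al k) * h k) G" for h
    unfolding en_def L2_set_def by (simp add: power_mult_distrib less_imp_le[OF lam_pos])
  show ?thesis unfolding e using L2_set_triangle_ineq[of "\<lambda>k. sqrt (lam al k) * f k" "\<lambda>k. sqrt (lam al k) * g k" G]
    by (simp add: distrib_left)
qed

lemma en_scale: "en al G (\<lambda>k. c * g k) = c\<^sup>2 * en al G g"
  unfolding en_def by (simp add: sum_distrib_left power_mult_distrib mult_ac)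

text \<open>Increments are measured in the energy norm, not coefficient by coefficient: the bound
  does not depend on the number of modes, as continuity in time with values in V requires.\<close>

lemma q_diff_en:
  assumes "real (m + d) * \<tau> N \<le> T" shows "sqrt (en al (F N) (\<lambda>k. q N (m + d) k - q N m k)) \<le> real d * \<tau> N * K"
  using assms
proof (induction d)
  case 0 then show ?case by (simp add: en_def)
next
  case (Suc d)
  have n: "real (m + d) * \<tau> N \<le> T" using Suc(2) \<tau>(1)[of N] by (simp add: algebra_simps)
  have e: "q N (m + Suc d) k - q N m k = (q N (m + d) k - q N m k) + \<tau> N * fB N (m + d) k" for k
    using q_step_fB[of N "m + d" k] by simp
  have "en al (F N) (fB N (m + d)) = en al (F N) (\<lambda>k. Bk (Uf (F N) (q N (m + d))) (th N (m + d)) k / lam al k)"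
    unfolding en_def fB_def by (intro sum.cong) auto
  then have "en al (F N) (fB N (m + d)) \<le> K\<^sup>2" using Be[OF n] by simp
  then have "sqrt (en al (F N) (\<lambda>k. \<tau> N * fB N (m + d) k)) \<le> \<tau> N * K"
    unfolding en_scale real_sqrt_mult using \<tau>(1)[of N] K0 by (intro mult_mono) (auto simp: real_le_lsqrt en_nonneg)
  then show ?case unfolding e using en_sqrt_triangle[of "F N" "\<lambda>k. q N (m + d) k - q N m k" "\<lambda>k. \<tau> N * fB N (m + d) k"] Suc(1)[OF n]
    by (simp add: algebra_simps)
qed

text \<open>Only finitely many modes are compared at a time, which allows the passage to the limit.
  Uniformity in \<open>G\<close> later gives Lipschitz continuity in H^1.\<close>

lemma QQ_lipschitz:
  assumes st: "0 \<le> s" "s \<le> t" "t \<le> T" and G: "finite G"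
  shows "en al G (\<lambda>k. QQ t k - QQ s k) \<le> (K * (t - s))\<^sup>2"
proof -
  have "en al G (\<lambda>k. QQ t k - QQ s k) \<le> (K * (t - s + 0))\<^sup>2"
  proof (rule en_limit[OF G])
    show "(\<lambda>N. q (rr N) (ix (\<tau> (rr N)) t) k - q (rr N) (ix (\<tau> (rr N)) s) k) \<longlonglongrightarrow> QQ t k - QQ s k" for k
      by (intro tendsto_diff QQ_lim) (use st in auto)
    show "(\<lambda>N. (K * (t - s + \<tau> (rr N)))\<^sup>2) \<longlonglongrightarrow> (K * (t - s + 0))\<^sup>2"
      by (intro tendsto_intros tau_rr)
    fix N
    define M where "M = rr N"
    define m n where "m = ix (\<tau> M) s" and "n = ix (\<tau> M) t"
    have mn: "m \<le> n" unfolding m_def n_def by (rule ix_mono[OF \<tau>(1) st(2)])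
    have b: "real n * \<tau> M \<le> t" "s < (real m + 1) * \<tau> M"
      using ix_bounds[OF \<tau>(1), of s M] ix_bounds[OF \<tau>(1), of t M] st by (auto simp: m_def n_def)
    obtain d where d: "n = m + d" using mn le_Suc_ex by blast
    have "sqrt (en al (F M) (\<lambda>k. q M n k - q M m k)) \<le> real d * \<tau> M * K"
      unfolding d by (rule q_diff_en) (use b st d in auto)
    also have "\<dots> \<le> (t - s + \<tau> M) * K"
    proof (rule mult_right_mono[OF _ K0])
      have "real d * \<tau> M = real n * \<tau> M - real m * \<tau> M" by (simp add: d algebra_simps)
      also have "\<dots> \<le> t - s + \<tau> M" using b by (simp add: algebra_simps)
      finally show "real d * \<tau> M \<le> t - s + \<tau> M" .
    qed
    finally have "sqrt (en al (F M) (\<lambda>k. q M n k - q M m k)) \<le> K * (t - s + \<tau> M)" by (simp add: mult.commute)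
    then have "(sqrt (en al (F M) (\<lambda>k. q M n k - q M m k)))\<^sup>2 \<le> (K * (t - s + \<tau> M))\<^sup>2"
      by (rule power_mono) (simp add: en_nonneg)
    then have "en al (F M) (\<lambda>k. q M n k - q M m k) \<le> (K * (t - s + \<tau> M))\<^sup>2" by (simp add: en_nonneg)
    then show "en al G (\<lambda>k. q (rr N) (ix (\<tau> (rr N)) t) k - q (rr N) (ix (\<tau> (rr N)) s) k) \<le> (K * (t - s + \<tau> (rr N)))\<^sup>2"
      using en_outside[OF G, of M "\<lambda>k. q M n k - q M m k"] qz unfolding m_def n_def M_def by simp
  qed
  then show ?thesis by simp
qed

lemma summable_of_bx:
  assumes "\<And>k. 0 \<le> (f k :: real)" "\<And>G. finite G \<Longrightarrow> sum f G \<le> C" shows "f summable_on (UNIV :: (int \<times> int) set)"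
  by (rule nonneg_bdd_above_summable_on) (use assms in \<open>auto intro!: bdd_aboveI[of _ C]\<close>)

section \<open>Limit functions rebuilt from their coefficients\<close>

definition is_u where "is_u t v \<longleftrightarrow> v \<in> borel_measurable borel \<and> periodic2 v \<and> sqi v \<and> hat v = (\<lambda>k. QQ t k *\<^sub>R Ev k)"
text \<open>A representative is chosen for each time separately, so nothing is known about joint
  measurability in time and space; dependence on time is always accessed through coefficients, norms
  and pairings.\<close>

definition uu where "uu t = (SOME v. is_u t v)"
definition is_th where "is_th t v \<longleftrightarrow> v \<in> borel_measurable borel \<and> periodic2 v \<and> sqi v \<and> hat v = HH t"
definition tth where "tth t = (SOME v. is_th t v)"

lemma sum_QQ_le: "t \<in> {0..T} \<Longrightarrow> finite G \<Longrightarrow> (\<Sum>k\<in>G. (norm (QQ t k *\<^sub>R Ev k))\<^sup>2) \<le> R\<^sup>2"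
proof -
  assume t: "t \<in> {0..T}" and G: "finite G"
  have "(\<Sum>k\<in>G. (norm (QQ t k *\<^sub>R Ev k))\<^sup>2) \<le> en al G (QQ t)"
    using L2norm_Uf_le[OF G, of "QQ t" al] unfolding Uf_def L2norm_Psum[OF G] .
  then show ?thesis using QQ_en[OF t G] by linarith
qed

lemma uu: assumes t: "t \<in> {0..T}"
  shows "uu t \<in> borel_measurable borel" "periodic2 (uu t)" "sqi (uu t)" "hat (uu t) k = QQ t k *\<^sub>R Ev k"
proof -
  have "(\<lambda>k. (norm (QQ t k *\<^sub>R Ev k))\<^sup>2) summable_on UNIV"
    by (rule summable_of_bx[OF zero_le_power2 sum_QQ_le[OF t]])
  from riesz_fischer_ex[OF this] have "\<exists>v. is_u t v" unfolding is_u_def .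
  then have "is_u t (uu t)" unfolding uu_def by (rule someI_ex)
  then show "uu t \<in> borel_measurable borel" "periodic2 (uu t)" "sqi (uu t)" "hat (uu t) k = QQ t k *\<^sub>R Ev k"
    by (auto simp: is_u_def)
qed

lemma sum_HH_le: "t \<in> {0..T} \<Longrightarrow> finite G \<Longrightarrow> (\<Sum>k\<in>G. (norm (HH t k))\<^sup>2) \<le> \<Theta>\<^sup>2"
proof -
  assume t: "t \<in> {0..T}" and G: "finite G"
  show ?thesis
  proof (rule LIMSEQ_le_const2)
    show "(\<lambda>N. \<Sum>k\<in>G. (norm (hat (tt (rr N) t) k))\<^sup>2) \<longlonglongrightarrow> (\<Sum>k\<in>G. (norm (HH t k))\<^sup>2)"
      by (intro tendsto_intros HH_lim t)
    have "(\<Sum>k\<in>G. (norm (hat (tt (rr N) t) k))\<^sup>2) \<le> \<Theta>\<^sup>2" for N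
      unfolding tt_def by (rule order_trans[OF bessel[OF th(1) G] power_mono[OF th(2) L2norm_nonneg]])
    then show "\<exists>M. \<forall>N\<ge>M. (\<Sum>k\<in>G. (norm (hat (tt (rr N) t) k))\<^sup>2) \<le> \<Theta>\<^sup>2" by blast
  qed
qed

lemma tth: assumes t: "t \<in> {0..T}"
  shows "tth t \<in> borel_measurable borel" "periodic2 (tth t)" "sqi (tth t)" "hat (tth t) k = HH t k"
proof -
  have "(\<lambda>k. (norm (HH t k))\<^sup>2) summable_on UNIV"
    by (rule summable_of_bx[OF zero_le_power2 sum_HH_le[OF t]])
  from riesz_fischer_ex[OF this] have "\<exists>v. is_th t v" unfolding is_th_def .
  then have "is_th t (tth t)" unfolding tth_def by (rule someI_ex)
  then show "tth t \<in> borel_measurable borel" "periodic2 (tth t)" "sqi (tth t)" "hat (tth t) k = HH t k"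
    by (auto simp: is_th_def)
qed

lemma tth_norm: assumes t: "t \<in> {0..T}" shows "L2norm (tth t) \<le> \<Theta>"
proof (rule power2_le_imp_le[OF _ Theta0])
  show "(L2norm (tth t))\<^sup>2 \<le> \<Theta>\<^sup>2"
    by (rule L2norm_le_of_hat[OF tth(3)[OF t]]) (unfold tth(4)[OF t], rule sum_HH_le[OF t finite_bx])
qed

lemma uu_norm: assumes t: "t \<in> {0..T}" shows "L2norm (uu t) \<le> R"
proof (rule power2_le_imp_le[OF _ R0])
  show "(L2norm (uu t))\<^sup>2 \<le> R\<^sup>2"
    by (rule L2norm_le_of_hat[OF uu(3)[OF t]]) (unfold uu(4)[OF t], rule sum_QQ_le[OF t finite_bx])
qed

lemma hat_ut: "hat (ut N t) k = q N (ix (\<tau> N) t) k *\<^sub>R Ev k"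
  unfolding ut_def Uf_def using F(1) by (auto simp: hat_Psum qz)

lemma sum_nk_en:
  "finite G \<Longrightarrow> (\<Sum>k\<in>G. nk k * (norm (g k *\<^sub>R Ev k))\<^sup>2) \<le> en al G g / (4 * pi\<^sup>2 * al\<^sup>2)"
proof -
  assume "finite G"
  have "(\<Sum>k\<in>G. nk k * (norm (g k *\<^sub>R Ev k))\<^sup>2) \<le> (\<Sum>k\<in>G. lam al k * (g k)\<^sup>2 / (4 * pi\<^sup>2 * al\<^sup>2))"
  proof (rule sum_mono)
    fix k
    have "nk k * (norm (g k *\<^sub>R Ev k))\<^sup>2 \<le> nk k * (g k)\<^sup>2" by (intro mult_left_mono) (auto simp: norm_Ev)
    moreover have "nk k \<le> lam al k / (4 * pi\<^sup>2 * al\<^sup>2)" using al by (simp add: lam_def field_simps)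
    then have "nk k * (g k)\<^sup>2 \<le> lam al k / (4 * pi\<^sup>2 * al\<^sup>2) * (g k)\<^sup>2" by (rule mult_right_mono) simp
    ultimately show "nk k * (norm (g k *\<^sub>R Ev k))\<^sup>2 \<le> lam al k * (g k)\<^sup>2 / (4 * pi\<^sup>2 * al\<^sup>2)" by simp
  qed
  then show ?thesis by (simp add: en_def sum_divide_distrib)
qed

lemma ut_strong:
  assumes t: "t \<in> {0..T}" shows "(\<lambda>N. L2norm (\<lambda>x. ut (rr N) t x - uu t x)) \<longlonglongrightarrow> 0"
proof (rule strong_convergence[where R="R\<^sup>2 / (4 * pi\<^sup>2 * al\<^sup>2)"])
  show "sqi (ut (rr N) t)" for N by (simp add: ut_def)
  show "sqi (uu t)" by (rule uu[OF t])
  have p: "0 \<le> 4 * pi\<^sup>2 * al\<^sup>2" by simp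
  show "(\<Sum>k\<in>bx n. nk k * (norm (hat (ut (rr N) t) k))\<^sup>2) \<le> R\<^sup>2 / (4 * pi\<^sup>2 * al\<^sup>2)" for N n
    unfolding hat_ut
    by (rule order_trans[OF sum_nk_en[OF finite_bx] divide_right_mono[OF order_trans[OF en_outside[OF finite_bx qz] qe[OF ixT[OF t]]] p]])
  show "(\<Sum>k\<in>bx n. nk k * (norm (hat (uu t) k))\<^sup>2) \<le> R\<^sup>2 / (4 * pi\<^sup>2 * al\<^sup>2)" for n
    unfolding uu(4)[OF t]
    by (rule order_trans[OF sum_nk_en[OF finite_bx] divide_right_mono[OF QQ_en[OF t finite_bx] p]])
  show "(\<lambda>N. hat (ut (rr N) t) k) \<longlonglongrightarrow> hat (uu t) k" for k
    unfolding hat_ut uu(4)[OF t] by (intro tendsto_scaleR QQ_lim[OF t] tendsto_const)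
qed

lemma L2norm_ut: "t \<in> {0..T} \<Longrightarrow> L2norm (ut N t) \<le> R"
  unfolding ut_def by (rule L2norm_Uf[OF ixT])

lemma tt_weak:
  assumes t: "t \<in> {0..T}" and g: "sqi g" shows "(\<lambda>N. ip (tt (rr N) t) g) \<longlonglongrightarrow> ip (tth t) g"
  by (rule weak_convergence[where R=\<Theta>])
     (auto simp: tth[OF t] g tt_def th intro: HH_lim[OF t, unfolded tt_def])

end

section \<open>Convergence of the quadratic terms\<close>

lemma strong_nth:
  fixes f :: "'i \<Rightarrow> pt \<Rightarrow> real^2"
  assumes "\<And>i. sqi (f i)" "sqi f0" "((\<lambda>i. L2norm (\<lambda>x. f i x - f0 x)) \<longlongrightarrow> 0) G"
  shows "((\<lambda>i. L2norm (\<lambda>x. f i x $ j - f0 x $ j)) \<longlongrightarrow> 0) G"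
proof (rule Lim_null_comparison[OF _ assms(3)])
  show "\<forall>\<^sub>F i in G. norm (L2norm (\<lambda>x. f i x $ j - f0 x $ j)) \<le> L2norm (\<lambda>x. f i x - f0 x)"
    using L2norm_nth_le[OF sqi_diff[OF assms(1,2)], of _ j] by (intro always_eventually) simp
qed

lemma strong_imp_weak:
  fixes f :: "'i \<Rightarrow> pt \<Rightarrow> real"
  assumes f: "\<And>i. sqi (f i)" "sqi f0" "((\<lambda>i. L2norm (\<lambda>x. f i x - f0 x)) \<longlongrightarrow> 0) G" and g: "sqi g"
  shows "((\<lambda>i. ip (f i) g) \<longlongrightarrow> ip f0 g) G"
proof (rule LIM_zero_cancel, rule Lim_null_comparison)
  show "\<forall>\<^sub>F i in G. norm (ip (f i) g - ip f0 g) \<le> L2norm (\<lambda>x. f i x - f0 x) * L2norm g"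
    using ip_cauchy_schwarz[OF sqi_diff[OF f(1,2)] g]
    by (intro always_eventually allI) (simp add: ip_diff_left[OF f(1,2) g, symmetric])
  show "((\<lambda>i. L2norm (\<lambda>x. f i x - f0 x) * L2norm g) \<longlongrightarrow> 0) G"
    using tendsto_mult[OF f(3) tendsto_const, of "L2norm g"] by simp
qed

lemma conv_tri_converges:
  fixes u :: "'i \<Rightarrow> pt \<Rightarrow> real^2"
  assumes u: "\<And>i. sqi (u i)" "sqi u0" and us: "((\<lambda>i. L2norm (\<lambda>x. u i x - u0 x)) \<longlongrightarrow> 0) G" and ub: "\<And>i. L2norm (u i) \<le> R"
    and h: "h \<in> borel_measurable tor" "\<And>x. x \<in> cell \<Longrightarrow> \<bar>h x\<bar> \<le> B"
  shows "((\<lambda>i. tri (\<lambda>x. u i x $ a) (\<lambda>x. u i x $ b) h) \<longlongrightarrow> tri (\<lambda>x. u0 x $ a) (\<lambda>x. u0 x $ b) h) G"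
proof (rule tri_converges[OF _ _ _ _ h strong_nth[OF u us], where R=R])
  show "L2norm (\<lambda>x. u i x $ b) \<le> R" for i by (rule order_trans[OF L2norm_nth_le[OF u(1)] ub])
  show "((\<lambda>i. ip (\<lambda>x. u i x $ b) \<phi>) \<longlongrightarrow> ip (\<lambda>x. u0 x $ b) \<phi>) G" if "sqi \<phi>" for \<phi>
    by (rule strong_imp_weak[OF _ _ strong_nth[OF u us] that]) (auto intro: sqi_nth u)
qed (auto intro: sqi_nth u)

lemma Bk_converges:
  fixes u :: "'i \<Rightarrow> pt \<Rightarrow> real^2" and \<theta> :: "'i \<Rightarrow> pt \<Rightarrow> real"
  assumes u: "\<And>i. sqi (u i)" "sqi u0" and us: "((\<lambda>i. L2norm (\<lambda>x. u i x - u0 x)) \<longlongrightarrow> 0) G" and ub: "\<And>i. L2norm (u i) \<le> R"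
    and \<theta>: "((\<lambda>i. hat (\<theta> i) k) \<longlongrightarrow> hat \<theta>0 k) G"
  shows "((\<lambda>i. Bk (u i) (\<theta> i) k) \<longlongrightarrow> Bk u0 \<theta>0 k) G"
  unfolding Bk_def hat_nth_inner[OF u(1)] hat_nth_inner[OF u(2)]
  by (intro tendsto_add tendsto_sum tendsto_mult tendsto_const \<theta> conv_tri_converges[OF u us ub cas_measurable(1) cas_bound])

lemma flux_converges:
  fixes u :: "'i \<Rightarrow> pt \<Rightarrow> real^2" and \<theta> :: "'i \<Rightarrow> pt \<Rightarrow> real"
  assumes u: "\<And>i. sqi (u i)" "sqi u0" and us: "((\<lambda>i. L2norm (\<lambda>x. u i x - u0 x)) \<longlongrightarrow> 0) G"
    and \<theta>: "\<And>i. sqi (\<theta> i)" "sqi \<theta>0" "\<And>i. L2norm (\<theta> i) \<le> R" "\<And>g. sqi g \<Longrightarrow> ((\<lambda>i. ip (\<theta> i) g) \<longlongrightarrow> ip \<theta>0 g) G"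
    and h: "\<And>j. pd j \<phi> \<in> borel_measurable tor" "\<And>j x. x \<in> cell \<Longrightarrow> \<bar>pd j \<phi> x\<bar> \<le> B"
  shows "((\<lambda>i. flux (u i) (\<theta> i) \<phi>) \<longlongrightarrow> flux u0 \<theta>0 \<phi>) G"
proof -
  have h': "AE x in tor. \<bar>pd j \<phi> x\<bar> \<le> B" for j by (intro AE_I2 h) simp
  show ?thesis
    unfolding flux_tri[OF u(1) \<theta>(1) h(1) h'] flux_tri[OF u(2) \<theta>(2) h(1) h']
    by (intro tendsto_sum tri_converges[OF _ _ \<theta>(1,2) h strong_nth[OF u us] \<theta>(3,4)] sqi_nth u)
qed

context approx
begin

lemma flux_lim:
  assumes t: "t \<in> {0..T}" shows "(\<lambda>N. flux (ut (rr N) t) (tt (rr N) t) (cas l)) \<longlonglongrightarrow> flux (uu t) (tth t) (cas l)"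
  by (rule flux_converges[where R=\<Theta> and B="2 * pl l"])
     (auto simp: ut_def tt_def th tth[OF t] uu[OF t] pd_cas_measurable pd_cas_bound
       intro: tt_weak[OF t, unfolded tt_def] ut_strong[OF t, unfolded ut_def])

lemma fB_lim:
  assumes t: "t \<in> {0..T}" shows "(\<lambda>N. fB (rr N) (ix (\<tau> (rr N)) t) k) \<longlonglongrightarrow> Bk (uu t) (tth t) k / lam al k"
proof (cases "k = 0")
  case True
  \<comment> \<open>Mode zero is never active, and in the limit its term vanishes because both the
    frequency and \<open>Ev 0\<close> are zero.\<close>
  then have "fB N n k = 0" for N n using F(2) by (simp add: fB_def)
  moreover have "Bk (uu t) (tth t) k = 0" using True by (simp add: Bk_def kc_simps)
  ultimately show ?thesis by simp
next
  case False
  have B: "(\<lambda>N. Bk (ut (rr N) t) (tt (rr N) t) k) \<longlonglongrightarrow> Bk (uu t) (tth t) k"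
    by (rule Bk_converges[where R=R])
       (use HH_lim[OF t] ut_strong[OF t] L2norm_ut[OF t] uu[OF t] tth[OF t] in \<open>auto simp: ut_def\<close>)
  have "\<forall>\<^sub>F N in sequentially. k \<in> F (rr N)"
    using F(3)[OF False] rr_at_top by (auto simp: filterlim_iff)
  then have "\<forall>\<^sub>F N in sequentially. Bk (ut (rr N) t) (tt (rr N) t) k / lam al k = fB (rr N) (ix (\<tau> (rr N)) t) k"
    by eventually_elim (simp add: fB_def ut_def tt_def)
  moreover have "(\<lambda>N. Bk (ut (rr N) t) (tt (rr N) t) k / lam al k) \<longlonglongrightarrow> Bk (uu t) (tth t) k / lam al k"
    by (intro tendsto_divide B tendsto_const) (use lam_pos[of al k] in simp)
  ultimately show ?thesis by (simp add: tendsto_cong)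
qed

lemma u_equation:
  assumes t: "t \<in> {0..T}" shows "QQ t k - QQ 0 k = integral {0..t} (\<lambda>s. Bk (uu s) (tth s) k / lam al k)"
proof (rule euler_limit[where \<tau>="\<lambda>N. \<tau> (rr N)" and e="\<lambda>N. 0" and x="\<lambda>N n. q (rr N) n k" and f="\<lambda>N n. fB (rr N) n k" and K=K and T=T])
  show "\<bar>q (rr N) (Suc n) k - q (rr N) n k - \<tau> (rr N) * fB (rr N) n k\<bar> \<le> \<tau> (rr N) * 0" for N n
    by (simp only: q_step_fB)
qed (use \<tau> tau_rr QQ_lim fB_lim t fB_bound in auto)

lemma theta_equation:
  assumes t: "t \<in> {0..T}" shows "HH t l - HH 0 l = integral {0..t} (\<lambda>s. flux (uu s) (tth s) (cas l))"
proof (rule euler_limit[where \<tau>="\<lambda>N. \<tau> (rr N)" and e="\<lambda>N. \<epsilon> (rr N) l" and x="\<lambda>N n. hat (th (rr N) n) l"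
      and f="\<lambda>N n. flux (Uf (F (rr N)) (q (rr N) n)) (th (rr N) n) (cas l)" and K="4 * pl l * (R * \<Theta>)" and T=T])
  show "(\<lambda>N. \<epsilon> (rr N) l) \<longlonglongrightarrow> 0"
    using LIMSEQ_subseq_LIMSEQ[OF \<epsilon>(2) rr_props(1), of l] by (simp add: o_def)
qed (use \<tau> tau_rr \<epsilon> ths flux_le t HH_lim[unfolded tt_def] flux_lim[unfolded tt_def ut_def] in auto)

lemma W_en:
  assumes t: "t \<in> {0..T}" and G: "finite G" shows "en al G (\<lambda>k. Bk (uu t) (tth t) k / lam al k) \<le> K\<^sup>2"
proof (rule en_limit[OF G fB_lim[OF t] tendsto_const])
  fix N
  have "en al (F (rr N)) (fB (rr N) (ix (\<tau> (rr N)) t)) = en al (F (rr N)) (\<lambda>k. Bk (Uf (F (rr N)) (q (rr N) (ix (\<tau> (rr N)) t))) (th (rr N) (ix (\<tau> (rr N)) t)) k / lam al k)"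
    unfolding en_def fB_def by (intro sum.cong) auto
  also have "\<dots> \<le> K\<^sup>2" by (rule Be[OF ixT[OF t]])
  finally show "en al G (fB (rr N) (ix (\<tau> (rr N)) t)) \<le> K\<^sup>2"
    using en_outside[OF G, of "rr N" "fB (rr N) (ix (\<tau> (rr N)) t)"] by (simp add: fB_def)
qed

lemma QQ_0: assumes "k \<noteq> 0" shows "QQ 0 k = q0 k"
proof -
  have "\<forall>\<^sub>F N in sequentially. k \<in> F (rr N)"
    using F(3)[OF assms] rr_at_top by (auto simp: filterlim_iff)
  then have "\<forall>\<^sub>F N in sequentially. q (rr N) (ix (\<tau> (rr N)) 0) k = q0 k"
    by eventually_elim (simp add: ix_def qi)
  then have "(\<lambda>N. q (rr N) (ix (\<tau> (rr N)) 0) k) \<longlonglongrightarrow> q0 k" by (rule tendsto_eventually)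
  then show ?thesis using QQ_lim[of 0 k] T LIMSEQ_unique by fastforce
qed

lemma HH_0: "HH 0 l = hat th0 l"
proof -
  have "hat (tt N 0) l = hat th0 l" for N by (simp add: tt_def ix_def thi)
  then show ?thesis using HH_lim[of 0 l] T by (simp add: LIMSEQ_const_iff)
qed

text \<open>A one-sided bound survives weak convergence: the limit is tested against the signed
  indicator of the very set on which it would exceed \<open>C\<close>. The resulting nonnegative
  integrand has nonpositive integral, so the set is null.\<close>

lemma tth_sup:
  assumes t: "t \<in> {0..T}" and C: "\<And>x. \<bar>th0 x\<bar> \<le> C" shows "AE x in tor. \<bar>tth t x\<bar> \<le> C"
proof -
  have m: "tth t \<in> borel_measurable tor" by (rule sqi_meas[OF tth(3)[OF t]])
  have one: "AE x in tor. s * tth t x \<le> C" if s: "\<bar>s\<bar> = 1" for s :: real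
  proof -
    define A where "A = {x \<in> space tor. s * tth t x > C}"
    have A: "A \<in> sets tor" unfolding A_def using m by measurable
    define g where "g x = s * indicator A x" for x :: pt
    have gm: "g \<in> borel_measurable tor" unfolding g_def using A by measurable
    have g: "sqi g" by (rule sqi_bounded[OF gm, of 1]) (auto simp: g_def indicator_def s)
    have iA: "sqi (indicator A :: pt \<Rightarrow> real)" by (rule sqi_bounded[of _ 1]) (use A in \<open>auto simp: indicator_def\<close>)
    have "ip (tth t) g \<le> (LINT x|tor. C * indicator A x)"
    proof (rule LIMSEQ_le_const2[OF tt_weak[OF t g]])
      have "ip (tt (rr N) t) g \<le> (LINT x|tor. C * indicator A x)" for N
        unfolding ip_tor
      proof (rule integral_mono)
        show "integrable tor (\<lambda>x. tt (rr N) t x \<bullet> g x)" unfolding tt_def by (rule integrable_inner[OF th(1) g])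
        show "integrable tor (\<lambda>x. C * indicator A x)" by (intro integrable_mult_right sqi_integrable iA)
        fix x
        have "\<bar>tt (rr N) t x\<bar> \<le> C" unfolding tt_def by (rule thb[OF C])
        then have "s * tt (rr N) t x \<le> C" using s by (auto simp: abs_if split: if_splits)
        then show "tt (rr N) t x \<bullet> g x \<le> C * indicator A x" by (auto simp: g_def indicator_def mult.commute)
      qed
      then show "\<exists>M. \<forall>N\<ge>M. ip (tt (rr N) t) g \<le> (LINT x|tor. C * indicator A x)" by blast
    qed
    then have "(LINT x|tor. tth t x * g x - C * indicator A x) \<le> 0"
      using integrable_inner[OF tth(3)[OF t] g] sqi_integrable[OF iA] by (simp add: ip_tor)
    moreover have n: "0 \<le> tth t x * g x - C * indicator A x" for x
      by (auto simp: g_def indicator_def A_def mult.commute)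
    moreover have i: "integrable tor (\<lambda>x. tth t x * g x - C * indicator A x)"
      using integrable_inner[OF tth(3)[OF t] g] sqi_integrable[OF iA] by simp
    moreover have "0 \<le> (LINT x|tor. tth t x * g x - C * indicator A x)"
      by (rule integral_nonneg_AE) (use n in auto)
    ultimately have "(LINT x|tor. tth t x * g x - C * indicator A x) = 0" by linarith
    then have "AE x in tor. tth t x * g x - C * indicator A x = 0"
      by (subst (asm) integral_nonneg_eq_0_iff_AE[OF i]) (use n in auto)
    then show ?thesis
      by (rule AE_mp) (auto intro!: AE_I2 simp: g_def A_def indicator_def mult.commute split: if_splits)
  qed
  have "AE x in tor. 1 * tth t x \<le> C" by (rule one) simp
  moreover have "AE x in tor. (-1) * tth t x \<le> C" by (rule one) simp
  ultimately show ?thesis by eventually_elim auto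
qed

end

subsection \<open>Existence of approximations\<close>

lemma approx_exists:
  assumes al: "al > 0" and T: "T > 0"
    and th: "th0 \<in> borel_measurable borel" "periodic2 th0" "sqi th0"
    and E0: "\<And>G. finite G \<Longrightarrow> en al G q0 \<le> E0"
  shows "\<exists>R \<Theta> K F \<tau> q th \<epsilon>. approx al T R \<Theta> K F \<tau> q th \<epsilon> q0 th0"
proof -
  define \<Theta> where "\<Theta> = L2norm th0"
  \<comment> \<open>With this choice
    \<open>R\<^sup>2 = R * (1 + E0 + T) + 2 * T * \<Theta> * R\<close>, and \<open>R \<ge> 1\<close>
    gives the bootstrap condition of the energy estimate.\<close>
  define R where "R = 1 + E0 + T + 2 * T * \<Theta>"
  define K where "K = K1 al * R\<^sup>2 + \<Theta>"
  \<comment> \<open>The successor keeps the set nonempty already for \<open>N = 0\<close>, as the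
    average over the modes requires.\<close>
  define F where "F N = bx (Suc N) - {0}" for N
  \<comment> \<open>Number of time steps. The first summand makes
    \<open>\<tau> N * (card (F N))\<^sup>2\<close> at most \<open>T / (N + 1)\<close>, which kills
    the error of the shears; the second gives \<open>\<tau> N * K\<^sup>2 \<le> 1\<close> for the
    energy estimate.\<close>
  define L where "L N = (N + 1) * (card (F N))\<^sup>2 + nat \<lceil>T * K\<^sup>2\<rceil>" for N
  define \<tau> where "\<tau> N = T / real (L N)" for N
  define s where "s N n = st al (F N) (\<tau> N) q0 th0 n" for N n
  \<comment> \<open>The consistency error per unit of time; 8 is the 2 of the Taylor remainder times
    the square of the bound 2 for a mode.\<close>
  define \<epsilon> where "\<epsilon> N l = 8 * (pl l)\<^sup>2 * R\<^sup>2 * \<Theta> * T / (real N + 1)" for N l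
  have E00: "0 \<le> E0" using E0[of "{}"] by (simp add: en_def)
  have \<Theta>0: "0 \<le> \<Theta>" by (simp add: \<Theta>_def)
  have R1: "1 \<le> R" unfolding R_def using E00 T \<Theta>0 by simp
  have RR: "E0 + T * (2 * \<Theta> * R + 1) \<le> R\<^sup>2"
  proof -
    have "R\<^sup>2 = R * (1 + E0 + T) + 2 * T * \<Theta> * R" unfolding power2_eq_square by (subst (2) R_def) (simp add: algebra_simps)
    moreover have "1 * (1 + E0 + T) \<le> R * (1 + E0 + T)" using R1 E00 T by (intro mult_right_mono) auto
    ultimately show ?thesis by (simp add: algebra_simps)
  qed
  have K0: "0 \<le> K" unfolding K_def using al \<Theta>0 by (simp add: K1_def)
  have F: "finite (F N)" "0 \<notin> F N" for N by (auto simp: F_def)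
  have F1: "(1, 0) \<in> F N" for N by (auto simp: F_def bx_def zero_prod_def)
  have Fne: "F N \<noteq> {}" for N using F1[of N] by blast
  have c1: "1 \<le> card (F N)" for N using F(1)[of N] Fne[of N] by (simp add: Suc_leI card_gt_0_iff)
  have Lge: "(real N + 1) * (real (card (F N)))\<^sup>2 \<le> real (L N)" "T * K\<^sup>2 \<le> real (L N)" for N
  proof -
    show "(real N + 1) * (real (card (F N)))\<^sup>2 \<le> real (L N)" by (simp add: L_def algebra_simps)
    have "T * K\<^sup>2 \<le> real (nat \<lceil>T * K\<^sup>2\<rceil>)" by linarith
    also have "\<dots> \<le> real (L N)" by (simp add: L_def)
    finally show "T * K\<^sup>2 \<le> real (L N)" .
  qed
  have LN: "real N + 1 \<le> real (L N)" for N
  proof -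
    have "1 \<le> (real (card (F N)))\<^sup>2" using c1[of N] by (intro one_le_power) simp
    then have "(real N + 1) * 1 \<le> (real N + 1) * (real (card (F N)))\<^sup>2" by (intro mult_left_mono) auto
    from order_trans[OF this Lge(1)] show ?thesis by (simp only: mult_1_right)
  qed
  have L0: "0 < real (L N)" for N using LN[of N] by simp
  have \<tau>0: "0 < \<tau> N" for N unfolding \<tau>_def using T L0[of N] by simp
  have \<tau>lim: "\<tau> \<longlonglongrightarrow> 0"
  proof (rule Lim_null_comparison)
    show "\<forall>\<^sub>F N in sequentially. norm (\<tau> N) \<le> T / (real N + 1)"
    proof (rule always_eventually, rule allI)
      fix N show "norm (\<tau> N) \<le> T / (real N + 1)"
        using \<tau>0[of N] T LN[of N] L0[of N] unfolding \<tau>_def by (auto intro!: divide_left_mono mult_pos_pos)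
    qed
    show "(\<lambda>N. T / (real N + 1)) \<longlonglongrightarrow> 0" by real_asymp
  qed
  have \<tau>K: "\<tau> N * (K1 al * R\<^sup>2 + \<Theta>)\<^sup>2 \<le> 1" for N
    using Lge(2)[of N] L0[of N] unfolding \<tau>_def K_def[symmetric] by (simp add: field_simps)
  have \<tau>M: "\<tau> N * (real (card (F N)))\<^sup>2 \<le> T / (real N + 1)" for N
  proof -
    have p: "0 < real N + 1" by simp
    have "T * ((real N + 1) * (real (card (F N)))\<^sup>2) \<le> T * real (L N)" using Lge(1) T by (intro mult_left_mono) auto
    then have "T * (real (card (F N)))\<^sup>2 \<le> T * real (L N) / (real N + 1)"
      by (subst pos_le_divide_eq[OF p]) (simp add: algebra_simps)
    then have "T * (real (card (F N)))\<^sup>2 / real (L N) \<le> T / (real N + 1)"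
      by (subst pos_divide_le_eq[OF L0]) simp
    then show ?thesis unfolding \<tau>_def by simp
  qed
  have th': "snd (s N n) \<in> borel_measurable borel" "periodic2 (snd (s N n))" "sqi (snd (s N n))" "L2norm (snd (s N n)) \<le> \<Theta>"
    "\<And>C x. (\<And>x. \<bar>th0 x\<bar> \<le> C) \<Longrightarrow> \<bar>snd (s N n) x\<bar> \<le> C" for N n
    using st_theta[OF F(1)[of N] Fne[of N] th] unfolding s_def \<Theta>_def by auto
  have qe: "en al (F N) (fst (s N n)) \<le> R\<^sup>2" if n: "real n * \<tau> N \<le> T" for N n
  proof -
    have "en al (F N) (fst (s N n)) \<le> E0 + real n * \<tau> N * (2 * \<Theta> * R + 1)"
      unfolding s_def
      by (rule st_energy[OF al F Fne th E0[OF F(1)] _ RR _ less_imp_le[OF \<tau>0] \<tau>K n]) (use R1 in \<open>auto simp: \<Theta>_def\<close>)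
    also have "\<dots> \<le> E0 + T * (2 * \<Theta> * R + 1)" using n R1 \<Theta>0 by (intro add_left_mono mult_right_mono) auto
    finally show ?thesis using RR by linarith
  qed
  have ss: "fst (s N (Suc n)) = q_step al (F N) (\<tau> N) (fst (s N n)) (snd (s N n))"
    "snd (s N (Suc n)) = th_step (F N) (\<tau> N) (fst (s N n)) (snd (s N n))" for N n
    by (simp_all add: s_def Let_def)
  have qz: "fst (s N n) k = 0" if "k \<notin> F N" for N n k
    using that by (cases n) (simp_all add: ss q_step_def, simp add: s_def)
  have lamsq: "\<bar>fst (s N n) k\<bar> \<le> R" if n: "real n * \<tau> N \<le> T" and k: "k \<in> F N" for N n k
  proof -
    have "lam al k * (fst (s N n) k)\<^sup>2 \<le> en al (F N) (fst (s N n))"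
      unfolding en_def by (rule member_le_sum) (use k F in \<open>auto intro!: mult_nonneg_nonneg less_imp_le[OF lam_pos]\<close>)
    moreover have "(fst (s N n) k)\<^sup>2 \<le> lam al k * (fst (s N n) k)\<^sup>2"
      using mult_right_mono[OF lam_ge_1, of "(fst (s N n) k)\<^sup>2" al k] by simp
    ultimately have "(fst (s N n) k)\<^sup>2 \<le> R\<^sup>2" using qe[OF n] by linarith
    then show ?thesis using R1 by (simp add: abs_le_square_iff[symmetric])
  qed
  have "approx al T R \<Theta> K F \<tau> (\<lambda>N n. fst (s N n)) (\<lambda>N n. snd (s N n)) \<epsilon> q0 th0"
  proof
    show "al > 0" "T > 0" "0 \<le> K" by (fact al T K0)+
    show "0 \<le> R" using R1 by simp
    show "finite (F N)" "0 \<notin> F N" for N by (rule F)+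
    show "\<forall>\<^sub>F N in sequentially. k \<in> F N" if "k \<noteq> 0" for k
      using eventually_mem_bx[of k] by eventually_elim (use that bx_mono[OF le_SucI[OF order_refl]] in \<open>auto simp: F_def\<close>)
    show "0 < \<tau> N" for N by (rule \<tau>0)
    show "\<tau> \<longlonglongrightarrow> 0" by (rule \<tau>lim)
    show "fst (s N n) k = 0" if "k \<notin> F N" for N n k by (rule qz[OF that])
    show "fst (s N 0) k = q0 k" if "k \<in> F N" for N k using that by (simp add: s_def)
    show "snd (s N 0) = th0" for N by (simp add: s_def)
    show "en al (F N) (fst (s N n)) \<le> R\<^sup>2" if "real n * \<tau> N \<le> T" for N n by (rule qe[OF that])
    show "fst (s N (Suc n)) k = fst (s N n) k + \<tau> N * (Bk (Uf (F N) (fst (s N n))) (snd (s N n)) k / lam al k)" if "k \<in> F N" for N n k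
      using that by (simp add: ss q_step_def)
    show "en al (F N) (\<lambda>k. Bk (Uf (F N) (fst (s N n))) (snd (s N n)) k / lam al k) \<le> K\<^sup>2" if "real n * \<tau> N \<le> T" for N n
    proof (rule order_trans[OF Bk_energy(2)[OF al F th'(3)] power_mono])
      show "K1 al * en al (F N) (fst (s N n)) + L2norm (snd (s N n)) \<le> K"
        unfolding K_def using al by (intro add_mono mult_left_mono qe[OF that] th') (auto simp: K1_def)
      show "0 \<le> K1 al * en al (F N) (fst (s N n)) + L2norm (snd (s N n))"
        using al en_nonneg[of al "F N" "fst (s N n)"] by (intro add_nonneg_nonneg mult_nonneg_nonneg) (auto simp: K1_def)
    qed
    show "sqi (snd (s N n))" "L2norm (snd (s N n)) \<le> \<Theta>" for N n by (rule th')+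
    show "\<bar>snd (s N n) x\<bar> \<le> C" if "\<And>x. \<bar>th0 x\<bar> \<le> C" for C N n x by (rule th'(5)[OF that])
    show "0 \<le> \<epsilon> N l" for N l unfolding \<epsilon>_def using \<Theta>0 T by simp
    show "(\<lambda>N. \<epsilon> N l) \<longlonglongrightarrow> 0" for l unfolding \<epsilon>_def by real_asymp
    show "\<epsilon> N l \<le> \<epsilon> 0 l" for N l
      unfolding \<epsilon>_def using \<Theta>0 T by (intro divide_left_mono) auto
    show "\<bar>hat (snd (s N (Suc n))) l - hat (snd (s N n)) l - \<tau> N * flux (Uf (F N) (fst (s N n))) (snd (s N n)) (cas l)\<bar> \<le> \<tau> N * \<epsilon> N l"
      if n: "real n * \<tau> N \<le> T" for N n l
    proof -
      define M where "M = real (card (F N))"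
      have "\<bar>hat (snd (s N (Suc n))) l - hat (snd (s N n)) l - \<tau> N * flux (Uf (F N) (fst (s N n))) (snd (s N n)) (cas l)\<bar>
         \<le> 2 * (pl l * (2 * (\<tau> N * M * R)))\<^sup>2 * L2norm (snd (s N n))"
        unfolding ss(2) M_def by (rule th_step_consistent[OF F(1) Fne th'(1-3) lamsq[OF n] less_imp_le[OF \<tau>0]])
      also have "\<dots> \<le> 2 * (pl l * (2 * (\<tau> N * M * R)))\<^sup>2 * \<Theta>" by (intro mult_left_mono th') auto
      also have "\<dots> = \<tau> N * (8 * (pl l)\<^sup>2 * R\<^sup>2 * \<Theta> * (\<tau> N * M\<^sup>2))" by (simp add: power2_eq_square mult_ac)
      also have "\<dots> \<le> \<tau> N * (8 * (pl l)\<^sup>2 * R\<^sup>2 * \<Theta> * (T / (real N + 1)))"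
        unfolding M_def using \<tau>0[of N] \<Theta>0 by (intro mult_left_mono \<tau>M) auto
      also have "\<dots> = \<tau> N * \<epsilon> N l" by (simp add: \<epsilon>_def)
      finally show ?thesis .
    qed
  qed
  then show ?thesis by blast
qed

subsection \<open>Fourier truncation of test functions\<close>

definition C1 :: "(pt \<Rightarrow> 'b::euclidean_space) \<Rightarrow> bool" where
  "C1 \<phi> \<longleftrightarrow> (\<forall>j. continuous_on UNIV (pd j \<phi>))"

lemma C1_smooth: "smooth \<phi> \<Longrightarrow> C1 \<phi>"
  unfolding C1_def by (intro allI smooth_continuous smooth_pd)

lemma C1_Psum: "C1 (Psum F a)"
  unfolding C1_def by (intro allI continuous_pd_Psum)

lemma C1_bound: assumes "C1 \<phi>" obtains B where "0 \<le> B" "\<And>j x. x \<in> cell \<Longrightarrow> norm (pd j \<phi> x) \<le> B"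
proof -
  obtain B1 where B1: "0 \<le> B1" "\<And>x. x \<in> cell \<Longrightarrow> norm (pd 1 \<phi> x) \<le> B1"
    using bounded_on_cell[of "pd 1 \<phi>"] assms unfolding C1_def by blast
  obtain B2 where B2: "0 \<le> B2" "\<And>x. x \<in> cell \<Longrightarrow> norm (pd 2 \<phi> x) \<le> B2"
    using bounded_on_cell[of "pd 2 \<phi>"] assms unfolding C1_def by blast
  have "norm (pd j \<phi> x) \<le> max B1 B2" if "x \<in> cell" for j x
    using B1(2)[OF that] B2(2)[OF that] exhaust_2[of j] by (auto simp: le_max_iff_disj)
  then show thesis by (intro that[of "max B1 B2"]) (use B1(1) in auto)
qed

lemma C1_measurable: "C1 \<phi> \<Longrightarrow> pd j \<phi> \<in> borel_measurable tor"
  unfolding C1_def by (intro continuous_tor) blast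

lemma tri_diff_bound:
  assumes f: "sqi f" "sqi g" and h: "h \<in> borel_measurable tor" "\<And>x. x \<in> cell \<Longrightarrow> \<bar>h x\<bar> \<le> B"
    and h': "h' \<in> borel_measurable tor" "\<And>x. x \<in> cell \<Longrightarrow> \<bar>h' x\<bar> \<le> B'"
    and d: "AE x in tor. \<bar>h x - h' x\<bar> \<le> \<delta>" "0 \<le> \<delta>"
  shows "\<bar>tri f g h - tri f g h'\<bar> \<le> \<delta> * (L2norm f * L2norm g)"
proof -
  have a: "AE x in tor. \<bar>h x\<bar> \<le> B" "AE x in tor. \<bar>h' x\<bar> \<le> B'" using h(2) h'(2) by (auto intro: AE_I2)
  have "tri f g h - tri f g h' = tri f g (\<lambda>x. h x - h' x)"
    unfolding tri_def right_diff_distrib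
    by (rule Bochner_Integration.integral_diff[symmetric] , (rule tri_integrable[OF f h(1) a(1)] tri_integrable[OF f h'(1) a(2)])+)
  then show ?thesis using tri_bound[OF f _ d] h(1) h'(1) by simp
qed

lemma flux_diff_bound:
  assumes u: "sqi u" and \<theta>: "sqi \<theta>" and \<phi>: "C1 \<phi>" "C1 \<psi>"
    and d: "\<And>j. AE x in tor. \<bar>pd j \<phi> x - pd j \<psi> x\<bar> \<le> \<delta>" "0 \<le> \<delta>"
  shows "\<bar>flux u \<theta> \<phi> - flux u \<theta> \<psi>\<bar> \<le> 2 * \<delta> * (L2norm u * L2norm \<theta>)"
proof -
  obtain B where B: "0 \<le> B" "\<And>j x. x \<in> cell \<Longrightarrow> norm (pd j \<phi> x) \<le> B" using C1_bound[OF \<phi>(1)] by blast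
  obtain B' where B': "0 \<le> B'" "\<And>j x. x \<in> cell \<Longrightarrow> norm (pd j \<psi> x) \<le> B'" using C1_bound[OF \<phi>(2)] by blast
  have a: "AE x in tor. \<bar>pd j \<phi> x\<bar> \<le> B" "AE x in tor. \<bar>pd j \<psi> x\<bar> \<le> B'" for j
    using B(2) B'(2) by (auto intro!: AE_I2)
  have t: "\<bar>tri (\<lambda>x. u x $ j) \<theta> (pd j \<phi>) - tri (\<lambda>x. u x $ j) \<theta> (pd j \<psi>)\<bar> \<le> \<delta> * (L2norm u * L2norm \<theta>)" for j
  proof -
    have "\<bar>tri (\<lambda>x. u x $ j) \<theta> (pd j \<phi>) - tri (\<lambda>x. u x $ j) \<theta> (pd j \<psi>)\<bar> \<le> \<delta> * (L2norm (\<lambda>x. u x $ j) * L2norm \<theta>)"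
      by (rule tri_diff_bound[OF sqi_nth[OF u] \<theta> C1_measurable[OF \<phi>(1)] _ C1_measurable[OF \<phi>(2)] _ d])
         (use B(2) B'(2) in \<open>auto simp flip: real_norm_def\<close>)
    also have "\<dots> \<le> \<delta> * (L2norm u * L2norm \<theta>)" by (intro mult_left_mono mult_right_mono L2norm_nth_le u d) auto
    finally show ?thesis .
  qed
  show ?thesis
    unfolding flux_tri[OF u \<theta> C1_measurable[OF \<phi>(1)] a(1)] flux_tri[OF u \<theta> C1_measurable[OF \<phi>(2)] a(2)] sum_2
    using t[of 1] t[of 2] by simp
qed

definition cv :: "2 \<Rightarrow> (pt \<Rightarrow> real^2) \<Rightarrow> (pt \<Rightarrow> real^2) \<Rightarrow> real" where
  "cv j u \<Phi> = ip (\<lambda>x. u x $ j *\<^sub>R u x) (pd j \<Phi>)"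

lemma conv_cv: "conv u \<Phi> = (\<Sum>j\<in>UNIV. cv j u \<Phi>)" by (simp add: conv_def cv_def)

lemma C1_nth:
  fixes \<Phi> :: "pt \<Rightarrow> real^2"
  assumes "C1 \<Phi>" shows "(\<lambda>x. pd j \<Phi> x $ i) \<in> borel_measurable tor"
  using assms unfolding C1_def by (intro continuous_tor continuous_on_component) blast

lemma cv_tri:
  assumes u: "sqi u" and \<Phi>: "C1 \<Phi>"
  shows "cv j u \<Phi> = (\<Sum>i\<in>UNIV. tri (\<lambda>x. u x $ j) (\<lambda>x. u x $ i) (\<lambda>x. pd j \<Phi> x $ i))"
proof -
  obtain B where B: "0 \<le> B" "\<And>j x. x \<in> cell \<Longrightarrow> norm (pd j \<Phi> x) \<le> B" using C1_bound[OF \<Phi>] by blast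
  have a: "AE x in tor. \<bar>pd j \<Phi> x $ i\<bar> \<le> B" for i
    using order_trans[OF component_le_norm_cart B(2)] by (intro AE_I2) auto
  have i: "integrable tor (\<lambda>x. u x $ j * u x $ i * pd j \<Phi> x $ i)" for i
    by (rule tri_integrable[OF sqi_nth[OF u] sqi_nth[OF u] C1_nth[OF \<Phi>] a])
  have "cv j u \<Phi> = (LINT x|tor. u x $ j * u x $ 1 * pd j \<Phi> x $ 1 + u x $ j * u x $ 2 * pd j \<Phi> x $ 2)"
    unfolding cv_def ip_tor by (simp add: inner_2 algebra_simps)
  then show ?thesis using i by (simp add: sum_2 tri_def)
qed

lemma cv_diff_bound:
  assumes u: "sqi u" and \<Phi>: "C1 \<Phi>" "C1 \<Psi>"
    and d: "AE x in tor. norm (pd j \<Phi> x - pd j \<Psi> x) \<le> \<delta>" "0 \<le> \<delta>"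
  shows "\<bar>cv j u \<Phi> - cv j u \<Psi>\<bar> \<le> 2 * \<delta> * (L2norm u * L2norm u)"
proof -
  obtain B where B: "0 \<le> B" "\<And>j x. x \<in> cell \<Longrightarrow> norm (pd j \<Phi> x) \<le> B" using C1_bound[OF \<Phi>(1)] by blast
  obtain B' where B': "0 \<le> B'" "\<And>j x. x \<in> cell \<Longrightarrow> norm (pd j \<Psi> x) \<le> B'" using C1_bound[OF \<Phi>(2)] by blast
  have t: "\<bar>tri (\<lambda>x. u x $ j) (\<lambda>x. u x $ i) (\<lambda>x. pd j \<Phi> x $ i) - tri (\<lambda>x. u x $ j) (\<lambda>x. u x $ i) (\<lambda>x. pd j \<Psi> x $ i)\<bar>
     \<le> \<delta> * (L2norm u * L2norm u)" for i
  proof -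
    have "AE x in tor. \<bar>pd j \<Phi> x $ i - pd j \<Psi> x $ i\<bar> \<le> \<delta>"
      using d(1) by eventually_elim (metis component_le_norm_cart order_trans vector_minus_component)
    then have "\<bar>tri (\<lambda>x. u x $ j) (\<lambda>x. u x $ i) (\<lambda>x. pd j \<Phi> x $ i) - tri (\<lambda>x. u x $ j) (\<lambda>x. u x $ i) (\<lambda>x. pd j \<Psi> x $ i)\<bar>
      \<le> \<delta> * (L2norm (\<lambda>x. u x $ j) * L2norm (\<lambda>x. u x $ i))"
      by (intro tri_diff_bound[OF sqi_nth[OF u] sqi_nth[OF u] C1_nth[OF \<Phi>(1)] order_trans[OF component_le_norm_cart B(2)]
            C1_nth[OF \<Phi>(2)] order_trans[OF component_le_norm_cart B'(2)] _ d(2)])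
    also have "\<dots> \<le> \<delta> * (L2norm u * L2norm u)" by (intro mult_left_mono mult_mono L2norm_nth_le u d) auto
    finally show ?thesis .
  qed
  show ?thesis unfolding cv_tri[OF u \<Phi>(1)] cv_tri[OF u \<Phi>(2)] sum_2 using t[of 1] t[of 2] by simp
qed

text \<open>Differentiation reflects the index, so truncation commutes with it because
  \<open>bx n\<close> is symmetric. The derivative of a truncation is thereby a truncation of a
  smooth function and converges uniformly outside null sets.\<close>

lemma pd_Psum_hat:
  assumes "smooth \<phi>" "periodic2 \<phi>" shows "pd j (Psum (bx n) (hat \<phi>)) = Psum (bx n) (hat (pd j \<phi>))"
proof
  fix x
  have inj: "inj_on uminus (bx n)" by (auto intro: inj_onI)
  have im: "uminus ` bx n = bx n"
  proof -
    have "k \<in> uminus ` bx n" if "k \<in> bx n" for k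
      by (rule image_eqI[of _ _ "- k"]) (use that in \<open>cases k; auto simp: bx_def\<close>)+
    then show ?thesis by (auto simp: bx_def)
  qed
  have "Psum (bx n) (hat (pd j \<phi>)) x = Psum (uminus ` bx n) (hat (pd j \<phi>)) x" by (simp only: im)
  also have "\<dots> = (\<Sum>k\<in>bx n. cas (- k) x *\<^sub>R hat (pd j \<phi>) (- k))" unfolding Psum_def by (simp add: sum.reindex[OF inj])
  also have "\<dots> = pd j (Psum (bx n) (hat \<phi>)) x"
    unfolding pd_Psum by (intro sum.cong refl) (simp add: hat_pd[OF assms] kc_simps mult.commute)
  finally show "pd j (Psum (bx n) (hat \<phi>)) x = Psum (bx n) (hat (pd j \<phi>)) x" by simp
qed

lemma pd_truncation:
  fixes \<phi> :: "pt \<Rightarrow> 'b::euclidean_space"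
  assumes "smooth \<phi>" "periodic2 \<phi>"
  shows "\<exists>\<delta>. \<delta> \<longlonglongrightarrow> 0 \<and> (\<forall>n. 0 \<le> \<delta> n) \<and> (\<forall>n j. AE x in tor. norm (pd j \<phi> x - pd j (Psum (bx n) (hat \<phi>)) x) \<le> \<delta> n)"
proof -
  have s: "smooth (pd j \<phi>)" "periodic2 (pd j \<phi>)" for j using smooth_pd periodic_pd assms by blast+
  obtain D1 where D1: "D1 \<longlonglongrightarrow> 0" "\<And>n. AE x in tor. norm (pd 1 \<phi> x - Psum (bx n) (hat (pd 1 \<phi>)) x) \<le> D1 n"
    using smooth_Psum_AE[OF s] by blast
  obtain D2 where D2: "D2 \<longlonglongrightarrow> 0" "\<And>n. AE x in tor. norm (pd 2 \<phi> x - Psum (bx n) (hat (pd 2 \<phi>)) x) \<le> D2 n"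
    using smooth_Psum_AE[OF s] by blast
  define \<delta> where "\<delta> n = \<bar>D1 n\<bar> + \<bar>D2 n\<bar>" for n
  have "\<delta> \<longlonglongrightarrow> 0" unfolding \<delta>_def[abs_def] using tendsto_add[OF tendsto_rabs[OF D1(1)] tendsto_rabs[OF D2(1)]] by simp
  moreover have "AE x in tor. norm (pd j \<phi> x - pd j (Psum (bx n) (hat \<phi>)) x) \<le> \<delta> n" for n j
  proof -
    have "j = 1 \<or> j = 2" using exhaust_2[of j] .
    then show ?thesis
    proof
      assume j: "j = 1"
      show ?thesis unfolding pd_Psum_hat[OF assms] \<delta>_def j using D1(2)[of n] by eventually_elim linarith
    next
      assume j: "j = 2"
      show ?thesis unfolding pd_Psum_hat[OF assms] \<delta>_def j using D2(2)[of n] by eventually_elim linarith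
    qed
  qed
  ultimately show ?thesis by (intro exI[of _ \<delta>]) (auto simp: \<delta>_def)
qed

lemma flux_Psum:
  assumes u: "sqi u" and \<theta>: "sqi \<theta>"
  shows "flux u \<theta> (Psum F a) = (\<Sum>k\<in>F. a k * flux u \<theta> (cas k))"
proof -
  have c: "C1 (cas k)" for k by (rule C1_smooth[OF smooth_cas])
  have pc: "pd j (Psum F a) x = (\<Sum>k\<in>F. a k * pd j (cas k) x)" for j x
    unfolding pd_Psum pd_cas by (simp add: mult_ac)
  have i: "integrable tor (\<lambda>x. \<theta> x * (u x \<bullet> grad (cas k) x))" for k
  proof -
    have "integrable tor (\<lambda>x. u x $ 1 * \<theta> x * pd 1 (cas k) x + u x $ 2 * \<theta> x * pd 2 (cas k) x)"
      by (intro Bochner_Integration.integrable_add tri_integrable[OF sqi_nth[OF u] \<theta> pd_cas_measurable, where B="2 * pl k"] AE_I2 pd_cas_bound)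
    then show ?thesis by (simp add: inner_2 grad_def algebra_simps)
  qed
  have "flux u \<theta> (Psum F a) = (LINT x|tor. (\<Sum>k\<in>F. a k * (\<theta> x * (u x \<bullet> grad (cas k) x))))"
    unfolding flux_def ip_tor by (intro Bochner_Integration.integral_cong refl)
       (simp add: inner_2 grad_def pc sum_distrib_left sum.distrib[symmetric] algebra_simps)
  also have "\<dots> = (\<Sum>k\<in>F. a k * (LINT x|tor. \<theta> x * (u x \<bullet> grad (cas k) x)))"
    by (subst Bochner_Integration.integral_sum) (auto intro: i)
  finally show ?thesis unfolding flux_def ip_tor by simp
qed

subsection \<open>The limit as a curve in time\<close>

context approx
begin

lemma HH_lipschitz:
  assumes st: "0 \<le> s" "s \<le> t" "t \<le> T"
  shows "\<bar>HH t l - HH s l\<bar> \<le> (4 * pl l * (R * \<Theta>) + \<epsilon> 0 l) * (t - s)"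
proof -
  define C where "C = 4 * pl l * (R * \<Theta>) + \<epsilon> 0 l"
  have "\<bar>HH t l - HH s l\<bar> \<le> C * (\<bar>t - s\<bar> + 0)"
  proof (rule LIMSEQ_le)
    show "(\<lambda>N. \<bar>hat (tt (rr N) t) l - hat (tt (rr N) s) l\<bar>) \<longlonglongrightarrow> \<bar>HH t l - HH s l\<bar>"
      by (intro tendsto_intros HH_lim) (use st in auto)
    show "(\<lambda>N. C * (\<bar>t - s\<bar> + \<tau> (rr N))) \<longlonglongrightarrow> C * (\<bar>t - s\<bar> + 0)"
      by (intro tendsto_intros tau_rr)
    have "\<bar>hat (tt N t) l - hat (tt N s) l\<bar> \<le> C * (\<bar>t - s\<bar> + \<tau> N)" for N
      unfolding tt_def C_def
      by (rule step_lipschitz[where x="\<lambda>n. hat (th N n) l" and T=T, OF \<tau>(1) th_hat_step _ st])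
         (use R0 Theta0 \<epsilon>(1) in auto)
    then show "\<exists>M. \<forall>N\<ge>M. \<bar>hat (tt (rr N) t) l - hat (tt (rr N) s) l\<bar> \<le> C * (\<bar>t - s\<bar> + \<tau> (rr N))" by blast
  qed
  then show ?thesis using st by (simp add: C_def)
qed

text \<open>Clamping the time to \<open>{0..T}\<close> makes the bounds for the limit hold for all real times.\<close>
definition cl :: "real \<Rightarrow> real" where "cl t = max 0 (min T t)"

lemma cl_in [simp]: "cl t \<in> {0..T}" using T by (auto simp: cl_def)
lemma cl_id: "t \<in> {0..T} \<Longrightarrow> cl t = t" by (auto simp: cl_def)
lemma cl_lip: "\<bar>cl s - cl t\<bar> \<le> \<bar>s - t\<bar>" by (auto simp: cl_def)

definition v where "v t = uu (cl t)"
definition \<theta> where "\<theta> t = tth (cl t)"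

lemmas v_props = uu[OF cl_in, folded v_def]
lemmas \<theta>_props = tth[OF cl_in, folded \<theta>_def]
lemmas v_norm = uu_norm[OF cl_in, folded v_def]
lemmas \<theta>_norm = tth_norm[OF cl_in, folded \<theta>_def]

lemma QQ_cl_lip: assumes "finite G" shows "en al G (\<lambda>k. QQ (cl t) k - QQ (cl s) k) \<le> (K * \<bar>t - s\<bar>)\<^sup>2"
proof -
  have "en al G (\<lambda>k. QQ (cl t) k - QQ (cl s) k) \<le> (K * \<bar>cl t - cl s\<bar>)\<^sup>2"
  proof (cases "cl s \<le> cl t")
    case True
    then show ?thesis using QQ_lipschitz[of "cl s" "cl t" G] cl_in[of s] cl_in[of t] assms by auto
  next
    case False
    have "en al G (\<lambda>k. QQ (cl t) k - QQ (cl s) k) = en al G (\<lambda>k. QQ (cl s) k - QQ (cl t) k)"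
      unfolding en_def by (simp add: power2_commute)
    then show ?thesis using False QQ_lipschitz[of "cl t" "cl s" G] cl_in[of s] cl_in[of t] assms by auto
  qed
  also have "\<dots> \<le> (K * \<bar>t - s\<bar>)\<^sup>2" using cl_lip[of t s] K0 by (intro power_mono mult_left_mono) auto
  finally show ?thesis .
qed

lemma v_lip: "L2norm (\<lambda>x. v s x - v t x) \<le> K * \<bar>s - t\<bar>"
proof (rule power2_le_imp_le)
  have sd: "sqi (\<lambda>x. v s x - v t x)" by (intro sqi_diff v_props)
  show "(L2norm (\<lambda>x. v s x - v t x))\<^sup>2 \<le> (K * \<bar>s - t\<bar>)\<^sup>2"
  proof (rule L2norm_le_of_hat[OF sd])
    fix n
    have "hat (\<lambda>x. v s x - v t x) k = (QQ (cl s) k - QQ (cl t) k) *\<^sub>R Ev k" for k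
      by (simp add: hat_diff sqi_integrable v_props scaleR_diff_left)
    then have "(\<Sum>k\<in>bx n. (norm (hat (\<lambda>x. v s x - v t x) k))\<^sup>2) = (L2norm (Uf (bx n) (\<lambda>k. QQ (cl s) k - QQ (cl t) k)))\<^sup>2"
      unfolding Uf_def by (simp add: L2norm_Psum)
    also have "\<dots> \<le> (K * \<bar>s - t\<bar>)\<^sup>2" by (rule order_trans[OF L2norm_Uf_le[OF finite_bx] QQ_cl_lip[OF finite_bx]])
    finally show "(\<Sum>k\<in>bx n. (norm (hat (\<lambda>x. v s x - v t x) k))\<^sup>2) \<le> (K * \<bar>s - t\<bar>)\<^sup>2" .
  qed
qed (use K0 in simp)

lemma v_strong: "((\<lambda>s. L2norm (\<lambda>x. v s x - v t x)) \<longlongrightarrow> 0) (at t within A)"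
proof (rule Lim_null_comparison)
  show "\<forall>\<^sub>F s in at t within A. norm (L2norm (\<lambda>x. v s x - v t x)) \<le> K * \<bar>s - t\<bar>"
    using v_lip by (intro always_eventually) simp
  have "((\<lambda>s. K * \<bar>s - t\<bar>) \<longlongrightarrow> K * \<bar>t - t\<bar>) (at t within A)" by (intro tendsto_intros)
  then show "((\<lambda>s. K * \<bar>s - t\<bar>) \<longlongrightarrow> 0) (at t within A)" by simp
qed

lemma \<theta>_hat_cont: "((\<lambda>s. hat (\<theta> s) l) \<longlongrightarrow> hat (\<theta> t) l) (at t within A)"
proof -
  define C where "C = 4 * pl l * (R * \<Theta>) + \<epsilon> 0 l"
  have C: "0 \<le> C" using R0 Theta0 \<epsilon>(1) by (simp add: C_def)
  have "\<bar>HH (cl s) l - HH (cl t) l\<bar> \<le> C * \<bar>s - t\<bar>" for s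
  proof -
    have "\<bar>HH (cl s) l - HH (cl t) l\<bar> \<le> C * \<bar>cl s - cl t\<bar>"
    proof (cases "cl t \<le> cl s")
      case True
      then show ?thesis using HH_lipschitz[of "cl t" "cl s" l] cl_in[of s] cl_in[of t] by (auto simp: C_def)
    next
      case False
      then show ?thesis using HH_lipschitz[of "cl s" "cl t" l] cl_in[of s] cl_in[of t] by (auto simp: C_def abs_minus_commute)
    qed
    also have "\<dots> \<le> C * \<bar>s - t\<bar>" using cl_lip C by (intro mult_left_mono) auto
    finally show ?thesis .
  qed
  note b = this
  have "((\<lambda>s. HH (cl s) l - HH (cl t) l) \<longlongrightarrow> 0) (at t within A)"
  proof (rule Lim_null_comparison)
    show "\<forall>\<^sub>F s in at t within A. norm (HH (cl s) l - HH (cl t) l) \<le> C * \<bar>s - t\<bar>"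
      using b by (intro always_eventually) simp
    have "((\<lambda>s. C * \<bar>s - t\<bar>) \<longlongrightarrow> C * \<bar>t - t\<bar>) (at t within A)" by (intro tendsto_intros)
    then show "((\<lambda>s. C * \<bar>s - t\<bar>) \<longlongrightarrow> 0) (at t within A)" by simp
  qed
  then show ?thesis unfolding \<theta>_props(4) by (rule LIM_zero_cancel)
qed

lemma \<theta>_weak: "sqi g \<Longrightarrow> ((\<lambda>s. ip (\<theta> s) g) \<longlongrightarrow> ip (\<theta> t) g) (at t within A)"
  by (rule weak_convergence[OF \<theta>_props(3) \<theta>_props(3) _ \<theta>_norm \<theta>_hat_cont])

lemma v_weak: 
  assumes "sqi g" shows "((\<lambda>s. ip (v s) g) \<longlongrightarrow> ip (v t) g) (at t within A)"
proof (rule LIM_zero_cancel, rule Lim_null_comparison)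
  show "\<forall>\<^sub>F s in at t within A. norm (ip (v s) g - ip (v t) g) \<le> L2norm (\<lambda>x. v s x - v t x) * L2norm g"
    using ip_cauchy_schwarz[OF sqi_diff[OF v_props(3) v_props(3)] assms]
    by (intro always_eventually allI) (simp add: ip_diff_left[OF v_props(3) v_props(3) assms, symmetric])
  show "((\<lambda>s. L2norm (\<lambda>x. v s x - v t x) * L2norm g) \<longlongrightarrow> 0) (at t within A)"
    using tendsto_mult[OF v_strong tendsto_const, of t "L2norm g" A] by simp
qed

lemma flux_cont:
  assumes \<phi>: "C1 \<phi>" shows "((\<lambda>s. flux (v s) (\<theta> s) \<phi>) \<longlongrightarrow> flux (v t) (\<theta> t) \<phi>) (at t within A)"
proof -
  obtain B where B: "0 \<le> B" "\<And>j x. x \<in> cell \<Longrightarrow> norm (pd j \<phi> x) \<le> B" using C1_bound[OF \<phi>] by blast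
  show ?thesis
    by (rule flux_converges[OF v_props(3) v_props(3) v_strong \<theta>_props(3) \<theta>_props(3) \<theta>_norm \<theta>_weak C1_measurable[OF \<phi>], where B=B])
       (use B(2) in \<open>auto simp flip: real_norm_def\<close>)
qed

lemma cv_cont:
  assumes \<Phi>: "C1 \<Phi>" shows "((\<lambda>s. cv j (v s) \<Phi>) \<longlongrightarrow> cv j (v t) \<Phi>) (at t within A)"
proof -
  obtain B where B: "0 \<le> B" "\<And>j x. x \<in> cell \<Longrightarrow> norm (pd j \<Phi> x) \<le> B" using C1_bound[OF \<Phi>] by blast
  show ?thesis
    unfolding cv_tri[OF v_props(3) \<Phi>]
    by (intro tendsto_sum conv_tri_converges[OF v_props(3) v_props(3) v_strong v_norm C1_nth[OF \<Phi>] order_trans[OF component_le_norm_cart B(2)]])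
qed

lemma Bk_cont: "((\<lambda>s. Bk (v s) (\<theta> s) k) \<longlongrightarrow> Bk (v t) (\<theta> t) k) (at t within A)"
  by (rule Bk_converges[OF v_props(3) v_props(3) v_strong v_norm \<theta>_hat_cont])

text \<open>The equation is known for single modes, hence for truncations of \<open>\<phi>\<close>.
  The flux sees only the gradient of the test function in sup norm, so the truncation error vanishes
  uniformly in time.\<close>

lemma theta_static:
  assumes \<phi>: "smooth \<phi>" "periodic2 \<phi>" and t: "t \<in> {0..T}"
  shows "ip (\<theta> t) \<phi> - ip (\<theta> 0) \<phi> = integral {0..t} (\<lambda>s. flux (v s) (\<theta> s) \<phi>)"
proof -
  have t0: "0 \<le> t" using t by simp
  define P where "P n = Psum (bx n) (hat \<phi>)" for n
  have c: "continuous_on {0..t} (\<lambda>s. flux (v s) (\<theta> s) \<psi>)" if "C1 \<psi>" for \<psi>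
    unfolding continuous_on_def using flux_cont[OF that] by blast
  have C1s: "C1 \<phi>" "C1 (P n)" for n unfolding P_def by (rule C1_smooth[OF \<phi>(1)] C1_Psum)+
  have io: "(\<lambda>s. flux (v s) (\<theta> s) \<psi>) integrable_on {0..t}" if "C1 \<psi>" for \<psi>
    by (rule integrable_continuous_real[OF c[OF that]])
  have e: "(\<Sum>k\<in>bx n. hat (\<theta> t) k \<bullet> hat \<phi> k) - (\<Sum>k\<in>bx n. hat (\<theta> 0) k \<bullet> hat \<phi> k) = integral {0..t} (\<lambda>s. flux (v s) (\<theta> s) (P n))" for n
  proof -
    have eq: "integral {0..t} (\<lambda>s. flux (v s) (\<theta> s) (cas k)) = HH t k - HH 0 k" for k
    proof -
      have "integral {0..t} (\<lambda>s. flux (v s) (\<theta> s) (cas k)) = integral {0..t} (\<lambda>s. flux (uu s) (tth s) (cas k))"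
        by (rule integral_cong) (use t in \<open>simp add: v_def \<theta>_def cl_id\<close>)
      then show ?thesis using theta_equation[OF t, of k] by simp
    qed
    have "integral {0..t} (\<lambda>s. flux (v s) (\<theta> s) (P n)) = integral {0..t} (\<lambda>s. \<Sum>k\<in>bx n. hat \<phi> k * flux (v s) (\<theta> s) (cas k))"
      unfolding P_def by (simp add: flux_Psum[OF v_props(3) \<theta>_props(3)])
    also have "\<dots> = (\<Sum>k\<in>bx n. integral {0..t} (\<lambda>s. hat \<phi> k * flux (v s) (\<theta> s) (cas k)))"
      by (intro integral_sum finite_bx integrable_on_mult_right io C1_smooth smooth_cas)
    also have "\<dots> = (\<Sum>k\<in>bx n. hat \<phi> k * (HH t k - HH 0 k))"
      by (simp add: eq)
    also have "\<dots> = (\<Sum>k\<in>bx n. hat (\<theta> t) k \<bullet> hat \<phi> k) - (\<Sum>k\<in>bx n. hat (\<theta> 0) k \<bullet> hat \<phi> k)"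
      using T t by (simp add: \<theta>_props cl_id sum_subtractf[symmetric] algebra_simps)
    finally show ?thesis by simp
  qed
  obtain \<delta> where \<delta>: "\<delta> \<longlonglongrightarrow> 0" "\<And>n. 0 \<le> \<delta> n" "\<And>n j. AE x in tor. norm (pd j \<phi> x - pd j (P n) x) \<le> \<delta> n"
    using pd_truncation[OF \<phi>] unfolding P_def by blast
  have "(\<lambda>n. integral {0..t} (\<lambda>s. flux (v s) (\<theta> s) \<phi>) - integral {0..t} (\<lambda>s. flux (v s) (\<theta> s) (P n))) \<longlonglongrightarrow> 0"
  proof (rule Lim_null_comparison)
    show "(\<lambda>n. 2 * \<delta> n * (R * \<Theta>) * (t - 0)) \<longlonglongrightarrow> 0"
      using tendsto_mult_left[OF tendsto_mult_right[OF \<delta>(1)], of "R * \<Theta> * t" 2] by (simp add: mult_ac)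
    show "\<forall>\<^sub>F n in sequentially. norm (integral {0..t} (\<lambda>s. flux (v s) (\<theta> s) \<phi>) - integral {0..t} (\<lambda>s. flux (v s) (\<theta> s) (P n))) \<le> 2 * \<delta> n * (R * \<Theta>) * (t - 0)"
    proof (rule always_eventually, rule allI)
      fix n
      have "norm (integral {0..t} (\<lambda>s. flux (v s) (\<theta> s) \<phi> - flux (v s) (\<theta> s) (P n))) \<le> 2 * \<delta> n * (R * \<Theta>) * (t - 0)"
      proof (rule integral_bound[OF t0])
        show "continuous_on {0..t} (\<lambda>s. flux (v s) (\<theta> s) \<phi> - flux (v s) (\<theta> s) (P n))"
          by (intro continuous_on_diff c C1s)
        fix s assume "s \<in> {0..t}"
        have "\<bar>flux (v s) (\<theta> s) \<phi> - flux (v s) (\<theta> s) (P n)\<bar> \<le> 2 * \<delta> n * (L2norm (v s) * L2norm (\<theta> s))"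
          by (rule flux_diff_bound[OF v_props(3) \<theta>_props(3) C1s \<delta>(3)[unfolded real_norm_def] \<delta>(2)])
        also have "\<dots> \<le> 2 * \<delta> n * (R * \<Theta>)" using \<delta>(2) R0 by (intro mult_left_mono mult_mono v_norm \<theta>_norm) auto
        finally show "norm (flux (v s) (\<theta> s) \<phi> - flux (v s) (\<theta> s) (P n)) \<le> 2 * \<delta> n * (R * \<Theta>)" by simp
      qed
      then show "norm (integral {0..t} (\<lambda>s. flux (v s) (\<theta> s) \<phi>) - integral {0..t} (\<lambda>s. flux (v s) (\<theta> s) (P n))) \<le> 2 * \<delta> n * (R * \<Theta>) * (t - 0)"
        by (subst (asm) Henstock_Kurzweil_Integration.integral_diff[OF io io]) (rule C1s)+
    qed
  qed
  then have "(\<lambda>n. integral {0..t} (\<lambda>s. flux (v s) (\<theta> s) \<phi>) - ((\<Sum>k\<in>bx n. hat (\<theta> t) k \<bullet> hat \<phi> k) - (\<Sum>k\<in>bx n. hat (\<theta> 0) k \<bullet> hat \<phi> k))) \<longlonglongrightarrow> 0"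
    unfolding e .
  moreover have "(\<lambda>n. integral {0..t} (\<lambda>s. flux (v s) (\<theta> s) \<phi>) - ((\<Sum>k\<in>bx n. hat (\<theta> t) k \<bullet> hat \<phi> k) - (\<Sum>k\<in>bx n. hat (\<theta> 0) k \<bullet> hat \<phi> k)))
     \<longlonglongrightarrow> integral {0..t} (\<lambda>s. flux (v s) (\<theta> s) \<phi>) - (ip (\<theta> t) \<phi> - ip (\<theta> 0) \<phi>)"
    by (intro tendsto_diff tendsto_const has_sum_bx parseval \<theta>_props sqi_smooth \<phi>)
  ultimately have "integral {0..t} (\<lambda>s. flux (v s) (\<theta> s) \<phi>) - (ip (\<theta> t) \<phi> - ip (\<theta> 0) \<phi>) = 0"
    using LIMSEQ_unique by blast
  then show ?thesis by simp
qed

text \<open>Coefficients of the time derivative of the velocity: the momentum right-hand side after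
  inversion of the Voigt operator.\<close>

definition WW where "WW t k = Bk (v t) (\<theta> t) k / lam al k"

lemma WW_en: "finite G \<Longrightarrow> en al G (WW t) \<le> K\<^sup>2"
  using W_en[OF cl_in, of G t] unfolding WW_def v_def \<theta>_def .

definition is_w where "is_w t w \<longleftrightarrow> w \<in> borel_measurable borel \<and> periodic2 w \<and> sqi w \<and> hat w = (\<lambda>k. WW t k *\<^sub>R Ev k)"
definition ww where "ww t = (SOME w. is_w t w)"

lemma sum_WW_le: "finite G \<Longrightarrow> (\<Sum>k\<in>G. (norm (WW t k *\<^sub>R Ev k))\<^sup>2) \<le> K\<^sup>2"
proof -
  assume G: "finite G"
  have "(\<Sum>k\<in>G. (norm (WW t k *\<^sub>R Ev k))\<^sup>2) \<le> en al G (WW t)"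
    using L2norm_Uf_le[OF G, of "WW t" al] unfolding Uf_def L2norm_Psum[OF G] .
  then show ?thesis using WW_en[OF G, of t] by linarith
qed

lemma ww: "ww t \<in> borel_measurable borel" "periodic2 (ww t)" "sqi (ww t)" "hat (ww t) k = WW t k *\<^sub>R Ev k"
proof -
  have "(\<lambda>k. (norm (WW t k *\<^sub>R Ev k))\<^sup>2) summable_on UNIV"
    by (rule summable_of_bx[OF zero_le_power2 sum_WW_le])
  from riesz_fischer_ex[OF this] have "\<exists>w. is_w t w" unfolding is_w_def .
  then have "is_w t (ww t)" unfolding ww_def by (rule someI_ex)
  then show "ww t \<in> borel_measurable borel" "periodic2 (ww t)" "sqi (ww t)" "hat (ww t) k = WW t k *\<^sub>R Ev k"
    by (auto simp: is_w_def)
qed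

lemma ww_norm: "L2norm (ww t) \<le> K"
proof (rule power2_le_imp_le[OF _ K0])
  show "(L2norm (ww t))\<^sup>2 \<le> K\<^sup>2"
    by (rule L2norm_le_of_hat[OF ww(3)]) (unfold ww(4), rule sum_WW_le[OF finite_bx])
qed

lemma WW_cont: "((\<lambda>s. WW s k) \<longlongrightarrow> WW t k) (at t within A)"
  unfolding WW_def by (intro tendsto_divide Bk_cont tendsto_const) (use lam_pos[of al k] in simp)

lemma ww_hat_cont: "((\<lambda>s. hat (ww s) k) \<longlongrightarrow> hat (ww t) k) (at t within A)"
  unfolding ww(4) by (intro tendsto_scaleR WW_cont tendsto_const)

lemma ww_weak: "sqi g \<Longrightarrow> ((\<lambda>s. ip (ww s) g) \<longlongrightarrow> ip (ww t) g) (at t within A)"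
  by (rule weak_convergence[OF ww(3) ww(3) _ ww_norm ww_hat_cont])

text \<open>Since the time derivative \<open>ww\<close> is bounded in L^2 uniformly in time,
  Parseval and dominated convergence in time reach every square-integrable \<open>\<psi>\<close>,
  without any truncation of derivatives.\<close>

lemma v_static:
  assumes \<psi>: "sqi \<psi>" and t: "t \<in> {0..T}"
  shows "ip (v t) \<psi> - ip (v 0) \<psi> = integral {0..t} (\<lambda>s. ip (ww s) \<psi>)"
proof -
  define c where "c k = Ev k \<bullet> hat \<psi> k" for k
  define f where "f n s = (\<Sum>k\<in>bx n. WW s k * c k)" for n s
  have fe: "f n s = (\<Sum>k\<in>bx n. hat (ww s) k \<bullet> hat \<psi> k)" for n s by (simp add: f_def ww c_def)
  have cW: "continuous_on {0..t} (\<lambda>s. WW s k)" for k unfolding continuous_on_def using WW_cont by blast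
  have lim: "(\<lambda>n. integral {0..t} (f n)) \<longlonglongrightarrow> integral {0..t} (\<lambda>s. ip (ww s) \<psi>)"
  proof (rule dominated_convergence(2)[where h="\<lambda>_. L2norm \<psi> * K"])
    show "f n integrable_on {0..t}" for n
      unfolding f_def by (intro integrable_continuous_real continuous_intros cW)
    show "norm (f n s) \<le> L2norm \<psi> * K" for n s
    proof -
      have "f n s = ip (Psum (bx n) (hat \<psi>)) (ww s)" unfolding fe by (rule ip_Psum[OF ww(3), symmetric])
      then have "norm (f n s) \<le> L2norm (Psum (bx n) (hat \<psi>)) * L2norm (ww s)"
        using ip_cauchy_schwarz[OF sqi_Psum ww(3)] by simp
      also have "\<dots> \<le> L2norm \<psi> * K"
      proof (intro mult_mono ww_norm)
        show "L2norm (Psum (bx n) (hat \<psi>)) \<le> L2norm \<psi>"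
          by (rule power2_le_imp_le[OF _ L2norm_nonneg]) (unfold L2norm_Psum[OF finite_bx], rule bessel[OF \<psi> finite_bx])
      qed auto
      finally show ?thesis .
    qed
    show "(\<lambda>n. f n s) \<longlonglongrightarrow> ip (ww s) \<psi>" for s
      unfolding fe by (rule has_sum_bx[OF parseval[OF ww(3) \<psi>]])
  qed auto
  have "integral {0..t} (f n) = (\<Sum>k\<in>bx n. hat (v t) k \<bullet> hat \<psi> k) - (\<Sum>k\<in>bx n. hat (v 0) k \<bullet> hat \<psi> k)" for n
  proof -
    have eq: "integral {0..t} (\<lambda>s. WW s k) = QQ t k - QQ 0 k" for k
    proof -
      have "integral {0..t} (\<lambda>s. WW s k) = integral {0..t} (\<lambda>s. Bk (uu s) (tth s) k / lam al k)"
        by (rule integral_cong) (use t in \<open>simp add: WW_def v_def \<theta>_def cl_id\<close>)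
      then show ?thesis using u_equation[OF t, of k] by simp
    qed
    have "integral {0..t} (f n) = (\<Sum>k\<in>bx n. integral {0..t} (\<lambda>s. WW s k * c k))"
      unfolding f_def by (intro integral_sum finite_bx integrable_on_mult_left integrable_continuous_real cW)
    also have "\<dots> = (\<Sum>k\<in>bx n. (QQ t k - QQ 0 k) * c k)" by (simp add: eq)
    also have "\<dots> = (\<Sum>k\<in>bx n. hat (v t) k \<bullet> hat \<psi> k) - (\<Sum>k\<in>bx n. hat (v 0) k \<bullet> hat \<psi> k)"
      using T t by (simp add: v_props cl_id c_def sum_subtractf[symmetric] left_diff_distrib)
    finally show ?thesis .
  qed
  then have "(\<lambda>n. (\<Sum>k\<in>bx n. hat (v t) k \<bullet> hat \<psi> k) - (\<Sum>k\<in>bx n. hat (v 0) k \<bullet> hat \<psi> k)) \<longlonglongrightarrow> integral {0..t} (\<lambda>s. ip (ww s) \<psi>)"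
    using lim by simp
  moreover have "(\<lambda>n. (\<Sum>k\<in>bx n. hat (v t) k \<bullet> hat \<psi> k) - (\<Sum>k\<in>bx n. hat (v 0) k \<bullet> hat \<psi> k)) \<longlonglongrightarrow> ip (v t) \<psi> - ip (v 0) \<psi>"
    by (intro tendsto_diff has_sum_bx parseval v_props \<psi>)
  ultimately show ?thesis using LIMSEQ_unique by blast
qed

text \<open>Two Laplacian terms on the test side reproduce the symbol \<open>lam\<close>, which
  cancels the division in \<open>WW\<close>. What remains is the sum of
  \<open>r k * Bk (v t) (\<theta> t) k\<close>, that is, convection plus buoyancy tested against the
  truncations of \<open>\<Psi>\<close>; their limit is taken separately in each term.\<close>

lemma voigt_identity:
  assumes \<Psi>: "smooth \<Psi>" "periodic2 \<Psi>" "meanzero \<Psi>" "\<And>x. div_cl \<Psi> x = 0"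
  shows "ip (ww t) \<Psi> - al\<^sup>2 * (\<Sum>j\<in>UNIV. ip (ww t) (pd j (pd j \<Psi>))) = (\<Sum>j\<in>UNIV. cv j (v t) \<Psi>) + force (\<theta> t) \<Psi>"
proof -
  define r where "r k = hat \<Psi> k \<bullet> Ev k" for k
  define P where "P n = Psum (bx n) (hat \<Psi>)" for n
  have P: "P n = Psum (bx n) (\<lambda>k. r k *\<^sub>R Ev k)" for n
    unfolding P_def r_def hat_div_free[OF \<Psi>, symmetric] ..
  have s\<theta>: "sqi (\<lambda>x. \<theta> t x *\<^sub>R e2)"
  proof -
    have "integrable tor (\<lambda>x. (norm (\<theta> t x *\<^sub>R e2))\<^sup>2)" using sqi_int2[OF \<theta>_props(3), of t] by (simp add: e2_def norm_axis_1)
    then show ?thesis using sqi_meas[OF \<theta>_props(3), of t] by (simp add: sqi_def)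
  qed
  have "((\<lambda>k. hat (ww t) k \<bullet> hat \<Psi> k + - al\<^sup>2 * (hat (ww t) k \<bullet> hat (pd 1 (pd 1 \<Psi>)) k + hat (ww t) k \<bullet> hat (pd 2 (pd 2 \<Psi>)) k))
     has_sum ip (ww t) \<Psi> + - al\<^sup>2 * (ip (ww t) (pd 1 (pd 1 \<Psi>)) + ip (ww t) (pd 2 (pd 2 \<Psi>)))) UNIV"
    by (intro has_sum_add has_sum_cmult_right parseval ww sqi_smooth smooth_pd \<Psi>)
  moreover have "hat (ww t) k \<bullet> hat \<Psi> k + - al\<^sup>2 * (hat (ww t) k \<bullet> hat (pd 1 (pd 1 \<Psi>)) k + hat (ww t) k \<bullet> hat (pd 2 (pd 2 \<Psi>)) k) = r k * Bk (v t) (\<theta> t) k" for k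
  proof -
    have "hat (ww t) k \<bullet> hat \<Psi> k + - al\<^sup>2 * (hat (ww t) k \<bullet> hat (pd 1 (pd 1 \<Psi>)) k + hat (ww t) k \<bullet> hat (pd 2 (pd 2 \<Psi>)) k)
      = (hat (ww t) k \<bullet> hat \<Psi> k) * (1 + al\<^sup>2 * ((2 * pi * kc k 1)\<^sup>2 + (2 * pi * kc k 2)\<^sup>2))"
      (is "?l = ?X * ?m") unfolding hat_pd_pd[OF \<Psi>(1,2)] inner_scaleR_right by algebra
    moreover have "?m = lam al k"
      unfolding lam_def nk_kc[symmetric] sum_2 by (simp add: power_mult_distrib algebra_simps)
    moreover have "?X = WW t k * r k" by (simp add: ww r_def inner_commute)
    moreover have "WW t k * r k * lam al k = r k * Bk (v t) (\<theta> t) k" using lam_pos[of al k] by (simp add: WW_def)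
    ultimately show ?thesis by simp
  qed
  ultimately have "((\<lambda>k. r k * Bk (v t) (\<theta> t) k) has_sum ip (ww t) \<Psi> + - al\<^sup>2 * (ip (ww t) (pd 1 (pd 1 \<Psi>)) + ip (ww t) (pd 2 (pd 2 \<Psi>)))) UNIV"
    by (simp only:)
  from has_sum_bx[OF this]
  have l1: "(\<lambda>n. conv (v t) (P n) + force (\<theta> t) (P n)) \<longlonglongrightarrow> ip (ww t) \<Psi> + - al\<^sup>2 * (ip (ww t) (pd 1 (pd 1 \<Psi>)) + ip (ww t) (pd 2 (pd 2 \<Psi>)))"
    unfolding P conv_force_Psum[OF v_props(3) \<theta>_props(3)] .
  have l2: "(\<lambda>n. force (\<theta> t) (P n)) \<longlonglongrightarrow> force (\<theta> t) \<Psi>"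
  proof -
    have "force (\<theta> t) (P n) = (\<Sum>k\<in>bx n. hat (\<lambda>x. \<theta> t x *\<^sub>R e2) k \<bullet> hat \<Psi> k)" for n
      unfolding force_def P_def by (subst ip_commute) (rule ip_Psum[OF s\<theta>])
    moreover have "(\<lambda>n. \<Sum>k\<in>bx n. hat (\<lambda>x. \<theta> t x *\<^sub>R e2) k \<bullet> hat \<Psi> k) \<longlonglongrightarrow> ip (\<lambda>x. \<theta> t x *\<^sub>R e2) \<Psi>"
      by (intro has_sum_bx parseval s\<theta> sqi_smooth \<Psi>)
    ultimately show ?thesis unfolding force_def by simp
  qed
  obtain \<delta> where \<delta>: "\<delta> \<longlonglongrightarrow> 0" "\<And>n. 0 \<le> \<delta> n" "\<And>n j. AE x in tor. norm (pd j \<Psi> x - pd j (P n) x) \<le> \<delta> n"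
    using pd_truncation[OF \<Psi>(1,2)] unfolding P_def by blast
  have l3: "(\<lambda>n. cv j (v t) (P n)) \<longlonglongrightarrow> cv j (v t) \<Psi>" for j
  proof -
    have "(\<lambda>n. cv j (v t) \<Psi> - cv j (v t) (P n)) \<longlonglongrightarrow> 0"
    proof (rule Lim_null_comparison)
      show "\<forall>\<^sub>F n in sequentially. norm (cv j (v t) \<Psi> - cv j (v t) (P n)) \<le> 2 * \<delta> n * (L2norm (v t) * L2norm (v t))"
        using cv_diff_bound[OF v_props(3) C1_smooth[OF \<Psi>(1)] C1_Psum \<delta>(3)[unfolded P_def] \<delta>(2)]
        unfolding P_def real_norm_def by (intro always_eventually allI)
      show "(\<lambda>n. 2 * \<delta> n * (L2norm (v t) * L2norm (v t))) \<longlonglongrightarrow> 0"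
        using tendsto_mult_left[OF tendsto_mult_right[OF \<delta>(1)], of "L2norm (v t) * L2norm (v t)" 2] by (simp add: mult_ac)
    qed
    from tendsto_diff[OF tendsto_const this, of "cv j (v t) \<Psi>"] show ?thesis by simp
  qed
  have "(\<lambda>n. conv (v t) (P n) + force (\<theta> t) (P n)) \<longlonglongrightarrow> (\<Sum>j\<in>UNIV. cv j (v t) \<Psi>) + force (\<theta> t) \<Psi>"
    unfolding conv_cv by (intro tendsto_add tendsto_sum l2 l3)
  from LIMSEQ_unique[OF l1 this] show ?thesis by (simp add: sum_2)
qed

end

subsection \<open>Time-dependent test functions\<close>

abbreviation jsm :: "(real \<Rightarrow> pt \<Rightarrow> 'b::real_normed_vector) \<Rightarrow> bool" where
  "jsm \<Phi> \<equiv> smooth (\<lambda>z::real \<times> pt. \<Phi> (fst z) (snd z))"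

lemma slice_derivative:
  fixes J :: "real \<times> pt \<Rightarrow> 'b::real_normed_vector"
  assumes "J differentiable (at (t, x))"
  shows "((\<lambda>y. J (t, y)) has_derivative (\<lambda>v. frechet_derivative J (at (t, x)) (0, v))) (at x)"
proof -
  have "((\<lambda>y. (t, y)) has_derivative (\<lambda>v. (0, v))) (at x)" by (auto intro!: derivative_eq_intros)
  then show ?thesis
    using has_derivative_compose[of "\<lambda>y. (t, y)" "\<lambda>v. (0, v)" x UNIV J "frechet_derivative J (at (t, x))"] frechet_derivative_works assms by blast
qed

text \<open>A derivative of the slice in direction \<open>v\<close> is the joint derivative in
  direction \<open>(0, v)\<close>, to which the induction hypothesis applies again.\<close>

lemma Ck_slice:
  fixes J :: "real \<times> pt \<Rightarrow> 'b::real_normed_vector"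
  shows "Ck k J \<Longrightarrow> Ck k (\<lambda>x. J (t, x))"
proof (induction k arbitrary: J)
  case 0
  then have "continuous_on UNIV J" by simp
  then have "continuous_on UNIV (J \<circ> Pair t)"
    by (intro continuous_on_compose continuous_intros) (auto intro: continuous_on_subset)
  then show ?case by (simp add: o_def)
next
  case (Suc k)
  have d: "((\<lambda>y. J (t, y)) has_derivative (\<lambda>v. frechet_derivative J (at (t, x)) (0, v))) (at x)" for x
    using Suc.prems by (intro slice_derivative) auto
  then have "frechet_derivative (\<lambda>x. J (t, x)) (at x) v = frechet_derivative J (at (t, x)) (0, v)" for x v
    by (rule fun_cong[OF frechet_derivative_at[symmetric]])
  moreover have "(\<lambda>x. J (t, x)) differentiable (at x)" for x using d unfolding differentiable_def by blast
  moreover have "Ck k (\<lambda>x. frechet_derivative J (at (t, x)) (0, v))" for v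
    using Suc.IH[of "\<lambda>z. frechet_derivative J (at z) (0, v)"] Suc.prems by simp
  ultimately show ?case by simp
qed

lemma jsm_slice: "jsm \<Phi> \<Longrightarrow> smooth (\<Phi> t)"
  using Ck_slice[of _ "\<lambda>z. \<Phi> (fst z) (snd z)" t] unfolding smooth_def by simp

lemma jsm_pd: assumes "jsm \<Phi>" shows "jsm (\<lambda>t. pd j (\<Phi> t))"
proof -
  let ?J = "\<lambda>z. \<Phi> (fst z) (snd z)"
  have "pd j (\<Phi> (fst z)) (snd z) = frechet_derivative ?J (at z) (0, axis j 1)" for z
    using fun_cong[OF frechet_derivative_at[OF slice_derivative[OF smooth_differentiable[OF assms], of "fst z" "snd z"], symmetric], of "axis j 1"]
    unfolding pd_def fst_conv snd_conv prod.collapse .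
  then have "(\<lambda>z. pd j (\<Phi> (fst z)) (snd z)) = (\<lambda>z. frechet_derivative ?J (at z) (0, axis j 1))" by (rule ext)
  then show ?thesis using smooth_frechet[OF assms] by (simp only:)
qed

lemma jsm_time_derivative: 
  assumes "jsm \<Phi>"
  shows "((\<lambda>s. \<Phi> s x) has_vector_derivative dt \<Phi> t x) (at t within S)" "jsm (dt \<Phi>)"
proof -
  let ?J = "\<lambda>z. \<Phi> (fst z) (snd z)"
  have d: "((\<lambda>s. \<Phi> s x) has_vector_derivative frechet_derivative ?J (at (t, x)) (1, 0)) (at t)" for t x
  proof -
    have "((\<lambda>s. (s, x)) has_derivative (\<lambda>h. (h, 0))) (at t)" by (auto intro!: derivative_eq_intros)
    from has_derivative_compose[OF this iffD1[OF frechet_derivative_works smooth_differentiable[OF assms, of "(t, x)"]]]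
    have "((\<lambda>s. ?J (s, x)) has_derivative (\<lambda>h. frechet_derivative ?J (at (t, x)) (h, 0))) (at t)" .
    moreover have "(\<lambda>h. frechet_derivative ?J (at (t, x)) (h, 0)) = (\<lambda>h. h *\<^sub>R frechet_derivative ?J (at (t, x)) (1, 0))"
    proof
      show "frechet_derivative ?J (at (t, x)) (h, 0) = h *\<^sub>R frechet_derivative ?J (at (t, x)) (1, 0)" for h
        using linear_cmul[OF linear_frechet_derivative[OF smooth_differentiable[OF assms, of "(t, x)"]], of h "(1, 0)"] 
        unfolding scaleR_Pair scaleR_zero_right real_scaleR_def mult_1_right .
    qed
    ultimately show ?thesis unfolding has_vector_derivative_def fst_conv snd_conv by (simp only:)
  qed
  then have e: "dt \<Phi> t x = frechet_derivative ?J (at (t, x)) (1, 0)" for t x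
    unfolding dt_def by (rule vector_derivative_at)
  show "((\<lambda>s. \<Phi> s x) has_vector_derivative dt \<Phi> t x) (at t within S)"
    unfolding e by (rule has_vector_derivative_at_within[OF d])
  show "jsm (dt \<Phi>)" unfolding e prod.collapse by (rule smooth_frechet[OF assms])
qed

lemma jsm_bound:
  assumes "jsm \<Phi>"
  obtains B where "0 \<le> B" "\<And>t x. t \<in> {0..T} \<Longrightarrow> x \<in> cell \<Longrightarrow> norm (\<Phi> t x) \<le> B"
proof -
  have "compact ((\<lambda>z. \<Phi> (fst z) (snd z)) ` ({0..T} \<times> cell))"
    by (intro compact_continuous_image smooth_continuous assms compact_Times) (simp_all add: cell_def)
  then have "bounded ((\<lambda>z. \<Phi> (fst z) (snd z)) ` ({0..T} \<times> cell))" by (rule compact_imp_bounded)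
  then obtain B where B: "\<And>y. y \<in> (\<lambda>z. \<Phi> (fst z) (snd z)) ` ({0..T} \<times> cell) \<Longrightarrow> norm y \<le> B"
    unfolding bounded_iff by blast
  show ?thesis
  proof (rule that[of "\<bar>B\<bar>"])
    fix t x assume "t \<in> {0..T}" "x \<in> cell"
    then have "norm (\<Phi> t x) \<le> B" by (intro B) (force intro: image_eqI[where x="(t, x)"])
    then show "norm (\<Phi> t x) \<le> \<bar>B\<bar>" by linarith
  qed simp
qed

lemma jsm_lipschitz:
  assumes "jsm \<Phi>"
  obtains B where "0 \<le> B" "\<And>s t x. s \<in> {0..T} \<Longrightarrow> t \<in> {0..T} \<Longrightarrow> x \<in> cell \<Longrightarrow> norm (\<Phi> s x - \<Phi> t x) \<le> B * \<bar>s - t\<bar>"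
proof -
  obtain B where B: "0 \<le> B" "\<And>t x. t \<in> {0..T} \<Longrightarrow> x \<in> cell \<Longrightarrow> norm (dt \<Phi> t x) \<le> B"
    by (rule jsm_bound[OF jsm_time_derivative(2)[OF assms], where T=T]) (rule that)
  \<comment> \<open>\<open>2 * B\<close> from the linearisation error and \<open>B\<close> from the
    linear term.\<close>
  have "norm (\<Phi> s x - \<Phi> t x) \<le> (3 * B) * \<bar>s - t\<bar>" if "s \<in> {0..T}" "t \<in> {0..T}" "x \<in> cell" for s t x
  proof -
    have "norm (\<Phi> s x - \<Phi> t x - (s - t) *\<^sub>R dt \<Phi> t x) \<le> norm (s - t) * (2 * B)"
    proof (rule vector_differentiable_bound_linearization[where S="{0..T}"])
      show "closed_segment t s \<subseteq> {0..T}" using that by (auto simp: closed_segment_eq_real_ivl)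
      fix r assume "r \<in> {0..T}"
      then show "norm (dt \<Phi> r x - dt \<Phi> t x) \<le> 2 * B"
        using norm_triangle_ineq4[of "dt \<Phi> r x" "dt \<Phi> t x"] B(2)[of r x] B(2)[of t x] that by linarith
    qed (use that jsm_time_derivative(1)[OF assms] in auto)
    moreover have "norm ((s - t) *\<^sub>R dt \<Phi> t x) \<le> \<bar>s - t\<bar> * B" using B(2)[of t x] that by (simp add: mult_left_mono)
    moreover have "norm (\<Phi> s x - \<Phi> t x) \<le> norm (\<Phi> s x - \<Phi> t x - (s - t) *\<^sub>R dt \<Phi> t x) + norm ((s - t) *\<^sub>R dt \<Phi> t x)"
      using norm_triangle_ineq[of "\<Phi> s x - \<Phi> t x - (s - t) *\<^sub>R dt \<Phi> t x" "(s - t) *\<^sub>R dt \<Phi> t x"] by simp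
    ultimately show ?thesis by (simp add: mult_ac)
  qed
  with B(1) show ?thesis by (intro that[of "3 * B"]) auto
qed

text \<open>The remainder is quadratic uniformly over the cell, so it stays quadratic after pairing
  with any family bounded in L^2; this permits differentiation in time under the pairing.\<close>

lemma jsm_taylor:
  assumes "jsm \<Phi>"
  obtains B where "0 \<le> B" "\<And>s t x. s \<in> {0..T} \<Longrightarrow> t \<in> {0..T} \<Longrightarrow> x \<in> cell \<Longrightarrow>
    norm (\<Phi> s x - \<Phi> t x - (s - t) *\<^sub>R dt \<Phi> t x) \<le> B * (s - t)\<^sup>2"
proof -
  obtain B where B: "0 \<le> B" "\<And>s t x. s \<in> {0..T} \<Longrightarrow> t \<in> {0..T} \<Longrightarrow> x \<in> cell \<Longrightarrow> norm (dt \<Phi> s x - dt \<Phi> t x) \<le> B * \<bar>s - t\<bar>"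
    by (rule jsm_lipschitz[OF jsm_time_derivative(2)[OF assms], where T=T]) (rule that)
  have "norm (\<Phi> s x - \<Phi> t x - (s - t) *\<^sub>R dt \<Phi> t x) \<le> B * (s - t)\<^sup>2"
    if st: "s \<in> {0..T}" "t \<in> {0..T}" and x: "x \<in> cell" for s t x
  proof -
    have "norm (\<Phi> s x - \<Phi> t x - (s - t) *\<^sub>R dt \<Phi> t x) \<le> norm (s - t) * (B * \<bar>s - t\<bar>)"
    proof (rule vector_differentiable_bound_linearization[where S="closed_segment s t"])
      show "closed_segment t s \<subseteq> closed_segment s t" by (simp add: closed_segment_commute)
      show "((\<lambda>r. \<Phi> r x) has_vector_derivative dt \<Phi> r x) (at r within closed_segment s t)" for r
        by (rule jsm_time_derivative(1)[OF assms])
      fix r assume r: "r \<in> closed_segment s t"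
      then have "r \<in> {0..T}" "\<bar>r - t\<bar> \<le> \<bar>s - t\<bar>" using st by (auto simp: closed_segment_eq_real_ivl split: if_splits)
      from B(2)[OF this(1) st(2) x] mult_left_mono[OF this(2) B(1)]
      show "norm (dt \<Phi> r x - dt \<Phi> t x) \<le> B * \<bar>s - t\<bar>" by (rule order_trans)
    qed simp
    moreover have "\<bar>s - t\<bar> * (B * \<bar>s - t\<bar>) = B * (s - t)\<^sup>2" by (simp add: power2_eq_square)
    ultimately show ?thesis by simp
  qed
  with B(1) show ?thesis by (rule that)
qed

lemma periodic_dt: "(\<And>s. periodic2 (\<Phi> s)) \<Longrightarrow> periodic2 (dt \<Phi> t)"
  unfolding periodic2_def dt_def by simp

lemma L2norm_bounded:
  fixes f :: "pt \<Rightarrow> 'b::euclidean_space"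
  assumes "f \<in> borel_measurable tor" "\<And>x. x \<in> cell \<Longrightarrow> norm (f x) \<le> B" "0 \<le> B"
  shows "L2norm f \<le> B"
proof (rule power2_le_imp_le[OF _ assms(3)])
  have "(LINT x|tor. (norm (f x))\<^sup>2) \<le> (LINT x|tor. B\<^sup>2)"
    using sqi_int2[OF sqi_bounded[of f B]] assms by (intro integral_mono) (auto intro: power_mono)
  then show "(L2norm f)\<^sup>2 \<le> B\<^sup>2" by (simp add: L2norm_power2 measure_tor)
qed

lemma DERIV_null_of_square:
  fixes r :: "real \<Rightarrow> 'a::real_normed_vector"
  assumes "\<And>s. s \<in> A \<Longrightarrow> norm (r s) \<le> C * (s - t)\<^sup>2" "t \<in> A"
  shows "(r has_vector_derivative 0) (at t within A)"
proof -
  have r0: "r t = 0" using assms(1)[OF assms(2)] by simp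
  have "((\<lambda>s. (1 / norm (s - t)) *\<^sub>R (r s - (r t + (s - t) *\<^sub>R 0))) \<longlongrightarrow> 0) (at t within A)"
  proof (rule Lim_null_comparison)
    have "((\<lambda>s. C * \<bar>s - t\<bar>) \<longlongrightarrow> C * \<bar>t - t\<bar>) (at t within A)" by (intro tendsto_intros)
    then show "((\<lambda>s. C * \<bar>s - t\<bar>) \<longlongrightarrow> 0) (at t within A)" by simp
    show "\<forall>\<^sub>F s in at t within A. norm ((1 / norm (s - t)) *\<^sub>R (r s - (r t + (s - t) *\<^sub>R 0))) \<le> C * \<bar>s - t\<bar>"
      unfolding eventually_at_filter
    proof (intro always_eventually allI impI)
      fix s assume s: "s \<noteq> t" "s \<in> A"
      have "norm (r s) / \<bar>s - t\<bar> \<le> C * (s - t)\<^sup>2 / \<bar>s - t\<bar>" using assms(1)[OF s(2)] by (intro divide_right_mono) auto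
      also have "C * (s - t)\<^sup>2 = C * \<bar>s - t\<bar> * \<bar>s - t\<bar>" by (simp add: power2_eq_square)
      also have "C * \<bar>s - t\<bar> * \<bar>s - t\<bar> / \<bar>s - t\<bar> = C * \<bar>s - t\<bar>" using s(1) by simp
      finally have "norm (r s) / \<bar>s - t\<bar> \<le> C * \<bar>s - t\<bar>" .
      then show "norm ((1 / norm (s - t)) *\<^sub>R (r s - (r t + (s - t) *\<^sub>R 0))) \<le> C * \<bar>s - t\<bar>" by (simp add: r0)
    qed
  qed
  then show ?thesis
    unfolding has_vector_derivative_def has_derivative_within using bounded_linear_zero by simp
qed

lemma hat_time_derivative:
  fixes \<Phi> :: "real \<Rightarrow> pt \<Rightarrow> 'b::euclidean_space"
  assumes "jsm \<Phi>" and t: "t \<in> {0..T}"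
  shows "((\<lambda>s. hat (\<Phi> s) k) has_vector_derivative hat (dt \<Phi> t) k) (at t within {0..T})"
proof -
  obtain B where B: "0 \<le> B" "\<And>s t x. s \<in> {0..T} \<Longrightarrow> t \<in> {0..T} \<Longrightarrow> x \<in> cell \<Longrightarrow>
    norm (\<Phi> s x - \<Phi> t x - (s - t) *\<^sub>R dt \<Phi> t x) \<le> B * (s - t)\<^sup>2" by (rule jsm_taylor[OF assms(1), where T=T]) (rule that)
  have sq: "sqi (\<Phi> s)" "sqi (dt \<Phi> s)" for s
    by (intro sqi_smooth jsm_slice assms jsm_time_derivative(2)[OF assms(1)])+
  define r where "r s = hat (\<lambda>x. \<Phi> s x - \<Phi> t x - (s - t) *\<^sub>R dt \<Phi> t x) k" for s
  have rsq: "sqi (\<lambda>x. \<Phi> s x - \<Phi> t x - (s - t) *\<^sub>R dt \<Phi> t x)" for s by (intro sqi_diff sqi_scaleR sq)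
  have eq: "hat (\<Phi> s) k = hat (\<Phi> t) k + (s - t) *\<^sub>R hat (dt \<Phi> t) k + r s" for s
  proof -
    have "r s = hat (\<Phi> s) k - hat (\<Phi> t) k - (s - t) *\<^sub>R hat (dt \<Phi> t) k"
      unfolding r_def by (simp only: hat_diff hat_scaleR sqi_integrable sq sqi_diff sqi_scaleR)
    then show ?thesis by (simp add: algebra_simps)
  qed
  have dr: "(r has_vector_derivative 0) (at t within {0..T})"
  proof (rule DERIV_null_of_square[OF _ t])
    fix s assume s: "s \<in> {0..T}"
    have "norm (r s) \<le> L2norm (\<lambda>x. \<Phi> s x - \<Phi> t x - (s - t) *\<^sub>R dt \<Phi> t x)" unfolding r_def by (rule norm_hat_le[OF rsq])
    also have "\<dots> \<le> B * (s - t)\<^sup>2" by (rule L2norm_bounded[OF sqi_meas[OF rsq]]) (use B s t in auto)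
    finally show "norm (r s) \<le> B * (s - t)\<^sup>2" .
  qed
  have "((\<lambda>s. hat (\<Phi> t) k + (s - t) *\<^sub>R hat (dt \<Phi> t) k) has_vector_derivative hat (dt \<Phi> t) k) (at t within {0..T})"
    by (auto intro!: derivative_eq_intros)
  from has_vector_derivative_add[OF this dr] have "((\<lambda>s. hat (\<Phi> t) k + (s - t) *\<^sub>R hat (dt \<Phi> t) k + r s) has_vector_derivative hat (dt \<Phi> t) k) (at t within {0..T})"
    by simp
  moreover have "(\<lambda>s. hat (\<Phi> s) k) = (\<lambda>s. hat (\<Phi> t) k + (s - t) *\<^sub>R hat (dt \<Phi> t) k + r s)" by (rule ext) (rule eq)
  ultimately show ?thesis by (simp only:)
qed

text \<open>Product rule for a factor \<open>f\<close> that is only weakly continuous and weakly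
  differentiable in time. The smooth factor is expanded at \<open>t\<close>: the constant term is
  differentiated by assumption, the linear one by weak continuity, and the remainder is
  quadratic.\<close>

lemma product_derivative:
  fixes f \<xi> :: "real \<Rightarrow> pt \<Rightarrow> 'b::euclidean_space"
  assumes f: "\<And>s. sqi (f s)" "\<And>s. L2norm (f s) \<le> R" and \<xi>: "jsm \<xi>" and t: "t \<in> {0..T}"
    and w: "\<And>g. sqi g \<Longrightarrow> ((\<lambda>s. ip (f s) g) \<longlongrightarrow> ip (f t) g) (at t within {0..T})"
    and d: "((\<lambda>s. ip (f s) (\<xi> t)) has_vector_derivative d) (at t within {0..T})"
  shows "((\<lambda>s. ip (f s) (\<xi> s)) has_vector_derivative d + ip (f t) (dt \<xi> t)) (at t within {0..T})"
proof -
  obtain B where B: "0 \<le> B" "\<And>s t x. s \<in> {0..T} \<Longrightarrow> t \<in> {0..T} \<Longrightarrow> x \<in> cell \<Longrightarrow>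
    norm (\<xi> s x - \<xi> t x - (s - t) *\<^sub>R dt \<xi> t x) \<le> B * (s - t)\<^sup>2" by (rule jsm_taylor[OF \<xi>, where T=T]) (rule that)
  have sq: "sqi (\<xi> s)" "sqi (dt \<xi> s)" for s
    by (intro sqi_smooth jsm_slice \<xi> jsm_time_derivative(2)[OF \<xi>])+
  have R: "0 \<le> R" using f(2)[of 0] L2norm_nonneg order_trans by blast
  define e where "e s x = \<xi> s x - \<xi> t x - (s - t) *\<^sub>R dt \<xi> t x" for s x
  define r where "r s = ip (f s) (e s)" for s
  have esq: "sqi (e s)" for s unfolding e_def by (intro sqi_diff sqi_scaleR sq)
  have eq: "ip (f s) (\<xi> s) = ip (f s) (\<xi> t) + (s - t) * ip (f s) (dt \<xi> t) + r s" for s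
  proof -
    have "ip (e s) (f s) = ip (\<xi> s) (f s) - ip (\<xi> t) (f s) - (s - t) * ip (dt \<xi> t) (f s)"
      unfolding e_def by (simp add: ip_diff_left ip_scaleR_left f sq sqi_diff sqi_scaleR)
    then show ?thesis unfolding r_def by (simp add: ip_commute[of "f s"])
  qed
  have dr: "(r has_vector_derivative 0) (at t within {0..T})"
  proof (rule DERIV_null_of_square[OF _ t])
    fix s assume s: "s \<in> {0..T}"
    have "norm (r s) \<le> L2norm (f s) * L2norm (e s)" unfolding r_def using ip_cauchy_schwarz[OF f(1) esq] by simp
    also have "\<dots> \<le> R * (B * (s - t)\<^sup>2)"
      by (intro mult_mono f(2) R L2norm_bounded[OF sqi_meas[OF esq]]) (use B s t in \<open>auto simp: e_def\<close>)
    finally show "norm (r s) \<le> (R * B) * (s - t)\<^sup>2" by (simp add: mult_ac)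
  qed
  \<comment> \<open>The factor \<open>s - t\<close> vanishes at \<open>t\<close>, so by
    Caratheodory's criterion continuity of the other factor suffices for differentiability.\<close>
  have dp: "((\<lambda>s. (s - t) * ip (f s) (dt \<xi> t)) has_vector_derivative ip (f t) (dt \<xi> t)) (at t within {0..T})"
    unfolding has_real_derivative_iff_has_vector_derivative[symmetric] DERIV_caratheodory_within
  proof (intro exI conjI allI)
    show "continuous (at t within {0..T}) (\<lambda>s. ip (f s) (dt \<xi> t))"
      unfolding continuous_within by (rule w[OF sq(2)])
  qed simp_all
  have "(\<lambda>s. ip (f s) (\<xi> s)) = (\<lambda>s. ip (f s) (\<xi> t) + (s - t) * ip (f s) (dt \<xi> t) + r s)" by (rule ext) (rule eq)
  moreover have "((\<lambda>s. ip (f s) (\<xi> t) + (s - t) * ip (f s) (dt \<xi> t) + r s) has_vector_derivative d + ip (f t) (dt \<xi> t)) (at t within {0..T})"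
    using has_vector_derivative_add[OF has_vector_derivative_add[OF d dp] dr] by simp
  ultimately show ?thesis by (simp only:)
qed

lemma product_continuous:
  fixes f \<xi> :: "real \<Rightarrow> pt \<Rightarrow> 'b::euclidean_space"
  assumes f: "\<And>s. sqi (f s)" "\<And>s. L2norm (f s) \<le> R" and \<xi>: "jsm \<xi>" and t: "t \<in> {0..T}"
    and w: "\<And>g. sqi g \<Longrightarrow> ((\<lambda>s. ip (f s) g) \<longlongrightarrow> ip (f t) g) (at t within {0..T})"
  shows "((\<lambda>s. ip (f s) (\<xi> s)) \<longlongrightarrow> ip (f t) (\<xi> t)) (at t within {0..T})"
proof -
  obtain B where B: "0 \<le> B" "\<And>s t x. s \<in> {0..T} \<Longrightarrow> t \<in> {0..T} \<Longrightarrow> x \<in> cell \<Longrightarrow> norm (\<xi> s x - \<xi> t x) \<le> B * \<bar>s - t\<bar>"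
    by (rule jsm_lipschitz[OF \<xi>, where T=T]) (rule that)
  have sq: "sqi (\<xi> s)" for s by (intro sqi_smooth jsm_slice \<xi>)
  have R: "0 \<le> R" using f(2)[of 0] L2norm_nonneg order_trans by blast
  have "((\<lambda>s. ip (f s) (\<xi> s) - ip (f s) (\<xi> t)) \<longlongrightarrow> 0) (at t within {0..T})"
  proof (rule Lim_null_comparison)
    have "((\<lambda>s. R * (B * \<bar>s - t\<bar>)) \<longlongrightarrow> R * (B * \<bar>t - t\<bar>)) (at t within {0..T})" by (intro tendsto_intros)
    then show "((\<lambda>s. R * (B * \<bar>s - t\<bar>)) \<longlongrightarrow> 0) (at t within {0..T})" by simp
    show "\<forall>\<^sub>F s in at t within {0..T}. norm (ip (f s) (\<xi> s) - ip (f s) (\<xi> t)) \<le> R * (B * \<bar>s - t\<bar>)"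
      unfolding eventually_at_filter
    proof (intro always_eventually allI impI)
      fix s assume s: "s \<in> {0..T}"
      have dsq: "sqi (\<lambda>x. \<xi> s x - \<xi> t x)" by (intro sqi_diff sq)
      have "ip (f s) (\<xi> s) - ip (f s) (\<xi> t) = ip (\<lambda>x. \<xi> s x - \<xi> t x) (f s)"
        unfolding ip_diff_left[OF sq sq f(1)] by (simp add: ip_commute)
      then have "norm (ip (f s) (\<xi> s) - ip (f s) (\<xi> t)) \<le> L2norm (\<lambda>x. \<xi> s x - \<xi> t x) * L2norm (f s)"
        using ip_cauchy_schwarz[OF dsq f(1)] by simp
      also have "\<dots> \<le> (B * \<bar>s - t\<bar>) * R"
        by (intro mult_mono f(2) L2norm_bounded[OF sqi_meas[OF dsq]]) (use B s t in auto)
      finally show "norm (ip (f s) (\<xi> s) - ip (f s) (\<xi> t)) \<le> R * (B * \<bar>s - t\<bar>)" by (simp add: mult_ac)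
    qed
  qed
  from tendsto_add[OF this w[OF sq[of t]]] show ?thesis by simp
qed

lemma jsm_C1_lipschitz:
  fixes \<Phi> :: "real \<Rightarrow> pt \<Rightarrow> 'b::euclidean_space"
  assumes "jsm \<Phi>"
  obtains B where "0 \<le> B" "\<And>s t j x. s \<in> {0..T} \<Longrightarrow> t \<in> {0..T} \<Longrightarrow> x \<in> cell \<Longrightarrow> norm (pd j (\<Phi> s) x - pd j (\<Phi> t) x) \<le> B * \<bar>s - t\<bar>"
proof -
  obtain B1 where B1: "0 \<le> B1" "\<And>s t x. s \<in> {0..T} \<Longrightarrow> t \<in> {0..T} \<Longrightarrow> x \<in> cell \<Longrightarrow> norm (pd 1 (\<Phi> s) x - pd 1 (\<Phi> t) x) \<le> B1 * \<bar>s - t\<bar>"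
    by (rule jsm_lipschitz[OF jsm_pd[OF assms, of 1], where T=T]) (rule that)
  obtain B2 where B2: "0 \<le> B2" "\<And>s t x. s \<in> {0..T} \<Longrightarrow> t \<in> {0..T} \<Longrightarrow> x \<in> cell \<Longrightarrow> norm (pd 2 (\<Phi> s) x - pd 2 (\<Phi> t) x) \<le> B2 * \<bar>s - t\<bar>"
    by (rule jsm_lipschitz[OF jsm_pd[OF assms, of 2], where T=T]) (rule that)
  have "norm (pd j (\<Phi> s) x - pd j (\<Phi> t) x) \<le> (B1 + B2) * \<bar>s - t\<bar>" if "s \<in> {0..T}" "t \<in> {0..T}" "x \<in> cell" for s t j x
  proof -
    consider "j = 1" | "j = 2" using exhaust_2 by blast
    then show ?thesis
      using B1(2)[OF that] B2(2)[OF that] mult_nonneg_nonneg[OF B1(1) abs_ge_zero, of "s - t"] mult_nonneg_nonneg[OF B2(1) abs_ge_zero, of "s - t"]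
      by cases (simp_all add: distrib_right)
  qed
  then show ?thesis using B1(1) B2(1) by (intro that[of "B1 + B2"]) auto
qed

lemma vector_derivative_unique_on_interval:
  fixes f :: "real \<Rightarrow> 'a::euclidean_space"
  assumes "0 < T" "t \<in> {0..T}" "(f has_vector_derivative a) (at t within {0..T})" "(f has_vector_derivative b) (at t within {0..T})"
  shows "a = b"
  using vector_derivative_unique_within_closed_interval[of 0 T t f a b] assms by simp

lemma LINT_continuous:
  fixes g :: "real \<Rightarrow> real"
  assumes "continuous_on {0..t} g" shows "(LINT s:{0..t}|lborel. g s) = integral {0..t} g"
  using borel_integrable_atLeastAtMost'[OF assms] set_borel_integral_eq_integral(2) by blast

lemma LINT_of_derivative:
  fixes h :: "real \<Rightarrow> real"
  assumes "0 \<le> T" "\<And>t. t \<in> {0..T} \<Longrightarrow> (h has_vector_derivative g t) (at t within {0..T})" "continuous_on {0..T} g"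
  shows "(LINT s:{0..T}|lborel. g s) = h T - h 0"
  unfolding LINT_continuous[OF assms(3)] by (rule integral_unique[OF fundamental_theorem_of_calculus[OF assms(1,2)]])

text \<open>Moves both derivatives to the test function by comparing coefficients. The chosen
  derivatives \<open>D j\<close> disappear, and the gradient pairing becomes an L^2 pairing that can
  be differentiated in time.\<close>

lemma ip1_smooth:
  assumes u: "u \<in> H1" and \<Psi>: "smooth \<Psi>" "periodic2 \<Psi>" "meanzero \<Psi>"
  shows "ip1 u \<Psi> = - (\<Sum>j\<in>UNIV. ip u (pd j (pd j \<Psi>)))"
proof -
  have "ip (D j u) (D j \<Psi>) = - ip u (pd j (pd j \<Psi>))" for j
  proof -
    have su: "sqi u" "sqi (D j u)" using H1_L2[OF u] D_weak_pd(2)[OF u] by (auto intro: sqi_L2)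
    have sp: "sqi (pd j \<Psi>)" "sqi (pd j (pd j \<Psi>))" by (intro sqi_smooth smooth_pd \<Psi>)+
    have sD: "sqi (D j \<Psi>)" using D_weak_pd(2)[OF H1_smooth[OF \<Psi>]] by (rule sqi_L2)
    have "ip (D j u) (D j \<Psi>) = ip (D j u) (pd j \<Psi>)"
      unfolding ip_commute[of "D j u"] by (rule ip_cong_AE[OF sqi_meas[OF sD] sqi_meas[OF sp(1)] sqi_meas[OF su(2)] D_smooth[OF \<Psi>]])
    also have "\<dots> = - ip u (pd j (pd j \<Psi>))"
    proof -
      have e: "hat (D j u) k \<bullet> hat (pd j \<Psi>) k = - (hat u (- k) \<bullet> hat (pd j (pd j \<Psi>)) (- k))" for k
        unfolding hat_weak_pd[OF D_weak_pd(1)[OF u]] hat_pd_pd[OF \<Psi>(1,2)] hat_pd[OF \<Psi>(1,2)]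
        by (simp add: kc_simps power2_eq_square)
      have "((\<lambda>k. hat u k \<bullet> hat (pd j (pd j \<Psi>)) k) has_sum ip u (pd j (pd j \<Psi>))) UNIV" by (rule parseval[OF su(1) sp(2)])
      then have "((\<lambda>k. hat u (- k) \<bullet> hat (pd j (pd j \<Psi>)) (- k)) has_sum ip u (pd j (pd j \<Psi>))) UNIV"
        using has_sum_reindex_bij_betw[OF bij_uminus_k, of "\<lambda>k. hat u k \<bullet> hat (pd j (pd j \<Psi>)) k"] by blast
      then have "((\<lambda>k. hat (D j u) k \<bullet> hat (pd j \<Psi>) k) has_sum - ip u (pd j (pd j \<Psi>))) UNIV"
        unfolding e by (rule has_sum_uminusI)
      then show ?thesis using has_sum_unique parseval[OF su(2) sp(1)] by blast
    qed
    finally show ?thesis .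
  qed
  then show ?thesis unfolding ip1_def by (simp add: sum_negf)
qed

text \<open>Commutation of time and space derivatives is proved on the coefficients, where a space
  derivative is multiplication by a constant; it holds almost everywhere, which is enough inside
  pairings. The zero mean is inherited in the same way, by differentiating the mean.\<close>

lemma dt_test:
  fixes \<Phi> :: "real \<Rightarrow> pt \<Rightarrow> 'b::euclidean_space"
  assumes \<Phi>: "jsm \<Phi>" "\<And>s. periodic2 (\<Phi> s)" "\<And>s. meanzero (\<Phi> s)" and T: "0 < T" and t: "t \<in> {0..T}"
  shows "smooth (dt \<Phi> t)" "periodic2 (dt \<Phi> t)" "meanzero (dt \<Phi> t)"
    "sqi f \<Longrightarrow> ip f (dt (\<lambda>s. pd j (pd j (\<Phi> s))) t) = ip f (pd j (pd j (dt \<Phi> t)))"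
proof -
  show s: "smooth (dt \<Phi> t)" by (rule jsm_slice[OF jsm_time_derivative(2)[OF \<Phi>(1)]])
  show p: "periodic2 (dt \<Phi> t)" by (rule periodic_dt[OF \<Phi>(2)])
  have "((\<lambda>s. hat (\<Phi> s) 0) has_vector_derivative hat (dt \<Phi> t) 0) (at t within {0..T})" by (rule hat_time_derivative[OF \<Phi>(1) t])
  then have "((\<lambda>s. 0) has_vector_derivative hat (dt \<Phi> t) 0) (at t within {0..T})" using \<Phi>(3) by (simp add: meanzero_hat)
  then show "meanzero (dt \<Phi> t)" unfolding meanzero_hat
    using vector_derivative_unique_on_interval[OF T t _ has_vector_derivative_const] by blast
  let ?\<Xi> = "\<lambda>s. pd j (pd j (\<Phi> s))"
  have j: "jsm ?\<Xi>" by (intro jsm_pd \<Phi>)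
  have "hat (dt ?\<Xi> t) k = hat (pd j (pd j (dt \<Phi> t))) k" for k
  proof -
    have "((\<lambda>s. hat (?\<Xi> s) k) has_vector_derivative hat (dt ?\<Xi> t) k) (at t within {0..T})" by (rule hat_time_derivative[OF j t])
    moreover have "((\<lambda>s. - (2 * pi * kc k j)\<^sup>2 *\<^sub>R hat (\<Phi> s) k) has_vector_derivative - (2 * pi * kc k j)\<^sup>2 *\<^sub>R hat (dt \<Phi> t) k) (at t within {0..T})"
      by (rule bounded_linear.has_vector_derivative[OF bounded_linear_scaleR_right hat_time_derivative[OF \<Phi>(1) t]])
    ultimately show ?thesis
      unfolding hat_pd_pd[OF jsm_slice[OF \<Phi>(1)] \<Phi>(2)] hat_pd_pd[OF s p]
      by (rule vector_derivative_unique_on_interval[OF T t])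
  qed
  note h = this
  have s1: "sqi (dt ?\<Xi> t)" by (rule sqi_smooth[OF jsm_slice[OF jsm_time_derivative(2)[OF j]]])
  have s2: "sqi (pd j (pd j (dt \<Phi> t)))" by (rule sqi_smooth[OF smooth_pd[OF smooth_pd[OF s]]])
  have ae: "AE x in tor. dt ?\<Xi> t x = pd j (pd j (dt \<Phi> t)) x"
    by (rule hat_eqI[OF sqi_integrable[OF s1] sqi_integrable[OF s2] h])
  show "ip f (dt ?\<Xi> t) = ip f (pd j (pd j (dt \<Phi> t)))" if f: "sqi f"
  proof -
    have "ip (dt ?\<Xi> t) f = ip (pd j (pd j (dt \<Phi> t))) f"
      by (rule ip_cong_AE[OF sqi_meas[OF s1] sqi_meas[OF s2] sqi_meas[OF f] ae])
    then show ?thesis by (simp only: ip_commute[of f])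
  qed
qed

subsection \<open>Regularity of the limit\<close>

lemma restrict_measurable:
  fixes g :: "real \<Rightarrow> real"
  assumes "continuous_on {0..T} g" shows "g \<in> borel_measurable (restrict_space lborel {0..T})"
proof -
  have "g \<in> borel_measurable (restrict_space borel {0..T})" by (rule borel_measurable_continuous_on_restrict[OF assms])
  moreover have "sets (restrict_space lborel {0..T}) = sets (restrict_space borel {0..T::real})"
    by (rule sets_restrict_space_cong) simp
  ultimately show ?thesis using measurable_cong_sets[OF _ refl] by blast
qed

lemma continuous_on_tendsto: "(\<And>t. t \<in> A \<Longrightarrow> (g \<longlongrightarrow> g t) (at t within A)) \<Longrightarrow> continuous_on A g"
  unfolding continuous_on_def by blast

text \<open>Rewrites a pairing with the chosen derivative as a pairing with \<open>u\<close>, so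
  that its measurability in time follows from weak continuity of the curve.\<close>

lemma ip_D:
  fixes u \<Psi> :: "pt \<Rightarrow> real^2"
  assumes u: "u \<in> H1" and \<Psi>: "smooth \<Psi>" "periodic2 \<Psi>"
  shows "ip (D j u) \<Psi> = - ip u (pd j \<Psi>)"
proof -
  have su: "sqi u" "sqi (D j u)" using H1_L2[OF u] D_weak_pd(2)[OF u] by (auto intro: sqi_L2)
  have sp: "sqi \<Psi>" "sqi (pd j \<Psi>)" by (intro sqi_smooth smooth_pd \<Psi>)+
  have e: "hat (D j u) k \<bullet> hat \<Psi> k = - (hat u (- k) \<bullet> hat (pd j \<Psi>) (- k))" for k
    unfolding hat_weak_pd[OF D_weak_pd(1)[OF u]] hat_pd[OF \<Psi>] by (simp add: kc_simps)
  have "((\<lambda>k. hat u k \<bullet> hat (pd j \<Psi>) k) has_sum ip u (pd j \<Psi>)) UNIV" by (rule parseval[OF su(1) sp(2)])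
  then have "((\<lambda>k. hat u (- k) \<bullet> hat (pd j \<Psi>) (- k)) has_sum ip u (pd j \<Psi>)) UNIV"
    using has_sum_reindex_bij_betw[OF bij_uminus_k, of "\<lambda>k. hat u k \<bullet> hat (pd j \<Psi>) k"] by blast
  then have "((\<lambda>k. hat (D j u) k \<bullet> hat \<Psi> k) has_sum - ip u (pd j \<Psi>)) UNIV"
    unfolding e by (rule has_sum_uminusI)
  then show ?thesis by (rule has_sum_unique[OF parseval[OF su(2) sp(1)]])
qed

section \<open>The velocity and its time derivative as curves in V\<close>

definition voigt_const :: "real \<Rightarrow> real" where "voigt_const al = max 1 (1 / al\<^sup>2)"

lemma voigt_const_nonneg: "0 \<le> voigt_const al" by (simp add: voigt_const_def)

lemma wt_le_lam: assumes "al > 0" shows "wt k \<le> voigt_const al * lam al k"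
proof -
  have "1 / al\<^sup>2 \<le> voigt_const al" "1 \<le> voigt_const al" by (simp_all add: voigt_const_def)
  then have "1 \<le> voigt_const al * al\<^sup>2" using assms by (simp add: divide_simps)
  then have "1 * (4 * pi\<^sup>2 * nk k) \<le> (voigt_const al * al\<^sup>2) * (4 * pi\<^sup>2 * nk k)" by (intro mult_right_mono) auto
  then show ?thesis using \<open>1 \<le> voigt_const al\<close> by (simp add: wt_def lam_def algebra_simps)
qed

lemma sum_wt_le:
  assumes "al > 0" "en al G g \<le> C" shows "(\<Sum>k\<in>G. wt k * (g k)\<^sup>2) \<le> voigt_const al * C"
proof -
  have "(\<Sum>k\<in>G. wt k * (g k)\<^sup>2) \<le> (\<Sum>k\<in>G. voigt_const al * (lam al k * (g k)\<^sup>2))"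
    using wt_le_lam[OF assms(1)] by (intro sum_mono) (simp add: mult_right_mono flip: mult.assoc)
  also have "\<dots> = voigt_const al * en al G g" by (simp add: en_def sum_distrib_left)
  also have "\<dots> \<le> voigt_const al * C" by (rule mult_left_mono[OF assms(2) voigt_const_nonneg])
  finally show ?thesis .
qed

lemma V_of_energy:
  fixes u :: "pt \<Rightarrow> real^2"
  assumes al: "al > 0" and u: "u \<in> borel_measurable borel" "periodic2 u" "sqi u" "\<And>k. hat u k = g k *\<^sub>R Ev k"
    and e: "\<And>G. finite G \<Longrightarrow> en al G g \<le> C\<^sup>2" and C: "0 \<le> C"
  shows "u \<in> H1" "u \<in> V" "H1norm u \<le> sqrt (voigt_const al) * C"
proof -
  have wt0: "0 \<le> wt k" for k using wt_ge_1[of k] by linarith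
  have s: "(\<lambda>k. wt k * (g k)\<^sup>2) summable_on UNIV"
  proof (rule nonneg_bdd_above_summable_on)
    show "0 \<le> wt k * (g k)\<^sup>2" for k by (rule mult_nonneg_nonneg[OF wt0 zero_le_power2])
    show "bdd_above (sum (\<lambda>k. wt k * (g k)\<^sup>2) ` {G. G \<subseteq> UNIV \<and> finite G})"
      by (rule bdd_aboveI[where M="voigt_const al * C\<^sup>2"]) (auto intro: sum_wt_le[OF al e])
  qed
  show h: "u \<in> H1" "u \<in> V" using V_I[OF u s] by blast+
  have "(\<lambda>n. \<Sum>k\<in>bx n. wt k * (norm (hat u k))\<^sup>2) \<longlonglongrightarrow> (H1norm u)\<^sup>2" by (rule has_sum_bx[OF H1norm_sum[OF h(1)]])
  moreover have "(\<Sum>k\<in>bx n. wt k * (norm (hat u k))\<^sup>2) \<le> voigt_const al * C\<^sup>2" for n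
  proof -
    have "(norm (hat u k))\<^sup>2 \<le> (g k)\<^sup>2" for k
      using power_mono[OF mult_left_mono[OF norm_Ev_le[of k] abs_ge_zero[of "g k"]], of 2] by (simp add: u(4))
    then have "(\<Sum>k\<in>bx n. wt k * (norm (hat u k))\<^sup>2) \<le> (\<Sum>k\<in>bx n. wt k * (g k)\<^sup>2)"
      using wt0 by (intro sum_mono mult_left_mono) auto
    also have "\<dots> \<le> voigt_const al * C\<^sup>2" by (rule sum_wt_le[OF al e[OF finite_bx]])
    finally show ?thesis .
  qed
  ultimately have "(H1norm u)\<^sup>2 \<le> voigt_const al * C\<^sup>2" by (intro LIMSEQ_le_const2) auto
  then show "H1norm u \<le> sqrt (voigt_const al) * C"
    using real_le_rsqrt[of "H1norm u" "voigt_const al * C\<^sup>2"] C by (simp add: real_sqrt_mult)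
qed

context approx
begin

lemma v_V: "v t \<in> H1" "v t \<in> V"
  using V_of_energy[OF al v_props QQ_en[OF cl_in] R0] by blast+

lemma ww_V: "ww t \<in> H1" "ww t \<in> V" "H1norm (ww t) \<le> sqrt (voigt_const al) * K"
  using V_of_energy[OF al ww WW_en K0] by blast+

lemma C_V_v: "C_V T v"
proof -
  have "((\<lambda>s. H1norm (\<lambda>x. v s x - v t x)) \<longlongrightarrow> 0) (at t within {0..T})" for t
  proof (rule Lim_null_comparison)
    have b: "H1norm (\<lambda>x. v s x - v t x) \<le> sqrt (voigt_const al) * (K * \<bar>s - t\<bar>)" for s
    proof (rule V_of_energy(3)[OF al])
      show "(\<lambda>x. v s x - v t x) \<in> borel_measurable borel" by (intro borel_measurable_diff v_props)
      show "periodic2 (\<lambda>x. v s x - v t x)" using v_props(2)[of s] v_props(2)[of t] by (simp add: periodic2_def)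
      show "sqi (\<lambda>x. v s x - v t x)" by (intro sqi_diff v_props)
      show "hat (\<lambda>x. v s x - v t x) k = (QQ (cl s) k - QQ (cl t) k) *\<^sub>R Ev k" for k
        by (simp only: hat_diff sqi_integrable v_props scaleR_diff_left)
    qed (use K0 QQ_cl_lip in auto)
    then show "\<forall>\<^sub>F s in at t within {0..T}. norm (H1norm (\<lambda>x. v s x - v t x)) \<le> sqrt (voigt_const al) * (K * \<bar>s - t\<bar>)"
      by (intro always_eventually allI) (simp only: real_norm_def abs_of_nonneg[OF H1norm_nonneg])
    have "((\<lambda>s. sqrt (voigt_const al) * (K * \<bar>s - t\<bar>)) \<longlongrightarrow> sqrt (voigt_const al) * (K * \<bar>t - t\<bar>)) (at t within {0..T})"
      by (intro tendsto_intros)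
    then show "((\<lambda>s. sqrt (voigt_const al) * (K * \<bar>s - t\<bar>)) \<longlongrightarrow> 0) (at t within {0..T})" by simp
  qed
  then show ?thesis unfolding C_V_def using v_V by blast
qed

lemma ww_ip_continuous: "sqi \<psi> \<Longrightarrow> continuous_on {0..t} (\<lambda>s. ip (ww s) \<psi>)"
  by (intro continuous_on_tendsto ww_weak)

lemma dt_Linf_V_v: "dt_Linf_V T v"
  unfolding dt_Linf_V_def
proof (intro exI[of _ ww] conjI allI impI ballI)
  show "AE t in lborel. t \<in> {0..T} \<longrightarrow> ww t \<in> V" using ww_V by simp
  show "\<exists>C. AE t in lborel. t \<in> {0..T} \<longrightarrow> H1norm (ww t) \<le> C" using ww_V(3) by (intro exI[of _ "sqrt (voigt_const al) * K"]) simp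
  fix \<psi> :: "pt \<Rightarrow> real^2" assume "smooth \<psi> \<and> periodic2 \<psi>"
  then have \<psi>: "smooth \<psi>" "periodic2 \<psi>" by auto
  show "(\<lambda>t. ip (ww t) \<psi>) \<in> borel_measurable (restrict_space lborel {0..T})"
    by (intro restrict_measurable ww_ip_continuous sqi_smooth \<psi>)
  show "(\<lambda>t. ip (D j (ww t)) \<psi>) \<in> borel_measurable (restrict_space lborel {0..T})" for j
    unfolding ip_D[OF ww_V(1) \<psi>]
    by (intro restrict_measurable continuous_on_minus ww_ip_continuous sqi_smooth smooth_pd \<psi>)
  fix t assume t: "t \<in> {0..T}"
  show "ip (v t) \<psi> - ip (v 0) \<psi> = (LINT s:{0..t}|lborel. ip (ww s) \<psi>)"
    unfolding v_static[OF sqi_smooth[OF \<psi>(1)] t] LINT_continuous[OF ww_ip_continuous[OF sqi_smooth[OF \<psi>(1)]]] ..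
qed

text \<open>The mean is conserved: mode zero is constant, so its flux vanishes.\<close>

lemma \<theta>_L2: assumes "hat th0 0 = 0" shows "\<theta> t \<in> L2"
proof (rule L2_I[OF \<theta>_props(1-3)])
  have "HH (cl t) 0 - HH 0 0 = 0"
    unfolding theta_equation[OF cl_in] flux_cas by (simp add: ph_simps(6))
  then show "hat (\<theta> t) 0 = 0" using assms unfolding \<theta>_props(4) HH_0 by simp
qed

lemma Linf_L2_\<theta>: "hat th0 0 = 0 \<Longrightarrow> Linf_L2 T \<theta>"
  unfolding Linf_L2_def using \<theta>_L2 \<theta>_norm by auto

lemma Cw_L2_\<theta>: "hat th0 0 = 0 \<Longrightarrow> Cw_L2 T \<theta>"
  unfolding Cw_L2_def using \<theta>_L2 by (auto intro!: continuous_on_tendsto \<theta>_weak sqi_L2)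

end

subsection \<open>The transport flux in the dual of H2\<close>

lemma Psum_nonzero: assumes "a 0 = 0" shows "Psum (bx n) a = Psum (bx n - {0}) a"
proof
  fix x show "Psum (bx n) a x = Psum (bx n - {0}) a x"
    unfolding Psum_def by (rule sum.mono_neutral_right) (use assms in auto)
qed

lemma sum_nk_pd_le:
  fixes \<phi> :: "pt \<Rightarrow> real"
  assumes \<phi>: "smooth \<phi>" "periodic2 \<phi>" and G: "finite G"
  shows "(\<Sum>k\<in>G. nk k * (hat (pd j \<phi>) k)\<^sup>2) \<le> (H2norm_cl \<phi>)\<^sup>2"
proof -
  have s: "smooth (pd j \<phi>)" "periodic2 (pd j \<phi>)" by (intro smooth_pd periodic_pd \<phi>)+
  have "nk k * (hat (pd j \<phi>) k)\<^sup>2 \<le> (\<Sum>i\<in>UNIV. (norm (hat (pd i (pd j \<phi>)) (- k)))\<^sup>2)" for k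
  proof -
    have h: "(norm (hat (pd i (pd j \<phi>)) (- k)))\<^sup>2 = (2 * pi)\<^sup>2 * ((kc k i)\<^sup>2 * (hat (pd j \<phi>) k)\<^sup>2)" for i
      unfolding hat_pd[OF s] by (simp add: kc_simps power_mult_distrib)
    have "(1::real) \<le> (2 * pi)\<^sup>2" using pi_gt3 by (intro one_le_power) linarith
    then have "1 * (nk k * (hat (pd j \<phi>) k)\<^sup>2) \<le> (2 * pi)\<^sup>2 * (nk k * (hat (pd j \<phi>) k)\<^sup>2)"
      by (intro mult_right_mono mult_nonneg_nonneg nk_nonneg zero_le_power2)
    also have "\<dots> = (\<Sum>i\<in>UNIV. (norm (hat (pd i (pd j \<phi>)) (- k)))\<^sup>2)"
      unfolding h nk_kc[symmetric] sum_distrib_left[symmetric] sum_distrib_right[symmetric] ..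
    finally show ?thesis by simp
  qed
  then have "(\<Sum>k\<in>G. nk k * (hat (pd j \<phi>) k)\<^sup>2) \<le> (\<Sum>k\<in>G. \<Sum>i\<in>UNIV. (norm (hat (pd i (pd j \<phi>)) (- k)))\<^sup>2)"
    by (rule sum_mono)
  also have "\<dots> = (\<Sum>i\<in>UNIV. \<Sum>k\<in>G. (norm (hat (pd i (pd j \<phi>)) (- k)))\<^sup>2)" by (rule sum.swap)
  also have "\<dots> \<le> (\<Sum>i\<in>UNIV. (L2norm (pd i (pd j \<phi>)))\<^sup>2)"
  proof (rule sum_mono)
    fix i
    have "(\<Sum>k\<in>G. (norm (hat (pd i (pd j \<phi>)) (- k)))\<^sup>2) = (\<Sum>k\<in>uminus ` G. (norm (hat (pd i (pd j \<phi>)) k))\<^sup>2)"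
      by (subst sum.reindex) (auto simp: inj_on_def)
    also have "\<dots> \<le> (L2norm (pd i (pd j \<phi>)))\<^sup>2" by (intro bessel sqi_smooth smooth_pd \<phi> finite_imageI G)
    finally show "(\<Sum>k\<in>G. (norm (hat (pd i (pd j \<phi>)) (- k)))\<^sup>2) \<le> (L2norm (pd i (pd j \<phi>)))\<^sup>2" .
  qed
  also have "\<dots> \<le> (\<Sum>j\<in>UNIV. \<Sum>i\<in>UNIV. (L2norm (pd i (pd j \<phi>)))\<^sup>2)"
    by (rule member_le_sum) (auto intro: sum_nonneg)
  also have "\<dots> \<le> (H2norm_cl \<phi>)\<^sup>2"
  proof -
    have "(H2norm_cl \<phi>)\<^sup>2 = (L2norm \<phi>)\<^sup>2 + (\<Sum>j\<in>UNIV. (L2norm (pd j \<phi>))\<^sup>2) + (\<Sum>j\<in>UNIV. \<Sum>k\<in>UNIV. (L2norm (pd k (pd j \<phi>)))\<^sup>2)"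
      unfolding H2norm_cl_def by (intro real_sqrt_pow2 add_nonneg_nonneg sum_nonneg zero_le_power2)
    moreover have "0 \<le> (\<Sum>j\<in>UNIV. (L2norm (pd j \<phi>))\<^sup>2)" by (intro sum_nonneg zero_le_power2)
    ultimately show ?thesis using zero_le_power2[of "L2norm \<phi>"] by linarith
  qed
  finally show ?thesis .
qed

text \<open>The gradient of an H^2 function need not be bounded in the plane, so the sup bound on
  the test factor is of no use here. Instead the product of velocity component and gradient is
  estimated in L^2 by \<open>product_estimate\<close>, for truncations of both, and then the limit
  is taken. The zero mean of \<open>f\<close> lets mode zero be dropped, which that estimate
  excludes.\<close>

lemma tri_H2_bound:
  assumes f: "sqi f" "hat f 0 = 0" and A: "\<And>n. (\<Sum>k\<in>bx n. nk k * (hat f k)\<^sup>2) \<le> A\<^sup>2" "0 \<le> A"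
    and g: "sqi g" and \<phi>: "smooth \<phi>" "periodic2 \<phi>"
  shows "\<bar>tri f g (pd j \<phi>)\<bar> \<le> 20 * A * H2norm_cl \<phi> * L2norm g"
proof -
  define P where "P n = Psum (bx n) (hat \<phi>)" for n
  define f' where "f' n = Psum (bx n) (hat f)" for n
  define h where "h n = Psum (bx n) (hat (pd j \<phi>))" for n
  have h: "h n = pd j (P n)" for n unfolding h_def P_def pd_Psum_hat[OF \<phi>] ..
  have H0: "0 \<le> H2norm_cl \<phi>" unfolding H2norm_cl_def by (intro real_sqrt_ge_zero add_nonneg_nonneg sum_nonneg zero_le_power2)
  have C1s: "C1 \<phi>" "C1 (P n)" for n unfolding P_def by (rule C1_smooth[OF \<phi>(1)] C1_Psum)+
  have sf: "sqi (f' n)" for n by (simp add: f'_def)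
  obtain B where B: "0 \<le> B" "\<And>j x. x \<in> cell \<Longrightarrow> norm (pd j \<phi> x) \<le> B" using C1_bound[OF C1s(1)] by blast
  obtain \<delta> where \<delta>: "\<delta> \<longlonglongrightarrow> 0" "\<And>n. 0 \<le> \<delta> n" "\<And>n j. AE x in tor. norm (pd j \<phi> x - pd j (P n) x) \<le> \<delta> n"
    using pd_truncation[OF \<phi>] unfolding P_def by blast
  have b: "\<bar>tri (f' n) g (h n)\<bar> \<le> 20 * A * H2norm_cl \<phi> * L2norm g" for n
  proof -
    have fe: "f' n = Psum (bx n - {0}) (hat f)" unfolding f'_def by (rule Psum_nonzero[of "hat f", OF f(2)])
    have he: "h n = Psum (bx n - {0}) (hat (pd j \<phi>))" unfolding h_def 
      by (rule Psum_nonzero) (simp only: hat_pd[OF \<phi>] kc_simps mult_zero_right minus_zero scaleR_zero_left)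
    have "L2norm (\<lambda>x. f' n x * h n x) \<le> 20 * A * H2norm_cl \<phi>" unfolding fe he
    proof (rule product_estimate)
      show "(\<Sum>k\<in>bx n - {0}. nk k * (hat f k)\<^sup>2) \<le> A\<^sup>2"
        by (rule order_trans[OF sum_mono2 A(1)[of n]]) auto
      show "(\<Sum>k\<in>bx n - {0}. nk k * (hat (pd j \<phi>) k)\<^sup>2) \<le> (H2norm_cl \<phi>)\<^sup>2" by (intro sum_nk_pd_le \<phi>) simp
    qed (use A(2) H0 in auto)
    moreover have "sqi (\<lambda>x. f' n x * h n x)"
      unfolding f'_def h_def by (intro sqi_continuous continuous_intros)
    moreover have "tri (f' n) g (h n) = ip (\<lambda>x. f' n x * h n x) g" unfolding tri_def ip_tor by (simp add: mult_ac)
    ultimately show ?thesis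
      using ip_cauchy_schwarz[of "\<lambda>x. f' n x * h n x" g] g mult_right_mono[OF _ L2norm_nonneg[of g], of "L2norm (\<lambda>x. f' n x * h n x)" "20 * A * H2norm_cl \<phi>"]
      by linarith
  qed
  have "(\<lambda>n. tri (f' n) g (pd j \<phi>)) \<longlonglongrightarrow> tri f g (pd j \<phi>)"
  proof (rule tri_converges[OF sf f(1) g g C1_measurable[OF C1s(1)], where B=B and R="L2norm g"])
    show "(\<lambda>i. L2norm (\<lambda>x. f' i x - f x)) \<longlonglongrightarrow> 0"
    proof -
      have "L2norm (\<lambda>x. f' i x - f x) = L2norm (\<lambda>x. f x - Psum (bx i) (hat f) x)" for i
        unfolding L2norm_def f'_def by (simp add: abs_minus_commute)
      then show ?thesis using Psum_converges[OF f(1)] by simp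
    qed
  qed (use B(2) in \<open>auto simp flip: real_norm_def\<close>)
  moreover have "(\<lambda>n. tri (f' n) g (pd j \<phi>) - tri (f' n) g (h n)) \<longlonglongrightarrow> 0"
  proof (rule Lim_null_comparison)
    show "\<forall>\<^sub>F n in sequentially. norm (tri (f' n) g (pd j \<phi>) - tri (f' n) g (h n)) \<le> \<delta> n * (L2norm f * L2norm g)"
    proof (rule always_eventually, rule allI)
      fix n
      obtain B' where B': "0 \<le> B'" "\<And>j x. x \<in> cell \<Longrightarrow> norm (pd j (P n) x) \<le> B'" using C1_bound[OF C1s(2)] by blast
      have "\<bar>tri (f' n) g (pd j \<phi>) - tri (f' n) g (h n)\<bar> \<le> \<delta> n * (L2norm (f' n) * L2norm g)"
        unfolding h
        by (rule tri_diff_bound[OF sf g C1_measurable[OF C1s(1)] _ C1_measurable[OF C1s(2)], where B=B and B'=B'])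
           (use B(2) B'(2) \<delta>(2,3) in \<open>simp_all flip: real_norm_def\<close>)
      also have "\<dots> \<le> \<delta> n * (L2norm f * L2norm g)"
      proof (intro mult_left_mono mult_right_mono)
        show "L2norm (f' n) \<le> L2norm f" unfolding f'_def
          by (rule power2_le_imp_le[OF _ L2norm_nonneg]) (unfold L2norm_Psum[OF finite_bx], rule bessel[OF f(1) finite_bx])
      qed (use \<delta>(2) in auto)
      finally show "norm (tri (f' n) g (pd j \<phi>) - tri (f' n) g (h n)) \<le> \<delta> n * (L2norm f * L2norm g)" by simp
    qed
    show "(\<lambda>n. \<delta> n * (L2norm f * L2norm g)) \<longlonglongrightarrow> 0"
      using tendsto_mult_right[OF \<delta>(1), of "L2norm f * L2norm g"] by simp
  qed
  ultimately have "(\<lambda>n. tri (f' n) g (pd j \<phi>) - (tri (f' n) g (pd j \<phi>) - tri (f' n) g (h n))) \<longlonglongrightarrow> tri f g (pd j \<phi>) - 0"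
    by (rule tendsto_diff)
  then have "(\<lambda>n. tri (f' n) g (h n)) \<longlonglongrightarrow> tri f g (pd j \<phi>)" by simp
  then have "(\<lambda>n. \<bar>tri (f' n) g (h n)\<bar>) \<longlonglongrightarrow> \<bar>tri f g (pd j \<phi>)\<bar>" by (rule tendsto_rabs)
  then show ?thesis by (rule LIMSEQ_le_const2) (use b in blast)
qed

lemma pd_linear:
  fixes \<phi> \<psi> :: "pt \<Rightarrow> real"
  assumes "smooth \<phi>" "smooth \<psi>"
  shows "pd j (\<lambda>x. a * \<phi> x + b * \<psi> x) = (\<lambda>x. a * pd j \<phi> x + b * pd j \<psi> x)"
proof
  fix x
  show "pd j (\<lambda>x. a * \<phi> x + b * \<psi> x) x = a * pd j \<phi> x + b * pd j \<psi> x"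
  proof (rule pd_unique)
    show "((\<lambda>s. a * \<phi> (x + s *\<^sub>R axis j 1) + b * \<psi> (x + s *\<^sub>R axis j 1)) has_vector_derivative a * pd j \<phi> x + b * pd j \<psi> x) (at 0)"
      by (intro has_vector_derivative_add has_vector_derivative_mult_right pd_directional assms)
    show "(\<lambda>x. a * \<phi> x + b * \<psi> x) differentiable at x"
      by (intro differentiable_add differentiable_mult differentiable_const smooth_differentiable assms)
  qed
qed

lemma flux_linear:
  fixes \<phi> \<psi> :: "pt \<Rightarrow> real"
  assumes u: "sqi u" and \<theta>: "sqi \<theta>" and s: "smooth \<phi>" "smooth \<psi>"
  shows "flux u \<theta> (\<lambda>x. a * \<phi> x + b * \<psi> x) = a * flux u \<theta> \<phi> + b * flux u \<theta> \<psi>"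
proof -
  have i: "integrable tor (\<lambda>x. u x $ j * \<theta> x * pd j \<eta> x)" and m: "integrable tor (\<lambda>x. (\<theta> x *\<^sub>R u x) \<bullet> grad \<eta> x)" if sm: "smooth \<eta>" for \<eta> :: "pt \<Rightarrow> real" and j
  proof -
    obtain B where B: "0 \<le> B" "\<And>j x. x \<in> cell \<Longrightarrow> norm (pd j \<eta> x) \<le> B" using C1_bound[OF C1_smooth[OF sm]] by blast
    show i: "integrable tor (\<lambda>x. u x $ j * \<theta> x * pd j \<eta> x)" for j
      by (rule tri_integrable[OF sqi_nth[OF u] \<theta> C1_measurable[OF C1_smooth[OF sm]], where B=B])
         (use B(2) in \<open>auto intro!: AE_I2\<close>)
    have "(\<lambda>x. (\<theta> x *\<^sub>R u x) \<bullet> grad \<eta> x) = (\<lambda>x. u x $ 1 * \<theta> x * pd 1 \<eta> x + u x $ 2 * \<theta> x * pd 2 \<eta> x)"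
      by (auto simp: inner_2 grad_def algebra_simps)
    then show "integrable tor (\<lambda>x. (\<theta> x *\<^sub>R u x) \<bullet> grad \<eta> x)" using Bochner_Integration.integrable_add[OF i[of 1] i[of 2]] by simp
  qed
  have "(\<lambda>x. (\<theta> x *\<^sub>R u x) \<bullet> grad (\<lambda>x. a * \<phi> x + b * \<psi> x) x) = (\<lambda>x. a * ((\<theta> x *\<^sub>R u x) \<bullet> grad \<phi> x) + b * ((\<theta> x *\<^sub>R u x) \<bullet> grad \<psi> x))"
    by (auto simp: inner_2 grad_def pd_linear[OF s] algebra_simps)
  note eq = this
  have i1: "integrable tor (\<lambda>x. a * ((\<theta> x *\<^sub>R u x) \<bullet> grad \<phi> x))" by (rule integrable_mult_right) (rule m[OF s(1)])
  have i2: "integrable tor (\<lambda>x. b * ((\<theta> x *\<^sub>R u x) \<bullet> grad \<psi> x))" by (rule integrable_mult_right) (rule m[OF s(2)])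
  show ?thesis unfolding flux_def ip_tor eq Bochner_Integration.integral_add[OF i1 i2] integral_mult_right_zero ..
qed

context approx
begin

lemma flux_H2_bound:
  assumes \<phi>: "smooth \<phi>" "periodic2 \<phi>"
  shows "\<bar>flux (v t) (\<theta> t) \<phi>\<bar> \<le> (40 * (R / (2 * pi * al)) * \<Theta>) * H2norm_cl \<phi>"
proof -
  \<comment> \<open>The root of the bound \<open>R\<^sup>2 / (4 * pi\<^sup>2 * al\<^sup>2)\<close>
    on the weighted coefficient sum of a velocity component; two components with constant 20 give
    the 40.\<close>
  define A where "A = R / (2 * pi * al)"
  have A0: "0 \<le> A" using R0 al by (simp add: A_def)
  have H0: "0 \<le> H2norm_cl \<phi>" unfolding H2norm_cl_def by (intro real_sqrt_ge_zero add_nonneg_nonneg sum_nonneg zero_le_power2)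
  obtain B where B: "0 \<le> B" "\<And>j x. x \<in> cell \<Longrightarrow> norm (pd j \<phi> x) \<le> B" using C1_bound[OF C1_smooth[OF \<phi>(1)]] by blast
  have h: "hat (\<lambda>x. v t x $ j) k = QQ (cl t) k * Ev k $ j" for j k
  proof -
    have "hat (\<lambda>x. v t x \<bullet> axis j 1) k = hat (v t) k \<bullet> axis j 1" by (rule hat_inner[OF sqi_integrable[OF v_props(3)], symmetric])
    then show ?thesis by (simp add: v_props(4) inner_axis)
  qed
  have t: "\<bar>tri (\<lambda>x. v t x $ j) (\<theta> t) (pd j \<phi>)\<bar> \<le> 20 * A * H2norm_cl \<phi> * \<Theta>" for j
  proof -
    have "\<bar>tri (\<lambda>x. v t x $ j) (\<theta> t) (pd j \<phi>)\<bar> \<le> 20 * A * H2norm_cl \<phi> * L2norm (\<theta> t)"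
    proof (rule tri_H2_bound[OF sqi_nth[OF v_props(3)] _ _ A0 \<theta>_props(3) \<phi>])
      show "hat (\<lambda>x. v t x $ j) 0 = 0" unfolding h by simp
      fix n
      have "(\<Sum>k\<in>bx n. nk k * (QQ (cl t) k * Ev k $ j)\<^sup>2) \<le> en al (bx n) (QQ (cl t)) / (4 * pi\<^sup>2 * al\<^sup>2)" by (rule sum_nk_le_en[OF al])
      also have "\<dots> \<le> R\<^sup>2 / (4 * pi\<^sup>2 * al\<^sup>2)" by (intro divide_right_mono QQ_en cl_in finite_bx) simp
      also have "\<dots> = A\<^sup>2" by (simp add: A_def power_divide power_mult_distrib)
      finally show "(\<Sum>k\<in>bx n. nk k * (hat (\<lambda>x. v t x $ j) k)\<^sup>2) \<le> A\<^sup>2" unfolding h .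
    qed
    also have "\<dots> \<le> 20 * A * H2norm_cl \<phi> * \<Theta>" using A0 H0 by (intro mult_left_mono \<theta>_norm) simp
    finally show ?thesis .
  qed
  have "flux (v t) (\<theta> t) \<phi> = (\<Sum>j\<in>UNIV. tri (\<lambda>x. v t x $ j) (\<theta> t) (pd j \<phi>))"
    by (rule flux_tri[OF v_props(3) \<theta>_props(3) C1_measurable[OF C1_smooth[OF \<phi>(1)]], where B=B]) (use B(2) in \<open>auto intro!: AE_I2\<close>)
  then have "\<bar>flux (v t) (\<theta> t) \<phi>\<bar> \<le> 20 * A * H2norm_cl \<phi> * \<Theta> + 20 * A * H2norm_cl \<phi> * \<Theta>"
    using t[of 1] t[of 2] unfolding sum_2 by linarith
  also have "\<dots> = (40 * A * \<Theta>) * H2norm_cl \<phi>" by simp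
  finally show ?thesis unfolding A_def .
qed

end

subsection \<open>The weak formulation\<close>

lemma LINT_add_continuous:
  fixes f g :: "real \<Rightarrow> real"
  assumes "continuous_on {0..t} f" "continuous_on {0..t} g"
  shows "(LINT s:{0..t}|lborel. f s + g s) = (LINT s:{0..t}|lborel. f s) + (LINT s:{0..t}|lborel. g s)"
  by (rule set_integral_add(2)) (rule borel_integrable_atLeastAtMost'[OF assms(1)] borel_integrable_atLeastAtMost'[OF assms(2)])+

text \<open>Separates the two ways in which time enters a form: through the solution, where
  continuity is known for fixed tests, and through the test function, where a uniform Lipschitz
  bound is available.\<close>

lemma tendsto_of_lipschitz_test:
  fixes G :: "real \<Rightarrow> real \<Rightarrow> real"
  assumes l: "\<And>s. s \<in> {0..T} \<Longrightarrow> \<bar>G s s - G s t\<bar> \<le> C * \<bar>s - t\<bar>" and c: "((\<lambda>s. G s t) \<longlongrightarrow> G t t) (at t within {0..T})"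
  shows "((\<lambda>s. G s s) \<longlongrightarrow> G t t) (at t within {0..T})"
proof -
  have "((\<lambda>s. G s s - G s t) \<longlongrightarrow> 0) (at t within {0..T})"
  proof (rule Lim_null_comparison)
    have "((\<lambda>s. C * \<bar>s - t\<bar>) \<longlongrightarrow> C * \<bar>t - t\<bar>) (at t within {0..T})" by (intro tendsto_intros)
    then show "((\<lambda>s. C * \<bar>s - t\<bar>) \<longlongrightarrow> 0) (at t within {0..T})" by simp
    show "\<forall>\<^sub>F s in at t within {0..T}. norm (G s s - G s t) \<le> C * \<bar>s - t\<bar>"
      unfolding eventually_at_filter using l by (intro always_eventually allI impI) (simp only: real_norm_def)
  qed
  from tendsto_add[OF this c] show ?thesis by simp
qed

lemma pd_zero: "pd j (\<lambda>x. 0) = (\<lambda>x. 0)"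
  by (rule ext) (simp add: pd_def)

lemma ip_zero: "ip f (\<lambda>x. 0) = 0"
  by (simp add: ip_tor)

context approx
begin

lemma flux_time_continuous:
  assumes \<phi>: "jsm \<phi>" shows "continuous_on {0..T} (\<lambda>s. flux (v s) (\<theta> s) (\<phi> s))"
proof (rule continuous_on_tendsto)
  fix t assume t: "t \<in> {0..T}"
  obtain B where B: "0 \<le> B" "\<And>s t j x. s \<in> {0..T} \<Longrightarrow> t \<in> {0..T} \<Longrightarrow> x \<in> cell \<Longrightarrow> norm (pd j (\<phi> s) x - pd j (\<phi> t) x) \<le> B * \<bar>s - t\<bar>"
    by (rule jsm_C1_lipschitz[OF \<phi>, where T=T]) (rule that)
  have C1s: "C1 (\<phi> s)" for s by (rule C1_smooth[OF jsm_slice[OF \<phi>]])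
  show "((\<lambda>s. flux (v s) (\<theta> s) (\<phi> s)) \<longlongrightarrow> flux (v t) (\<theta> t) (\<phi> t)) (at t within {0..T})"
  proof (rule tendsto_of_lipschitz_test[where G="\<lambda>s r. flux (v s) (\<theta> s) (\<phi> r)" and C="2 * B * (R * \<Theta>)"])
    fix s assume s: "s \<in> {0..T}"
    have "\<bar>flux (v s) (\<theta> s) (\<phi> s) - flux (v s) (\<theta> s) (\<phi> t)\<bar> \<le> 2 * (B * \<bar>s - t\<bar>) * (L2norm (v s) * L2norm (\<theta> s))"
      by (rule flux_diff_bound[OF v_props(3) \<theta>_props(3) C1s C1s]) (use B s t in \<open>auto intro!: AE_I2\<close>)
    also have "\<dots> \<le> 2 * (B * \<bar>s - t\<bar>) * (R * \<Theta>)"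
      by (intro mult_left_mono mult_mono v_norm \<theta>_norm R0) (use B(1) in auto)
    finally show "\<bar>flux (v s) (\<theta> s) (\<phi> s) - flux (v s) (\<theta> s) (\<phi> t)\<bar> \<le> 2 * B * (R * \<Theta>) * \<bar>s - t\<bar>" by (simp add: mult_ac)
  qed (rule flux_cont[OF C1s])
qed

lemma cv_time_continuous:
  assumes \<Phi>: "jsm \<Phi>" shows "continuous_on {0..T} (\<lambda>s. cv j (v s) (\<Phi> s))"
proof (rule continuous_on_tendsto)
  fix t assume t: "t \<in> {0..T}"
  obtain B where B: "0 \<le> B" "\<And>s t j x. s \<in> {0..T} \<Longrightarrow> t \<in> {0..T} \<Longrightarrow> x \<in> cell \<Longrightarrow> norm (pd j (\<Phi> s) x - pd j (\<Phi> t) x) \<le> B * \<bar>s - t\<bar>"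
    by (rule jsm_C1_lipschitz[OF \<Phi>, where T=T]) (rule that)
  have C1s: "C1 (\<Phi> s)" for s by (rule C1_smooth[OF jsm_slice[OF \<Phi>]])
  show "((\<lambda>s. cv j (v s) (\<Phi> s)) \<longlongrightarrow> cv j (v t) (\<Phi> t)) (at t within {0..T})"
  proof (rule tendsto_of_lipschitz_test[where G="\<lambda>s r. cv j (v s) (\<Phi> r)" and C="2 * B * (R * R)"])
    fix s assume s: "s \<in> {0..T}"
    have "\<bar>cv j (v s) (\<Phi> s) - cv j (v s) (\<Phi> t)\<bar> \<le> 2 * (B * \<bar>s - t\<bar>) * (L2norm (v s) * L2norm (v s))"
      by (rule cv_diff_bound[OF v_props(3) C1s C1s]) (use B s t in \<open>auto intro!: AE_I2\<close>)
    also have "\<dots> \<le> 2 * (B * \<bar>s - t\<bar>) * (R * R)"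
      by (intro mult_left_mono mult_mono v_norm R0) (use B(1) in auto)
    finally show "\<bar>cv j (v s) (\<Phi> s) - cv j (v s) (\<Phi> t)\<bar> \<le> 2 * B * (R * R) * \<bar>s - t\<bar>" by (simp add: mult_ac)
  qed (rule cv_cont[OF C1s])
qed

lemma buoyancy: "sqi (\<lambda>x. \<theta> s x *\<^sub>R e2)" "L2norm (\<lambda>x. \<theta> s x *\<^sub>R e2) \<le> \<Theta>"
proof -
  have n: "norm (\<theta> s x *\<^sub>R e2) = norm (\<theta> s x)" for x by (simp add: e2_def norm_axis_1)
  have "(\<lambda>x. \<theta> s x *\<^sub>R e2) \<in> borel_measurable tor" using sqi_meas[OF \<theta>_props(3), of s] by measurable
  then show "sqi (\<lambda>x. \<theta> s x *\<^sub>R e2)" using sqi_int2[OF \<theta>_props(3), of s] unfolding sqi_def n by blast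
  show "L2norm (\<lambda>x. \<theta> s x *\<^sub>R e2) \<le> \<Theta>" using \<theta>_norm[of s] unfolding L2norm_def n .
qed

lemma force_time_continuous:
  assumes \<Phi>: "jsm \<Phi>" shows "continuous_on {0..T} (\<lambda>s. force (\<theta> s) (\<Phi> s))"
  unfolding force_def
proof (rule continuous_on_tendsto)
  fix t assume t: "t \<in> {0..T}"
  show "((\<lambda>s. ip (\<lambda>x. \<theta> s x *\<^sub>R e2) (\<Phi> s)) \<longlongrightarrow> ip (\<lambda>x. \<theta> t x *\<^sub>R e2) (\<Phi> t)) (at t within {0..T})"
  proof (rule product_continuous[OF buoyancy \<Phi> t])
    fix g :: "pt \<Rightarrow> real^2" assume g: "sqi g"
    have e: "ip (\<lambda>x. \<theta> s x *\<^sub>R e2) g = ip (\<theta> s) (\<lambda>x. g x $ 2)" for s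
      unfolding force_def[symmetric] force_eq ip_tor by simp
    show "((\<lambda>s. ip (\<lambda>x. \<theta> s x *\<^sub>R e2) g) \<longlongrightarrow> ip (\<lambda>x. \<theta> t x *\<^sub>R e2) g) (at t within {0..T})"
      unfolding e by (rule \<theta>_weak[OF sqi_nth[OF g]])
  qed
qed

lemma \<theta>_time_continuous:
  assumes "jsm \<phi>" shows "continuous_on {0..T} (\<lambda>s. ip (\<theta> s) (\<phi> s))"
  by (intro continuous_on_tendsto product_continuous[OF \<theta>_props(3) \<theta>_norm assms] \<theta>_weak)

lemma v_time_continuous:
  assumes "jsm \<Phi>" shows "continuous_on {0..T} (\<lambda>s. ip (v s) (\<Phi> s))"
  by (intro continuous_on_tendsto product_continuous[OF v_props(3) v_norm assms] v_weak)

lemma \<theta>_derivative: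
  assumes \<phi>: "smooth \<phi>" "periodic2 \<phi>" and t: "t \<in> {0..T}"
  shows "((\<lambda>s. ip (\<theta> s) \<phi>) has_vector_derivative flux (v t) (\<theta> t) \<phi>) (at t within {0..T})"
proof -
  have "continuous_on {0..T} (\<lambda>s. flux (v s) (\<theta> s) \<phi>)" by (intro continuous_on_tendsto flux_cont C1_smooth \<phi>)
  from has_vector_derivative_add[OF has_vector_derivative_const[of "ip (\<theta> 0) \<phi>"] integral_has_vector_derivative[OF this t]]
  have "((\<lambda>s. ip (\<theta> 0) \<phi> + integral {0..s} (\<lambda>s. flux (v s) (\<theta> s) \<phi>)) has_vector_derivative flux (v t) (\<theta> t) \<phi>) (at t within {0..T})" by simp
  moreover have "ip (\<theta> s) \<phi> = ip (\<theta> 0) \<phi> + integral {0..s} (\<lambda>s. flux (v s) (\<theta> s) \<phi>)" if "s \<in> {0..T}" for s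
    using theta_static[OF \<phi> that] by simp
  ultimately show ?thesis by (rule has_vector_derivative_transform[OF t, rotated])
qed

lemma v_derivative:
  assumes \<psi>: "sqi \<psi>" and t: "t \<in> {0..T}"
  shows "((\<lambda>s. ip (v s) \<psi>) has_vector_derivative ip (ww t) \<psi>) (at t within {0..T})"
proof -
  have "continuous_on {0..T} (\<lambda>s. ip (ww s) \<psi>)" by (intro continuous_on_tendsto ww_weak \<psi>)
  from has_vector_derivative_add[OF has_vector_derivative_const[of "ip (v 0) \<psi>"] integral_has_vector_derivative[OF this t]]
  have "((\<lambda>s. ip (v 0) \<psi> + integral {0..s} (\<lambda>s. ip (ww s) \<psi>)) has_vector_derivative ip (ww t) \<psi>) (at t within {0..T})" by simp
  moreover have "ip (v s) \<psi> = ip (v 0) \<psi> + integral {0..s} (\<lambda>s. ip (ww s) \<psi>)" if "s \<in> {0..T}" for s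
    using v_static[OF \<psi> that] by simp
  ultimately show ?thesis by (rule has_vector_derivative_transform[OF t, rotated])
qed

text \<open>The pairing of \<open>\<theta> s\<close> with \<open>\<phi> s\<close> is continuously
  differentiable in time; the identity is the fundamental theorem of calculus on [0,T], where the
  test function vanishes at the right end.\<close>

lemma transport_weak_form:
  assumes \<phi>: "testS T \<phi>"
  shows "- (LINT s:{0..T}|lborel. ip (\<theta> s) (dt \<phi> s)) - (LINT s:{0..T}|lborel. flux (v s) (\<theta> s) (\<phi> s)) = ip (\<theta> 0) (\<phi> 0)"
proof -
  have j: "jsm \<phi>" and p: "\<And>t. periodic2 (\<phi> t)" and z: "\<phi> T = (\<lambda>x. 0)" using \<phi> by (auto simp: testS_def)
  have T0: "0 \<le> T" using T by simp
  have sm: "smooth (\<phi> t)" for t by (rule jsm_slice[OF j])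
  have c: "continuous_on {0..T} (\<lambda>s. flux (v s) (\<theta> s) (\<phi> s))" "continuous_on {0..T} (\<lambda>s. ip (\<theta> s) (dt \<phi> s))"
    by (rule flux_time_continuous[OF j] \<theta>_time_continuous[OF jsm_time_derivative(2)[OF j]])+
  have "(LINT s:{0..T}|lborel. flux (v s) (\<theta> s) (\<phi> s) + ip (\<theta> s) (dt \<phi> s)) = ip (\<theta> T) (\<phi> T) - ip (\<theta> 0) (\<phi> 0)"
  proof (rule LINT_of_derivative[OF T0 _ continuous_on_add[OF c]])
    fix t assume t: "t \<in> {0..T}"
    show "((\<lambda>s. ip (\<theta> s) (\<phi> s)) has_vector_derivative flux (v t) (\<theta> t) (\<phi> t) + ip (\<theta> t) (dt \<phi> t)) (at t within {0..T})"
      by (rule product_derivative[OF \<theta>_props(3) \<theta>_norm j t \<theta>_weak \<theta>_derivative[OF sm p t]])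
  qed
  then show ?thesis unfolding LINT_add_continuous[OF c] z ip_zero by linarith
qed

text \<open>The Voigt pairing of velocity and test function, with the Laplacian on the test side, is
  differentiated in time. The part of the derivative that falls on the velocity is replaced by
  convection and buoyancy through \<open>voigt_identity\<close>, and the result is integrated over
  [0,T].\<close>

lemma momentum_weak_form:
  assumes \<Phi>: "testV T \<Phi>"
  shows "- (LINT s:{0..T}|lborel. ip (v s) (dt \<Phi> s)) - al\<^sup>2 * (LINT s:{0..T}|lborel. ip1 (v s) (dt \<Phi> s))
      - (\<Sum>j\<in>UNIV. LINT s:{0..T}|lborel. cv j (v s) (\<Phi> s))
    = ip (v 0) (\<Phi> 0) - al\<^sup>2 * (\<Sum>j\<in>UNIV. ip (v 0) (pd j (pd j (\<Phi> 0)))) + (LINT s:{0..T}|lborel. force (\<theta> s) (\<Phi> s))"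
proof -
  have j: "jsm \<Phi>" and p: "\<And>t. periodic2 (\<Phi> t)" and m: "\<And>t. meanzero (\<Phi> t)" and dv: "\<And>t x. div_cl (\<Phi> t) x = 0"
    and z: "\<Phi> T = (\<lambda>x. 0)" using \<Phi> by (auto simp: testV_def)
  have T0: "0 \<le> T" using T by simp
  note vH1 = v_V(1)
  define \<Xi> where "\<Xi> i s = pd i (pd i (\<Phi> s))" for i s
  have jX: "jsm (\<Xi> i)" for i unfolding \<Xi>_def by (intro jsm_pd j)
  have sm: "smooth (\<Phi> t)" "smooth (\<Xi> i t)" for i t by (rule jsm_slice[OF j] jsm_slice[OF jX])+
  define a where "a s = (\<Sum>i\<in>UNIV. ip (v s) (dt (\<Xi> i) s))" for s
  define b where "b s = (\<Sum>i\<in>UNIV. cv i (v s) (\<Phi> s))" for s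
  have cv: "continuous_on {0..T} (\<lambda>s. cv i (v s) (\<Phi> s))" for i by (rule cv_time_continuous[OF j])
  have cb: "continuous_on {0..T} b" unfolding b_def by (intro continuous_on_sum cv)
  have cf: "continuous_on {0..T} (\<lambda>s. force (\<theta> s) (\<Phi> s))" by (rule force_time_continuous[OF j])
  have cd: "continuous_on {0..T} (\<lambda>s. ip (v s) (dt \<Phi> s))" by (rule v_time_continuous[OF jsm_time_derivative(2)[OF j]])
  have ca: "continuous_on {0..T} a" unfolding a_def by (intro continuous_on_sum v_time_continuous jsm_time_derivative(2)[OF jX])
  have ca': "continuous_on {0..T} (\<lambda>s. - al\<^sup>2 * a s)" by (intro continuous_intros ca)
  define h where "h s = ip (v s) (\<Phi> s) - al\<^sup>2 * (\<Sum>i\<in>UNIV. ip (v s) (\<Xi> i s))" for s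
  have "(LINT s:{0..T}|lborel. ((b s + force (\<theta> s) (\<Phi> s)) + ip (v s) (dt \<Phi> s)) + - al\<^sup>2 * a s) = h T - h 0"
  proof (rule LINT_of_derivative[OF T0])
    show "continuous_on {0..T} (\<lambda>s. ((b s + force (\<theta> s) (\<Phi> s)) + ip (v s) (dt \<Phi> s)) + - al\<^sup>2 * a s)"
      by (rule continuous_on_add[OF continuous_on_add[OF continuous_on_add[OF cb cf] cd] ca'])
    fix t assume t: "t \<in> {0..T}"
    have d1: "((\<lambda>s. ip (v s) (\<Phi> s)) has_vector_derivative ip (ww t) (\<Phi> t) + ip (v t) (dt \<Phi> t)) (at t within {0..T})"
      by (rule product_derivative[OF v_props(3) v_norm j t v_weak v_derivative[OF sqi_smooth[OF sm(1)] t]])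
    have d2: "((\<lambda>s. ip (v s) (\<Xi> i s)) has_vector_derivative ip (ww t) (\<Xi> i t) + ip (v t) (dt (\<Xi> i) t)) (at t within {0..T})" for i
      by (rule product_derivative[OF v_props(3) v_norm jX t v_weak v_derivative[OF sqi_smooth[OF sm(2)] t]])
    have "(h has_vector_derivative (ip (ww t) (\<Phi> t) + ip (v t) (dt \<Phi> t)) - al\<^sup>2 * (\<Sum>i\<in>UNIV. ip (ww t) (\<Xi> i t) + ip (v t) (dt (\<Xi> i) t))) (at t within {0..T})"
      unfolding h_def by (intro has_vector_derivative_diff d1 has_vector_derivative_mult_right has_vector_derivative_sum d2)
    moreover have "(ip (ww t) (\<Phi> t) + ip (v t) (dt \<Phi> t)) - al\<^sup>2 * (\<Sum>i\<in>UNIV. ip (ww t) (\<Xi> i t) + ip (v t) (dt (\<Xi> i) t))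
      = ((b t + force (\<theta> t) (\<Phi> t)) + ip (v t) (dt \<Phi> t)) + - al\<^sup>2 * a t"
      using voigt_identity[OF sm(1) p m dv, of t t] unfolding a_def b_def \<Xi>_def sum.distrib distrib_left by linarith
    ultimately show "(h has_vector_derivative ((b t + force (\<theta> t) (\<Phi> t)) + ip (v t) (dt \<Phi> t)) + - al\<^sup>2 * a t) (at t within {0..T})"
      by (simp only:)
  qed
  moreover have "h T = 0" unfolding h_def \<Xi>_def z pd_zero ip_zero by simp
  moreover have "(LINT s:{0..T}|lborel. ip1 (v s) (dt \<Phi> s)) = (LINT s:{0..T}|lborel. (- 1) * a s)"
  proof (rule set_lebesgue_integral_cong)
    show "{0..T} \<in> sets lborel" by simp
    have "ip1 (v s) (dt \<Phi> s) = - 1 * a s" if s: "s \<in> {0..T}" for s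
    proof -
      have "ip1 (v s) (dt \<Phi> s) = - (\<Sum>i\<in>UNIV. ip (v s) (pd i (pd i (dt \<Phi> s))))"
        by (rule ip1_smooth[OF vH1 dt_test(1-3)[OF j p m T s]])
      also have "\<dots> = - (\<Sum>i\<in>UNIV. ip (v s) (dt (\<Xi> i) s))"
        unfolding \<Xi>_def dt_test(4)[OF j p m T s v_props(3)] ..
      finally show ?thesis by (simp add: a_def)
    qed
    then show "\<forall>s. s \<in> {0..T} \<longrightarrow> ip1 (v s) (dt \<Phi> s) = - 1 * a s" by blast
  qed
  moreover have "(LINT s:{0..T}|lborel. b s) = (\<Sum>i\<in>UNIV. LINT s:{0..T}|lborel. cv i (v s) (\<Phi> s))"
    unfolding b_def sum_2 by (rule LINT_add_continuous[OF cv cv])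
  ultimately show ?thesis
    unfolding LINT_add_continuous[OF continuous_on_add[OF continuous_on_add[OF cb cf] cd] ca'] LINT_add_continuous[OF continuous_on_add[OF cb cf] cd]
      LINT_add_continuous[OF cb cf] set_integral_mult_right h_def \<Xi>_def
    by (simp add: algebra_simps)
qed

text \<open>\<open>Linf\<close> asks for a bound almost everywhere in the plane, while the bound
  obtained so far concerns the cell. By periodicity the exceptional set is covered by countably many
  lattice translates of its part in the cell.\<close>

lemma \<theta>_essential_bound:
  assumes C: "\<And>x. \<bar>th0 x\<bar> \<le> C" shows "AE x in lebesgue. \<bar>\<theta> t x\<bar> \<le> C"
proof -
  define N where "N = {x. C < \<bar>\<theta> t x\<bar>}"
  have Nb: "N \<in> sets borel" unfolding N_def using \<theta>_props(1)[of t] by measurable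
  have "AE x in lebesgue. x \<in> cell \<longrightarrow> \<bar>\<theta> t x\<bar> \<le> C"
    using tth_sup[OF cl_in C, of t] unfolding AE_tor_iff \<theta>_def .
  then have "AE x in lebesgue. x \<notin> N \<inter> cell" by (rule AE_mp) (auto intro!: AE_I2 simp: N_def)
  moreover have "N \<inter> cell \<in> sets lebesgue" using Nb by (intro sets.Int) auto
  ultimately have neg: "negligible (N \<inter> cell)" unfolding negligible_iff_null_sets using AE_iff_null_sets by blast
  have "N \<subseteq> (\<Union>n\<in>lat. (+) n ` (N \<inter> cell))"
  proof
    fix x assume x: "x \<in> N"
    obtain n where n: "n \<in> lat" "x - n \<in> ucell" using ucell_lat_unique[of x] by blast
    have "x - n \<in> cell" unfolding cell_def mem_box_cart
    proof
      fix i :: 2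
      have "(axis i 1 :: pt) \<in> Basis" by (simp add: axis_in_Basis_iff)
      then have "0 \<le> (x - n) \<bullet> axis i 1 \<and> (x - n) \<bullet> axis i 1 < 1"
        using n(2) unfolding ucell_def by blast
      then show "0 $ i \<le> (x - n) $ i \<and> (x - n) $ i \<le> 1 $ i" by (simp add: inner_axis)
    qed
    moreover have "\<theta> t (x - n) = \<theta> t x" using periodic2_lat[OF \<theta>_props(2)[of t] n(1), of "x - n"] by simp
    ultimately have "x - n \<in> N \<inter> cell" using x by (simp add: N_def)
    then have "x \<in> (+) n ` (N \<inter> cell)" by (intro image_eqI[where x="x - n"]) auto
    then show "x \<in> (\<Union>n\<in>lat. (+) n ` (N \<inter> cell))" using n(1) by blast
  qed
  moreover have "negligible (\<Union>n\<in>(lat :: pt set). (+) n ` (N \<inter> cell))"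
    unfolding negligible_iff_null_sets
    by (rule null_sets_UN'[OF countable_lat]) (rule negligible_translation[OF neg, unfolded negligible_iff_null_sets])
  ultimately have "negligible N" using negligible_subset by blast
  then have "N \<in> null_sets lebesgue" unfolding negligible_iff_null_sets .
  then show ?thesis by (rule AE_I') (auto simp: N_def)
qed

end

text \<open>The scheme composes the initial temperature with shears, so it needs a Borel function,
  and its sup bound has to hold at every point. For data in \<open>Linf\<close> the Borel version is
  therefore cut off at the essential bound, which changes it on a null set only.\<close>

lemma borel_representative:
  fixes \<theta>0 :: "pt \<Rightarrow> real"
  assumes "\<theta>0 \<in> L2"
  obtains th0 where "th0 \<in> borel_measurable borel" "periodic2 th0" "sqi th0" "hat th0 = hat \<theta>0"
    "\<theta>0 \<in> Linf \<Longrightarrow> \<exists>C. \<forall>x. \<bar>th0 x\<bar> \<le> C"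
proof -
  have s0: "sqi \<theta>0" by (rule sqi_L2[OF assms])
  obtain f where f: "f \<in> borel_measurable borel" "periodic2 f" "sqi f" "hat f = hat \<theta>0"
    using riesz_fischer_ex[OF summable_hat[OF s0]] by blast
  show ?thesis
  proof (cases "\<theta>0 \<in> Linf")
    case False
    then show ?thesis using that[OF f] by blast
  next
    case True
    then obtain C where "AE x in lebesgue. norm (\<theta>0 x) \<le> C" unfolding Linf_def by blast
    then have C: "AE x in tor. \<bar>\<theta>0 x\<bar> \<le> C" unfolding AE_tor_iff by (rule AE_mp) (auto intro!: AE_I2)
    define g where "g x = max (- \<bar>C\<bar>) (min \<bar>C\<bar> (f x))" for x
    have gb: "\<bar>g x\<bar> \<le> \<bar>C\<bar>" for x by (auto simp: g_def)
    have g1: "g \<in> borel_measurable borel" unfolding g_def using f(1) by measurable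
    have g2: "periodic2 g" using f(2) by (simp add: periodic2_def g_def)
    have g3: "sqi g" by (rule sqi_bounded[OF borel_tor[OF g1], of "\<bar>C\<bar>"]) (use gb in simp)
    have "AE x in tor. f x = \<theta>0 x" by (rule hat_eqI[OF sqi_integrable[OF f(3)] sqi_integrable[OF s0]]) (simp only: f(4))
    then have ae: "AE x in tor. g x = \<theta>0 x" using C by eventually_elim (auto simp: g_def)
    have "hat g k = hat \<theta>0 k" for k by (rule hat_cong_AE[OF sqi_meas[OF g3] sqi_meas[OF s0] ae])
    then have g4: "hat g = hat \<theta>0" by (rule ext)
    show ?thesis by (rule that[OF g1 g2 g3 g4]) (use gb in blast)
  qed
qed

lemma initial_energy:
  assumes u: "u0 \<in> H1" and G: "finite G"
  shows "en al G (\<lambda>k. hat u0 k \<bullet> Ev k) \<le> max 1 (al\<^sup>2) * (H1norm u0)\<^sup>2"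
proof -
  have wt0: "0 \<le> wt k" for k using wt_ge_1[of k] by linarith
  have lw: "lam al k \<le> max 1 (al\<^sup>2) * wt k" for k
  proof -
    have "al\<^sup>2 * (4 * pi\<^sup>2 * nk k) \<le> max 1 (al\<^sup>2) * (4 * pi\<^sup>2 * nk k)" by (intro mult_right_mono) auto
    then show ?thesis by (simp add: lam_def wt_def distrib_left mult_ac)
  qed
  have "en al G (\<lambda>k. hat u0 k \<bullet> Ev k) \<le> (\<Sum>k\<in>G. max 1 (al\<^sup>2) * (wt k * (norm (hat u0 k))\<^sup>2))"
    unfolding en_def
  proof (rule sum_mono)
    fix k
    have "\<bar>hat u0 k \<bullet> Ev k\<bar> \<le> norm (hat u0 k) * norm (Ev k)" by (rule Cauchy_Schwarz_ineq2)
    also have "\<dots> \<le> norm (hat u0 k)" using mult_left_mono[OF norm_Ev_le[of k] norm_ge_zero[of "hat u0 k"]] by simp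
    finally have "(hat u0 k \<bullet> Ev k)\<^sup>2 \<le> (norm (hat u0 k))\<^sup>2" using power_mono[of "\<bar>hat u0 k \<bullet> Ev k\<bar>" _ 2] by simp
    then have "lam al k * (hat u0 k \<bullet> Ev k)\<^sup>2 \<le> (max 1 (al\<^sup>2) * wt k) * (norm (hat u0 k))\<^sup>2"
      by (intro mult_mono lw mult_nonneg_nonneg wt0) auto
    then show "lam al k * (hat u0 k \<bullet> Ev k)\<^sup>2 \<le> max 1 (al\<^sup>2) * (wt k * (norm (hat u0 k))\<^sup>2)" by (simp only: mult.assoc)
  qed
  also have "\<dots> = max 1 (al\<^sup>2) * (\<Sum>k\<in>G. wt k * (norm (hat u0 k))\<^sup>2)" by (simp only: sum_distrib_left)
  also have "\<dots> \<le> max 1 (al\<^sup>2) * (H1norm u0)\<^sup>2"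
  proof (rule mult_left_mono)
    show "(\<Sum>k\<in>G. wt k * (norm (hat u0 k))\<^sup>2) \<le> (H1norm u0)\<^sup>2"
      by (rule finite_sum_le_has_sum[OF H1norm_sum[OF u] G]) (auto intro: mult_nonneg_nonneg wt0)
  qed simp
  finally show ?thesis .
qed

subsection \<open>Existence\<close>

context approx
begin

lemma dt_Linf_Hm2_\<theta>: "dt_Linf_Hm2 T \<theta>"
  unfolding dt_Linf_Hm2_def Let_def
proof (intro exI[of _ "\<lambda>t \<phi>. flux (v t) (\<theta> t) \<phi>"] conjI ballI allI)
  fix t :: real and \<phi> \<psi> :: "pt \<Rightarrow> real" and a b :: real
  assume "\<phi> \<in> {\<phi>. smooth \<phi> \<and> periodic2 \<phi> \<and> meanzero \<phi>}" "\<psi> \<in> {\<phi>. smooth \<phi> \<and> periodic2 \<phi> \<and> meanzero \<phi>}"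
  then have s: "smooth \<phi>" "smooth \<psi>" by auto
  show "flux (v t) (\<theta> t) (\<lambda>x. a * \<phi> x + b * \<psi> x) = a * flux (v t) (\<theta> t) \<phi> + b * flux (v t) (\<theta> t) \<psi>"
    by (rule flux_linear[OF v_props(3) \<theta>_props(3) s])
next
  show "\<exists>C. AE t in lborel. t \<in> {0..T} \<longrightarrow> (\<forall>\<phi>\<in>{\<phi>. smooth \<phi> \<and> periodic2 \<phi> \<and> meanzero \<phi>}. \<bar>flux (v t) (\<theta> t) \<phi>\<bar> \<le> C * H2norm_cl \<phi>)"
    by (intro exI[of _ "40 * (R / (2 * pi * al)) * \<Theta>"] AE_I2 impI ballI flux_H2_bound) auto
next
  fix \<phi> :: "pt \<Rightarrow> real" assume "\<phi> \<in> {\<phi>. smooth \<phi> \<and> periodic2 \<phi> \<and> meanzero \<phi>}"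
  then have \<phi>: "smooth \<phi>" "periodic2 \<phi>" by auto
  have c: "continuous_on {0..t} (\<lambda>s. flux (v s) (\<theta> s) \<phi>)" for t by (intro continuous_on_tendsto flux_cont C1_smooth \<phi>)
  show "(\<lambda>t. flux (v t) (\<theta> t) \<phi>) \<in> borel_measurable (restrict_space lborel {0..T})" by (rule restrict_measurable[OF c])
  show "ip (\<theta> t) \<phi> - ip (\<theta> 0) \<phi> = (LINT s:{0..t}|lborel. flux (v s) (\<theta> s) \<phi>)" if t: "t \<in> {0..T}" for t
    unfolding theta_static[OF \<phi> t] LINT_continuous[OF c] ..
qed

lemma Linf_Linf_\<theta>:
  assumes "hat th0 0 = 0" and C: "\<And>x. \<bar>th0 x\<bar> \<le> C" shows "Linf_Linf T \<theta>"
proof -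
  have b: "AE x in lebesgue. \<bar>\<theta> t x\<bar> \<le> C" for t by (rule \<theta>_essential_bound[OF C])
  have "\<theta> t \<in> Linf" for t using \<theta>_L2[OF assms(1), of t] b[of t] unfolding Linf_def L2_def by auto
  then show ?thesis unfolding Linf_Linf_def using b by (intro exI[of _ C] AE_I2) auto
qed

text \<open>The scheme starts from the components of \<open>hat u0 k\<close> along
  \<open>Ev k\<close>, and a field whose coefficients are multiples of \<open>Ev k\<close> sees
  exactly these components.\<close>

lemma initial_velocity:
  assumes u0: "sqi u0" "q0 = (\<lambda>k. hat u0 k \<bullet> Ev k)" and \<Xi>: "sqi \<Xi>" "\<And>k. hat \<Xi> k = r k *\<^sub>R Ev k"
  shows "ip u0 \<Xi> = ip (v 0) \<Xi>"
proof -
  have cl0: "cl 0 = 0" using T by (simp add: cl_def)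
  have e: "hat u0 k \<bullet> hat \<Xi> k = hat (v 0) k \<bullet> hat \<Xi> k" for k
  proof (cases "k = 0")
    case True
    show ?thesis unfolding \<Xi>(2) True by simp
  next
    case False
    then have "QQ 0 k = hat u0 k \<bullet> Ev k" using QQ_0[OF False] u0(2) by simp
    then show ?thesis unfolding \<Xi>(2) v_props(4) cl0 inner_scaleR_left inner_scaleR_right Ev_inner using False by simp
  qed
  have "((\<lambda>k. hat u0 k \<bullet> hat \<Xi> k) has_sum ip (v 0) \<Xi>) UNIV" unfolding e by (rule parseval[OF v_props(3) \<Xi>(1)])
  then show ?thesis by (rule has_sum_unique[OF parseval[OF u0(1) \<Xi>(1)]])
qed

end

theorem theorem5p3:
  fixes \<alpha> T :: real and u0 :: "pt \<Rightarrow> real^2" and \<theta>0 :: "pt \<Rightarrow> real"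
  assumes "\<alpha> > 0" and "T > 0" and "u0 \<in> V" and "\<theta>0 \<in> L2"
  shows "\<exists>u \<theta>. weak_solution \<alpha> T u0 \<theta>0 u \<theta> \<and> (\<theta>0 \<in> Linf \<longrightarrow> Linf_Linf T \<theta>)"
proof -
  have uH: "u0 \<in> H1" using assms(3) by (simp add: V_def)
  have su: "sqi u0" by (rule sqi_L2[OF H1_L2[OF uH]])
  have s\<theta>: "sqi \<theta>0" by (rule sqi_L2[OF assms(4)])
  obtain th0 where th0: "th0 \<in> borel_measurable borel" "periodic2 th0" "sqi th0" "hat th0 = hat \<theta>0"
    and bd: "\<theta>0 \<in> Linf \<Longrightarrow> \<exists>C. \<forall>x. \<bar>th0 x\<bar> \<le> C"
    by (rule borel_representative[OF assms(4)]) (rule that)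
  define q0 where "q0 = (\<lambda>k. hat u0 k \<bullet> Ev k)"
  have "en \<alpha> G q0 \<le> max 1 (\<alpha>\<^sup>2) * (H1norm u0)\<^sup>2" if "finite G" for G
    unfolding q0_def by (rule initial_energy[OF uH that])
  from approx_exists[OF assms(1,2) th0(1-3) this]
  obtain R \<Theta> K F \<tau> q th \<epsilon> where "approx \<alpha> T R \<Theta> K F \<tau> q th \<epsilon> q0 th0" by blast
  then interpret approx \<alpha> T R \<Theta> K F \<tau> q th \<epsilon> q0 th0 .
  have "meanzero \<theta>0" using assms(4) by (simp add: L2_def)
  then have z: "hat th0 0 = 0" unfolding th0(4) by (simp only: meanzero_hat)
  have cl0: "cl 0 = 0" using T by (simp add: cl_def)
  have h\<theta>: "hat (\<theta> 0) k = hat \<theta>0 k" for k unfolding \<theta>_props(4) cl0 HH_0 th0(4) ..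
  \<comment> \<open>The curve starts at a chosen representative that agrees with the datum only
    almost everywhere; the pairing with the initial test function does not see the
    difference.\<close>
  have ae: "AE x in tor. \<theta> 0 x = \<theta>0 x" by (rule hat_eqI[OF sqi_integrable[OF \<theta>_props(3)] sqi_integrable[OF s\<theta>] h\<theta>])
  have "weak_solution \<alpha> T u0 \<theta>0 v \<theta>"
    unfolding weak_solution_def
  proof (intro conjI allI impI C_V_v dt_Linf_V_v Linf_L2_\<theta>[OF z] Cw_L2_\<theta>[OF z] dt_Linf_Hm2_\<theta>)
    fix \<Phi> assume \<Phi>: "testV T \<Phi>"
    then have j: "jsm \<Phi>" and p: "periodic2 (\<Phi> 0)" and m: "meanzero (\<Phi> 0)" and dv: "\<And>x. div_cl (\<Phi> 0) x = 0"
      unfolding testV_def by blast+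
    have sm: "smooth (\<Phi> 0)" by (rule jsm_slice[OF j])
    have "ip u0 (\<Phi> 0) = ip (v 0) (\<Phi> 0)"
      by (rule initial_velocity[OF su q0_def sqi_smooth[OF sm] hat_div_free[OF sm p m dv]])
    moreover have "ip u0 (pd i (pd i (\<Phi> 0))) = ip (v 0) (pd i (pd i (\<Phi> 0)))" for i
    proof (rule initial_velocity[OF su q0_def sqi_smooth[OF smooth_pd[OF smooth_pd[OF sm]]]])
      show "hat (pd i (pd i (\<Phi> 0))) k = (- (2 * pi * kc k i)\<^sup>2 * (hat (\<Phi> 0) k \<bullet> Ev k)) *\<^sub>R Ev k" for k
        unfolding hat_pd_pd[OF sm p] by (subst hat_div_free[OF sm p m dv]) simp
    qed
    ultimately have i: "ip u0 (\<Phi> 0) + \<alpha>\<^sup>2 * ip1 u0 (\<Phi> 0) = ip (v 0) (\<Phi> 0) - \<alpha>\<^sup>2 * (\<Sum>i\<in>UNIV. ip (v 0) (pd i (pd i (\<Phi> 0))))"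
      unfolding ip1_smooth[OF uH sm p m] by simp
    show "- (LINT s:{0..T}|lborel. ip (v s) (dt \<Phi> s))
        - \<alpha>^2 * (LINT s:{0..T}|lborel. ip1 (v s) (dt \<Phi> s))
        - (\<Sum>j\<in>UNIV. LINT s:{0..T}|lborel. ip (\<lambda>x. v s x $ j *\<^sub>R v s x) (pd j (\<Phi> s)))
        = ip u0 (\<Phi> 0) + \<alpha>^2 * ip1 u0 (\<Phi> 0)
          + (LINT s:{0..T}|lborel. ip (\<lambda>x. \<theta> s x *\<^sub>R e2) (\<Phi> s))"
      unfolding i by (rule momentum_weak_form[OF \<Phi>, unfolded cv_def force_def])
  next
    fix \<phi> assume \<phi>: "testS T \<phi>"
    then have "jsm \<phi>" unfolding testS_def by blast
    then have "sqi (\<phi> 0)" by (intro sqi_smooth jsm_slice)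
    then have "ip (\<theta> 0) (\<phi> 0) = ip \<theta>0 (\<phi> 0)" by (intro ip_cong_AE sqi_meas \<theta>_props s\<theta> ae)
    then show "- (LINT s:{0..T}|lborel. ip (\<theta> s) (dt \<phi> s))
        - (LINT s:{0..T}|lborel. ip (\<lambda>x. \<theta> s x *\<^sub>R v s x) (grad (\<phi> s))) = ip \<theta>0 (\<phi> 0)"
      using transport_weak_form[OF \<phi>, unfolded flux_def] by (simp only:)
  qed
  moreover have "Linf_Linf T \<theta>" if "\<theta>0 \<in> Linf" using bd[OF that] Linf_Linf_\<theta>[OF z] by blast
  ultimately show ?thesis by blast
qed

end
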